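(* For every graph $G$, the following are equivalent: (a) $G$ is $(2P_3,C_4,C_6,C_7,T_0)$-free and contains no simplicial vertices; (b) $G$ has exactly one nontrivial anticomponent, and this anticomponent is a 5-basket, a villa, a mansion, or a 5-crown; (c) $G$ can be obtained from a 5-basket, a villa, a mansion, or a 5-crown by possibly adding universal vertices to it.
   Context: All graphs are finite, simple, nonnull. A graph is $(H_1,\dots,H_m)$-free if it has no induced subgraph isomorphic to any $H_i$. $P_k$, $C_k$ are the path and cycle on $k$ vertices; $2P_3$ is two disjoint copies of $P_3$. $T_0$ is the graph with vertices $p,q,u_0,u_1,u_2,u_3,w_1,w_2,w_3$ and edges $pq,pu_0,pu_2,pu_3,qu_1,qu_2,qu_3,u_0w_1,u_1w_1,u_2w_2,u_3w_3,w_1w_2,w_1w_3,w_2w_3$. A clique (stable set) is a possibly empty set of pairwise adjacent (nonadjacent) vertices. A vertex is simplicial if its neighbours form a clique, universal if adjacent to all other vertices. For disjoint vertex sets $X,Y$, $X$ is complete (anticomplete) to $Y$ if every vertex of $X$ is adjacent (nonadjacent) to every vertex of $Y$. An anticomponent of $G$ is a maximal induced subgraph whose complement is connected; it is nontrivial if it has at least two vertices. "$G$ can be obtained from $Q$ by possibly adding universal vertices" means $Q$ is an induced subgraph of $G$ and $V(G)\setminus V(Q)$ is a (possibly empty) clique complete to $V(Q)$. 5-basket: a graph $Q$ whose vertex set partitions into $A,B_1,B_2,B_3,C_1,C_2,C_3,F$ where $A,B_i,C_i$ are nonempty cliques, $F$ is a possibly empty clique, $B_1,B_2,B_3$ are pairwise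 anticomplete, $C_1,C_2,C_3$ are pairwise complete; there is $i^*\in\{1,2,3\}$ such that $A$ is complete to $(B_1\cup B_2\cup B_3)\setminus B_{i^*}$ and $A$ can be ordered $a_1,\dots,a_t$ with $N(a_t)\cap B_{i^*}\subseteq\cdots\subseteq N(a_1)\cap B_{i^*}=B_{i^*}$; $A$ is anticomplete to $C_1\cup C_2\cup C_3$; each $B_i$ is complete to $C_i$ and anticomplete to $C_j$ for $j\ne i$; and there is $j^*\in\{1,2,3\}$ such that $F$ is complete to $V(Q)\setminus(B_{j^*}\cup C_{j^*}\cup F)$ and anticomplete to $B_{j^*}\cup C_{j^*}$. $t$-villa ($t\ge3$): a graph $Q$ whose vertex set partitions into nonempty cliques $A,B_1,\dots,B_t,C_1,\dots,C_t$ such that $A$ is complete to $B_1\cup\dots\cup B_t$ and anticomplete to $C_1\cup\dots\cup C_t$; the $B_i$ are pairwise anticomplete; the $C_i$ are pairwise complete; $B_i$ is anticomplete to $C_j$ for $i\ne j$; and each $B_i$ can be ordered $b^i_1,\dots,b^i_{r_i}$ with $\emptyset\ne N(b^i_{r_i})\cap C_i\subseteq\dots\subseteq N(b^i_1)\cap C_i=C_i$. Then $(A;B_1,\dots,B_t;C_1,\dots,C_t)$ is a $t$-villa partition. A villa is a $t$-villa for some $t\ge3$. $t$-mansion ($t\ge3$): a graph $Q$ whose vertex set partitions into cliques $A,B_1,\dots,B_t,C_1,\dots,C_t,F,X,Y$, with $A,B_i,C_i,F$ nonempty ($X,Y$ possibly empty), such that $Q[A\cup B_1\cup\dots\cup C_t]$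 is a $t$-villa with $t$-villa partition $(A;B_1,\dots,B_t;C_1,\dots,C_t)$; there is $j^*$ such that $F$ is complete to $A$, to $\bigcup_{i\ne j^*}B_i$ and to $\bigcup_{i\ne j^*}C_i$ and anticomplete to $B_{j^*}\cup C_{j^*}$, $B_{j^*}$ is complete to $C_{j^*}$, and $X$ is complete to $A\cup B_{j^*}$ and anticomplete to $\bigcup_{i\ne j^*}B_i$ and to $C_1\cup\dots\cup C_t$; $F$ is complete to $X\cup Y$; $X$ is anticomplete to $Y$; $Y$ is complete to $C_1\cup\dots\cup C_t$ and anticomplete to $A\cup B_1\cup\dots\cup B_t$. A mansion is a $t$-mansion for some $t\ge3$. $k$-ring ($k\ge4$): a graph $R$ whose vertex set partitions into nonempty sets $X_0,\dots,X_{k-1}$ (indices mod $k$) such that each $X_i$ can be ordered $u^i_1,\dots,u^i_{|X_i|}$ with $X_i\subseteq N[u^i_{|X_i|}]\subseteq\dots\subseteq N[u^i_1]=X_{i-1}\cup X_i\cup X_{i+1}$ (closed neighbourhoods); $(X_0,\dots,X_{k-1})$ is a ring partition. A 5-crown is a 5-ring with ring partition $(X_0,\dots,X_4)$ such that for some $i^*\in\mathbb{Z}_5$, $X_{i^*-1}$ is complete to $X_{i^*-2}$ and $X_{i^*+1}$ is complete to $X_{i^*+2}$. *)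

theory Defs
  imports Main
begin

definition is_graph :: "'a set \<Rightarrow> ('a \<Rightarrow> 'a \<Rightarrow> bool) \<Rightarrow> bool" where
  "is_graph V E \<longleftrightarrow> finite V \<and> V \<noteq> {} \<and> (\<forall>x\<in>V. \<forall>y\<in>V. E x y \<longleftrightarrow> E y x) \<and> (\<forall>x\<in>V. \<not> E x x)"

definition has_induced :: "'a set \<Rightarrow> ('a \<Rightarrow> 'a \<Rightarrow> bool) \<Rightarrow> nat set \<Rightarrow> (nat \<Rightarrow> nat \<Rightarrow> bool) \<Rightarrow> bool" where
  "has_induced V E VH EH \<longleftrightarrow>
     (\<exists>f. inj_on f VH \<and> f ` VH \<subseteq> V \<and> (\<forall>x\<in>VH. \<forall>y\<in>VH. E (f x) (f y) \<longleftrightarrow> EH x y))"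

definition edges_rel :: "(nat \<times> nat) list \<Rightarrow> nat \<Rightarrow> nat \<Rightarrow> bool" where
  "edges_rel es x y \<longleftrightarrow> (x, y) \<in> set es \<or> (y, x) \<in> set es"

definition cycle_rel :: "nat \<Rightarrow> nat \<Rightarrow> nat \<Rightarrow> bool" where
  "cycle_rel k x y \<longleftrightarrow> y = (x + 1) mod k \<or> x = (y + 1) mod k"

definition twoP3_rel :: "nat \<Rightarrow> nat \<Rightarrow> bool" where
  "twoP3_rel = edges_rel [(0,1),(1,2),(3,4),(4,5)]"

text \<open>T_0 on vertices 0..8 with p=0, q=1, u0=2, u1=3, u2=4, u3=5, w1=6, w2=7, w3=8.\<close>
definition T0_rel :: "nat \<Rightarrow> nat \<Rightarrow> bool" where
  "T0_rel = edges_rel [(0,1),(0,2),(0,4),(0,5),(1,3),(1,4),(1,5),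
                       (2,6),(3,6),(4,7),(5,8),(6,7),(6,8),(7,8)]"

definition is_free :: "'a set \<Rightarrow> ('a \<Rightarrow> 'a \<Rightarrow> bool) \<Rightarrow> bool" where
  "is_free V E \<longleftrightarrow>
     \<not> has_induced V E {0..<6} twoP3_rel \<and>
     \<not> has_induced V E {0..<4} (cycle_rel 4) \<and>
     \<not> has_induced V E {0..<6} (cycle_rel 6) \<and>
     \<not> has_induced V E {0..<7} (cycle_rel 7) \<and>
     \<not> has_induced V E {0..<9} T0_rel"

definition clique :: "('a \<Rightarrow> 'a \<Rightarrow> bool) \<Rightarrow> 'a set \<Rightarrow> bool" where
  "clique E X \<longleftrightarrow> (\<forall>x\<in>X. \<forall>y\<in>X. x \<noteq> y \<longrightarrow> E x y)"

definition complete :: "('a \<Rightarrow> 'a \<Rightarrow> bool) \<Rightarrow> 'a set \<Rightarrow> 'a set \<Rightarrow> bool" where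
  "complete E X Y \<longleftrightarrow> (\<forall>x\<in>X. \<forall>y\<in>Y. E x y)"

definition anticomplete :: "('a \<Rightarrow> 'a \<Rightarrow> bool) \<Rightarrow> 'a set \<Rightarrow> 'a set \<Rightarrow> bool" where
  "anticomplete E X Y \<longleftrightarrow> (\<forall>x\<in>X. \<forall>y\<in>Y. \<not> E x y)"

definition nbhd :: "'a set \<Rightarrow> ('a \<Rightarrow> 'a \<Rightarrow> bool) \<Rightarrow> 'a \<Rightarrow> 'a set" where
  "nbhd V E v = {u \<in> V. E v u}"

definition closed_nbhd :: "'a set \<Rightarrow> ('a \<Rightarrow> 'a \<Rightarrow> bool) \<Rightarrow> 'a \<Rightarrow> 'a set" where
  "closed_nbhd V E v = insert v (nbhd V E v)"

definition simplicial :: "'a set \<Rightarrow> ('a \<Rightarrow> 'a \<Rightarrow> bool) \<Rightarrow> 'a \<Rightarrow> bool" where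
  "simplicial V E v \<longleftrightarrow> v \<in> V \<and> clique E (nbhd V E v)"

definition anticonnected :: "('a \<Rightarrow> 'a \<Rightarrow> bool) \<Rightarrow> 'a set \<Rightarrow> bool" where
  "anticonnected E S \<longleftrightarrow> S \<noteq> {} \<and>
     (\<forall>x\<in>S. \<forall>y\<in>S. (\<lambda>a b. a \<in> S \<and> b \<in> S \<and> a \<noteq> b \<and> \<not> E a b)\<^sup>*\<^sup>* x y)"

definition anticomponent :: "'a set \<Rightarrow> ('a \<Rightarrow> 'a \<Rightarrow> bool) \<Rightarrow> 'a set \<Rightarrow> bool" where
  "anticomponent V E S \<longleftrightarrow> S \<subseteq> V \<and> anticonnected E S \<and>
     (\<forall>T. S \<subset> T \<and> T \<subseteq> V \<longrightarrow> \<not> anticonnected E T)"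

definition partition_list :: "'a set \<Rightarrow> 'a set list \<Rightarrow> bool" where
  "partition_list Q Ps \<longleftrightarrow> \<Union>(set Ps) = Q \<and>
     (\<forall>i<length Ps. \<forall>j<length Ps. i \<noteq> j \<longrightarrow> Ps ! i \<inter> Ps ! j = {})"

definition nested_order :: "('a \<Rightarrow> 'a \<Rightarrow> bool) \<Rightarrow> 'a set \<Rightarrow> 'a set \<Rightarrow> 'a list \<Rightarrow> bool" where
  "nested_order E X Y xs \<longleftrightarrow> distinct xs \<and> set xs = X \<and> xs \<noteq> [] \<and>
     (\<forall>i. Suc i < length xs \<longrightarrow> {y \<in> Y. E (xs ! Suc i) y} \<subseteq> {y \<in> Y. E (xs ! i) y}) \<and>
     {y \<in> Y. E (xs ! 0) y} = Y"

definition five_basket :: "'a set \<Rightarrow> ('a \<Rightarrow> 'a \<Rightarrow> bool) \<Rightarrow> bool" where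
  "five_basket Q E \<longleftrightarrow> (\<exists>A B C F.
     partition_list Q [A, B 1, B 2, B 3, C 1, C 2, C 3, F] \<and>
     A \<noteq> {} \<and> clique E A \<and> clique E F \<and>
     (\<forall>i\<in>{1,2,3::nat}. B i \<noteq> {} \<and> C i \<noteq> {} \<and> clique E (B i) \<and> clique E (C i)) \<and>
     (\<forall>i\<in>{1,2,3}. \<forall>j\<in>{1,2,3}. i \<noteq> j \<longrightarrow> anticomplete E (B i) (B j) \<and> complete E (C i) (C j)) \<and>
     (\<exists>i0\<in>{1,2,3}. complete E A (\<Union>i\<in>{1,2,3} - {i0}. B i) \<and>
        (\<exists>as. nested_order E A (B i0) as)) \<and>
     anticomplete E A (C 1 \<union> C 2 \<union> C 3) \<and>
     (\<forall>i\<in>{1,2,3}. complete E (B i) (C i) \<and>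
        (\<forall>j\<in>{1,2,3}. j \<noteq> i \<longrightarrow> anticomplete E (B i) (C j))) \<and>
     (\<exists>j0\<in>{1,2,3}. complete E F (Q - (B j0 \<union> C j0 \<union> F)) \<and>
        anticomplete E F (B j0 \<union> C j0)))"

definition villa_partition :: "('a \<Rightarrow> 'a \<Rightarrow> bool) \<Rightarrow> nat \<Rightarrow> 'a set \<Rightarrow> (nat \<Rightarrow> 'a set) \<Rightarrow> (nat \<Rightarrow> 'a set) \<Rightarrow> bool" where
  "villa_partition E t A B C \<longleftrightarrow> 3 \<le> t \<and>
     A \<noteq> {} \<and> clique E A \<and>
     (\<forall>i\<in>{1..t}. B i \<noteq> {} \<and> C i \<noteq> {} \<and> clique E (B i) \<and> clique E (C i)) \<and>
     complete E A (\<Union>i\<in>{1..t}. B i) \<and> anticomplete E A (\<Union>i\<in>{1..t}. C i) \<and>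
     (\<forall>i\<in>{1..t}. \<forall>j\<in>{1..t}. i \<noteq> j \<longrightarrow>
        anticomplete E (B i) (B j) \<and> complete E (C i) (C j) \<and> anticomplete E (B i) (C j)) \<and>
     (\<forall>i\<in>{1..t}. \<exists>bs. nested_order E (B i) (C i) bs \<and>
        {c \<in> C i. E (last bs) c} \<noteq> {})"

definition villa_parts :: "nat \<Rightarrow> 'a set \<Rightarrow> (nat \<Rightarrow> 'a set) \<Rightarrow> (nat \<Rightarrow> 'a set) \<Rightarrow> 'a set list" where
  "villa_parts t A B C = A # map B [1..<t+1] @ map C [1..<t+1]"

definition t_villa :: "nat \<Rightarrow> 'a set \<Rightarrow> ('a \<Rightarrow> 'a \<Rightarrow> bool) \<Rightarrow> bool" where
  "t_villa t Q E \<longleftrightarrow> 3 \<le> t \<and> (\<exists>A B C.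
     partition_list Q (villa_parts t A B C) \<and> villa_partition E t A B C)"

definition villa :: "'a set \<Rightarrow> ('a \<Rightarrow> 'a \<Rightarrow> bool) \<Rightarrow> bool" where
  "villa Q E \<longleftrightarrow> (\<exists>t\<ge>3. t_villa t Q E)"

definition t_mansion :: "nat \<Rightarrow> 'a set \<Rightarrow> ('a \<Rightarrow> 'a \<Rightarrow> bool) \<Rightarrow> bool" where
  "t_mansion t Q E \<longleftrightarrow> 3 \<le> t \<and> (\<exists>A B C F X Y.
     partition_list Q (villa_parts t A B C @ [F, X, Y]) \<and>
     F \<noteq> {} \<and> clique E F \<and> clique E X \<and> clique E Y \<and>
     villa_partition E t A B C \<and>
     (\<exists>j0\<in>{1..t}.
        complete E F A \<and> complete E F (\<Union>i\<in>{1..t} - {j0}. B i) \<and>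
        complete E F (\<Union>i\<in>{1..t} - {j0}. C i) \<and>
        anticomplete E F (B j0 \<union> C j0) \<and>
        complete E (B j0) (C j0) \<and>
        complete E X (A \<union> B j0) \<and>
        anticomplete E X (\<Union>i\<in>{1..t} - {j0}. B i) \<and>
        anticomplete E X (\<Union>i\<in>{1..t}. C i)) \<and>
     complete E F (X \<union> Y) \<and> anticomplete E X Y \<and>
     complete E Y (\<Union>i\<in>{1..t}. C i) \<and>
     anticomplete E Y (A \<union> (\<Union>i\<in>{1..t}. B i)))"

definition mansion :: "'a set \<Rightarrow> ('a \<Rightarrow> 'a \<Rightarrow> bool) \<Rightarrow> bool" where
  "mansion Q E \<longleftrightarrow> (\<exists>t\<ge>3. t_mansion t Q E)"

definition ring_partition :: "nat \<Rightarrow> 'a set \<Rightarrow> ('a \<Rightarrow> 'a \<Rightarrow> bool) \<Rightarrow> (nat \<Rightarrow> 'a set) \<Rightarrow> bool" where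
  "ring_partition k R E X \<longleftrightarrow> 4 \<le> k \<and>
     partition_list R (map X [0..<k]) \<and>
     (\<forall>i<k. X i \<noteq> {} \<and>
        (\<exists>us. distinct us \<and> set us = X i \<and> us \<noteq> [] \<and>
           X i \<subseteq> closed_nbhd R E (last us) \<and>
           (\<forall>j. Suc j < length us \<longrightarrow>
              closed_nbhd R E (us ! Suc j) \<subseteq> closed_nbhd R E (us ! j)) \<and>
           closed_nbhd R E (us ! 0) = X ((i + k - 1) mod k) \<union> X i \<union> X ((i + 1) mod k)))"

definition k_ring :: "nat \<Rightarrow> 'a set \<Rightarrow> ('a \<Rightarrow> 'a \<Rightarrow> bool) \<Rightarrow> bool" where
  "k_ring k R E \<longleftrightarrow> 4 \<le> k \<and> (\<exists>X. ring_partition k R E X)"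

definition five_crown :: "'a set \<Rightarrow> ('a \<Rightarrow> 'a \<Rightarrow> bool) \<Rightarrow> bool" where
  "five_crown R E \<longleftrightarrow> (\<exists>X. ring_partition 5 R E X \<and>
     (\<exists>i<5::nat. complete E (X ((i + 4) mod 5)) (X ((i + 3) mod 5)) \<and>
                 complete E (X ((i + 1) mod 5)) (X ((i + 2) mod 5))))"

definition special :: "'a set \<Rightarrow> ('a \<Rightarrow> 'a \<Rightarrow> bool) \<Rightarrow> bool" where
  "special Q E \<longleftrightarrow> five_basket Q E \<or> villa Q E \<or> mansion Q E \<or> five_crown Q E"

end

(*
Deleting the universal vertices of G leaves a graph in which simpliciality and the five obstructions are
unchanged, so one may assume that there are none; a C4-free graph without universal vertices has a connected
complement, which links the anticomponents to this reduction.  If the reduced graph has no simplicial vertex,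
it contains a 5-hole.  Call a vertex a joined to three pairwise nonadjacent vertices b_i, each with a private
neighbour c_i in a triangle, a pyramid.  Without pyramids, every vertex attaches to a well chosen 5-hole in
three consecutive vertices, and the five classes form a 5-crown.  Otherwise take a pyramid with the largest
number t of paths and then of largest degree sum: C4, C6, C7, 2P3 and T0 restrict the neighbourhoods on it
to a few types, and these types are the parts of a villa, a mansion or a 5-basket.

Conversely, neighbourhoods are nested inside each part, so that an induced C4, C6, C7 or T0 meets each part
at most once, and the few possible transversals are excluded by hand.
*)
theory Submission
  imports Defs
begin

section \<open>Graphs and forbidden induced subgraphs\<close>

text \<open>The workhorse is \<open>clique_attachment\<close>: a nonempty clique with pairwise
  adjacent outside neighbours would contain a simplicial vertex, because C4-freeness nests the
  outside neighbourhoods of its members. A class of unwanted vertices is therefore shown to be empty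
  in two steps: its components are cliques (otherwise 2P3, with a P3 placed far away), and any two
  outside neighbours of a component are adjacent. This serves for vertices without neighbours on a
  5-hole, for badly attached ones and for several types over a pyramid. The 5-hole is chosen to have
  as many vertices as possible attached to it in three consecutive vertices, so that an exchange
  which turns one bad vertex good and loses none is impossible. Over a pyramid, the adjacencies to
  it do not settle everything: an unwanted edge can survive, but it then produces a vertex whose
  closed neighbourhood strictly contains that of \<open>a\<close>, some \<open>b i\<close> or some
  \<open>c i\<close>. This is why degrees enter the choice. In the forward direction T0 is needed
  only against vertices whose neighbours on the pyramid are some, but not all, of the
  \<open>c i\<close>.\<close>

locale simple_graph =
  fixes V :: "'a set" and E :: "'a \<Rightarrow> 'a \<Rightarrow> bool"
  assumes graph: "is_graph V E"
begin

text \<open>\<open>E\<close> is arbitrary outside \<open>V\<close>. With membership built into the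
  relation, every adjacency hypothesis also supplies the vertex conditions, which the long case
  analyses would otherwise have to carry along.\<close>

definition adj :: "'a \<Rightarrow> 'a \<Rightarrow> bool" where
  "adj x y \<longleftrightarrow> x \<in> V \<and> y \<in> V \<and> E x y"

definition cadj :: "'a \<Rightarrow> 'a \<Rightarrow> bool" where
  "cadj x y \<longleftrightarrow> x = y \<or> adj x y"

lemma finite_V: "finite V" and V_nonempty: "V \<noteq> {}"
  using graph by (auto simp: is_graph_def)

lemma adj_sym: "adj x y \<Longrightarrow> adj y x"
  using graph by (auto simp: is_graph_def adj_def)

lemma adj_commute: "adj x y \<longleftrightarrow> adj y x"
  using adj_sym by blast

lemma adj_irrefl [simp]: "\<not> adj x x"
  using graph unfolding is_graph_def adj_def by blast

lemma adjD: "adj x y \<Longrightarrow> x \<in> V \<and> y \<in> V \<and> x \<noteq> y"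
  using adj_irrefl by (metis adj_def)

lemma adj_iff: "x \<in> V \<Longrightarrow> y \<in> V \<Longrightarrow> adj x y \<longleftrightarrow> E x y"
  by (simp add: adj_def)

text \<open>Symmetry of both relations reduces the adjacency table of a pattern to the positions
  \<open>i < j\<close>.\<close>

lemma has_inducedI:
  assumes "distinct xs" "set xs \<subseteq> V" and n: "length xs = n"
    and sym: "\<And>i j. EH i j \<Longrightarrow> EH j i"
    and irr: "\<And>i. i < n \<Longrightarrow> \<not> EH i i"
    and adj: "\<And>i j. j < n \<Longrightarrow> i < j \<Longrightarrow> adj (xs ! i) (xs ! j) \<longleftrightarrow> EH i j"
  shows "has_induced V E {0..<n} EH"
  unfolding has_induced_def
proof (intro exI conjI ballI)
  show "inj_on (\<lambda>i. xs ! i) {0..<n}"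
    using assms(1) n by (auto simp: inj_on_def nth_eq_iff_index_eq)
  show "(\<lambda>i. xs ! i) ` {0..<n} \<subseteq> V"
    using assms(2) n by auto
  fix i j assume ij: "i \<in> {0..<n}" "j \<in> {0..<n}"
  then have V: "xs ! i \<in> V" "xs ! j \<in> V" using assms(2) n by auto
  have "adj (xs ! i) (xs ! j) \<longleftrightarrow> EH i j"
    using ij adj[of j i] adj[of i j] adj_commute[of "xs ! i" "xs ! j"] sym irr[of i]
    by (cases i j rule: linorder_cases) auto
  then show "E (xs ! i) (xs ! j) \<longleftrightarrow> EH i j" using V adj_iff by simp
qed

lemma cycle_rel_sym: "cycle_rel k i j \<Longrightarrow> cycle_rel k j i"
  by (auto simp: cycle_rel_def)

lemma edges_rel_sym: "edges_rel es i j \<Longrightarrow> edges_rel es j i"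
  by (auto simp: edges_rel_def)

lemma twoP3_rel_sym: "twoP3_rel i j \<Longrightarrow> twoP3_rel j i"
  by (metis twoP3_rel_def edges_rel_sym)

lemma T0_rel_sym: "T0_rel i j \<Longrightarrow> T0_rel j i"
  by (metis T0_rel_def edges_rel_sym)

end

locale free_graph = simple_graph +
  assumes free: "is_free V E"
begin

text \<open>Opposite vertices of a 4-cycle have the same neighbours, so the adjacency pattern cannot
  tell them apart and two inequalities must be assumed. In C6, C7 and T0 different vertices have
  different neighbourhoods, and in 2P3 only the two ends of one path coincide in this respect; hence
  the different hypotheses of the lemmas below.\<close>

lemma C4:
  assumes "adj x0 x1" "adj x1 x2" "adj x2 x3" "adj x3 x0" "x0 \<noteq> x2" "x1 \<noteq> x3"
  shows "adj x0 x2 \<or> adj x1 x3"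
proof (rule ccontr)
  assume no: "\<not> ?thesis"
  let ?xs = "[x0, x1, x2, x3]"
  have "has_induced V E {0..<4} (cycle_rel 4)"
  proof (rule has_inducedI[of ?xs])
    show "distinct ?xs" using assms by auto
    show "set ?xs \<subseteq> V" using assms by (simp add: adj_def)
    show "length ?xs = 4" by simp
  next
    fix i assume "i < (4::nat)"
    then have "i \<in> {0, 1, 2, 3}" by (simp_all add: numeral_eq_Suc less_Suc_eq)
    then show "\<not> cycle_rel 4 i i"
      by (elim insertE emptyE; simp add: cycle_rel_def)
  next
    fix i j assume "j < (4::nat)" "i < j"
    then have "i < 4" "j < 4" by simp_all
    then have "i \<in> {0, 1, 2, 3}" "j \<in> {0, 1, 2, 3}" by (simp_all add: numeral_eq_Suc less_Suc_eq)
    then show "adj (?xs ! i) (?xs ! j) \<longleftrightarrow> cycle_rel 4 i j"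
      using no \<open>i < j\<close> by (elim insertE emptyE; simp add: assms assms(4)[THEN adj_sym] cycle_rel_def)
  qed (rule cycle_rel_sym)
  then show False using free by (simp add: is_free_def)
qed

lemma C6:
  assumes "adj x0 x1" "adj x1 x2" "adj x2 x3" "adj x3 x4" "adj x4 x5" "adj x5 x0"
    and "\<not> adj x0 x2" "\<not> adj x0 x3" "\<not> adj x0 x4" "\<not> adj x1 x3" "\<not> adj x1 x4" "\<not> adj x1 x5"
      "\<not> adj x2 x4" "\<not> adj x2 x5" "\<not> adj x3 x5"
  shows False
proof -
  let ?xs = "[x0, x1, x2, x3, x4, x5]"
  have "has_induced V E {0..<6} (cycle_rel 6)"
  proof (rule has_inducedI[of ?xs])
    show "distinct ?xs" using assms by (auto simp: adj_commute)
    show "set ?xs \<subseteq> V" using assms by (simp add: adj_def)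
    show "length ?xs = 6" by simp
  next
    fix i assume "i < (6::nat)"
    then have "i \<in> {0, 1, 2, 3, 4, 5}" by (simp_all add: numeral_eq_Suc less_Suc_eq)
    then show "\<not> cycle_rel 6 i i"
      by (elim insertE emptyE; simp add: cycle_rel_def)
  next
    fix i j assume "j < (6::nat)" "i < j"
    then have "i < 6" "j < 6" by simp_all
    then have "i \<in> {0, 1, 2, 3, 4, 5}" "j \<in> {0, 1, 2, 3, 4, 5}" by (simp_all add: numeral_eq_Suc less_Suc_eq)
    then show "adj (?xs ! i) (?xs ! j) \<longleftrightarrow> cycle_rel 6 i j"
      using \<open>i < j\<close> by (elim insertE emptyE; simp add: assms assms(6)[THEN adj_sym] cycle_rel_def)
  qed (rule cycle_rel_sym)
  then show False using free by (simp add: is_free_def)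
qed

lemma C7:
  assumes "adj x0 x1" "adj x1 x2" "adj x2 x3" "adj x3 x4" "adj x4 x5" "adj x5 x6" "adj x6 x0"
    and "\<not> adj x0 x2" "\<not> adj x0 x3" "\<not> adj x0 x4" "\<not> adj x0 x5"
      "\<not> adj x1 x3" "\<not> adj x1 x4" "\<not> adj x1 x5" "\<not> adj x1 x6"
      "\<not> adj x2 x4" "\<not> adj x2 x5" "\<not> adj x2 x6" "\<not> adj x3 x5" "\<not> adj x3 x6" "\<not> adj x4 x6"
  shows False
proof -
  let ?xs = "[x0, x1, x2, x3, x4, x5, x6]"
  have "has_induced V E {0..<7} (cycle_rel 7)"
  proof (rule has_inducedI[of ?xs])
    show "distinct ?xs" using assms by (auto simp: adj_commute)
    show "set ?xs \<subseteq> V" using assms by (simp add: adj_def)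
    show "length ?xs = 7" by simp
  next
    fix i assume "i < (7::nat)"
    then have "i \<in> {0, 1, 2, 3, 4, 5, 6}" by (simp_all add: numeral_eq_Suc less_Suc_eq)
    then show "\<not> cycle_rel 7 i i"
      by (elim insertE emptyE; simp add: cycle_rel_def)
  next
    fix i j assume "j < (7::nat)" "i < j"
    then have "i < 7" "j < 7" by simp_all
    then have "i \<in> {0, 1, 2, 3, 4, 5, 6}" "j \<in> {0, 1, 2, 3, 4, 5, 6}" by (simp_all add: numeral_eq_Suc less_Suc_eq)
    then show "adj (?xs ! i) (?xs ! j) \<longleftrightarrow> cycle_rel 7 i j"
      using \<open>i < j\<close> by (elim insertE emptyE; simp add: assms assms(7)[THEN adj_sym] cycle_rel_def)
  qed (rule cycle_rel_sym)
  then show False using free by (simp add: is_free_def)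
qed

lemma twoP3:
  assumes "adj x0 x1" "adj x1 x2" "adj x3 x4" "adj x4 x5" "x0 \<noteq> x2" "x3 \<noteq> x5"
    and "\<not> adj x0 x2" "\<not> adj x3 x5"
      "\<not> adj x0 x3" "\<not> adj x0 x4" "\<not> adj x0 x5" "\<not> adj x1 x3" "\<not> adj x1 x4" "\<not> adj x1 x5"
      "\<not> adj x2 x3" "\<not> adj x2 x4" "\<not> adj x2 x5"
  shows False
proof -
  let ?xs = "[x0, x1, x2, x3, x4, x5]"
  have "has_induced V E {0..<6} twoP3_rel"
  proof (rule has_inducedI[of ?xs])
    show "distinct ?xs" using assms by (auto simp: adj_commute)
    show "set ?xs \<subseteq> V" using assms by (simp add: adj_def)
    show "length ?xs = 6" by simp
  next
    fix i assume "i < (6::nat)"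
    then have "i \<in> {0, 1, 2, 3, 4, 5}" by (simp_all add: numeral_eq_Suc less_Suc_eq)
    then show "\<not> twoP3_rel i i"
      by (elim insertE emptyE; simp add: twoP3_rel_def edges_rel_def)
  next
    fix i j assume "j < (6::nat)" "i < j"
    then have "i < 6" "j < 6" by simp_all
    then have "i \<in> {0, 1, 2, 3, 4, 5}" "j \<in> {0, 1, 2, 3, 4, 5}" by (simp_all add: numeral_eq_Suc less_Suc_eq)
    then show "adj (?xs ! i) (?xs ! j) \<longleftrightarrow> twoP3_rel i j"
      using \<open>i < j\<close> by (elim insertE emptyE; simp add: assms twoP3_rel_def edges_rel_def)
  qed (rule twoP3_rel_sym)
  then show False using free by (simp add: is_free_def)
qed

lemma T0:
  assumes "adj p q" "adj p u0" "adj p u2" "adj p u3" "adj q u1" "adj q u2" "adj q u3"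
      "adj u0 w1" "adj u1 w1" "adj u2 w2" "adj u3 w3" "adj w1 w2" "adj w1 w3" "adj w2 w3"
    and "\<not> adj p u1" "\<not> adj p w1" "\<not> adj p w2" "\<not> adj p w3"
      "\<not> adj q u0" "\<not> adj q w1" "\<not> adj q w2" "\<not> adj q w3"
      "\<not> adj u0 u1" "\<not> adj u0 u2" "\<not> adj u0 u3" "\<not> adj u0 w2" "\<not> adj u0 w3"
      "\<not> adj u1 u2" "\<not> adj u1 u3" "\<not> adj u1 w2" "\<not> adj u1 w3"
      "\<not> adj u2 u3" "\<not> adj u2 w1" "\<not> adj u2 w3" "\<not> adj u3 w1" "\<not> adj u3 w2"
  shows False
proof -
  let ?xs = "[p, q, u0, u1, u2, u3, w1, w2, w3]"
  have "has_induced V E {0..<9} T0_rel"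
  proof (rule has_inducedI[of ?xs])
    show "distinct ?xs" using assms by (auto simp: adj_commute)
    show "set ?xs \<subseteq> V" using assms(1-14) by (simp add: adj_def)
    show "length ?xs = 9" by simp
  next
    fix i assume "i < (9::nat)"
    then have "i \<in> {0, 1, 2, 3, 4, 5, 6, 7, 8}" by (simp_all add: numeral_eq_Suc less_Suc_eq)
    then show "\<not> T0_rel i i"
      by (elim insertE emptyE; simp add: T0_rel_def edges_rel_def)
  next
    fix i j assume "j < (9::nat)" "i < j"
    then have "i < 9" "j < 9" by simp_all
    then have "i \<in> {0, 1, 2, 3, 4, 5, 6, 7, 8}" "j \<in> {0, 1, 2, 3, 4, 5, 6, 7, 8}" by (simp_all add: numeral_eq_Suc less_Suc_eq)
    then show "adj (?xs ! i) (?xs ! j) \<longleftrightarrow> T0_rel i j"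
      using \<open>i < j\<close> by (elim insertE emptyE; simp add: assms T0_rel_def edges_rel_def)
  qed (rule T0_rel_sym)
  then show False using free by (simp add: is_free_def)
qed

section \<open>Simplicial vertices in the absence of 5-holes\<close>

definition simpl_in :: "'a set \<Rightarrow> 'a \<Rightarrow> bool" where
  "simpl_in W s \<longleftrightarrow> s \<in> W \<and>
     (\<forall>x\<in>W. \<forall>y\<in>W. adj s x \<longrightarrow> adj s y \<longrightarrow> x \<noteq> y \<longrightarrow> adj x y)"

definition hole5 :: "'a \<Rightarrow> 'a \<Rightarrow> 'a \<Rightarrow> 'a \<Rightarrow> 'a \<Rightarrow> bool" where
  "hole5 x0 x1 x2 x3 x4 \<longleftrightarrow>
     adj x0 x1 \<and> adj x1 x2 \<and> adj x2 x3 \<and> adj x3 x4 \<and> adj x4 x0 \<and>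
     \<not> adj x0 x2 \<and> \<not> adj x1 x3 \<and> \<not> adj x2 x4 \<and> \<not> adj x3 x0 \<and> \<not> adj x4 x1"

text \<open>A shortest walk through \<open>D\<close> closes up with \<open>v\<close> to an induced cycle.\<close>

lemma no_hole_through_connected:
  assumes no5: "\<And>x0 x1 x2 x3 x4. \<not> hole5 x0 x1 x2 x3 x4"
    and D: "\<And>d. d \<in> D \<Longrightarrow> d \<noteq> v \<and> \<not> adj d v"
    and conn: "\<And>d d'. d \<in> D \<Longrightarrow> d' \<in> D \<Longrightarrow> (\<lambda>a b. adj a b \<and> b \<in> D)\<^sup>*\<^sup>* d d'"
    and x: "adj x v" "adj x d" "d \<in> D" and y: "adj y v" "adj y d'" "d' \<in> D" and "x \<noteq> y"
  shows "adj x y"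
proof (rule ccontr)
  assume nxy: "\<not> adj x y"
  \<comment> \<open>A step may end in \<open>D\<close> or at \<open>y\<close>; the inner vertices of
    a shortest walk from \<open>x\<close> to \<open>y\<close> then lie in \<open>D\<close>, so that
    only its two ends are adjacent to \<open>v\<close>.\<close>
  define Q where "Q = (\<lambda>a b. adj a b \<and> (b \<in> D \<or> b = y))"
  have "Q\<^sup>*\<^sup>* d d'"
    using conn[OF x(3) y(3)] by (rule rtranclp_mono[THEN predicate2D, rotated]) (auto simp: Q_def)
  moreover have "Q x d" "Q d' y" using x y adj_sym by (auto simp: Q_def)
  ultimately have "Q\<^sup>*\<^sup>* x y" by (meson converse_rtranclp_into_rtranclp rtranclp.rtrancl_into_rtrancl)
  then have ex: "\<exists>n. (Q ^^ n) x y" by (simp add: rtranclp_power)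
  define m where "m = (LEAST n. (Q ^^ n) x y)"
  have m: "(Q ^^ m) x y" using ex unfolding m_def by (rule LeastI_ex)
  have least: "m \<le> n" if "(Q ^^ n) x y" for n
    using that unfolding m_def by (rule Least_le)
  obtain p where p: "p 0 = x" "p m = y" "\<And>i. i < m \<Longrightarrow> Q (p i) (p (Suc i))"
    using m by (auto simp: relpowp_fun_conv)
  have seg: "(Q ^^ (j - i)) (p i) (p j)" if "i \<le> j" "j \<le> m" for i j
    unfolding relpowp_fun_conv
    using that p(3) by (intro exI[of _ "\<lambda>k. p (i + k)"]) auto
  have nonadj: "\<not> adj (p i) (p j)" if "Suc i < j" "j \<le> m" for i j
  proof
    assume a: "adj (p i) (p j)"
    have "Q (p i) (p j)"
      using a p(3)[of "j - 1"] that by (auto simp: Q_def)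
    then have "(Q ^^ Suc i) x (p j)"
      using seg[of 0 i] that p(1) by (auto intro: relpowp_Suc_I)
    then have "(Q ^^ (Suc i + (m - j))) x y"
      unfolding relpowp_add using seg[of j m] that p(2) by (auto intro!: relcomppI)
    from least[OF this] that show False by simp
  qed
  have pneq: "p i \<noteq> p j" if "i < j" "j \<le> m" for i j
  proof
    assume e: "p i = p j"
    have "(Q ^^ (i + (m - j))) x y"
      unfolding relpowp_add using seg[of 0 i] seg[of j m] that p(1,2) e by (auto intro!: relcomppI)
    from least[OF this] that show False by simp
  qed
  have pD: "p i \<in> D" if "0 < i" "i < m" for i
    using p(3)[of "i - 1"] pneq[of i m] that p(2) by (auto simp: Q_def)
  have pv: "p i \<noteq> v" "\<not> adj (p i) v" "\<not> adj v (p i)" if "0 < i" "i < m" for i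
    using D[OF pD[OF that]] adj_sym by blast+
  have step: "adj (p i) (p (Suc i))" if "i < m" for i
    using p(3)[OF that] by (simp add: Q_def)
  have v: "adj v (p 0)" "adj (p m) v" using x y p adj_sym by auto
  \<comment> \<open>The walk closes with \<open>v\<close> to an induced cycle of length
    \<open>m + 2\<close>: \<open>m = 2\<close> gives C4, \<open>m = 3\<close> a 5-hole,
    \<open>m = 4\<close> and \<open>m = 5\<close> give C6 and C7. For larger \<open>m\<close> the
    first seven vertices of the walk induce a path, and dropping its middle vertex leaves
    2P3.\<close>
  have "m \<noteq> 0" using p \<open>x \<noteq> y\<close> by (intro notI) simp
  moreover have "m \<noteq> 1" using step[of 0] nxy p by (intro notI) simp
  moreover have "m \<noteq> 2"
    using C4[of v "p 0" "p 1" "p 2"] step[of 0] step[of 1] v pv[of 1] nonadj[of 0 2] pneq[of 0 2]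
    by (auto simp: numeral_2_eq_2)
  moreover have "m \<noteq> 3"
    using no5[of v "p 0" "p 1" "p 2" "p 3"] step[of 0] step[of 1] step[of 2] v pv[of 1] pv[of 2]
      nonadj[of 0 2] nonadj[of 0 3] nonadj[of 1 3]
    by (auto simp: hole5_def numeral_eq_Suc adj_commute)
  moreover have "m \<noteq> 4"
    using C6[of v "p 0" "p 1" "p 2" "p 3" "p 4"] step[of 0] step[of 1] step[of 2] step[of 3] v
      pv[of 1] pv[of 2] pv[of 3] nonadj[of 0 2] nonadj[of 0 3] nonadj[of 0 4] nonadj[of 1 3]
      nonadj[of 1 4] nonadj[of 2 4]
    by (auto simp: numeral_eq_Suc)
  moreover have "m \<noteq> 5"
    using C7[of v "p 0" "p 1" "p 2" "p 3" "p 4" "p 5"] step[of 0] step[of 1] step[of 2] step[of 3]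
      step[of 4] v pv[of 1] pv[of 2] pv[of 3] pv[of 4] nonadj[of 0 2] nonadj[of 0 3] nonadj[of 0 4]
      nonadj[of 0 5] nonadj[of 1 3] nonadj[of 1 4] nonadj[of 1 5] nonadj[of 2 4] nonadj[of 2 5]
      nonadj[of 3 5]
    by (auto simp: numeral_eq_Suc)
  moreover have "\<not> 6 \<le> m"
    using twoP3[of "p 0" "p 1" "p 2" "p 4" "p 5" "p 6"] step[of 0] step[of 1] step[of 4] step[of 5]
      pneq[of 0 2] pneq[of 4 6] nonadj[of 0 2] nonadj[of 4 6] nonadj[of 0 4] nonadj[of 0 5]
      nonadj[of 0 6] nonadj[of 1 4] nonadj[of 1 5] nonadj[of 1 6] nonadj[of 2 4] nonadj[of 2 5]
      nonadj[of 2 6]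
    by (auto simp: numeral_eq_Suc)
  ultimately show False by linarith
qed

text \<open>Without 5-holes the graph is chordal: longer holes contain 2P3 or are forbidden. This is
  the strong form of Dirac's theorem, in which the simplicial vertex can be found among the
  nonneighbours of a prescribed vertex. The prescribed vertex is what makes the induction
  work.\<close>

lemma simplicial_nonneighbour:
  assumes no5: "\<And>x0 x1 x2 x3 x4. \<not> hole5 x0 x1 x2 x3 x4"
    and "finite W" "v \<in> W" "u \<in> W" "u \<noteq> v" "\<not> adj u v"
  shows "\<exists>s. simpl_in W s \<and> s \<noteq> v \<and> \<not> adj s v"
  using assms(2-)
proof (induction "card W" arbitrary: W v u rule: less_induct)
  case less
  define W' where "W' = {x \<in> W. x \<noteq> v \<and> \<not> adj x v}"
  define R where "R = (\<lambda>a b. adj a b \<and> a \<in> W' \<and> b \<in> W')"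
  \<comment> \<open>\<open>D\<close> is the component of \<open>u\<close> among the nonneighbours of
    \<open>v\<close>, and \<open>K\<close> its attachment. \<open>K\<close> consists of neighbours
    of \<open>v\<close> and is a clique by the preceding lemma, so a simplicial vertex of the graph
    on \<open>D \<union> K\<close> that lies in \<open>D\<close> is simplicial in
    \<open>W\<close>.\<close>
  define D where "D = {x. R\<^sup>*\<^sup>* u x}"
  define K where "K = {x \<in> W. x \<notin> D \<and> (\<exists>d\<in>D. adj x d)}"
  have uD: "u \<in> D" by (simp add: D_def)
  have DW': "d \<in> W'" if "d \<in> D" for d
  proof -
    have "R\<^sup>*\<^sup>* u d" using that by (simp add: D_def)
    then show ?thesis using less.prems by (induction) (auto simp: R_def W'_def)
  qed
  have ext: "x \<in> D" if "d \<in> D" "adj d x" "x \<in> W'" for d x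
    using that DW'[OF that(1)] by (auto simp: D_def R_def intro: rtranclp.rtrancl_into_rtrancl)
  have Kv: "adj x v" if "x \<in> K" for x
  proof -
    obtain d where d: "d \<in> D" "adj x d" "x \<in> W" "x \<notin> D" using \<open>x \<in> K\<close> by (auto simp: K_def)
    then have "x \<notin> W'" using ext adj_sym by blast
    moreover have "x \<noteq> v" using d DW'[of d] by (auto simp: W'_def adj_commute)
    ultimately show ?thesis using d by (auto simp: W'_def)
  qed
  have conn: "(\<lambda>a b. adj a b \<and> b \<in> D)\<^sup>*\<^sup>* d d'" if "d \<in> D" "d' \<in> D" for d d'
  proof -
    have symR: "symp R" by (auto simp: symp_def R_def adj_commute)
    have "R\<^sup>*\<^sup>* d u" using that(1) symR
      by (metis D_def mem_Collect_eq sympD symp_rtranclp)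
    then have "R\<^sup>*\<^sup>* d d'" using that(2) by (auto simp: D_def)
    then show ?thesis
    proof (induction rule: rtranclp_induct)
      case (step y z)
      have "R\<^sup>*\<^sup>* u z" using that(1) step(1,2) by (auto simp: D_def)
      then show ?case using step by (auto simp: D_def R_def intro: rtranclp.rtrancl_into_rtrancl)
    qed simp
  qed
  have Kcl: "adj x y" if xy: "x \<in> K" "y \<in> K" "x \<noteq> y" for x y
  proof -
    obtain d d' where dd: "adj x d" "d \<in> D" "adj y d'" "d' \<in> D"
      using xy unfolding K_def by blast
    have "\<And>d. d \<in> D \<Longrightarrow> d \<noteq> v \<and> \<not> adj d v" using DW' by (auto simp: W'_def)
    then show ?thesis
      by (rule no_hole_through_connected[where D = D and v = v and d = d and d' = d', OF no5])
        (use conn dd Kv xy in blast)+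
  qed
  have nbr: "x \<in> D \<union> K" if "d \<in> D" "adj d x" "x \<in> W" for d x
    using that adj_sym by (auto simp: K_def)
  have sub: "D \<union> K \<subseteq> W" "v \<notin> D \<union> K"
    using DW' Kv by (fastforce simp: W'_def K_def)+
  have up: "\<exists>s. simpl_in W s \<and> s \<noteq> v \<and> \<not> adj s v" if "s \<in> D" "simpl_in (D \<union> K) s" for s
  proof -
    have "simpl_in W s" unfolding simpl_in_def
    proof (intro conjI ballI impI)
      show "s \<in> W" using that sub by auto
      fix x y assume "x \<in> W" "y \<in> W" "adj s x" "adj s y" "x \<noteq> y"
      then show "adj x y" using nbr[OF that(1)] that(2) by (simp add: simpl_in_def)
    qed
    then show ?thesis using DW'[OF that(1)] by (auto simp: W'_def)
  qed
  have fin: "finite (D \<union> K)" using sub(1) less.prems(1) finite_subset by blast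
  have lt: "card (D \<union> K) < card W"
    using sub less.prems by (metis psubsetI psubset_card_mono)
  show ?case
  \<comment> \<open>If some \<open>k\<close> misses a vertex of \<open>D\<close>, induction inside
    \<open>D \<union> K\<close> gives a simplicial nonneighbour of \<open>k\<close>, which cannot
    belong to the clique \<open>K\<close>. Otherwise \<open>D\<close> is complete to
    \<open>K\<close>, and a simplicial vertex of \<open>D\<close> stays simplicial when the clique
    \<open>K\<close> is added.\<close>
  proof (cases "\<exists>k\<in>K. \<exists>d\<in>D. \<not> adj d k")
    case True
    then obtain k d where kd: "k \<in> K" "d \<in> D" "\<not> adj d k" by blast
    moreover have "d \<noteq> k" using kd by (auto simp: K_def)
    ultimately obtain s where s: "simpl_in (D \<union> K) s" "s \<noteq> k" "\<not> adj s k"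
      using less.hyps[OF lt fin, of k d] by auto
    then have "s \<in> D" using Kcl[of s k] kd by (auto simp: simpl_in_def)
    then show ?thesis using up s by blast
  next
    case False
    then have DK: "adj d k" "adj k d" if "d \<in> D" "k \<in> K" for d k using that adj_sym by blast+
    have "card D \<le> card (D \<union> K)" using fin by (simp add: card_mono)
    then have ltD: "card D < card W" using lt by simp
    obtain s where s: "simpl_in D s"
    proof (cases "\<exists>d\<in>D. \<exists>d'\<in>D. d' \<noteq> d \<and> \<not> adj d' d")
      case True
      then show ?thesis using less.hyps[OF ltD] fin that by blast
    next
      case False
      then have "simpl_in D u" using uD by (auto simp: simpl_in_def)
      then show ?thesis by (rule that)
    qed
    then have "simpl_in (D \<union> K) s" using DK Kcl by (auto simp: simpl_in_def)
    moreover have "s \<in> D" using s by (simp add: simpl_in_def)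
    ultimately show ?thesis using up by blast
  qed
qed

end

locale nonsimplicial_graph = free_graph +
  assumes nonsimplicial: "v \<in> V \<Longrightarrow> \<not> simplicial V E v"
    and nonuniversal: "v \<in> V \<Longrightarrow> \<exists>u\<in>V. u \<noteq> v \<and> \<not> E u v"
begin

lemma nbr_pair:
  assumes "v \<in> V"
  obtains x y where "adj v x" "adj v y" "x \<noteq> y" "\<not> adj x y"
  using nonsimplicial[OF assms] assms that
  by (auto simp: simplicial_def clique_def nbhd_def adj_def)

lemma exists_hole5: "\<exists>x0 x1 x2 x3 x4. hole5 x0 x1 x2 x3 x4"
proof (rule ccontr)
  assume no: "\<not> ?thesis"
  obtain v where v: "v \<in> V" using V_nonempty by blast
  obtain u where "u \<in> V" "u \<noteq> v" "\<not> adj u v" using nonuniversal[OF v] by (auto simp: adj_def)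
  then obtain s where "simpl_in V s"
    using simplicial_nonneighbour[OF _ finite_V v] no by blast
  then show False using nbr_pair[of s] adjD unfolding simpl_in_def by metis
qed

text \<open>Suppose that the outside neighbours of \<open>D\<close> were pairwise adjacent. Two
  members of \<open>D\<close> with incomparable outside neighbourhoods would then give an induced
  4-cycle with their private neighbours, so the member \<open>d\<close> with the fewest outside
  neighbours has all of them in common with the rest of \<open>D\<close>. Such a \<open>d\<close> is
  simplicial.\<close>

lemma clique_attachment:
  assumes "D \<noteq> {}" "D \<subseteq> V" and cl: "\<And>x y. x \<in> D \<Longrightarrow> y \<in> D \<Longrightarrow> x \<noteq> y \<Longrightarrow> adj x y"
  obtains x y d d' where "x \<notin> D" "y \<notin> D" "d \<in> D" "d' \<in> D" "adj d x" "adj d' y" "x \<noteq> y" "\<not> adj x y"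
proof (rule ccontr)
  note obt = that
  assume no: "\<not> thesis"
  let ?N = "\<lambda>d. {x. x \<notin> D \<and> adj d x}"
  have Ncl: "adj x y" if "x \<notin> D" "y \<notin> D" "d \<in> D" "d' \<in> D" "adj d x" "adj d' y" "x \<noteq> y" for x y d d'
    using obt[of x y d d'] no that by blast
  have finN: "finite (?N d)" for d
    using finite_V by (rule finite_subset[rotated]) (auto dest: adjD)
  obtain d where d: "d \<in> D" "\<And>e. e \<in> D \<Longrightarrow> card (?N d) \<le> card (?N e)"
    using ex_has_least_nat[of "\<lambda>d. d \<in> D" _ "\<lambda>d. card (?N d)"] assms(1) by blast
  have nest: "?N d \<subseteq> ?N e" if e: "e \<in> D" for e
  proof (rule ccontr)
    assume "\<not> ?thesis"
    then obtain k where k: "k \<notin> D" "adj d k" "\<not> adj e k" by blast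
    have "\<not> ?N e \<subset> ?N d" using d(2)[OF e] psubset_card_mono[OF finN, of "?N e" d] by linarith
    then obtain k' where k': "k' \<notin> D" "adj e k'" "\<not> adj d k'" using k by blast
    have "k \<noteq> k'" "d \<noteq> e" using k k' by auto
    then have "adj d e" "adj k k'" using cl e d(1) Ncl[of k k' d e] k k' by auto
    then show False using C4[of d e k' k] k k' adj_sym \<open>k \<noteq> k'\<close> \<open>d \<noteq> e\<close> k(1) k'(1) d(1) e by blast
  qed
  have "d \<in> V" using d assms by auto
  then obtain x y where xy: "adj d x" "adj d y" "x \<noteq> y" "\<not> adj x y" by (rule nbr_pair)
  then show False
    using cl Ncl[of x y d d] nest[of x] nest[of y] d(1) adj_sym[of x y] adj_sym[of y x]
    by (cases "x \<in> D"; cases "y \<in> D") blast+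
qed

end

section \<open>Pyramid-free graphs\<close>

context simple_graph
begin

definition pyramid :: "'a \<Rightarrow> 'a \<Rightarrow> 'a \<Rightarrow> 'a \<Rightarrow> 'a \<Rightarrow> 'a \<Rightarrow> 'a \<Rightarrow> bool" where
  "pyramid a b0 b1 b2 c0 c1 c2 \<longleftrightarrow>
     adj a b0 \<and> adj a b1 \<and> adj a b2 \<and> adj b0 c0 \<and> adj b1 c1 \<and> adj b2 c2 \<and>
     adj c0 c1 \<and> adj c0 c2 \<and> adj c1 c2 \<and>
     \<not> adj b0 b1 \<and> \<not> adj b0 b2 \<and> \<not> adj b1 b2 \<and> \<not> adj a c0 \<and> \<not> adj a c1 \<and> \<not> adj a c2 \<and>
     \<not> adj b0 c1 \<and> \<not> adj b0 c2 \<and> \<not> adj b1 c0 \<and> \<not> adj b1 c2 \<and> \<not> adj b2 c0 \<and> \<not> adj b2 c1"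

end

section \<open>Attachment of vertices to a 5-hole\<close>

context free_graph
begin

text \<open>
  A transversal of the five paths of length two on a 5-cycle contains two vertices at distance two;
  hence this conjunction says that \<open>v\<close> is equal or adjacent to three consecutive vertices.
\<close>

definition good :: "'a \<Rightarrow> 'a \<Rightarrow> 'a \<Rightarrow> 'a \<Rightarrow> 'a \<Rightarrow> 'a \<Rightarrow> bool" where
  "good x0 x1 x2 x3 x4 v \<longleftrightarrow>
     (cadj v x0 \<or> cadj v x2) \<and> (cadj v x1 \<or> cadj v x3) \<and> (cadj v x2 \<or> cadj v x4) \<and>
     (cadj v x3 \<or> cadj v x0) \<and> (cadj v x4 \<or> cadj v x1)"

text \<open>Optimality refers to a number and not to inclusion of the sets of good vertices, so that
  all 5-holes are comparable; it is used only through \<open>no_better_hole\<close>, where one set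
  of good vertices strictly contains the other.\<close>

definition maxhole :: "'a \<Rightarrow> 'a \<Rightarrow> 'a \<Rightarrow> 'a \<Rightarrow> 'a \<Rightarrow> bool" where
  "maxhole x0 x1 x2 x3 x4 \<longleftrightarrow> hole5 x0 x1 x2 x3 x4 \<and>
     (\<forall>y0 y1 y2 y3 y4. hole5 y0 y1 y2 y3 y4 \<longrightarrow>
        card {v \<in> V. good y0 y1 y2 y3 y4 v} \<le> card {v \<in> V. good x0 x1 x2 x3 x4 v})"

lemma hole5_rot: "hole5 x0 x1 x2 x3 x4 \<Longrightarrow> hole5 x1 x2 x3 x4 x0"
  and hole5_refl: "hole5 x0 x1 x2 x3 x4 \<Longrightarrow> hole5 x0 x4 x3 x2 x1"
  by (auto simp: hole5_def intro: adj_sym)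

lemma hole5_distinct: "hole5 x0 x1 x2 x3 x4 \<Longrightarrow> distinct [x0, x1, x2, x3, x4]"
  by (auto simp: hole5_def intro: adj_sym)

lemma good_rot: "good x1 x2 x3 x4 x0 = good x0 x1 x2 x3 x4"
  and good_refl: "good x0 x4 x3 x2 x1 = good x0 x1 x2 x3 x4"
  by (auto simp: good_def fun_eq_iff)

lemma maxhole_rot: "maxhole x0 x1 x2 x3 x4 \<Longrightarrow> maxhole x1 x2 x3 x4 x0"
  using hole5_rot[of x0 x1 x2 x3 x4] good_rot[of x1 x2 x3 x4 x0] by (simp add: maxhole_def)

lemma maxhole_refl: "maxhole x0 x1 x2 x3 x4 \<Longrightarrow> maxhole x0 x4 x3 x2 x1"
  using hole5_refl[of x0 x1 x2 x3 x4] good_refl[of x0 x4 x3 x2 x1] by (simp add: maxhole_def)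

lemma
  assumes "maxhole x0 x1 x2 x3 x4"
  shows maxhole_rot2: "maxhole x2 x3 x4 x0 x1"
    and maxhole_rot3: "maxhole x3 x4 x0 x1 x2"
    and maxhole_rot4: "maxhole x4 x0 x1 x2 x3"
  using assms[THEN maxhole_rot, THEN maxhole_rot]
    assms[THEN maxhole_rot, THEN maxhole_rot, THEN maxhole_rot]
    assms[THEN maxhole_rot, THEN maxhole_rot, THEN maxhole_rot, THEN maxhole_rot]
  by blast+

lemma good_hole_vertex: "hole5 x0 x1 x2 x3 x4 \<Longrightarrow> v \<in> {x0, x1, x2, x3, x4} \<Longrightarrow> good x0 x1 x2 x3 x4 v"
  by (auto simp: hole5_def good_def cadj_def intro: adj_sym)

text \<open>Two neighbours at distance two on the hole force the vertex between them by C4-freeness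
  (\<open>mid\<close>), and three consecutive neighbours make \<open>v\<close> good. A bad vertex
  therefore sees one vertex of the hole or two consecutive ones; each case leaves open whether the
  second one is seen.\<close>

lemma bad_cases:
  assumes hole: "hole5 x0 x1 x2 x3 x4" and bad: "\<not> good x0 x1 x2 x3 x4 v"
    and att: "adj v x0 \<or> adj v x1 \<or> adj v x2 \<or> adj v x3 \<or> adj v x4"
  obtains "adj v x0" "\<not> adj v x2" "\<not> adj v x3" "\<not> adj v x4"
  | "adj v x1" "\<not> adj v x3" "\<not> adj v x4" "\<not> adj v x0"
  | "adj v x2" "\<not> adj v x4" "\<not> adj v x0" "\<not> adj v x1"
  | "adj v x3" "\<not> adj v x0" "\<not> adj v x1" "\<not> adj v x2"
  | "adj v x4" "\<not> adj v x1" "\<not> adj v x2" "\<not> adj v x3"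
proof -
  have ne: "v \<noteq> x0" "v \<noteq> x1" "v \<noteq> x2" "v \<noteq> x3" "v \<noteq> x4"
    using good_hole_vertex[OF hole, of v] bad by auto
  have mid: "adj v y" if "adj v x" "adj v z" "adj x y" "adj y z" "\<not> adj x z" "v \<noteq> y" "x \<noteq> z" for x y z
    using C4[of v x y z] that adj_sym by blast
  have d: "x0 \<noteq> x2" "x1 \<noteq> x3" "x2 \<noteq> x4" "x3 \<noteq> x0" "x4 \<noteq> x1"
    using hole5_distinct[OF hole] by auto
  show thesis
    using that bad att ne d hole mid[of x0 x2 x1] mid[of x1 x3 x2] mid[of x2 x4 x3] mid[of x3 x0 x4]
      mid[of x4 x1 x0] unfolding hole5_def good_def cadj_def by sat
qed

lemma exists_maxhole:
  assumes "hole5 y0 y1 y2 y3 y4"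
  obtains x0 x1 x2 x3 x4 where "maxhole x0 x1 x2 x3 x4"
proof -
  let ?P = "\<lambda>(x0, x1, x2, x3, x4). hole5 x0 x1 x2 x3 x4"
  let ?f = "\<lambda>(x0, x1, x2, x3, x4). card {v \<in> V. good x0 x1 x2 x3 x4 v}"
  have "\<exists>x. ?P x \<and> (\<forall>y. ?P y \<longrightarrow> ?f y \<le> ?f x)"
  proof (rule ex_has_greatest_nat[of ?P "(y0, y1, y2, y3, y4)" ?f "Suc (card V)"])
    show "?P (y0, y1, y2, y3, y4)" using assms by simp
    show "\<forall>y. ?P y \<longrightarrow> ?f y < Suc (card V)"
      using finite_V by (auto simp: less_Suc_eq_le intro: card_mono)
  qed
  then show thesis using that by (auto simp: maxhole_def)
qed

end

section \<open>Every 5-hole dominates the graph\<close>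

locale pyramid_free_graph = nonsimplicial_graph +
  assumes pyramid_free: "\<not> pyramid a b0 b1 b2 c0 c1 c2"
begin

lemmas no_pyramid = pyramid_free[unfolded pyramid_def]

text \<open>The neighbours \<open>x\<close> and \<open>y\<close> of \<open>z\<close> are joined
  through the hole, and such a connection closes with \<open>z\<close> to a forbidden configuration.
  This and the following case lemmas are finite checks: the listed instances exclude every possible
  attachment, \<open>ne\<close> supplies the inequalities needed for C4 and 2P3, and
  \<open>co\<close> identifies the two orientations of an edge, after which only propositional
  reasoning remains.\<close>

lemma undominated_one:
  assumes h: "hole5 x0 x1 x2 x3 x4"
    and l: "\<not> adj z x0" "\<not> adj z x1" "\<not> adj z x2" "\<not> adj z x3"
    "\<not> adj z x4" "adj z x" "adj z y" "\<not> adj x y" "adj x x0"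
    and d: "x \<noteq> y"
    and ny: "adj y x0 \<or> adj y x1 \<or> adj y x2 \<or> adj y x3 \<or> adj y x4"
  shows False
proof -
  have ne: "x0 \<noteq> x2" "x1 \<noteq> x" "x0 \<noteq> y" "x1 \<noteq> x4" "x0 \<noteq> x3"
  "x4 \<noteq> x" "x0 \<noteq> z" "x \<noteq> y" "x1 \<noteq> x3" "x2 \<noteq> x" "x1 \<noteq> z"
  "x2 \<noteq> x4" "x3 \<noteq> x" "x2 \<noteq> z" "x3 \<noteq> z" "x4 \<noteq> z"
    using h l d hole5_distinct[OF h] unfolding hole5_def by (auto simp: adj_commute)
  note co = adj_commute[of x y] adj_commute[of x0 x1] adj_commute[of x0 x2] adj_commute[of x0 x3]
  adj_commute[of x0 x4] adj_commute[of x0 x] adj_commute[of x0 y] adj_commute[of x0 z]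
  adj_commute[of x1 x2] adj_commute[of x1 x3] adj_commute[of x1 x4] adj_commute[of x1 x]
  adj_commute[of x1 y] adj_commute[of x1 z] adj_commute[of x2 x3] adj_commute[of x2 x4]
  adj_commute[of x2 x] adj_commute[of x2 y] adj_commute[of x2 z] adj_commute[of x3 x4]
  adj_commute[of x3 x] adj_commute[of x3 y] adj_commute[of x3 z] adj_commute[of x4 x]
  adj_commute[of x4 y] adj_commute[of x4 z] adj_commute[of z x] adj_commute[of z y]
  show False using h[unfolded hole5_def] l co ne ny C4[of x0 x1 x2 x] C4[of x0 x1 y x4]
    C4[of x0 x4 x3 x] C4[of x0 x z y] C4[of x1 x2 x3 x] C4[of x1 x z y] C4[of x2 x3 x4 x]
    C4[of x2 x z y] C4[of x3 x z y] C4[of x4 x z y] C6[of x0 x1 x2 y z x] C6[of x0 x4 x3 y z x]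
    C6[of x1 x2 x3 x z y] C6[of x1 x2 x3 y z x] C6[of x2 x3 x4 x z y] C6[of x2 x3 x4 y z x]
    C7[of x0 x1 x2 x3 y z x] C7[of x0 x4 x3 x2 y z x] C7[of x1 x2 x3 x4 x z y]
    C7[of x1 x2 x3 x4 y z x] twoP3[of x1 x2 x3 x z y] twoP3[of x2 x3 x4 x z y]
    no_pyramid[of x x0 x2 z x4 x3 y] no_pyramid[of x x0 x3 z x1 x2 y]
    no_pyramid[of x x1 x4 z x2 x3 y] no_pyramid[of y x1 x3 z x0 x4 x]
    no_pyramid[of y x2 x4 z x1 x0 x]
    by sat
qed

text \<open>The induced path \<open>x z w y\<close> replaces the path \<open>x z y\<close> of the
  preceding lemma; being longer, it leaves less room for its connection through the hole.\<close>

lemma undominated_two: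
  assumes h: "hole5 x0 x1 x2 x3 x4"
    and l: "\<not> adj z x0" "\<not> adj z x1" "\<not> adj z x2" "\<not> adj z x3"
    "\<not> adj z x4" "\<not> adj w x0" "\<not> adj w x1" "\<not> adj w x2" "\<not> adj w x3"
    "\<not> adj w x4" "adj z w" "adj z x" "adj w y" "\<not> adj x y" "\<not> adj z y"
    "\<not> adj w x" "adj x x0"
    and d: "z \<noteq> y"
    and ny: "adj y x0 \<or> adj y x1 \<or> adj y x2 \<or> adj y x3 \<or> adj y x4"
  shows False
proof -
  have ne: "x0 \<noteq> x2" "x1 \<noteq> x" "x0 \<noteq> x3" "x4 \<noteq> x" "x \<noteq> y"
  "x1 \<noteq> x3" "x1 \<noteq> x4" "x2 \<noteq> x4" "z \<noteq> y" "w \<noteq> x"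
    using h l d hole5_distinct[OF h] unfolding hole5_def by (auto simp: adj_commute)
  note co = adj_commute[of w x] adj_commute[of w y] adj_commute[of x y] adj_commute[of x0 w]
  adj_commute[of x0 x1] adj_commute[of x0 x3] adj_commute[of x0 x4] adj_commute[of x0 x]
  adj_commute[of x0 y] adj_commute[of x0 z] adj_commute[of x1 w] adj_commute[of x1 x4]
  adj_commute[of x1 x] adj_commute[of x1 y] adj_commute[of x1 z] adj_commute[of x2 w]
  adj_commute[of x2 x] adj_commute[of x2 y] adj_commute[of x2 z] adj_commute[of x3 w]
  adj_commute[of x3 x4] adj_commute[of x3 x] adj_commute[of x3 y] adj_commute[of x3 z]
  adj_commute[of x4 w] adj_commute[of x4 x] adj_commute[of x4 z] adj_commute[of z w]
  adj_commute[of z x] adj_commute[of z y]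
  show False using h[unfolded hole5_def] l co ne C4[of x0 x1 x2 x] C4[of x0 x4 x3 x]
    C4[of x0 x x2 y] C4[of x0 x x3 y] C4[of x1 x x3 y] C4[of x1 x x4 y] C4[of x2 x x4 y]
    C6[of x0 x1 y w z x] C6[of x0 x4 y w z x] C6[of x1 x2 y w z x] C6[of x2 x3 x z w y]
    C6[of x2 x3 y w z x] C6[of x3 x4 x z w y] C7[of x0 x1 x2 y w z x] C7[of x0 x4 x3 y w z x]
    C7[of x1 x2 x3 x z w y] C7[of x1 x2 x3 y w z x] C7[of x2 x3 x4 x z w y]
    C7[of x2 x3 x4 y w z x] twoP3[of x0 x1 x2 z w y] twoP3[of x0 x4 x3 z w y]
    twoP3[of x1 x0 x4 z w y] twoP3[of x1 x2 x3 z w y] twoP3[of x1 x2 x3 w z x]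
    twoP3[of x2 x3 x4 z w y] twoP3[of x2 x3 x4 w z x]
    by sat
qed

text \<open>If \<open>d\<close> sees \<open>y\<close> or \<open>e\<close> sees \<open>x\<close>, a
  single undominated vertex has both attachments. Otherwise \<open>d\<close> and \<open>e\<close>
  are different, hence adjacent, and \<open>x d e y\<close> is an induced path.\<close>

lemma not_undominated_attachment:
  assumes hole: "hole5 x0 x1 x2 x3 x4" and C: "C = {x0, x1, x2, x3, x4}"
    and d: "\<And>c. c \<in> C \<Longrightarrow> \<not> adj d c" and e: "\<And>c. c \<in> C \<Longrightarrow> \<not> adj e c"
    and de: "d = e \<or> adj d e" and xy: "adj d x" "adj e y" "x \<noteq> y" "\<not> adj x y"
    and x: "adj x x0" and y: "c \<in> C" "adj y c"
  shows False
proof -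
  have y': "adj y x0 \<or> adj y x1 \<or> adj y x2 \<or> adj y x3 \<or> adj y x4" using y C by blast
  have d': "\<not> adj d x0" "\<not> adj d x1" "\<not> adj d x2" "\<not> adj d x3" "\<not> adj d x4"
    and e': "\<not> adj e x0" "\<not> adj e x1" "\<not> adj e x2" "\<not> adj e x3" "\<not> adj e x4"
    using d e C by simp_all
  show False
  proof (cases "adj d y")
    case True
    then show False using undominated_one[OF hole d', of x y] xy x y' by blast
  next
    case dy: False
    show False
    proof (cases "adj e x")
      case True
      then show False using undominated_one[OF hole e', of x y] xy x y' by blast
    next
      case False
      moreover have "adj d e" "d \<noteq> y" using de dy xy d y by blast+
      ultimately show False using undominated_two[OF hole d' e', of x y] xy x y' dy by blast
    qed
  qed
qed

text \<open>A P3 of the hole is anticomplete to all vertices without neighbours on the hole, so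
  these form components that are cliques. The nonadjacent outside neighbours provided by
  \<open>clique_attachment\<close> both have neighbours on the hole, because they do not belong to
  the component.\<close>

lemma dominating_set:
  assumes hole: "hole5 x0 x1 x2 x3 x4" and C: "C = {x0, x1, x2, x3, x4}" and v: "v \<in> V"
  shows "\<exists>c\<in>C. adj v c"
proof (rule ccontr)
  let ?att = "\<lambda>v. \<exists>c\<in>C. adj v c"
  assume nv: "\<not> ?att v"
  have P3: "adj x z" if "\<not> ?att x" "\<not> ?att y" "\<not> ?att z" "adj x y" "adj y z" "x \<noteq> z" for x y z
    using that twoP3[of x y z x0 x1 x2] hole hole5_distinct[OF hole] unfolding hole5_def C by auto
  define D where "D = {w \<in> V. \<not> ?att w \<and> cadj v w}"
  have cl: "adj x y" if "x \<in> D" "y \<in> D" "x \<noteq> y" for x y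
    using that P3[of x v y] nv adj_commute[of v x] unfolding D_def cadj_def by blast
  have "v \<in> D" "D \<subseteq> V" using v nv by (auto simp: D_def cadj_def)
  then obtain x y d d' where xy: "x \<notin> D" "y \<notin> D" "d \<in> D" "d' \<in> D" "adj d x" "adj d' y"
      "x \<noteq> y" "\<not> adj x y"
    using clique_attachment[of D] cl by blast
  have att: "?att x" if "x \<notin> D" "d \<in> D" "adj d x" for x d
    using that P3[of v d x] nv adjD[of d x] unfolding D_def cadj_def by blast
  have dd: "\<And>c. c \<in> C \<Longrightarrow> \<not> adj d c" "\<And>c. c \<in> C \<Longrightarrow> \<not> adj d' c" "d = d' \<or> adj d d'"
    using xy cl unfolding D_def by blast+
  obtain c where c: "c \<in> C" "adj x c" using att[OF xy(1,3,5)] by blast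
  obtain c' where c': "c' \<in> C" "adj y c'" using att[OF xy(2,4,6)] by blast
  \<comment> \<open>A rotation makes the neighbour of \<open>x\<close> on the hole its first vertex,
    as the case lemmas require.\<close>
  have fin: "False" if "hole5 y0 y1 y2 y3 y4" "C = {y0, y1, y2, y3, y4}" "y0 = c" for y0 y1 y2 y3 y4
    using not_undominated_attachment[OF that(1,2), of d d' x y c'] dd xy(5-8) c c' that(3) by blast
  note h = hole5_rot[OF hole]
  have "C = {x1, x2, x3, x4, x0}" "C = {x2, x3, x4, x0, x1}" "C = {x3, x4, x0, x1, x2}"
    "C = {x4, x0, x1, x2, x3}"
    using C by blast+
  note fins = fin[OF hole C] fin[OF h this(1)] fin[OF hole5_rot[OF h] this(2)]
    fin[OF hole5_rot[OF hole5_rot[OF h]] this(3)]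
    fin[OF hole5_rot[OF hole5_rot[OF hole5_rot[OF h]]] this(4)]
  show False using fins c(1) C by blast
qed

lemma dominating:
  "hole5 x0 x1 x2 x3 x4 \<Longrightarrow> v \<in> V \<Longrightarrow>
    adj v x0 \<or> adj v x1 \<or> adj v x2 \<or> adj v x3 \<or> adj v x4"
  using dominating_set[OF _ refl] by simp

section \<open>Exchange arguments on an optimal 5-hole\<close>

lemma shift_loses_nothing:
  assumes h: "hole5 x0 x1 x2 x3 x4"
    and l: "adj k x0" "adj k x1" "\<not> adj k x2" "\<not> adj k x3" "\<not> adj k x4"
    "\<not> adj t x0" "adj t x1" "adj t x2" "adj t x3" "\<not> adj t x4" "adj k t"
    "\<not> adj y t"
    and d: "y \<notin> {x0, x1, x2, x3, x4}" "y \<noteq> t"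
    and gy: "good x0 x1 x2 x3 x4 y"
    and cy: "\<not> good x0 x1 t x3 x4 y"
  shows False
proof -
  have ne: "x1 \<noteq> x3" "t \<noteq> y" "x2 \<noteq> k"
    using h l d hole5_distinct[OF h] unfolding hole5_def by (auto simp: adj_commute)
  note co = adj_commute[of k t] adj_commute[of k y] adj_commute[of t y] adj_commute[of x0 k]
  adj_commute[of x0 t] adj_commute[of x0 x3] adj_commute[of x0 x4] adj_commute[of x0 y]
  adj_commute[of x1 t] adj_commute[of x2 k] adj_commute[of x2 t] adj_commute[of x2 x3]
  adj_commute[of x2 x4] adj_commute[of x3 t] adj_commute[of x3 x4] adj_commute[of x3 y]
  adj_commute[of x4 k] adj_commute[of x4 t] adj_commute[of x4 y]
  show False using h[unfolded hole5_def] l co ne d[unfolded insert_iff empty_iff]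
    gy[unfolded good_def cadj_def] cy[unfolded good_def cadj_def] C4[of x1 t x3 y]
    C4[of x2 t k y] C6[of x0 x4 y x2 t k] no_pyramid[of x0 x4 k y x3 t x2]
    by sat
qed

lemma double_shift_loses_nothing:
  assumes h: "hole5 x0 x1 x2 x3 x4"
    and l: "adj k x0" "\<not> adj k x1" "\<not> adj k x2" "\<not> adj k x3" "\<not> adj k x4"
    "adj t x0" "adj t x1" "adj t x2" "\<not> adj t x3" "\<not> adj t x4" "adj u x0"
    "\<not> adj u x1" "\<not> adj u x2" "adj u x3" "adj u x4" "adj k t" "adj k u"
    and d: "y \<notin> {x0, x1, x2, x3, x4}" "y \<noteq> t" "y \<noteq> u"
    and gy: "good x0 x1 x2 x3 x4 y"
    and cy: "\<not> good x0 t x2 x3 u y"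
    and yV: "y \<in> V"
  shows False
proof -
  have ne: "x0 \<noteq> x2" "t \<noteq> y" "x0 \<noteq> x3" "u \<noteq> y" "x1 \<noteq> k"
  "x2 \<noteq> u" "x3 \<noteq> t" "x3 \<noteq> k" "x4 \<noteq> k" "x4 \<noteq> y"
    using h l d hole5_distinct[OF h] unfolding hole5_def by (auto simp: adj_commute)
  note co = adj_commute[of k t] adj_commute[of k u] adj_commute[of k y] adj_commute[of t u]
  adj_commute[of t y] adj_commute[of u y] adj_commute[of x0 t] adj_commute[of x0 u]
  adj_commute[of x0 x3] adj_commute[of x1 k] adj_commute[of x1 t] adj_commute[of x1 u]
  adj_commute[of x1 x2] adj_commute[of x1 x3] adj_commute[of x1 x4] adj_commute[of x1 y]
  adj_commute[of x2 k] adj_commute[of x2 t] adj_commute[of x2 u] adj_commute[of x2 x3]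
  adj_commute[of x2 y] adj_commute[of x3 k] adj_commute[of x3 t] adj_commute[of x3 u]
  adj_commute[of x3 x4] adj_commute[of x3 y] adj_commute[of x4 k] adj_commute[of x4 u]
  adj_commute[of x4 y]
  show False using h[unfolded hole5_def] l co ne d[unfolded insert_iff empty_iff]
    gy[unfolded good_def cadj_def] cy[unfolded good_def cadj_def] yV C4[of x0 t x2 y]
    C4[of x0 u x3 y] C4[of x1 t k y] C4[of x2 x3 u t] C4[of x3 u k y] C4[of x4 u k y]
    C6[of x1 t k u x3 y] C6[of x2 t k u x4 y] twoP3[of x1 t k x4 x3 y]
    no_pyramid[of t x2 k y x3 u x4] no_pyramid[of u x3 k y x2 t x1]
    dominating[unfolded hole5_def, of x2 x3 u k t y]
    by sat
qed

lemma no_better_hole: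
  assumes max: "maxhole x0 x1 x2 x3 x4" and hole: "hole5 y0 y1 y2 y3 y4"
    and k: "k \<in> V" "good y0 y1 y2 y3 y4 k" "\<not> good x0 x1 x2 x3 x4 k"
    and le: "\<And>v. v \<in> V \<Longrightarrow> good x0 x1 x2 x3 x4 v \<Longrightarrow> good y0 y1 y2 y3 y4 v"
  shows False
proof -
  have "{v \<in> V. good x0 x1 x2 x3 x4 v} \<subset> {v \<in> V. good y0 y1 y2 y3 y4 v}"
    using k le by blast
  then have "card {v \<in> V. good x0 x1 x2 x3 x4 v} < card {v \<in> V. good y0 y1 y2 y3 y4 v}"
    using finite_V by (intro psubset_card_mono) auto
  then show False using max hole unfolding maxhole_def by (meson leD)
qed

text \<open>Exchanging \<open>x2\<close> for \<open>t\<close> makes \<open>k\<close> good, since it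
  sees the consecutive vertices \<open>x0\<close>, \<open>x1\<close>, \<open>t\<close> of the new
  hole, and \<open>shift_loses_nothing\<close> keeps all other vertices good.\<close>

lemma no_shift:
  assumes max: "maxhole x0 x1 x2 x3 x4"
  shows "\<not> (adj k x0 \<and> adj k x1 \<and> \<not> adj k x2 \<and> \<not> adj k x3 \<and> \<not> adj k x4 \<and>
    adj t x1 \<and> adj t x2 \<and> adj t x3 \<and> \<not> adj t x4 \<and> \<not> adj t x0 \<and> adj k t)"
proof
  assume a: "adj k x0 \<and> adj k x1 \<and> \<not> adj k x2 \<and> \<not> adj k x3 \<and> \<not> adj k x4 \<and>
    adj t x1 \<and> adj t x2 \<and> adj t x3 \<and> \<not> adj t x4 \<and> \<not> adj t x0 \<and> adj k t"
  have hole: "hole5 x0 x1 x2 x3 x4" using max by (simp add: maxhole_def)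
  have hole': "hole5 x0 x1 t x3 x4"
    using hole a adj_sym unfolding hole5_def by blast
  have ne: "k \<noteq> x0" "k \<noteq> x1" "k \<noteq> x2" "k \<noteq> x3" "k \<noteq> x4"
    using hole a unfolding hole5_def by (auto simp: adj_commute)
  show False
  proof (rule no_better_hole[OF max hole', of k])
    show "k \<in> V" using a adjD by blast
    show "good x0 x1 t x3 x4 k" "\<not> good x0 x1 x2 x3 x4 k"
      using a ne by (auto simp: good_def cadj_def)
    fix y assume yV: "y \<in> V" and y: "good x0 x1 x2 x3 x4 y"
    show "good x0 x1 t x3 x4 y"
    proof (rule ccontr)
      assume n: "\<not> good x0 x1 t x3 x4 y"
      have nt: "\<not> cadj y t" using y n by (auto simp: good_def)
      \<comment> \<open>The discarded vertex \<open>x2\<close> has to be told apart from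
        \<open>y\<close>: it is adjacent to \<open>t\<close>, whereas \<open>y\<close> is
        not.\<close>
      have "cadj x2 t"
        using C4[of x1 x2 x3 t] a hole hole5_distinct[OF hole]
        unfolding hole5_def cadj_def by (auto simp: adj_commute)
      then have "y \<notin> {x0, x1, x2, x3, x4}"
        using nt n good_hole_vertex[OF hole', of y] by blast
      then show False
        using shift_loses_nothing[OF hole, of k t y] a nt y n by (auto simp: cadj_def)
    qed
  qed
qed

text \<open>Both neighbours of \<open>x0\<close> on the hole are exchanged at once,
  \<open>x1\<close> for \<open>t\<close> and \<open>x4\<close> for \<open>u\<close>. Then
  \<open>k\<close> sees the consecutive vertices \<open>u\<close>, \<open>x0\<close>,
  \<open>t\<close>; a single exchange would leave it bad.\<close>

lemma no_double_shift:
  assumes max: "maxhole x0 x1 x2 x3 x4"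
  shows "\<not> (adj k x0 \<and> \<not> adj k x1 \<and> \<not> adj k x2 \<and> \<not> adj k x3 \<and> \<not> adj k x4 \<and>
    adj t x0 \<and> adj t x1 \<and> adj t x2 \<and> \<not> adj t x3 \<and> \<not> adj t x4 \<and>
    adj u x0 \<and> \<not> adj u x1 \<and> \<not> adj u x2 \<and> adj u x3 \<and> adj u x4 \<and> adj k t \<and> adj k u)"
proof
  assume a: "adj k x0 \<and> \<not> adj k x1 \<and> \<not> adj k x2 \<and> \<not> adj k x3 \<and> \<not> adj k x4 \<and>
    adj t x0 \<and> adj t x1 \<and> adj t x2 \<and> \<not> adj t x3 \<and> \<not> adj t x4 \<and>
    adj u x0 \<and> \<not> adj u x1 \<and> \<not> adj u x2 \<and> adj u x3 \<and> adj u x4 \<and> adj k t \<and> adj k u"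
  have hole: "hole5 x0 x1 x2 x3 x4" using max by (simp add: maxhole_def)
  have "\<not> adj t u"
    using C4[of t u x3 x2] a hole unfolding hole5_def by (auto simp: adj_commute)
  then have hole': "hole5 x0 t x2 x3 u"
    using hole a adj_sym unfolding hole5_def by blast
  have ne: "k \<noteq> x0" "k \<noteq> x1" "k \<noteq> x2" "k \<noteq> x3" "k \<noteq> x4"
    using hole a unfolding hole5_def by (auto simp: adj_commute)
  show False
  proof (rule no_better_hole[OF max hole', of k])
    show "k \<in> V" using a adjD by blast
    show "good x0 t x2 x3 u k" "\<not> good x0 x1 x2 x3 x4 k"
      using a ne by (auto simp: good_def cadj_def)
    fix y assume yV: "y \<in> V" and y: "good x0 x1 x2 x3 x4 y"
    show "good x0 t x2 x3 u y"
    proof (rule ccontr)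
      assume n: "\<not> good x0 t x2 x3 u y"
      \<comment> \<open>The discarded vertices \<open>x1\<close> and \<open>x4\<close> remain good,
        each being attached around its replacement, and so they cannot be the lost vertex
        \<open>y\<close>.\<close>
      have "adj x1 t" "adj x4 u"
        using C4[of x0 x1 x2 t] C4[of x0 x4 x3 u] a hole hole5_distinct[OF hole]
        unfolding hole5_def by (auto simp: adj_commute)
      then have "good x0 t x2 x3 u x1" "good x0 t x2 x3 u x4"
        using hole adj_sym unfolding hole5_def good_def cadj_def by blast+
      then have "y \<notin> {x0, x1, x2, x3, x4}" "y \<noteq> t" "y \<noteq> u"
        using n good_hole_vertex[OF hole', of y] by blast+
      then show False
        using double_shift_loses_nothing[OF hole, of k t u y] a y n yV by blast
    qed
  qed
qed

section \<open>Components of bad vertices and their attachments\<close>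

lemma bad_P3_free_single:
  assumes h: "hole5 x0 x1 x2 x3 x4"
    and l: "adj l x0" "\<not> adj l x1" "\<not> adj l x2" "\<not> adj l x3" "\<not> adj l x4"
    "adj k l" "adj l m" "\<not> adj k m"
    and d: "k \<notin> {x0, x1, x2, x3, x4}" "m \<notin> {x0, x1, x2, x3, x4}" "k \<noteq> m"
    and bk: "\<not> good x0 x1 x2 x3 x4 k"
    and bm: "\<not> good x0 x1 x2 x3 x4 m"
  shows False
proof -
  have ne: "x0 \<noteq> x2" "x1 \<noteq> k" "x1 \<noteq> m" "x0 \<noteq> m" "x1 \<noteq> l"
  "x0 \<noteq> x3" "x4 \<noteq> k" "x4 \<noteq> m" "x0 \<noteq> k" "x4 \<noteq> l"
  "x1 \<noteq> x3" "x2 \<noteq> k" "k \<noteq> m" "x2 \<noteq> x4"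
    using h l d hole5_distinct[OF h] unfolding hole5_def by (auto simp: adj_commute)
  note co = adj_commute[of k l] adj_commute[of k m] adj_commute[of l m] adj_commute[of x0 k]
  adj_commute[of x0 l] adj_commute[of x0 m] adj_commute[of x0 x3] adj_commute[of x0 x4]
  adj_commute[of x1 k] adj_commute[of x1 l] adj_commute[of x1 m] adj_commute[of x1 x4]
  adj_commute[of x2 k] adj_commute[of x2 l] adj_commute[of x2 m] adj_commute[of x2 x3]
  adj_commute[of x2 x4] adj_commute[of x3 k] adj_commute[of x3 l] adj_commute[of x3 m]
  adj_commute[of x3 x4] adj_commute[of x4 k] adj_commute[of x4 l] adj_commute[of x4 m]
  show False using h[unfolded hole5_def] l co ne d[unfolded insert_iff empty_iff]
    bk[unfolded good_def cadj_def] bm[unfolded good_def cadj_def] C4[of x0 x1 x2 k]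
    C4[of x0 x1 x2 m] C4[of x0 x1 m l] C4[of x0 x4 x3 k] C4[of x0 x4 x3 m] C4[of x0 x4 k l]
    C4[of x0 x4 m l] C4[of x1 x2 x3 k] C6[of x0 x1 x2 x3 k l] C6[of x0 x1 x2 x3 m l]
    C6[of x0 x4 x3 x2 k l] C6[of x0 x4 x3 x2 m l] C7[of x1 x2 x3 x4 k l m]
    C7[of x1 x2 x3 x4 m l k] twoP3[of x1 x2 x3 k l m] twoP3[of x2 x3 x4 k l m]
    no_pyramid[of x0 x1 x4 l x2 x3 k] no_pyramid[of x0 x1 x4 l x2 x3 m]
    by sat
qed

lemma bad_P3_free_double:
  assumes h: "hole5 x0 x1 x2 x3 x4"
    and l: "adj l x0" "adj l x1" "\<not> adj l x2" "\<not> adj l x3" "\<not> adj l x4" "adj k l"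
    "adj l m" "\<not> adj k m"
    and d: "k \<notin> {x0, x1, x2, x3, x4}" "m \<notin> {x0, x1, x2, x3, x4}" "k \<noteq> m"
    and bk: "\<not> good x0 x1 x2 x3 x4 k"
    and bm: "\<not> good x0 x1 x2 x3 x4 m"
  shows False
proof -
  have ne: "x0 \<noteq> x3" "x4 \<noteq> k" "x4 \<noteq> m" "x0 \<noteq> k" "x4 \<noteq> l"
  "x0 \<noteq> m" "x1 \<noteq> x3" "x2 \<noteq> k" "x2 \<noteq> m" "x1 \<noteq> k"
  "x2 \<noteq> l" "x1 \<noteq> m" "x2 \<noteq> x4" "k \<noteq> m"
    using h l d hole5_distinct[OF h] unfolding hole5_def by (auto simp: adj_commute)
  note co = adj_commute[of l m] adj_commute[of x0 k] adj_commute[of x0 l] adj_commute[of x0 m]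
  adj_commute[of x0 x1] adj_commute[of x0 x2] adj_commute[of x0 x3] adj_commute[of x0 x4]
  adj_commute[of x1 k] adj_commute[of x1 l] adj_commute[of x1 m] adj_commute[of x1 x2]
  adj_commute[of x1 x3] adj_commute[of x1 x4] adj_commute[of x2 k] adj_commute[of x2 l]
  adj_commute[of x2 m] adj_commute[of x2 x3] adj_commute[of x2 x4] adj_commute[of x3 k]
  adj_commute[of x3 l] adj_commute[of x3 m] adj_commute[of x3 x4] adj_commute[of x4 k]
  adj_commute[of x4 l] adj_commute[of x4 m]
  show False using h[unfolded hole5_def] l co ne d[unfolded insert_iff empty_iff]
    bk[unfolded good_def cadj_def] bm[unfolded good_def cadj_def] C4[of x0 x4 x3 k]
    C4[of x0 x4 x3 m] C4[of x0 x4 k l] C4[of x0 x4 m l] C4[of x1 x2 x3 k] C4[of x1 x2 x3 m]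
    C4[of x1 x2 k l] C4[of x1 x2 m l] C6[of x0 x4 x3 x2 k l] C6[of x0 x4 x3 x2 m l]
    C6[of x1 x2 x3 x4 k l] C6[of x1 x2 x3 x4 m l] twoP3[of x2 x3 x4 k l m]
    no_pyramid[of x3 x2 x4 k x1 x0 l] no_pyramid[of x3 x2 x4 m x1 x0 l]
    by sat
qed

text \<open>In the names of these lemmas, \<open>single\<close> and \<open>double\<close> tell
  whether the bad vertex sees one vertex of the hole or two consecutive ones; up to rotation this is
  all that \<open>bad_cases\<close> leaves. Optimality enters here: the configuration with
  \<open>x\<close> and \<open>y\<close> on the two sides of \<open>x0\<close> is the one excluded by
  \<open>no_double_shift\<close>.\<close>

lemma common_attachment_single:
  assumes h: "maxhole x0 x1 x2 x3 x4"
    and l: "adj k x0" "\<not> adj k x1" "\<not> adj k x2" "\<not> adj k x3" "\<not> adj k x4"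
    "adj k x" "adj k y" "\<not> adj x y"
    and d: "x \<notin> {x0, x1, x2, x3, x4}" "y \<notin> {x0, x1, x2, x3, x4}" "x \<noteq> y"
    and gx: "good x0 x1 x2 x3 x4 x"
    and gy: "good x0 x1 x2 x3 x4 y"
  shows False
proof -
  have h5: "hole5 x0 x1 x2 x3 x4" using h by (simp add: maxhole_def)
  have ne: "x0 \<noteq> x2" "x1 \<noteq> x" "x1 \<noteq> y" "x0 \<noteq> x" "x4 \<noteq> k"
  "x0 \<noteq> y" "x1 \<noteq> k" "x \<noteq> y" "x3 \<noteq> k"
    using h5 l d hole5_distinct[OF h5] unfolding hole5_def by (auto simp: adj_commute)
  note co = adj_commute[of k x] adj_commute[of k y] adj_commute[of x0 x4] adj_commute[of x0 x]
  adj_commute[of x0 y] adj_commute[of x1 k] adj_commute[of x1 x] adj_commute[of x1 y]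
  adj_commute[of x2 x] adj_commute[of x2 y] adj_commute[of x3 k] adj_commute[of x3 x]
  adj_commute[of x4 k] adj_commute[of x4 x] adj_commute[of x4 y]
  show False using h5[unfolded hole5_def] l co ne d[unfolded insert_iff empty_iff]
    gx[unfolded good_def cadj_def] gy[unfolded good_def cadj_def] C4[of x0 x1 x2 x]
    C4[of x0 x1 x2 y] C4[of x0 x4 x k] C4[of x0 x4 y k] C4[of x1 x k y] C4[of x3 x k y]
    C4[of x4 x k y] no_double_shift[OF h, of k x y]
    no_double_shift[OF maxhole_refl[OF h], of k x y]
    by sat
qed

lemma common_attachment_double:
  assumes h: "maxhole x0 x1 x2 x3 x4"
    and l: "adj k x0" "adj k x1" "\<not> adj k x2" "\<not> adj k x3" "\<not> adj k x4" "adj k x"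
    "adj k y" "\<not> adj x y"
    and d: "x \<notin> {x0, x1, x2, x3, x4}" "y \<notin> {x0, x1, x2, x3, x4}" "x \<noteq> y"
    and gx: "good x0 x1 x2 x3 x4 x"
    and gy: "good x0 x1 x2 x3 x4 y"
  shows False
proof -
  have h5: "hole5 x0 x1 x2 x3 x4" using h by (simp add: maxhole_def)
  have ne: "x0 \<noteq> x3" "x4 \<noteq> x" "x4 \<noteq> y" "x1 \<noteq> x3" "x2 \<noteq> x"
  "x2 \<noteq> y" "x1 \<noteq> x" "x2 \<noteq> k" "x1 \<noteq> y" "x \<noteq> y" "x4 \<noteq> k"
    using h5 l d hole5_distinct[OF h5] unfolding hole5_def by (auto simp: adj_commute)
  note co = adj_commute[of k x] adj_commute[of k y] adj_commute[of x y] adj_commute[of x0 x3]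
  adj_commute[of x0 x4] adj_commute[of x1 x] adj_commute[of x1 y] adj_commute[of x2 k]
  adj_commute[of x2 x] adj_commute[of x2 y] adj_commute[of x3 k] adj_commute[of x3 x4]
  adj_commute[of x3 x] adj_commute[of x3 y] adj_commute[of x4 k] adj_commute[of x4 x]
  adj_commute[of x4 y]
  show False using h5[unfolded hole5_def] l co ne d[unfolded insert_iff empty_iff]
    gx[unfolded good_def cadj_def] gy[unfolded good_def cadj_def] C4[of x0 x4 x3 x]
    C4[of x0 x4 x3 y] C4[of x1 x2 x3 x] C4[of x1 x2 x3 y] C4[of x1 x2 x k] C4[of x1 x2 y k]
    C4[of x2 x k y] C4[of x4 x k y] C6[of x2 x3 x4 x k y] C6[of x2 x3 x4 y k x]
    no_shift[OF h, of k x] no_shift[OF maxhole_rot4[OF maxhole_refl[OF h]], of k x]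
    no_shift[OF h, of k y] no_shift[OF maxhole_rot4[OF maxhole_refl[OF h]], of k y]
    by sat
qed

text \<open>Vertices of the hole are good as well, so an attachment of a bad vertex may lie on the
  hole itself. Trailing digits in the names give the position of such an attachment, and two digits
  occur when both attachments are on the hole.\<close>

lemma hole_attachment_double_0:
  assumes h: "maxhole x0 x1 x2 x3 x4"
    and l: "adj k x0" "adj k x1" "\<not> adj k x2" "\<not> adj k x3" "\<not> adj k x4" "adj k y"
    "\<not> adj x0 y"
    and d: "y \<notin> {x0, x1, x2, x3, x4}"
    and gy: "good x0 x1 x2 x3 x4 y"
  shows False
proof -
  have h5: "hole5 x0 x1 x2 x3 x4" using h by (simp add: maxhole_def)
  have ne: "x0 \<noteq> y" "x4 \<noteq> k"
    using h5 l d hole5_distinct[OF h5] unfolding hole5_def by (auto simp: adj_commute)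
  note co = adj_commute[of k y] adj_commute[of x0 x4] adj_commute[of x0 y] adj_commute[of x4 k]
  adj_commute[of x4 y]
  show False using h5[unfolded hole5_def] l co ne d[unfolded insert_iff empty_iff]
    gy[unfolded good_def cadj_def] C4[of x0 x4 y k] no_shift[OF h, of k y]
    by sat
qed

lemma hole_attachment_double_1:
  assumes h: "maxhole x0 x1 x2 x3 x4"
    and l: "adj k x0" "adj k x1" "\<not> adj k x2" "\<not> adj k x3" "\<not> adj k x4" "adj k y"
    "\<not> adj x1 y"
    and d: "y \<notin> {x0, x1, x2, x3, x4}"
    and gy: "good x0 x1 x2 x3 x4 y"
  shows False
proof -
  have h5: "hole5 x0 x1 x2 x3 x4" using h by (simp add: maxhole_def)
  have ne: "x1 \<noteq> y" "x2 \<noteq> k"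
    using h5 l d hole5_distinct[OF h5] unfolding hole5_def by (auto simp: adj_commute)
  note co = adj_commute[of k y] adj_commute[of x1 y] adj_commute[of x2 k] adj_commute[of x2 y]
  show False using h5[unfolded hole5_def] l co ne d[unfolded insert_iff empty_iff]
    gy[unfolded good_def cadj_def] C4[of x1 x2 y k]
    no_shift[OF maxhole_rot4[OF maxhole_refl[OF h]], of k y]
    by sat
qed

lemma hole_attachment_single_0:
  assumes h: "maxhole x0 x1 x2 x3 x4"
    and l: "adj k x0" "\<not> adj k x1" "\<not> adj k x2" "\<not> adj k x3" "\<not> adj k x4"
    "adj k y" "\<not> adj x0 y"
    and d: "y \<notin> {x0, x1, x2, x3, x4}"
    and gy: "good x0 x1 x2 x3 x4 y"
  shows False
proof -
  have h5: "hole5 x0 x1 x2 x3 x4" using h by (simp add: maxhole_def)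
  have ne: "x0 \<noteq> y" "x1 \<noteq> k" "x4 \<noteq> k"
    using h5 l d hole5_distinct[OF h5] unfolding hole5_def by (auto simp: adj_commute)
  note co = adj_commute[of k y] adj_commute[of x0 k] adj_commute[of x0 x3] adj_commute[of x0 x4]
  adj_commute[of x0 y] adj_commute[of x1 k] adj_commute[of x1 x4] adj_commute[of x1 y]
  adj_commute[of x2 x4] adj_commute[of x2 y] adj_commute[of x3 x4] adj_commute[of x3 y]
  adj_commute[of x4 k] adj_commute[of x4 y]
  show False using h5[unfolded hole5_def] l co ne d[unfolded insert_iff empty_iff]
    gy[unfolded good_def cadj_def] C4[of x0 x1 y k] C4[of x0 x4 y k]
    no_pyramid[of x0 x1 x4 k x2 x3 y]
    by sat
qed

text \<open>The two good vertices hang on different ends of the edge \<open>k l\<close> between bad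
  vertices. Rotation normalises the position of \<open>k\<close> only, so all positions of
  \<open>l\<close> have to be considered.\<close>

lemma split_attachment_single:
  assumes h: "maxhole x0 x1 x2 x3 x4"
    and l: "adj k x0" "\<not> adj k x1" "\<not> adj k x2" "\<not> adj k x3" "\<not> adj k x4"
    "adj k x" "adj l y" "\<not> adj x y" "adj k l" "\<not> adj k y" "\<not> adj l x"
    and d: "l \<notin> {x0, x1, x2, x3, x4}" "x \<notin> {x0, x1, x2, x3, x4}"
    "y \<notin> {x0, x1, x2, x3, x4}"
    and gx: "good x0 x1 x2 x3 x4 x"
    and gy: "good x0 x1 x2 x3 x4 y"
    and bl: "\<not> good x0 x1 x2 x3 x4 l"
    and nl: "adj l x0 \<or> adj l x1 \<or> adj l x2 \<or> adj l x3 \<or> adj l x4"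
  shows False
proof -
  have h5: "hole5 x0 x1 x2 x3 x4" using h by (simp add: maxhole_def)
  have ne: "x0 \<noteq> x2" "x1 \<noteq> l" "x1 \<noteq> x" "x0 \<noteq> l" "x1 \<noteq> k"
  "x0 \<noteq> x" "x0 \<noteq> y" "x1 \<noteq> x4" "x0 \<noteq> x3" "x4 \<noteq> l"
  "x4 \<noteq> x" "x4 \<noteq> y" "x4 \<noteq> k" "x \<noteq> y" "l \<noteq> x"
    using h5 l d hole5_distinct[OF h5] unfolding hole5_def by (auto simp: adj_commute)
  note co = adj_commute[of k l] adj_commute[of k x] adj_commute[of k y] adj_commute[of l x]
  adj_commute[of l y] adj_commute[of x y] adj_commute[of x0 k] adj_commute[of x0 l]
  adj_commute[of x0 x3] adj_commute[of x0 x4] adj_commute[of x0 x] adj_commute[of x0 y]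
  adj_commute[of x1 k] adj_commute[of x1 l] adj_commute[of x1 x4] adj_commute[of x1 x]
  adj_commute[of x1 y] adj_commute[of x2 k] adj_commute[of x2 l] adj_commute[of x2 x3]
  adj_commute[of x2 x4] adj_commute[of x2 x] adj_commute[of x2 y] adj_commute[of x3 k]
  adj_commute[of x3 l] adj_commute[of x3 x4] adj_commute[of x3 x] adj_commute[of x3 y]
  adj_commute[of x4 k] adj_commute[of x4 l] adj_commute[of x4 x] adj_commute[of x4 y]
  show False using h5[unfolded hole5_def] l co ne d[unfolded insert_iff empty_iff]
    gx[unfolded good_def cadj_def] gy[unfolded good_def cadj_def] bl[unfolded good_def cadj_def]
    C4[of x0 x1 x2 l] C4[of x0 x1 x2 x] C4[of x0 x1 l k] C4[of x0 x1 x k] C4[of x0 x1 y x4]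
    C4[of x0 x1 y l] C4[of x0 x4 x3 l] C4[of x0 x4 x3 x] C4[of x0 x4 x3 y] C4[of x0 x4 l k]
    C4[of x0 x4 x k] C4[of x0 x4 y l] C4[of x0 x x2 y] C4[of x0 x x3 y] C4[of x1 l k x]
    C4[of x1 x x4 y] C4[of x4 l k x] C6[of x0 x1 x2 x3 l k] C6[of x0 x1 x2 y l k]
    C6[of x0 x4 x3 x2 l k] C6[of x0 x4 x3 y l k] C6[of x1 x2 x3 x k l] C6[of x1 x2 y l k x]
    C6[of x2 x3 x4 l k x] C6[of x2 x3 x k l y] C6[of x2 x3 y l k x] C7[of x1 x2 x3 x k l y]
    C7[of x1 x2 x3 y l k x] C7[of x2 x3 x4 x k l y] C7[of x2 x3 x4 y l k x]
    no_pyramid[of x0 x1 x4 k x2 x3 l]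
    by sat
qed

lemma split_attachment_double:
  assumes h: "maxhole x0 x1 x2 x3 x4"
    and l: "adj k x0" "adj k x1" "\<not> adj k x2" "\<not> adj k x3" "\<not> adj k x4" "adj k x"
    "adj l y" "\<not> adj x y" "adj k l" "\<not> adj k y" "\<not> adj l x"
    and d: "l \<notin> {x0, x1, x2, x3, x4}" "x \<notin> {x0, x1, x2, x3, x4}"
    "y \<notin> {x0, x1, x2, x3, x4}"
    and gx: "good x0 x1 x2 x3 x4 x"
    and gy: "good x0 x1 x2 x3 x4 y"
    and bl: "\<not> good x0 x1 x2 x3 x4 l"
    and nl: "adj l x0 \<or> adj l x1 \<or> adj l x2 \<or> adj l x3 \<or> adj l x4"
  shows False
proof -
  have h5: "hole5 x0 x1 x2 x3 x4" using h by (simp add: maxhole_def)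
  have ne: "x0 \<noteq> x3" "x4 \<noteq> l" "x4 \<noteq> x" "x0 \<noteq> l" "x4 \<noteq> k"
  "x0 \<noteq> x" "x0 \<noteq> y" "k \<noteq> y" "x0 \<noteq> x2" "x \<noteq> y" "x1 \<noteq> x3"
  "x2 \<noteq> l" "x2 \<noteq> x" "x1 \<noteq> l" "x2 \<noteq> k" "x1 \<noteq> x" "x1 \<noteq> y"
  "x1 \<noteq> x4" "l \<noteq> x" "x2 \<noteq> x4"
    using h5 l d hole5_distinct[OF h5] unfolding hole5_def by (auto simp: adj_commute)
  note co = adj_commute[of k l] adj_commute[of k x] adj_commute[of k y] adj_commute[of l x]
  adj_commute[of l y] adj_commute[of x y] adj_commute[of x0 k] adj_commute[of x0 l]
  adj_commute[of x0 x2] adj_commute[of x0 x3] adj_commute[of x0 x4] adj_commute[of x0 x]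
  adj_commute[of x0 y] adj_commute[of x1 k] adj_commute[of x1 l] adj_commute[of x1 x2]
  adj_commute[of x1 x4] adj_commute[of x1 x] adj_commute[of x1 y] adj_commute[of x2 k]
  adj_commute[of x2 l] adj_commute[of x2 x3] adj_commute[of x2 x4] adj_commute[of x2 x]
  adj_commute[of x2 y] adj_commute[of x3 k] adj_commute[of x3 l] adj_commute[of x3 x4]
  adj_commute[of x3 x] adj_commute[of x3 y] adj_commute[of x4 k] adj_commute[of x4 l]
  adj_commute[of x4 x] adj_commute[of x4 y]
  show False using h5[unfolded hole5_def] l co ne d[unfolded insert_iff empty_iff]
    gx[unfolded good_def cadj_def] gy[unfolded good_def cadj_def] bl[unfolded good_def cadj_def]
    C4[of x0 x4 x3 l] C4[of x0 x4 x3 x] C4[of x0 x4 l k] C4[of x0 x4 x k] C4[of x0 x4 y l]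
    C4[of x0 k l y] C4[of x0 x x2 y] C4[of x0 x x3 y] C4[of x1 x2 x3 l] C4[of x1 x2 x3 x]
    C4[of x1 x2 l k] C4[of x1 x2 x k] C4[of x1 x2 y l] C4[of x1 k l y] C4[of x1 x x3 y]
    C4[of x1 x x4 y] C4[of x2 l k x] C4[of x2 x x4 y] C4[of x4 l k x] C6[of x0 x4 x3 y l k]
    C6[of x1 x2 x3 y l k] C6[of x2 x3 x4 l k x] C6[of x2 x3 x4 x k l] C6[of x2 x3 y l k x]
    C6[of x3 x4 x k l y] C7[of x2 x3 x4 x k l y] C7[of x2 x3 x4 y l k x]
    no_pyramid[of x0 x4 l x x3 y x2] no_pyramid[of x1 x2 l x x3 y x4]
    no_pyramid[of y x2 x4 l x1 x k] no_pyramid[of y x2 x4 l x x0 k] no_shift[OF h, of k x]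
    no_shift[OF maxhole_rot4[OF maxhole_refl[OF h]], of k x]
    by sat
qed

lemma hole_split_double_2:
  assumes h: "maxhole x0 x1 x2 x3 x4"
    and l: "adj k x0" "adj k x1" "\<not> adj k x2" "\<not> adj k x3" "\<not> adj k x4" "adj l x2"
    "adj k y" "\<not> adj x2 y" "adj k l" "\<not> adj l y"
    and d: "l \<notin> {x0, x1, x2, x3, x4}" "y \<notin> {x0, x1, x2, x3, x4}"
    and gy: "good x0 x1 x2 x3 x4 y"
    and bl: "\<not> good x0 x1 x2 x3 x4 l"
    and nl: "adj l x0 \<or> adj l x1 \<or> adj l x2 \<or> adj l x3 \<or> adj l x4"
  shows False
proof -
  have h5: "hole5 x0 x1 x2 x3 x4" using h by (simp add: maxhole_def)
  have ne: "x1 \<noteq> l" "x2 \<noteq> k" "x4 \<noteq> k" "l \<noteq> y"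
    using h5 l d hole5_distinct[OF h5] unfolding hole5_def by (auto simp: adj_commute)
  note co = adj_commute[of k l] adj_commute[of x0 l] adj_commute[of x0 x3] adj_commute[of x0 x4]
  adj_commute[of x1 l] adj_commute[of x2 k] adj_commute[of x2 l] adj_commute[of x2 x3]
  adj_commute[of x2 x4] adj_commute[of x2 y] adj_commute[of x3 k] adj_commute[of x3 l]
  adj_commute[of x3 x4] adj_commute[of x4 k] adj_commute[of x4 l]
  show False using h5[unfolded hole5_def] l co ne d[unfolded insert_iff empty_iff]
    gy[unfolded good_def cadj_def] bl[unfolded good_def cadj_def] C4[of x1 x2 l k]
    C4[of x4 l k y] C6[of x0 x4 x3 x2 l k]
    by sat
qed

lemma hole_split_double_3:
  assumes h: "maxhole x0 x1 x2 x3 x4"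
    and l: "adj k x0" "adj k x1" "\<not> adj k x2" "\<not> adj k x3" "\<not> adj k x4" "adj l x3"
    "adj k y" "\<not> adj x3 y" "adj k l" "\<not> adj l y"
    and d: "l \<notin> {x0, x1, x2, x3, x4}" "y \<notin> {x0, x1, x2, x3, x4}"
    and gy: "good x0 x1 x2 x3 x4 y"
    and bl: "\<not> good x0 x1 x2 x3 x4 l"
    and nl: "adj l x0 \<or> adj l x1 \<or> adj l x2 \<or> adj l x3 \<or> adj l x4"
  shows False
proof -
  have h5: "hole5 x0 x1 x2 x3 x4" using h by (simp add: maxhole_def)
  have ne: "x0 \<noteq> x3" "x4 \<noteq> l" "x0 \<noteq> l" "x4 \<noteq> k" "x1 \<noteq> x3"
  "x2 \<noteq> l" "x1 \<noteq> l" "x2 \<noteq> k"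
    using h5 l d hole5_distinct[OF h5] unfolding hole5_def by (auto simp: adj_commute)
  note co = adj_commute[of k l] adj_commute[of x0 k] adj_commute[of x0 l] adj_commute[of x0 x1]
  adj_commute[of x0 x2] adj_commute[of x0 x3] adj_commute[of x0 x4] adj_commute[of x1 k]
  adj_commute[of x1 l] adj_commute[of x1 x2] adj_commute[of x1 x3] adj_commute[of x2 k]
  adj_commute[of x2 l] adj_commute[of x2 x3] adj_commute[of x3 k] adj_commute[of x3 l]
  adj_commute[of x3 x4] adj_commute[of x4 k] adj_commute[of x4 l]
  show False using h5[unfolded hole5_def] l co ne d[unfolded insert_iff empty_iff]
    bl[unfolded good_def cadj_def] C4[of x0 x4 x3 l] C4[of x0 x4 l k] C4[of x1 x2 x3 l]
    C4[of x1 x2 l k] no_pyramid[of x3 x2 x4 l x1 x0 k]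
    by sat
qed

lemma hole_split_double_4:
  assumes h: "maxhole x0 x1 x2 x3 x4"
    and l: "adj k x0" "adj k x1" "\<not> adj k x2" "\<not> adj k x3" "\<not> adj k x4" "adj l x4"
    "adj k y" "\<not> adj x4 y" "adj k l" "\<not> adj l y"
    and d: "l \<notin> {x0, x1, x2, x3, x4}" "y \<notin> {x0, x1, x2, x3, x4}"
    and gy: "good x0 x1 x2 x3 x4 y"
    and bl: "\<not> good x0 x1 x2 x3 x4 l"
    and nl: "adj l x0 \<or> adj l x1 \<or> adj l x2 \<or> adj l x3 \<or> adj l x4"
  shows False
proof -
  have h5: "hole5 x0 x1 x2 x3 x4" using h by (simp add: maxhole_def)
  have ne: "x0 \<noteq> x2" "x1 \<noteq> l" "x0 \<noteq> l" "x4 \<noteq> k"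
    using h5 l d hole5_distinct[OF h5] unfolding hole5_def by (auto simp: adj_commute)
  note co = adj_commute[of k l] adj_commute[of x0 l] adj_commute[of x0 x4] adj_commute[of x1 l]
  adj_commute[of x1 x4] adj_commute[of x2 k] adj_commute[of x2 l] adj_commute[of x3 k]
  adj_commute[of x3 l] adj_commute[of x4 k] adj_commute[of x4 l]
  show False using h5[unfolded hole5_def] l co ne d[unfolded insert_iff empty_iff]
    bl[unfolded good_def cadj_def] C4[of x0 x1 x2 l] C4[of x0 x4 l k] C6[of x1 x2 x3 x4 l k]
    by sat
qed

lemma hole_split_single_1:
  assumes h: "maxhole x0 x1 x2 x3 x4"
    and l: "adj k x0" "\<not> adj k x1" "\<not> adj k x2" "\<not> adj k x3" "\<not> adj k x4"
    "adj l x1" "adj k y" "\<not> adj x1 y" "adj k l" "\<not> adj l y"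
    and d: "l \<notin> {x0, x1, x2, x3, x4}" "y \<notin> {x0, x1, x2, x3, x4}"
    and gy: "good x0 x1 x2 x3 x4 y"
    and bl: "\<not> good x0 x1 x2 x3 x4 l"
    and nl: "adj l x0 \<or> adj l x1 \<or> adj l x2 \<or> adj l x3 \<or> adj l x4"
  shows False
proof -
  have h5: "hole5 x0 x1 x2 x3 x4" using h by (simp add: maxhole_def)
  have ne: "x0 \<noteq> x2" "x1 \<noteq> y" "x0 \<noteq> l" "x1 \<noteq> k" "x0 \<noteq> y"
  "x4 \<noteq> k" "x3 \<noteq> k" "l \<noteq> y"
    using h5 l d hole5_distinct[OF h5] unfolding hole5_def by (auto simp: adj_commute)
  note co = adj_commute[of k l] adj_commute[of k y] adj_commute[of l y] adj_commute[of x0 l]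
  adj_commute[of x0 x4] adj_commute[of x0 y] adj_commute[of x1 k] adj_commute[of x1 l]
  adj_commute[of x1 y] adj_commute[of x2 k] adj_commute[of x2 l] adj_commute[of x2 y]
  adj_commute[of x3 k] adj_commute[of x3 l] adj_commute[of x3 y] adj_commute[of x4 k]
  adj_commute[of x4 y]
  show False using h5[unfolded hole5_def] l co ne d[unfolded insert_iff empty_iff]
    gy[unfolded good_def cadj_def] bl[unfolded good_def cadj_def] C4[of x0 x1 x2 y]
    C4[of x0 x1 l k] C4[of x0 x4 y k] C4[of x3 l k y] C6[of x1 x2 x3 y k l]
    by sat
qed

lemma hole_split_single_2:
  assumes h: "maxhole x0 x1 x2 x3 x4"
    and l: "adj k x0" "\<not> adj k x1" "\<not> adj k x2" "\<not> adj k x3" "\<not> adj k x4"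
    "adj l x2" "adj k y" "\<not> adj x2 y" "adj k l" "\<not> adj l y"
    and d: "l \<notin> {x0, x1, x2, x3, x4}" "y \<notin> {x0, x1, x2, x3, x4}"
    and gy: "good x0 x1 x2 x3 x4 y"
    and bl: "\<not> good x0 x1 x2 x3 x4 l"
    and nl: "adj l x0 \<or> adj l x1 \<or> adj l x2 \<or> adj l x3 \<or> adj l x4"
  shows False
proof -
  have h5: "hole5 x0 x1 x2 x3 x4" using h by (simp add: maxhole_def)
  have ne: "x0 \<noteq> x2" "x1 \<noteq> l" "x1 \<noteq> k" "l \<noteq> y" "x3 \<noteq> k"
  "x4 \<noteq> k"
    using h5 l d hole5_distinct[OF h5] unfolding hole5_def by (auto simp: adj_commute)
  note co = adj_commute[of k l] adj_commute[of k y] adj_commute[of l y] adj_commute[of x0 l]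
  adj_commute[of x0 x3] adj_commute[of x0 x4] adj_commute[of x1 k] adj_commute[of x1 l]
  adj_commute[of x1 x4] adj_commute[of x2 k] adj_commute[of x2 l] adj_commute[of x2 x3]
  adj_commute[of x2 x4] adj_commute[of x2 y] adj_commute[of x3 k] adj_commute[of x3 l]
  adj_commute[of x3 x4] adj_commute[of x4 k] adj_commute[of x4 l]
  show False using h5[unfolded hole5_def] l co ne d[unfolded insert_iff empty_iff]
    gy[unfolded good_def cadj_def] bl[unfolded good_def cadj_def] C4[of x0 x1 x2 l]
    C4[of x1 l k y] C4[of x3 l k y] C4[of x4 l k y] C6[of x0 x4 x3 x2 l k]
    no_pyramid[of y x1 x4 k x2 x3 l]
    by sat
qed

lemma hole_split_single_3:
  assumes h: "maxhole x0 x1 x2 x3 x4"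
    and l: "adj k x0" "\<not> adj k x1" "\<not> adj k x2" "\<not> adj k x3" "\<not> adj k x4"
    "adj l x3" "adj k y" "\<not> adj x3 y" "adj k l" "\<not> adj l y"
    and d: "l \<notin> {x0, x1, x2, x3, x4}" "y \<notin> {x0, x1, x2, x3, x4}"
    and gy: "good x0 x1 x2 x3 x4 y"
    and bl: "\<not> good x0 x1 x2 x3 x4 l"
    and nl: "adj l x0 \<or> adj l x1 \<or> adj l x2 \<or> adj l x3 \<or> adj l x4"
  shows False
proof -
  have h5: "hole5 x0 x1 x2 x3 x4" using h by (simp add: maxhole_def)
  have ne: "x0 \<noteq> x3" "x4 \<noteq> l" "x0 \<noteq> l" "x4 \<noteq> k" "x1 \<noteq> k"
  "l \<noteq> y"
    using h5 l d hole5_distinct[OF h5] unfolding hole5_def by (auto simp: adj_commute)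
  note co = adj_commute[of k l] adj_commute[of x0 k] adj_commute[of x0 l] adj_commute[of x0 x3]
  adj_commute[of x0 x4] adj_commute[of x1 k] adj_commute[of x1 l] adj_commute[of x1 x4]
  adj_commute[of x2 k] adj_commute[of x2 l] adj_commute[of x2 x4] adj_commute[of x3 k]
  adj_commute[of x3 l] adj_commute[of x3 x4] adj_commute[of x3 y] adj_commute[of x4 k]
  adj_commute[of x4 l]
  show False using h5[unfolded hole5_def] l co ne d[unfolded insert_iff empty_iff]
    gy[unfolded good_def cadj_def] bl[unfolded good_def cadj_def] C4[of x0 x4 x3 l]
    C4[of x0 x4 l k] C4[of x1 l k y] C6[of x0 x1 x2 x3 l k] no_pyramid[of x0 x1 x4 k x2 x3 l]
    by sat
qed

lemma hole_split_single_4: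
  assumes h: "maxhole x0 x1 x2 x3 x4"
    and l: "adj k x0" "\<not> adj k x1" "\<not> adj k x2" "\<not> adj k x3" "\<not> adj k x4"
    "adj l x4" "adj k y" "\<not> adj x4 y" "adj k l" "\<not> adj l y"
    and d: "l \<notin> {x0, x1, x2, x3, x4}" "y \<notin> {x0, x1, x2, x3, x4}"
    and gy: "good x0 x1 x2 x3 x4 y"
    and bl: "\<not> good x0 x1 x2 x3 x4 l"
    and nl: "adj l x0 \<or> adj l x1 \<or> adj l x2 \<or> adj l x3 \<or> adj l x4"
  shows False
proof -
  have h5: "hole5 x0 x1 x2 x3 x4" using h by (simp add: maxhole_def)
  have ne: "x0 \<noteq> x2" "x1 \<noteq> l" "x0 \<noteq> y" "x1 \<noteq> k" "x0 \<noteq> x3"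
  "x4 \<noteq> y" "x0 \<noteq> l" "x4 \<noteq> k"
    using h5 l d hole5_distinct[OF h5] unfolding hole5_def by (auto simp: adj_commute)
  note co = adj_commute[of k l] adj_commute[of k y] adj_commute[of x0 l] adj_commute[of x0 x3]
  adj_commute[of x0 x4] adj_commute[of x0 y] adj_commute[of x1 k] adj_commute[of x1 l]
  adj_commute[of x1 y] adj_commute[of x2 k] adj_commute[of x2 l] adj_commute[of x3 k]
  adj_commute[of x3 l] adj_commute[of x3 x4] adj_commute[of x3 y] adj_commute[of x4 k]
  adj_commute[of x4 l] adj_commute[of x4 y]
  show False using h5[unfolded hole5_def] l co ne d[unfolded insert_iff empty_iff]
    gy[unfolded good_def cadj_def] bl[unfolded good_def cadj_def] C4[of x0 x1 x2 l]
    C4[of x0 x1 y k] C4[of x0 x4 x3 y] C4[of x0 x4 l k] C6[of x2 x3 x4 l k y]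
    by sat
qed

lemma hole_hole_double_0_2:
  assumes h: "hole5 x0 x1 x2 x3 x4"
    and l: "adj k x0" "adj k x1" "\<not> adj k x2" "\<not> adj k x3" "\<not> adj k x4" "adj k l"
    "adj l x2" "\<not> adj l x0"
    and d: "l \<notin> {x0, x1, x2, x3, x4}"
    and bl: "\<not> good x0 x1 x2 x3 x4 l"
  shows False
proof -
  have ne: "x0 \<noteq> l" "x4 \<noteq> k" "x1 \<noteq> l" "x2 \<noteq> k"
    using h l d hole5_distinct[OF h] unfolding hole5_def by (auto simp: adj_commute)
  note co = adj_commute[of k l] adj_commute[of x0 l] adj_commute[of x0 x3] adj_commute[of x0 x4]
  adj_commute[of x1 l] adj_commute[of x2 k] adj_commute[of x2 l] adj_commute[of x2 x3]
  adj_commute[of x2 x4] adj_commute[of x3 k] adj_commute[of x3 l] adj_commute[of x3 x4]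
  adj_commute[of x4 k] adj_commute[of x4 l]
  show False using h[unfolded hole5_def] l co ne d[unfolded insert_iff empty_iff]
    bl[unfolded good_def cadj_def] C4[of x0 x4 l k] C4[of x1 x2 l k] C6[of x0 x4 x3 x2 l k]
    by sat
qed

lemma hole_hole_double_0_3:
  assumes h: "hole5 x0 x1 x2 x3 x4"
    and l: "adj k x0" "adj k x1" "\<not> adj k x2" "\<not> adj k x3" "\<not> adj k x4" "adj k l"
    "adj l x3" "\<not> adj l x0"
    and d: "l \<notin> {x0, x1, x2, x3, x4}"
    and bl: "\<not> good x0 x1 x2 x3 x4 l"
  shows False
proof -
  have ne: "x0 \<noteq> l" "x4 \<noteq> k" "x1 \<noteq> x3" "x2 \<noteq> l" "x1 \<noteq> l"
  "x2 \<noteq> k"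
    using h l d hole5_distinct[OF h] unfolding hole5_def by (auto simp: adj_commute)
  note co = adj_commute[of k l] adj_commute[of x0 k] adj_commute[of x0 l] adj_commute[of x0 x1]
  adj_commute[of x0 x2] adj_commute[of x0 x4] adj_commute[of x1 k] adj_commute[of x1 l]
  adj_commute[of x1 x2] adj_commute[of x1 x3] adj_commute[of x2 k] adj_commute[of x2 l]
  adj_commute[of x2 x3] adj_commute[of x3 k] adj_commute[of x3 l] adj_commute[of x4 k]
  adj_commute[of x4 l]
  show False using h[unfolded hole5_def] l co ne d[unfolded insert_iff empty_iff]
    bl[unfolded good_def cadj_def] C4[of x0 x4 l k] C4[of x1 x2 x3 l] C4[of x1 x2 l k]
    no_pyramid[of x3 x2 x4 l x1 x0 k]
    by sat
qed

lemma hole_hole_double_1_3: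
  assumes h: "hole5 x0 x1 x2 x3 x4"
    and l: "adj k x0" "adj k x1" "\<not> adj k x2" "\<not> adj k x3" "\<not> adj k x4" "adj k l"
    "adj l x3" "\<not> adj l x1"
    and d: "l \<notin> {x0, x1, x2, x3, x4}"
    and bl: "\<not> good x0 x1 x2 x3 x4 l"
  shows False
proof -
  have ne: "x0 \<noteq> x3" "x4 \<noteq> l" "x0 \<noteq> l" "x4 \<noteq> k" "x1 \<noteq> l"
  "x2 \<noteq> k"
    using h l d hole5_distinct[OF h] unfolding hole5_def by (auto simp: adj_commute)
  note co = adj_commute[of k l] adj_commute[of x0 k] adj_commute[of x0 l] adj_commute[of x0 x1]
  adj_commute[of x0 x2] adj_commute[of x0 x3] adj_commute[of x0 x4] adj_commute[of x1 k]
  adj_commute[of x1 l] adj_commute[of x1 x2] adj_commute[of x1 x3] adj_commute[of x2 k]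
  adj_commute[of x2 l] adj_commute[of x2 x3] adj_commute[of x3 k] adj_commute[of x3 l]
  adj_commute[of x3 x4] adj_commute[of x4 k] adj_commute[of x4 l]
  show False using h[unfolded hole5_def] l co ne d[unfolded insert_iff empty_iff]
    bl[unfolded good_def cadj_def] C4[of x0 x4 x3 l] C4[of x0 x4 l k] C4[of x1 x2 l k]
    no_pyramid[of x3 x2 x4 l x1 x0 k]
    by sat
qed

lemma hole_hole_double_1_4:
  assumes h: "hole5 x0 x1 x2 x3 x4"
    and l: "adj k x0" "adj k x1" "\<not> adj k x2" "\<not> adj k x3" "\<not> adj k x4" "adj k l"
    "adj l x4" "\<not> adj l x1"
    and d: "l \<notin> {x0, x1, x2, x3, x4}"
    and bl: "\<not> good x0 x1 x2 x3 x4 l"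
  shows False
proof -
  have ne: "x0 \<noteq> l" "x4 \<noteq> k" "x1 \<noteq> l" "x2 \<noteq> k"
    using h l d hole5_distinct[OF h] unfolding hole5_def by (auto simp: adj_commute)
  note co = adj_commute[of k l] adj_commute[of x0 l] adj_commute[of x0 x4] adj_commute[of x1 l]
  adj_commute[of x1 x4] adj_commute[of x2 k] adj_commute[of x2 l] adj_commute[of x3 k]
  adj_commute[of x3 l] adj_commute[of x4 k] adj_commute[of x4 l]
  show False using h[unfolded hole5_def] l co ne d[unfolded insert_iff empty_iff]
    bl[unfolded good_def cadj_def] C4[of x0 x4 l k] C4[of x1 x2 l k] C6[of x1 x2 x3 x4 l k]
    by sat
qed

lemma hole_hole_single_0_2:
  assumes h: "hole5 x0 x1 x2 x3 x4"
    and l: "adj k x0" "\<not> adj k x1" "\<not> adj k x2" "\<not> adj k x3" "\<not> adj k x4"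
    "adj k l" "adj l x2" "\<not> adj l x0"
    and d: "l \<notin> {x0, x1, x2, x3, x4}"
    and bl: "\<not> good x0 x1 x2 x3 x4 l"
  shows False
proof -
  have ne: "x0 \<noteq> l" "x1 \<noteq> k" "x4 \<noteq> k"
    using h l d hole5_distinct[OF h] unfolding hole5_def by (auto simp: adj_commute)
  note co = adj_commute[of k l] adj_commute[of x0 k] adj_commute[of x0 l] adj_commute[of x0 x3]
  adj_commute[of x0 x4] adj_commute[of x1 k] adj_commute[of x1 x4] adj_commute[of x2 k]
  adj_commute[of x2 l] adj_commute[of x2 x3] adj_commute[of x2 x4] adj_commute[of x3 k]
  adj_commute[of x3 x4] adj_commute[of x4 k]
  show False using h[unfolded hole5_def] l co ne d[unfolded insert_iff empty_iff]
    C4[of x0 x1 l k] C4[of x0 x4 l k] C6[of x0 x4 x3 x2 l k] no_pyramid[of x0 x1 x4 k x2 x3 l]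
    by sat
qed

lemma hole_hole_single_0_3:
  assumes h: "hole5 x0 x1 x2 x3 x4"
    and l: "adj k x0" "\<not> adj k x1" "\<not> adj k x2" "\<not> adj k x3" "\<not> adj k x4"
    "adj k l" "adj l x3" "\<not> adj l x0"
    and d: "l \<notin> {x0, x1, x2, x3, x4}"
    and bl: "\<not> good x0 x1 x2 x3 x4 l"
  shows False
proof -
  have ne: "x0 \<noteq> l" "x1 \<noteq> k" "x4 \<noteq> k"
    using h l d hole5_distinct[OF h] unfolding hole5_def by (auto simp: adj_commute)
  note co = adj_commute[of k l] adj_commute[of x0 k] adj_commute[of x0 l] adj_commute[of x0 x3]
  adj_commute[of x0 x4] adj_commute[of x1 k] adj_commute[of x1 x4] adj_commute[of x2 k]
  adj_commute[of x2 x4] adj_commute[of x3 k] adj_commute[of x3 l] adj_commute[of x3 x4]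
  adj_commute[of x4 k]
  show False using h[unfolded hole5_def] l co ne d[unfolded insert_iff empty_iff]
    C4[of x0 x1 l k] C4[of x0 x4 l k] C6[of x0 x1 x2 x3 l k] no_pyramid[of x0 x1 x4 k x2 x3 l]
    by sat
qed

lemma not_good_notin_hole:
  "hole5 x0 x1 x2 x3 x4 \<Longrightarrow> \<not> good x0 x1 x2 x3 x4 v \<Longrightarrow> v \<notin> {x0, x1, x2, x3, x4}"
  using good_hole_vertex by blast

lemma bad_P3_free_typed:
  assumes hole: "hole5 x0 x1 x2 x3 x4"
    and l: "adj l x0" "\<not> adj l x2" "\<not> adj l x3" "\<not> adj l x4"
    and a: "adj k l" "adj l m" "k \<noteq> m"
    and bad: "\<not> good x0 x1 x2 x3 x4 k" "\<not> good x0 x1 x2 x3 x4 m"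
  shows "adj k m"
  using bad_P3_free_single[of x0 x1 x2 x3 x4 l k m] bad_P3_free_double[of x0 x1 x2 x3 x4 l k m]
    assms not_good_notin_hole[OF hole] by blast

lemma common_attachment_typed:
  assumes max: "maxhole x0 x1 x2 x3 x4"
    and k: "adj k x0" "\<not> adj k x2" "\<not> adj k x3" "\<not> adj k x4"
    and a: "adj k x" "adj k y" "x \<noteq> y"
    and good: "good x0 x1 x2 x3 x4 x" "good x0 x1 x2 x3 x4 y"
  shows "adj x y"
proof (rule ccontr)
  have hole: "hole5 x0 x1 x2 x3 x4" using max by (simp add: maxhole_def)
  have half: "adj x y" if h: "adj k x" "adj k y" "x \<noteq> y" "good x0 x1 x2 x3 x4 x"
      "good x0 x1 x2 x3 x4 y" "y \<notin> {x0, x1, x2, x3, x4}" for x y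
  proof (rule ccontr)
    assume n: "\<not> adj x y"
    consider "x \<notin> {x0, x1, x2, x3, x4}" | "x = x0" | "x = x1" "adj k x1" using k h(1) by blast
    then show False
    proof cases
      case 1
      then show False
        using common_attachment_single[OF max, of k x y] common_attachment_double[OF max, of k x y]
          k h n by blast
    next
      case 2
      then show False
        using hole_attachment_single_0[OF max, of k y] hole_attachment_double_0[OF max, of k y]
          k h n by blast
    next
      case 3
      then show False using hole_attachment_double_1[OF max, of k y] k h n by blast
    qed
  qed
  assume n: "\<not> adj x y"
  then have "x \<in> {x0, x1, x2, x3, x4}" "y \<in> {x0, x1, x2, x3, x4}"
    using half[of x y] half[of y x] a good adj_sym by blast+
  then have "x \<in> {x0, x1}" "y \<in> {x0, x1}" using a k by blast+
  then show False using n a hole adj_sym unfolding hole5_def by blast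
qed

text \<open>The hypothesis \<open>xy\<close> omits only the case of \<open>x\<close> on the hole and
  \<open>y\<close> off it; exchanging the roles of \<open>k\<close> and \<open>l\<close> in
  \<open>split_attachment\<close> turns that case into a permitted one.\<close>

lemma split_attachment_typed:
  assumes max: "maxhole x0 x1 x2 x3 x4"
    and k: "adj k x0" "\<not> adj k x2" "\<not> adj k x3" "\<not> adj k x4"
    and bad: "\<not> good x0 x1 x2 x3 x4 l"
    and a: "adj k x" "adj l y" "adj k l" "\<not> adj k y" "\<not> adj l x"
    and good: "good x0 x1 x2 x3 x4 x" "good x0 x1 x2 x3 x4 y"
    and xy: "x \<notin> {x0, x1, x2, x3, x4} \<or> y \<in> {x0, x1, x2, x3, x4}"
  shows "adj x y"
proof (rule ccontr)
  assume n: "\<not> adj x y"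
  have hole: "hole5 x0 x1 x2 x3 x4" using max by (simp add: maxhole_def)
  have l: "l \<notin> {x0, x1, x2, x3, x4}" "adj l x0 \<or> adj l x1 \<or> adj l x2 \<or> adj l x3 \<or> adj l x4"
    using not_good_notin_hole[OF hole bad] dominating[OF hole, of l] adjD[OF a(2)] by blast+
  show False
  proof (cases "y \<in> {x0, x1, x2, x3, x4}")
    case False
    then show False
      using split_attachment_single[OF max, of k x l y] split_attachment_double[OF max, of k x l y]
        k xy a good bad l n by blast
  next
    case y: True
    show False
    proof (cases "x \<in> {x0, x1, x2, x3, x4}")
      case True
      then have "x = x0 \<or> x = x1 \<and> adj k x1" using a k by blast
      then show False
        using y n a k l bad hole adj_sym
          hole_hole_single_0_2[OF hole, of k l] hole_hole_single_0_3[OF hole, of k l]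
          hole_hole_double_0_2[OF hole, of k l] hole_hole_double_0_3[OF hole, of k l]
          hole_hole_double_1_3[OF hole, of k l] hole_hole_double_1_4[OF hole, of k l]
        unfolding hole5_def by blast
    next
      case False
      have n': "\<not> adj y x" using n adj_sym by blast
      consider "y = x1" "\<not> adj k x1" | "y = x2" | "y = x3" | "y = x4" using y a k by blast
      then show False
      proof cases
        case 1
        then show False
          using hole_split_single_1[OF max, of k l x] False a k l bad good n' by blast
      next
        case 2
        then show False
          using hole_split_single_2[OF max, of k l x] hole_split_double_2[OF max, of k l x]
            False a k l bad good n' by blast
      next
        case 3
        then show False
          using hole_split_single_3[OF max, of k l x] hole_split_double_3[OF max, of k l x]
            False a k l bad good n' by blast
      next
        case 4
        then show False
          using hole_split_single_4[OF max, of k l x] hole_split_double_4[OF max, of k l x]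
            False a k l bad good n' by blast
      qed
    qed
  qed
qed

text \<open>Rotating the hole changes neither its vertex set nor the notion of goodness, so a bad
  vertex may be assumed to see the first vertex and, besides it, at most the second.\<close>

lemma bad_rotation:
  assumes max: "maxhole x0 x1 x2 x3 x4" and bad: "\<not> good x0 x1 x2 x3 x4 k" and k: "k \<in> V"
  obtains y0 y1 y2 y3 y4 where "maxhole y0 y1 y2 y3 y4"
    "good y0 y1 y2 y3 y4 = good x0 x1 x2 x3 x4" "{y0, y1, y2, y3, y4} = {x0, x1, x2, x3, x4}"
    "adj k y0" "\<not> adj k y2" "\<not> adj k y3" "\<not> adj k y4"
proof -
  have hole: "hole5 x0 x1 x2 x3 x4" using max by (simp add: maxhole_def)
  note g = good_rot[of x1 x2 x3 x4 x0] good_rot[of x2 x3 x4 x0 x1] good_rot[of x3 x4 x0 x1 x2]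
    good_rot[of x4 x0 x1 x2 x3]
  have s: "{x1, x2, x3, x4, x0} = {x0, x1, x2, x3, x4}" "{x2, x3, x4, x0, x1} = {x0, x1, x2, x3, x4}"
    "{x3, x4, x0, x1, x2} = {x0, x1, x2, x3, x4}" "{x4, x0, x1, x2, x3} = {x0, x1, x2, x3, x4}"
    by blast+
  show thesis
  proof (rule bad_cases[OF hole bad dominating[OF hole k]], goal_cases)
    case 1 then show ?case by (rule that[OF max refl refl])
  next
    case 2 then show ?case by (rule that[OF maxhole_rot[OF max] g(1) s(1)])
  next
    case 3 then show ?case by (rule that[OF maxhole_rot2[OF max] trans[OF g(2) g(1)] s(2)])
  next
    case 4 then show ?case
      by (rule that[OF maxhole_rot3[OF max] trans[OF g(3) trans[OF g(2) g(1)]] s(3)])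
  next
    case 5 then show ?case
      by (rule that[OF maxhole_rot4[OF max] trans[OF g(4) trans[OF g(3) trans[OF g(2) g(1)]]] s(4)])
  qed
qed

lemma bad_P3_free:
  assumes max: "maxhole x0 x1 x2 x3 x4" and a: "adj k l" "adj l m" "k \<noteq> m"
    and bad: "\<not> good x0 x1 x2 x3 x4 k" "\<not> good x0 x1 x2 x3 x4 l" "\<not> good x0 x1 x2 x3 x4 m"
  shows "adj k m"
proof -
  have "l \<in> V" using a adjD by blast
  then obtain y0 y1 y2 y3 y4 where y: "maxhole y0 y1 y2 y3 y4"
      "good y0 y1 y2 y3 y4 = good x0 x1 x2 x3 x4" "{y0, y1, y2, y3, y4} = {x0, x1, x2, x3, x4}"
      "adj l y0" "\<not> adj l y2" "\<not> adj l y3" "\<not> adj l y4"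
    by (rule bad_rotation[OF max bad(2)])
  have "hole5 y0 y1 y2 y3 y4" using y(1) by (simp add: maxhole_def)
  then show ?thesis by (rule bad_P3_free_typed) (use y a bad in simp_all)
qed

lemma common_attachment:
  assumes max: "maxhole x0 x1 x2 x3 x4" and a: "adj k x" "adj k y" "x \<noteq> y"
    and bad: "\<not> good x0 x1 x2 x3 x4 k"
    and good: "good x0 x1 x2 x3 x4 x" "good x0 x1 x2 x3 x4 y"
  shows "adj x y"
proof -
  have "k \<in> V" using a adjD by blast
  then obtain y0 y1 y2 y3 y4 where y: "maxhole y0 y1 y2 y3 y4"
      "good y0 y1 y2 y3 y4 = good x0 x1 x2 x3 x4" "{y0, y1, y2, y3, y4} = {x0, x1, x2, x3, x4}"
      "adj k y0" "\<not> adj k y2" "\<not> adj k y3" "\<not> adj k y4"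
    by (rule bad_rotation[OF max bad])
  from y(1) show ?thesis by (rule common_attachment_typed) (use y a good in simp_all)
qed

lemma split_attachment:
  assumes max: "maxhole x0 x1 x2 x3 x4"
    and a: "adj k x" "adj l y" "adj k l" "\<not> adj k y" "\<not> adj l x"
    and bad: "\<not> good x0 x1 x2 x3 x4 k" "\<not> good x0 x1 x2 x3 x4 l"
    and good: "good x0 x1 x2 x3 x4 x" "good x0 x1 x2 x3 x4 y"
  shows "adj x y"
proof -
  have half: "adj x y" if a: "adj k x" "adj l y" "adj k l" "\<not> adj k y" "\<not> adj l x"
    and bad: "\<not> good x0 x1 x2 x3 x4 k" "\<not> good x0 x1 x2 x3 x4 l"
    and good: "good x0 x1 x2 x3 x4 x" "good x0 x1 x2 x3 x4 y"
    and xy: "x \<notin> {x0, x1, x2, x3, x4} \<or> y \<in> {x0, x1, x2, x3, x4}" for k l x y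
  proof -
    have "k \<in> V" using a adjD by blast
    then obtain y0 y1 y2 y3 y4 where y: "maxhole y0 y1 y2 y3 y4"
      "good y0 y1 y2 y3 y4 = good x0 x1 x2 x3 x4" "{y0, y1, y2, y3, y4} = {x0, x1, x2, x3, x4}"
      "adj k y0" "\<not> adj k y2" "\<not> adj k y3" "\<not> adj k y4"
      by (rule bad_rotation[OF max bad(1)])
    from y(1) show ?thesis
      by (rule split_attachment_typed[where k = k and l = l]) (use y a bad good xy in simp_all)
  qed
  show ?thesis
    using half[of k x l y] half[of l y k x] a bad good adj_sym by blast
qed

text \<open>The scheme of \<open>dominating_set\<close> once more: bad vertices form components that
  are cliques by \<open>bad_P3_free\<close>, the outside neighbours of a component are good, and two
  of them are adjacent whether they share a bad neighbour or hang on the two ends of an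
  edge.\<close>

lemma all_good:
  assumes max: "maxhole x0 x1 x2 x3 x4" and "v \<in> V"
  shows "good x0 x1 x2 x3 x4 v"
proof (rule ccontr)
  let ?g = "good x0 x1 x2 x3 x4"
  assume nv: "\<not> ?g v"
  define D where "D = {w \<in> V. \<not> ?g w \<and> cadj v w}"
  have cl: "adj x y" if "x \<in> D" "y \<in> D" "x \<noteq> y" for x y
    using that bad_P3_free[OF max, of x v y] nv adj_commute[of v x] unfolding D_def cadj_def by blast
  have "v \<in> D" "D \<subseteq> V" using assms nv by (auto simp: D_def cadj_def)
  then obtain x y d d' where xy: "x \<notin> D" "y \<notin> D" "d \<in> D" "d' \<in> D" "adj d x" "adj d' y"
      "x \<noteq> y" "\<not> adj x y"
    using clique_attachment[of D] cl by blast
  have att: "?g x" if "x \<notin> D" "d \<in> D" "adj d x" for x d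
    using that bad_P3_free[OF max, of v d x] nv adjD[of d x] unfolding D_def cadj_def by blast
  have "\<not> ?g d" "\<not> ?g d'" "d = d' \<or> adj d d'" using xy cl by (auto simp: D_def)
  then show False
    using common_attachment[OF max, of d x y] common_attachment[OF max, of d' x y]
      split_attachment[OF max, of d x d' y] att[OF xy(1,3,5)] att[OF xy(2,4,6)] xy by blast
qed

end

text \<open>In a chain of finite sets inclusion is decided by cardinality, so sorting by decreasing
  cardinality produces the required order.\<close>

lemma chain_list:
  fixes f :: "'a \<Rightarrow> 'b set"
  assumes "finite X" and fin: "\<And>x. x \<in> X \<Longrightarrow> finite (f x)"
    and chain: "\<And>x y. x \<in> X \<Longrightarrow> y \<in> X \<Longrightarrow> f x \<subseteq> f y \<or> f y \<subseteq> f x"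
  obtains us where "distinct us" "set us = X"
    "\<And>i j. i \<le> j \<Longrightarrow> j < length us \<Longrightarrow> f (us ! j) \<subseteq> f (us ! i)"
proof -
  obtain xs where xs: "set xs = X" "distinct xs"
    using finite_distinct_list[OF \<open>finite X\<close>] by blast
  define k where "k x = - int (card (f x))" for x
  define us where "us = sort_key k xs"
  have us: "set us = X" "distinct us" using xs by (simp_all add: us_def)
  have "f (us ! j) \<subseteq> f (us ! i)" if "i \<le> j" "j < length us" for i j
  proof -
    have "sorted (map k us)" by (simp add: us_def)
    then have "k (us ! i) \<le> k (us ! j)" using sorted_nth_mono[of "map k us" i j] that by simp
    then have "card (f (us ! j)) \<le> card (f (us ! i))" by (simp add: k_def)
    moreover have "us ! i \<in> X" "us ! j \<in> X" using that us(1) nth_mem by fastforce+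
    ultimately show ?thesis
      using chain[of "us ! i" "us ! j"] fin card_seteq[of "f (us ! j)" "f (us ! i)"] by blast
  qed
  then show thesis using that us by blast
qed

section \<open>The ring partition around an optimal 5-hole\<close>

context free_graph
begin

text \<open>These are the vertices attached to the hole in the way \<open>x0\<close> is; closed
  adjacency lets \<open>x0\<close> itself belong to its part. Rotating the arguments gives the other
  four parts.\<close>

definition ring_part :: "'a \<Rightarrow> 'a \<Rightarrow> 'a \<Rightarrow> 'a \<Rightarrow> 'a \<Rightarrow> 'a set" where
  "ring_part x0 x1 x2 x3 x4 =
     {v \<in> V. cadj v x4 \<and> cadj v x0 \<and> cadj v x1 \<and> \<not> cadj v x2 \<and> \<not> cadj v x3}"

definition full_hole :: "'a \<Rightarrow> 'a \<Rightarrow> 'a \<Rightarrow> 'a \<Rightarrow> 'a \<Rightarrow> bool" where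
  "full_hole x0 x1 x2 x3 x4 \<longleftrightarrow> hole5 x0 x1 x2 x3 x4 \<and>
     V = ring_part x0 x1 x2 x3 x4 \<union> ring_part x1 x2 x3 x4 x0 \<union> ring_part x2 x3 x4 x0 x1 \<union>
         ring_part x3 x4 x0 x1 x2 \<union> ring_part x4 x0 x1 x2 x3"

lemma full_hole_rot: "full_hole x0 x1 x2 x3 x4 \<Longrightarrow> full_hole x1 x2 x3 x4 x0"
  unfolding full_hole_def using hole5_rot by blast

lemma cadj_commute: "cadj x y \<longleftrightarrow> cadj y x"
  by (auto simp: cadj_def intro: adj_sym)

lemma ring_partD:
  assumes "hole5 x0 x1 x2 x3 x4" "v \<in> ring_part x0 x1 x2 x3 x4"
  shows "v \<in> V" "adj v x4" "adj v x1" "cadj v x0" "\<not> adj v x2" "\<not> adj v x3" "v \<noteq> x2" "v \<noteq> x3"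
    "adj x4 v" "adj x1 v" "\<not> adj x2 v" "\<not> adj x3 v"
  using assms adj_commute unfolding ring_part_def hole5_def cadj_def by blast+

lemma center_in_ring_part:
  "hole5 x0 x1 x2 x3 x4 \<Longrightarrow> x0 \<in> ring_part x0 x1 x2 x3 x4"
  using hole5_distinct[of x0 x1 x2 x3 x4] adj_commute adjD[of x0 x1]
  unfolding ring_part_def hole5_def cadj_def by auto

lemma ring_part_clique:
  assumes h: "hole5 x0 x1 x2 x3 x4"
    and "v \<in> ring_part x0 x1 x2 x3 x4" "w \<in> ring_part x0 x1 x2 x3 x4" "v \<noteq> w"
  shows "adj v w"
  using ring_partD[OF h assms(2)] ring_partD[OF h assms(3)] C4[of v x4 w x1] h hole5_distinct[OF h]
    assms(4) unfolding hole5_def by auto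

text \<open>An edge between the parts of \<open>x0\<close> and \<open>x2\<close> would complete the
  4-cycle \<open>v x4 x3 w\<close> on the far side of the hole.\<close>

lemma ring_part_anti:
  assumes h: "hole5 x0 x1 x2 x3 x4"
    and v: "v \<in> ring_part x0 x1 x2 x3 x4" and w: "w \<in> ring_part x2 x3 x4 x0 x1"
  shows "\<not> adj v w" "\<not> adj w v"
proof -
  show "\<not> adj v w"
  proof
    assume a: "adj v w"
    have "adj v x4" "\<not> adj v x3" "v \<noteq> x3" using ring_partD[OF h v] by blast+
    moreover have "adj w x3" "\<not> adj x4 w" "w \<noteq> x4" "adj x3 w"
      using ring_partD[OF hole5_rot[OF hole5_rot[OF h]] w] by blast+
    moreover have "adj x4 x3" using h adj_sym unfolding hole5_def by blast
    ultimately show False using C4[of v x4 x3 w] a adj_sym by blast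
  qed
  then show "\<not> adj w v" using adj_sym by blast
qed

lemma full_hole_nbr:
  assumes f: "full_hole x0 x1 x2 x3 x4" and v: "v \<in> ring_part x0 x1 x2 x3 x4" and vy: "adj v y"
  shows "y \<in> ring_part x4 x0 x1 x2 x3 \<union> ring_part x0 x1 x2 x3 x4 \<union> ring_part x1 x2 x3 x4 x0"
proof -
  have h: "hole5 x0 x1 x2 x3 x4" using f by (simp add: full_hole_def)
  have "y \<notin> ring_part x2 x3 x4 x0 x1" using ring_part_anti[OF h v] vy by blast
  moreover have "y \<notin> ring_part x3 x4 x0 x1 x2"
    using ring_part_anti[OF hole5_rot[OF hole5_rot[OF hole5_rot[OF h]]] _ v] vy by blast
  moreover have "y \<in> V" using vy adjD by blast
  ultimately show ?thesis using f unfolding full_hole_def by blast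
qed

lemma closed_nbhd_cadj: "v \<in> V \<Longrightarrow> closed_nbhd V E v = {u. cadj v u}"
  by (auto simp: closed_nbhd_def nbhd_def adj_def cadj_def)

text \<open>Let \<open>y\<close> and \<open>z\<close> be private neighbours of \<open>v\<close> and
  \<open>w\<close>. They lie in the two parts next to the common part. In the same part they are
  adjacent and give the 4-cycle \<open>v y z w\<close>; in different parts the 6-cycle closes
  through \<open>x2\<close> and \<open>x3\<close>.\<close>

lemma ring_part_nested:
  assumes f: "full_hole x0 x1 x2 x3 x4"
    and v: "v \<in> ring_part x0 x1 x2 x3 x4" and w: "w \<in> ring_part x0 x1 x2 x3 x4"
  shows "{u. cadj v u} \<subseteq> {u. cadj w u} \<or> {u. cadj w u} \<subseteq> {u. cadj v u}"
proof (rule ccontr)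
  assume "\<not> ?thesis"
  then obtain y z where y: "cadj v y" "\<not> cadj w y" and z: "cadj w z" "\<not> cadj v z" by blast
  have h: "hole5 x0 x1 x2 x3 x4" using f by (simp add: full_hole_def)
  have "v \<noteq> w" using y by auto
  then have vw: "adj v w" "adj w v" using ring_part_clique[OF h] v w adj_sym by blast+
  then have a: "adj v y" "adj w z" "\<not> adj w y" "\<not> adj v z" "v \<noteq> z" "w \<noteq> y"
    using y z by (auto simp: cadj_def)
  have s: "u \<in> ring_part x4 x0 x1 x2 x3 \<or> u \<in> ring_part x1 x2 x3 x4 x0"
    if "adj v u \<and> \<not> cadj w u \<or> adj w u \<and> \<not> cadj v u" for u
    using that full_hole_nbr[OF f v] full_hole_nbr[OF f w] ring_part_clique[OF h _ v, of u]
      ring_part_clique[OF h _ w, of u] cadj_commute unfolding cadj_def by blast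
  have h2: "hole5 x1 x2 x3 x4 x0" and h5: "hole5 x4 x0 x1 x2 x3"
    using h hole5_rot by blast+
  have two: False if "u \<in> ring_part x1 x2 x3 x4 x0" "t \<in> ring_part x4 x0 x1 x2 x3" "adj p u" "adj q t"
    "\<not> adj q u" "\<not> adj p t" "p \<in> ring_part x0 x1 x2 x3 x4" "q \<in> ring_part x0 x1 x2 x3 x4" "adj q p"
    for u t p q
  proof (rule C6[of p u x2 x3 t q])
    show "adj u x2" "\<not> adj u x3" using ring_partD[OF h2 that(1)] by blast+
    show "adj x3 t" "\<not> adj x2 t" using ring_partD[OF h5 that(2)] by blast+
    show "\<not> adj u t" using ring_part_anti[OF h5 that(2,1)] by blast
    show "\<not> adj p x2" "\<not> adj p x3" using ring_partD[OF h that(7)] by blast+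
    show "\<not> adj x2 q" "\<not> adj x3 q" using ring_partD[OF h that(8)] by blast+
    show "adj x2 x3" using h unfolding hole5_def by blast
  qed (use that adj_sym in blast)+
  have same: False if "adj y z"
    using C4[of v y z w] that vw a adj_sym by blast
  have "y \<noteq> z" using a by blast
  then show False
    using s[of y] s[of z] a y z vw two[of y z v w] two[of z y w v] v w same
      ring_part_clique[OF h2, of y z] ring_part_clique[OF h5, of y z] by blast
qed

lemma full_hole_closed_nbhd:
  assumes f: "full_hole x0 x1 x2 x3 x4"
  shows "{u. cadj x0 u} =
    ring_part x4 x0 x1 x2 x3 \<union> ring_part x0 x1 x2 x3 x4 \<union> ring_part x1 x2 x3 x4 x0"
proof (intro equalityI subsetI)
  have h: "hole5 x0 x1 x2 x3 x4" using f by (simp add: full_hole_def)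
  note c = center_in_ring_part[OF h]
  {
    fix u assume "u \<in> {u. cadj x0 u}"
    then show "u \<in> ring_part x4 x0 x1 x2 x3 \<union> ring_part x0 x1 x2 x3 x4 \<union> ring_part x1 x2 x3 x4 x0"
      using full_hole_nbr[OF f c, of u] c by (auto simp: cadj_def)
  next
    fix u assume "u \<in> ring_part x4 x0 x1 x2 x3 \<union> ring_part x0 x1 x2 x3 x4 \<union> ring_part x1 x2 x3 x4 x0"
    then show "u \<in> {u. cadj x0 u}"
      using cadj_commute[of u x0] by (auto simp: ring_part_def)
  }
qed

lemma full_hole_list:
  assumes f: "full_hole x0 x1 x2 x3 x4"
  defines "X \<equiv> ring_part x0 x1 x2 x3 x4"
  shows "\<exists>us. distinct us \<and> set us = X \<and> us \<noteq> [] \<and> X \<subseteq> closed_nbhd V E (last us) \<and>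
    (\<forall>j. Suc j < length us \<longrightarrow> closed_nbhd V E (us ! Suc j) \<subseteq> closed_nbhd V E (us ! j)) \<and>
    closed_nbhd V E (us ! 0) =
      ring_part x4 x0 x1 x2 x3 \<union> X \<union> ring_part x1 x2 x3 x4 x0"
proof -
  have h: "hole5 x0 x1 x2 x3 x4" using f by (simp add: full_hole_def)
  have XV: "X \<subseteq> V" and x0: "x0 \<in> X"
    using center_in_ring_part[OF h] by (auto simp: X_def ring_part_def)
  have fin: "finite (closed_nbhd V E x)" for x
    using finite_V by (simp add: closed_nbhd_def nbhd_def)
  obtain us where us: "distinct us" "set us = X"
    "\<And>i j. i \<le> j \<Longrightarrow> j < length us \<Longrightarrow> closed_nbhd V E (us ! j) \<subseteq> closed_nbhd V E (us ! i)"
  proof (rule chain_list[of X "closed_nbhd V E"])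
    show "finite X" using XV finite_V finite_subset by blast
    show "closed_nbhd V E x \<subseteq> closed_nbhd V E y \<or> closed_nbhd V E y \<subseteq> closed_nbhd V E x"
      if "x \<in> X" "y \<in> X" for x y
      using ring_part_nested[OF f] that XV by (auto simp: closed_nbhd_cadj X_def subset_iff)
  qed (use fin in auto)
  have ne: "us \<noteq> []" using us(2) x0 by auto
  have "last us \<in> X" using ne us(2) by auto
  moreover from this have "last us \<in> V" using XV by blast
  ultimately have "X \<subseteq> closed_nbhd V E (last us)"
    using ring_part_clique[OF h] by (auto simp: X_def closed_nbhd_cadj cadj_def)
  \<comment> \<open>The sorted list need not begin with \<open>x0\<close>. Its first closed
    neighbourhood is at least that of \<open>x0\<close>, and the latter already is the union of
    three parts to which every neighbourhood from this part is confined.\<close>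
  moreover have "closed_nbhd V E (us ! 0) = closed_nbhd V E x0"
  proof
    obtain i where "i < length us" "us ! i = x0" using x0 us(2) by (metis in_set_conv_nth)
    then show "closed_nbhd V E x0 \<subseteq> closed_nbhd V E (us ! 0)" using us(3)[of 0 i] by auto
    have u: "us ! 0 \<in> X" using ne us(2) by auto
    then have "us ! 0 \<in> V" "x0 \<in> V" using XV x0 by auto
    moreover have "{v. cadj (us ! 0) v} \<subseteq> {v. cadj x0 v}"
      using full_hole_nbr[OF f, of "us ! 0"] u full_hole_closed_nbhd[OF f] by (auto simp: X_def cadj_def)
    ultimately show "closed_nbhd V E (us ! 0) \<subseteq> closed_nbhd V E x0"
      by (simp add: closed_nbhd_cadj)
  qed
  moreover have "closed_nbhd V E x0 = ring_part x4 x0 x1 x2 x3 \<union> X \<union> ring_part x1 x2 x3 x4 x0"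
    using full_hole_closed_nbhd[OF f] closed_nbhd_cadj[of x0] XV x0 X_def by blast
  ultimately show ?thesis using us ne by (intro exI[of _ us]) auto
qed

text \<open>As neighbourhoods within a part are nested, one vertex \<open>l1\<close> of the second
  part misses both \<open>a0\<close> and \<open>b2\<close>; then one vertex \<open>l2\<close> of the
  third part misses both \<open>l1\<close> and \<open>c3\<close>. The paths \<open>a0 x0 l1\<close>
  and \<open>l2 x3 c3\<close> form 2P3.\<close>

lemma three_incomplete:
  assumes f: "full_hole x0 x1 x2 x3 x4"
    and a: "a0 \<in> ring_part x0 x1 x2 x3 x4" "a1 \<in> ring_part x1 x2 x3 x4 x0" "\<not> adj a0 a1"
    and b: "b1 \<in> ring_part x1 x2 x3 x4 x0" "b2 \<in> ring_part x2 x3 x4 x0 x1" "\<not> adj b1 b2"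
    and c: "c2 \<in> ring_part x2 x3 x4 x0 x1" "c3 \<in> ring_part x3 x4 x0 x1 x2" "\<not> adj c2 c3"
  shows False
proof -
  note f1 = full_hole_rot[OF f]
  note f2 = full_hole_rot[OF f1]
  have h: "hole5 x0 x1 x2 x3 x4" and h1: "hole5 x1 x2 x3 x4 x0" and h2: "hole5 x2 x3 x4 x0 x1"
    and h3: "hole5 x3 x4 x0 x1 x2"
    using f hole5_rot unfolding full_hole_def by blast+
  have dis: "a0 \<noteq> a1" "b1 \<noteq> b2" "c2 \<noteq> c3"
    using a(1,2) b(1,2) c(1,2) by (auto simp: ring_part_def)
  have lowest: "\<exists>l\<in>{v, w}. \<not> cadj l p \<and> \<not> cadj l q"
    if "{u. cadj v u} \<subseteq> {u. cadj w u} \<or> {u. cadj w u} \<subseteq> {u. cadj v u}"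
      "\<not> cadj v p" "\<not> cadj w q" for v w p q
    using that by blast
  have "\<not> cadj a1 a0" "\<not> cadj b1 b2" using a b dis adj_sym unfolding cadj_def by blast+
  then obtain l1 where l1: "l1 \<in> ring_part x1 x2 x3 x4 x0" "\<not> cadj l1 a0" "\<not> cadj l1 b2"
    using lowest[OF ring_part_nested[OF f1 a(2) b(1)]] a(2) b(1) by blast
  have "\<not> cadj b2 l1" "\<not> cadj c2 c3" using l1(3) c dis cadj_commute unfolding cadj_def by blast+
  then obtain l2 where l2: "l2 \<in> ring_part x2 x3 x4 x0 x1" "\<not> cadj l2 l1" "\<not> cadj l2 c3"
    using lowest[OF ring_part_nested[OF f2 b(2) c(1)]] b(2) c(1) by blast
  show False
  proof (rule twoP3[of a0 x0 l1 l2 x3 c3])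
    have x0: "x0 \<in> ring_part x0 x1 x2 x3 x4" and x3: "x3 \<in> ring_part x3 x4 x0 x1 x2"
      using center_in_ring_part h h3 by blast+
    show x0l: "adj x0 l1" using ring_partD[OF h1 l1(1)] adj_sym by blast
    show l2x: "adj l2 x3" using ring_partD[OF h2 l2(1)] by blast
    have "a0 \<noteq> x0" using x0l l1(2) adj_sym by (auto simp: cadj_def)
    then show "adj a0 x0" using ring_part_clique[OF h a(1) x0] by blast
    have "c3 \<noteq> x3" using l2x l2(3) by (auto simp: cadj_def)
    then show "adj x3 c3" using ring_part_clique[OF h3 x3 c(2)] by blast
    show "a0 \<noteq> l1" "l2 \<noteq> c3" "\<not> adj a0 l1" "\<not> adj l2 c3" "\<not> adj l1 l2"
      using l1 l2 adj_sym by (auto simp: cadj_def)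
    show "\<not> adj a0 l2" "\<not> adj x0 l2" using ring_part_anti[OF h _ l2(1)] a(1) x0 by blast+
    show "\<not> adj a0 x3" "\<not> adj a0 c3" "\<not> adj x0 x3" "\<not> adj x0 c3"
      using ring_part_anti[OF h3 _ a(1)] ring_part_anti[OF h3 _ x0] x3 c(2) by blast+
    show "\<not> adj l1 x3" "\<not> adj l1 c3" using ring_part_anti[OF h1 l1(1)] x3 c(2) by blast+
  qed
qed

lemma full_hole_crown:
  assumes f0: "full_hole x0 x1 x2 x3 x4"
  shows "five_crown V E"
proof -
  define X where "X = nth [ring_part x0 x1 x2 x3 x4, ring_part x1 x2 x3 x4 x0,
    ring_part x2 x3 x4 x0 x1, ring_part x3 x4 x0 x1 x2, ring_part x4 x0 x1 x2 x3]"
  have X: "X 0 = ring_part x0 x1 x2 x3 x4" "X 1 = ring_part x1 x2 x3 x4 x0"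
    "X 2 = ring_part x2 x3 x4 x0 x1" "X 3 = ring_part x3 x4 x0 x1 x2"
    "X 4 = ring_part x4 x0 x1 x2 x3"
    "X (Suc 0) = ring_part x1 x2 x3 x4 x0" "X (Suc (Suc 0)) = ring_part x2 x3 x4 x0 x1"
    by (simp_all add: X_def)
  note f1 = full_hole_rot[OF f0]
  note f2 = full_hole_rot[OF f1]
  note f3 = full_hole_rot[OF f2]
  note f4 = full_hole_rot[OF f3]
  have five: "i = 0 \<or> i = 1 \<or> i = 2 \<or> i = 3 \<or> i = 4" if "i < 5" for i :: nat
    using that by arith
  have XV: "X i \<subseteq> V" if "i < 5" for i
    using five[OF that] X by (auto simp: ring_part_def)
  have disj: "X i \<inter> X j = {}" if "i < 5" "j < 5" "i \<noteq> j" for i j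
    using five[OF that(1)] five[OF that(2)] that(3)
    by (elim disjE; simp add: X; auto simp: ring_part_def)
  have "partition_list V (map X [0..<5])"
    unfolding partition_list_def
  proof
    have "[0..<5] = [0, 1, 2, 3, 4::nat]" by (simp add: upt_rec)
    then show "\<Union> (set (map X [0..<5])) = V" using f0 by (auto simp: X full_hole_def)
    show "\<forall>i<length (map X [0..<5]). \<forall>j<length (map X [0..<5]). i \<noteq> j \<longrightarrow>
      map X [0..<5] ! i \<inter> map X [0..<5] ! j = {}"
      using disj by simp
  qed
  moreover have "X i \<noteq> {} \<and> (\<exists>us. distinct us \<and> set us = X i \<and> us \<noteq> [] \<and>
      X i \<subseteq> closed_nbhd V E (last us) \<and>
      (\<forall>j. Suc j < length us \<longrightarrow> closed_nbhd V E (us ! Suc j) \<subseteq> closed_nbhd V E (us ! j)) \<and>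
      closed_nbhd V E (us ! 0) = X ((i + 5 - 1) mod 5) \<union> X i \<union> X ((i + 1) mod 5))"
    (is "_ \<and> ?L i") if "i < 5" for i
  proof -
    have "?L i" using five[OF that]
      full_hole_list[OF f0] full_hole_list[OF f1] full_hole_list[OF f2] full_hole_list[OF f3]
      full_hole_list[OF f4]
      by (elim disjE; simp add: X)
    moreover from this have "X i \<noteq> {}" by auto
    ultimately show ?thesis by blast
  qed
  ultimately have ring: "ring_partition 5 V E X" by (simp add: ring_partition_def)
  define Q where "Q i j \<longleftrightarrow> (\<forall>x\<in>X i. \<forall>y\<in>X j. adj x y)" for i j
  have Q: "complete E (X i) (X j)" "complete E (X j) (X i)" if "i < 5" "j < 5" "Q i j" for i j
    using that XV adj_sym unfolding Q_def complete_def adj_def by blast+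
  \<comment> \<open>Every three consecutive pairs of parts contain a complete pair. If all complete
    pairs were among two consecutive ones, the other three would be consecutive and incomplete; so
    two complete pairs have no part in common. The part that they leave out has the distinguished
    index of the crown.\<close>
  have "Q 0 1 \<or> Q 1 2 \<or> Q 2 3"
    unfolding Q_def X(1-5) using three_incomplete[OF f0] by blast
  moreover have "Q 1 2 \<or> Q 2 3 \<or> Q 3 4"
    unfolding Q_def X(1-5) using three_incomplete[OF f1] by blast
  moreover have "Q 2 3 \<or> Q 3 4 \<or> Q 4 0"
    unfolding Q_def X(1-5) using three_incomplete[OF f2] by blast
  moreover have "Q 3 4 \<or> Q 4 0 \<or> Q 0 1"
    unfolding Q_def X(1-5) using three_incomplete[OF f3] by blast
  moreover have "Q 4 0 \<or> Q 0 1 \<or> Q 1 2"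
    unfolding Q_def X(1-5) using three_incomplete[OF f4] by blast
  ultimately consider "Q 3 4" "Q 1 2" | "Q 4 0" "Q 2 3" | "Q 0 1" "Q 3 4" | "Q 1 2" "Q 4 0"
    | "Q 2 3" "Q 0 1" by blast
  then have "\<exists>i<5::nat. complete E (X ((i + 4) mod 5)) (X ((i + 3) mod 5)) \<and>
    complete E (X ((i + 1) mod 5)) (X ((i + 2) mod 5))"
  proof cases
    case 1 then show ?thesis using Q(2)[of 3 4] Q(1)[of 1 2] by (intro exI[of _ 0]) (simp add: numeral_2_eq_2[symmetric])
  next
    case 2 then show ?thesis using Q(2)[of 4 0] Q(1)[of 2 3] by (intro exI[of _ 1]) (simp add: numeral_2_eq_2[symmetric])
  next
    case 3 then show ?thesis using Q(2)[of 0 1] Q(1)[of 3 4] by (intro exI[of _ 2]) (simp add: numeral_2_eq_2[symmetric])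
  next
    case 4 then show ?thesis using Q(2)[of 1 2] Q(1)[of 4 0] by (intro exI[of _ 3]) (simp add: numeral_2_eq_2[symmetric])
  next
    case 5 then show ?thesis using Q(2)[of 2 3] Q(1)[of 0 1] by (intro exI[of _ 4]) (simp add: numeral_2_eq_2[symmetric])
  qed
  then show ?thesis using ring unfolding five_crown_def by blast
qed

end

context nonsimplicial_graph
begin

lemma nonadj_exists: "v \<in> V \<Longrightarrow> \<exists>u\<in>V. u \<noteq> v \<and> \<not> adj u v"
  using nonuniversal adj_commute by (metis adj_def)

end

context pyramid_free_graph
begin

lemma is_five_crown: "five_crown V E"
proof -
  obtain y0 y1 y2 y3 y4 where "hole5 y0 y1 y2 y3 y4" using exists_hole5 by blast
  then obtain x0 x1 x2 x3 x4 where max: "maxhole x0 x1 x2 x3 x4" by (rule exists_maxhole)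
  then have h: "hole5 x0 x1 x2 x3 x4" by (simp add: maxhole_def)
  note h1 = hole5_rot[OF h]
  note h2 = hole5_rot[OF h1]
  note h3 = hole5_rot[OF h2]
  note h4 = hole5_rot[OF h3]
  \<comment> \<open>A vertex \<open>u\<close> complete to the hole would be universal: any other
    vertex off the hole is good, hence sees two nonadjacent vertices of the hole, and together with
    \<open>u\<close> these would give an induced 4-cycle. So the attachments are exactly three
    consecutive vertices.\<close>
  have universal: False if u: "u \<in> V" "adj u x0" "adj u x1" "adj u x2" "adj u x3" "adj u x4" for u
  proof -
    obtain v where v: "v \<in> V" "v \<noteq> u" "\<not> adj v u" using nonadj_exists[OF u(1)] by blast
    then have "v \<noteq> x0" "v \<noteq> x1" "v \<noteq> x2" "v \<noteq> x3" "v \<noteq> x4" using u adj_sym by blast+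
    then have "adj v x0 \<and> adj v x2 \<or> adj v x1 \<and> adj v x3 \<or> adj v x2 \<and> adj v x4 \<or>
      adj v x3 \<and> adj v x0 \<or> adj v x4 \<and> adj v x1"
      using all_good[OF max v(1)] unfolding good_def cadj_def by argo
    moreover have False if "adj v p" "adj v q" "adj u p" "adj u q" "p \<noteq> q" "\<not> adj p q" for p q
      using C4[of v p u q] that v adj_sym by blast
    ultimately show False using u h hole5_distinct[OF h] unfolding hole5_def by simp metis
  qed
  have "v \<in> ring_part x0 x1 x2 x3 x4 \<union> ring_part x1 x2 x3 x4 x0 \<union> ring_part x2 x3 x4 x0 x1 \<union>
    ring_part x3 x4 x0 x1 x2 \<union> ring_part x4 x0 x1 x2 x3" if v: "v \<in> V" for v
  proof (cases "v \<in> {x0, x1, x2, x3, x4}")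
    case True
    have "x0 \<in> ring_part x0 x1 x2 x3 x4" "x1 \<in> ring_part x1 x2 x3 x4 x0"
      "x2 \<in> ring_part x2 x3 x4 x0 x1" "x3 \<in> ring_part x3 x4 x0 x1 x2" "x4 \<in> ring_part x4 x0 x1 x2 x3"
      by (rule center_in_ring_part, use h1 h2 h3 h4 h in blast)+
    then show ?thesis using True by blast
  next
    case False
    have mid: "adj v y" if "adj v x" "adj v z" "adj x y" "adj y z" "\<not> adj x z" "v \<noteq> y" "x \<noteq> z" for x y z
      using C4[of v x y z] that adj_sym by blast
    have d: "x0 \<noteq> x2" "x1 \<noteq> x3" "x2 \<noteq> x4" "x3 \<noteq> x0" "x4 \<noteq> x1"
      using hole5_distinct[OF h] by auto
    have ne: "v \<noteq> x0" "v \<noteq> x1" "v \<noteq> x2" "v \<noteq> x3" "v \<noteq> x4" using False by auto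
    show ?thesis
      using universal[of v] v ne d h all_good[OF max v] mid[of x0 x2 x1] mid[of x1 x3 x2]
        mid[of x2 x4 x3] mid[of x3 x0 x4] mid[of x4 x1 x0]
      unfolding hole5_def good_def ring_part_def cadj_def Un_iff mem_Collect_eq by sat
  qed
  moreover have "ring_part p q r s t \<subseteq> V" for p q r s t by (auto simp: ring_part_def)
  ultimately have "full_hole x0 x1 x2 x3 x4"
    unfolding full_hole_def by (intro conjI h equalityI subsetI Un_least) blast+
  then show ?thesis by (rule full_hole_crown)
qed

end

section \<open>Vertex types over a maximal pyramid\<close>

context simple_graph
begin

text \<open>Three paths give a \<open>pyramid\<close>; any further paths are the germs of further
  parts of a villa or mansion. Distinctness of the vertices follows from the adjacencies, see
  \<open>pyr_neq\<close>.\<close>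

definition tpyramid :: "nat \<Rightarrow> 'a \<Rightarrow> (nat \<Rightarrow> 'a) \<Rightarrow> (nat \<Rightarrow> 'a) \<Rightarrow> bool" where
  "tpyramid t a b c \<longleftrightarrow> 3 \<le> t \<and>
     (\<forall>i\<in>{1..t}. adj a (b i) \<and> adj (b i) (c i) \<and> \<not> adj a (c i)) \<and>
     (\<forall>i\<in>{1..t}. \<forall>j\<in>{1..t}. i \<noteq> j \<longrightarrow> \<not> adj (b i) (b j) \<and> adj (c i) (c j) \<and> \<not> adj (b i) (c j))"

end

locale max_pyramid = nonsimplicial_graph +
  fixes t :: nat and a :: 'a and b c :: "nat \<Rightarrow> 'a"
  assumes pyr: "tpyramid t a b c"
    and max_t: "\<And>s a' b' c'. tpyramid s a' b' c' \<Longrightarrow> s \<le> t"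
begin

definition I :: "nat set" where "I = {1..t}"

lemma finite_I [simp]: "finite I" and card_I: "card I = t" and t_ge: "3 \<le> t"
  using pyr by (simp_all add: I_def tpyramid_def)

lemma pick4:
  assumes "4 \<le> t"
  obtains i where "i \<in> I" "i \<noteq> k" "i \<noteq> l" "i \<noteq> m"
proof -
  have "\<not> I \<subseteq> {k, l, m}"
    using card_mono[of "{k, l, m}" I] card_I assms by (auto simp: card_insert_if split: if_splits)
  then show thesis using that by blast
qed

text \<open>With at least three paths, up to two indices can always be avoided. Nearly all arguments
  below compare one or two paths with a path chosen away from them.\<close>

lemma pick3: obtains i where "i \<in> I" "i \<noteq> k" "i \<noteq> l"
proof -
  have "\<not> I \<subseteq> {k, l}"
    using card_mono[of "{k, l}" I] card_I t_ge by (auto simp: card_insert_if split: if_splits)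
  then show thesis using that by blast
qed

lemma pick2: obtains i j where "i \<in> I" "j \<in> I" "i \<noteq> k" "j \<noteq> k" "i \<noteq> j"
proof -
  obtain i where i: "i \<in> I" "i \<noteq> k" by (rule pick3[of k k])
  moreover obtain j where "j \<in> I" "j \<noteq> k" "j \<noteq> i" by (rule pick3)
  ultimately show thesis using that by blast
qed

lemma pyr_adj [simp]:
  "i \<in> I \<Longrightarrow> adj a (b i)" "i \<in> I \<Longrightarrow> adj (b i) a"
  "i \<in> I \<Longrightarrow> \<not> adj a (c i)" "i \<in> I \<Longrightarrow> \<not> adj (c i) a"
  "i \<in> I \<Longrightarrow> j \<in> I \<Longrightarrow> \<not> adj (b i) (b j)"
  "i \<in> I \<Longrightarrow> j \<in> I \<Longrightarrow> adj (c i) (c j) \<longleftrightarrow> i \<noteq> j"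
  "i \<in> I \<Longrightarrow> j \<in> I \<Longrightarrow> adj (b i) (c j) \<longleftrightarrow> i = j"
  "i \<in> I \<Longrightarrow> j \<in> I \<Longrightarrow> adj (c j) (b i) \<longleftrightarrow> i = j"
  using pyr adj_sym adj_irrefl unfolding tpyramid_def I_def by metis+

lemma pyr_neq [simp]:
  "i \<in> I \<Longrightarrow> a \<noteq> b i" "i \<in> I \<Longrightarrow> b i \<noteq> a" "i \<in> I \<Longrightarrow> a \<noteq> c i" "i \<in> I \<Longrightarrow> c i \<noteq> a"
  "i \<in> I \<Longrightarrow> j \<in> I \<Longrightarrow> b i = b j \<longleftrightarrow> i = j" "i \<in> I \<Longrightarrow> j \<in> I \<Longrightarrow> c i = c j \<longleftrightarrow> i = j"
  "i \<in> I \<Longrightarrow> j \<in> I \<Longrightarrow> b i \<noteq> c j" "i \<in> I \<Longrightarrow> j \<in> I \<Longrightarrow> c j \<noteq> b i"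
proof -
  show ac: "a \<noteq> c i" if i: "i \<in> I" for i
  proof -
    obtain j where "j \<in> I" "j \<noteq> i" by (rule pick3[of i i])
    then show ?thesis using pyr_adj(2) pyr_adj(7) i by metis
  qed
  show "c i \<noteq> a" if "i \<in> I" for i using ac[OF that] by simp
  show ab: "a \<noteq> b i" if "i \<in> I" for i using pyr_adj(1)[OF that] adj_irrefl by metis
  show "b i \<noteq> a" if "i \<in> I" for i using ab[OF that] by simp
  show "b i = b j \<longleftrightarrow> i = j" if "i \<in> I" "j \<in> I" for i j
    using pyr_adj(7) that by metis
  show "c i = c j \<longleftrightarrow> i = j" if "i \<in> I" "j \<in> I" for i j
    using pyr_adj(7) that by metis
  show bc: "b i \<noteq> c j" if "i \<in> I" "j \<in> I" for i j
    using pyr_adj(1) pyr_adj(3) that by metis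
  show "c j \<noteq> b i" if "i \<in> I" "j \<in> I" for i j using bc[OF that] by simp
qed

lemma pyr_in_V [simp]: "a \<in> V" "i \<in> I \<Longrightarrow> b i \<in> V" "i \<in> I \<Longrightarrow> c i \<in> V"
  using pyr_adj(1) pyr_adj(7) adjD pick2 by metis+

text \<open>
  The types collect the vertices by their neighbours on the pyramid and are named after the part of the
  final decomposition to which they belong; \<open>tAm\<close> is
  a part of \<open>A\<close>, and \<open>tD\<close>, \<open>tU\<close>, \<open>tZ\<close>, \<open>tL\<close>, \<open>tG\<close> turn out to be empty.
\<close>

definition tA where "tA = {v \<in> V. \<forall>i\<in>I. adj v (b i) \<and> \<not> adj v (c i)}"
definition tAm where "tAm j = {v \<in> V. (\<forall>i\<in>I. adj v (b i) \<longleftrightarrow> i \<noteq> j) \<and> (\<forall>i\<in>I. \<not> adj v (c i))}"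
definition tB where "tB k = {v \<in> V. adj v a \<and> adj v (c k) \<and>
  (\<forall>i\<in>I. i \<noteq> k \<longrightarrow> \<not> adj v (b i) \<and> \<not> adj v (c i))}"
definition tX where "tX k = {v \<in> V. adj v a \<and> adj v (b k) \<and> \<not> adj v (c k) \<and>
  (\<forall>i\<in>I. i \<noteq> k \<longrightarrow> \<not> adj v (b i) \<and> \<not> adj v (c i))}"
definition tD where "tD k = {v \<in> V. \<not> adj v a \<and> adj v (b k) \<and>
  (\<forall>i\<in>I. i \<noteq> k \<longrightarrow> \<not> adj v (b i) \<and> \<not> adj v (c i))}"
definition tC where "tC k = {v \<in> V. \<not> adj v a \<and> adj v (b k) \<and>
  (\<forall>i\<in>I. i \<noteq> k \<longrightarrow> \<not> adj v (b i) \<and> adj v (c i))}"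
definition tY where "tY = {v \<in> V. \<not> adj v a \<and> (\<forall>i\<in>I. \<not> adj v (b i) \<and> adj v (c i))}"
definition tF where "tF j = {v \<in> V. \<forall>i\<in>I. (adj v (b i) \<longleftrightarrow> i \<noteq> j) \<and> (adj v (c i) \<longleftrightarrow> i \<noteq> j)}"
definition tU where "tU = {v \<in> V. \<forall>i\<in>I. adj v (b i) \<and> adj v (c i)}"
definition tZ where "tZ = {v \<in> V. \<not> adj v a \<and> (\<forall>i\<in>I. \<not> adj v (b i) \<and> \<not> adj v (c i))}"
definition tL where "tL = {v \<in> V. adj v a \<and> (\<forall>i\<in>I. \<not> adj v (b i) \<and> \<not> adj v (c i))}"
definition tG where "tG = {v \<in> V. \<not> adj v a \<and> (\<forall>i\<in>I. \<not> adj v (b i)) \<and>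
  (\<exists>i\<in>I. adj v (c i)) \<and> (\<exists>i\<in>I. \<not> adj v (c i))}"

lemma tA_simps [simp]:
  "v \<in> tA \<Longrightarrow> i \<in> I \<Longrightarrow> adj v (b i)" "v \<in> tA \<Longrightarrow> i \<in> I \<Longrightarrow> adj (b i) v"
  "v \<in> tA \<Longrightarrow> i \<in> I \<Longrightarrow> \<not> adj v (c i)" "v \<in> tA \<Longrightarrow> i \<in> I \<Longrightarrow> \<not> adj (c i) v"
  by (auto simp: tA_def adj_commute)

lemma tAm_simps [simp]:
  "v \<in> tAm j \<Longrightarrow> i \<in> I \<Longrightarrow> adj v (b i) \<longleftrightarrow> i \<noteq> j" "v \<in> tAm j \<Longrightarrow> i \<in> I \<Longrightarrow> adj (b i) v \<longleftrightarrow> i \<noteq> j"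
  "v \<in> tAm j \<Longrightarrow> i \<in> I \<Longrightarrow> \<not> adj v (c i)" "v \<in> tAm j \<Longrightarrow> i \<in> I \<Longrightarrow> \<not> adj (c i) v"
  by (auto simp: tAm_def adj_commute)

lemma tB_simps [simp]:
  "v \<in> tB k \<Longrightarrow> adj v a" "v \<in> tB k \<Longrightarrow> adj a v"
  "v \<in> tB k \<Longrightarrow> k \<in> I \<Longrightarrow> i \<in> I \<Longrightarrow> adj v (c i) \<longleftrightarrow> i = k"
  "v \<in> tB k \<Longrightarrow> k \<in> I \<Longrightarrow> i \<in> I \<Longrightarrow> adj (c i) v \<longleftrightarrow> i = k"
  "v \<in> tB k \<Longrightarrow> i \<in> I \<Longrightarrow> i \<noteq> k \<Longrightarrow> \<not> adj v (b i)" "v \<in> tB k \<Longrightarrow> i \<in> I \<Longrightarrow> i \<noteq> k \<Longrightarrow> \<not> adj (b i) v"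
  by (auto simp: tB_def adj_commute)

lemma tX_simps [simp]:
  "v \<in> tX k \<Longrightarrow> adj v a" "v \<in> tX k \<Longrightarrow> adj a v"
  "v \<in> tX k \<Longrightarrow> k \<in> I \<Longrightarrow> i \<in> I \<Longrightarrow> \<not> adj v (c i)"
  "v \<in> tX k \<Longrightarrow> k \<in> I \<Longrightarrow> i \<in> I \<Longrightarrow> \<not> adj (c i) v"
  "v \<in> tX k \<Longrightarrow> i \<in> I \<Longrightarrow> adj v (b i) \<longleftrightarrow> i = k" "v \<in> tX k \<Longrightarrow> i \<in> I \<Longrightarrow> adj (b i) v \<longleftrightarrow> i = k"
  by (auto simp: tX_def adj_commute)

lemma tD_simps [simp]:
  "v \<in> tD k \<Longrightarrow> \<not> adj v a" "v \<in> tD k \<Longrightarrow> \<not> adj a v"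
  "v \<in> tD k \<Longrightarrow> i \<in> I \<Longrightarrow> i \<noteq> k \<Longrightarrow> \<not> adj v (c i)" "v \<in> tD k \<Longrightarrow> i \<in> I \<Longrightarrow> i \<noteq> k \<Longrightarrow> \<not> adj (c i) v"
  "v \<in> tD k \<Longrightarrow> i \<in> I \<Longrightarrow> adj v (b i) \<longleftrightarrow> i = k" "v \<in> tD k \<Longrightarrow> i \<in> I \<Longrightarrow> adj (b i) v \<longleftrightarrow> i = k"
  by (auto simp: tD_def adj_commute)

lemma tC_simps [simp]:
  "v \<in> tC k \<Longrightarrow> \<not> adj v a" "v \<in> tC k \<Longrightarrow> \<not> adj a v"
  "v \<in> tC k \<Longrightarrow> i \<in> I \<Longrightarrow> i \<noteq> k \<Longrightarrow> adj v (c i)" "v \<in> tC k \<Longrightarrow> i \<in> I \<Longrightarrow> i \<noteq> k \<Longrightarrow> adj (c i) v"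
  "v \<in> tC k \<Longrightarrow> i \<in> I \<Longrightarrow> adj v (b i) \<longleftrightarrow> i = k" "v \<in> tC k \<Longrightarrow> i \<in> I \<Longrightarrow> adj (b i) v \<longleftrightarrow> i = k"
  by (auto simp: tC_def adj_commute)

lemma tY_simps [simp]:
  "v \<in> tY \<Longrightarrow> \<not> adj v a" "v \<in> tY \<Longrightarrow> \<not> adj a v"
  "v \<in> tY \<Longrightarrow> i \<in> I \<Longrightarrow> \<not> adj v (b i)" "v \<in> tY \<Longrightarrow> i \<in> I \<Longrightarrow> \<not> adj (b i) v"
  "v \<in> tY \<Longrightarrow> i \<in> I \<Longrightarrow> adj v (c i)" "v \<in> tY \<Longrightarrow> i \<in> I \<Longrightarrow> adj (c i) v"
  by (auto simp: tY_def adj_commute)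

lemma tF_simps [simp]:
  "v \<in> tF j \<Longrightarrow> i \<in> I \<Longrightarrow> adj v (b i) \<longleftrightarrow> i \<noteq> j" "v \<in> tF j \<Longrightarrow> i \<in> I \<Longrightarrow> adj (b i) v \<longleftrightarrow> i \<noteq> j"
  "v \<in> tF j \<Longrightarrow> i \<in> I \<Longrightarrow> adj v (c i) \<longleftrightarrow> i \<noteq> j" "v \<in> tF j \<Longrightarrow> i \<in> I \<Longrightarrow> adj (c i) v \<longleftrightarrow> i \<noteq> j"
  by (auto simp: tF_def adj_commute)

lemma tU_simps [simp]:
  "v \<in> tU \<Longrightarrow> i \<in> I \<Longrightarrow> adj v (b i)" "v \<in> tU \<Longrightarrow> i \<in> I \<Longrightarrow> adj (b i) v"
  "v \<in> tU \<Longrightarrow> i \<in> I \<Longrightarrow> adj v (c i)" "v \<in> tU \<Longrightarrow> i \<in> I \<Longrightarrow> adj (c i) v"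
  by (auto simp: tU_def adj_commute)

lemma tZ_simps [simp]:
  "v \<in> tZ \<Longrightarrow> \<not> adj v a" "v \<in> tZ \<Longrightarrow> \<not> adj a v"
  "v \<in> tZ \<Longrightarrow> i \<in> I \<Longrightarrow> \<not> adj v (b i)" "v \<in> tZ \<Longrightarrow> i \<in> I \<Longrightarrow> \<not> adj (b i) v"
  "v \<in> tZ \<Longrightarrow> i \<in> I \<Longrightarrow> \<not> adj v (c i)" "v \<in> tZ \<Longrightarrow> i \<in> I \<Longrightarrow> \<not> adj (c i) v"
  by (auto simp: tZ_def adj_commute)

lemma tL_simps [simp]:
  "v \<in> tL \<Longrightarrow> adj v a" "v \<in> tL \<Longrightarrow> adj a v"
  "v \<in> tL \<Longrightarrow> i \<in> I \<Longrightarrow> \<not> adj v (b i)" "v \<in> tL \<Longrightarrow> i \<in> I \<Longrightarrow> \<not> adj (b i) v"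
  "v \<in> tL \<Longrightarrow> i \<in> I \<Longrightarrow> \<not> adj v (c i)" "v \<in> tL \<Longrightarrow> i \<in> I \<Longrightarrow> \<not> adj (c i) v"
  by (auto simp: tL_def adj_commute)

lemma tG_simps [simp]:
  "v \<in> tG \<Longrightarrow> \<not> adj v a" "v \<in> tG \<Longrightarrow> \<not> adj a v"
  "v \<in> tG \<Longrightarrow> i \<in> I \<Longrightarrow> \<not> adj v (b i)" "v \<in> tG \<Longrightarrow> i \<in> I \<Longrightarrow> \<not> adj (b i) v"
  by (auto simp: tG_def adj_commute)

lemma in_type_V:
  "v \<in> tA \<Longrightarrow> v \<in> V" "v \<in> tAm j \<Longrightarrow> v \<in> V" "v \<in> tB j \<Longrightarrow> v \<in> V" "v \<in> tX j \<Longrightarrow> v \<in> V"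
  "v \<in> tD j \<Longrightarrow> v \<in> V" "v \<in> tC j \<Longrightarrow> v \<in> V" "v \<in> tY \<Longrightarrow> v \<in> V" "v \<in> tF j \<Longrightarrow> v \<in> V"
  "v \<in> tU \<Longrightarrow> v \<in> V" "v \<in> tZ \<Longrightarrow> v \<in> V" "v \<in> tL \<Longrightarrow> v \<in> V" "v \<in> tG \<Longrightarrow> v \<in> V"
  unfolding tA_def tAm_def tB_def tX_def tD_def tC_def tY_def tF_def tU_def tZ_def tL_def tG_def
  by blast+

lemma pyr_types [simp]: "a \<in> tA" "i \<in> I \<Longrightarrow> b i \<in> tB i" "i \<in> I \<Longrightarrow> c i \<in> tC i"
  unfolding tA_def tB_def tC_def by auto

text \<open>4-cycles propagate adjacencies: two of the \<open>b i\<close> force \<open>a\<close>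
  (\<open>p1\<close>), a \<open>b\<close> and a \<open>c\<close> of different paths force the
  \<open>c\<close> next to that \<open>b\<close> (\<open>p2\<close>), and \<open>a\<close> together
  with \<open>c i\<close> forces \<open>b i\<close> (\<open>p3\<close>). By 2P3, a vertex that sees
  two of the \<open>b i\<close> misses at most one path (\<open>p5\<close>). A 6-cycle through
  \<open>a\<close> makes a vertex that misses \<open>a\<close> and sees \<open>b k\<close> treat all
  other \<open>c i\<close> alike.\<close>

lemma type_cases:
  assumes v: "v \<in> V"
  shows "v \<in> tZ \<or> v \<in> tL \<or> v \<in> tG \<or> v \<in> tA \<or> v \<in> tY \<or> v \<in> tU \<or> (\<exists>j\<in>I. v \<in> tAm j) \<or>
    (\<exists>j\<in>I. v \<in> tB j) \<or> (\<exists>j\<in>I. v \<in> tX j) \<or> (\<exists>j\<in>I. v \<in> tD j) \<or> (\<exists>j\<in>I. v \<in> tC j) \<or> (\<exists>j\<in>I. v \<in> tF j)"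
proof (cases "v = a \<or> (\<exists>i\<in>I. v = b i) \<or> (\<exists>i\<in>I. v = c i)")
  case True
  then show ?thesis using pyr_types by blast
next
  case False
  then have ne: "v \<noteq> a" "\<And>i. i \<in> I \<Longrightarrow> v \<noteq> b i" "\<And>i. i \<in> I \<Longrightarrow> v \<noteq> c i" by auto
  have p1: "adj v a" if "adj v (b i)" "adj v (b j)" "i \<in> I" "j \<in> I" "i \<noteq> j" for i j
    using C4[of v "b i" a "b j"] that ne adj_commute[of "b j" v] by auto
  have p2: "adj v (c i)" if "adj v (b i)" "adj v (c j)" "i \<in> I" "j \<in> I" "i \<noteq> j" for i j
    using C4[of v "b i" "c i" "c j"] that ne adj_commute[of "c j" v] by auto
  have p3: "adj v (b i)" if "adj v a" "adj v (c i)" "i \<in> I" for i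
    using C4[of v a "b i" "c i"] that ne adj_commute[of "c i" v] by auto
  have p5: False if "i \<in> I" "j \<in> I" "k \<in> I" "l \<in> I" "i \<noteq> j" "k \<noteq> l" "adj v (b i)" "adj v (b j)"
    "\<not> adj v (b k)" "\<not> adj v (c k)" "\<not> adj v (c l)" "l \<noteq> i" "l \<noteq> j" for i j k l
    using twoP3[of "b i" v "b j" "b k" "c k" "c l"] that ne adj_commute[of "b i" v] by auto
  show ?thesis
  proof (cases "adj v a")
    case va: False
    show ?thesis
    proof (cases "\<exists>k\<in>I. adj v (b k)")
      case False
      then show ?thesis using va v unfolding tZ_def tY_def tG_def by blast
    next
      case True
      then obtain k where k: "k \<in> I" "adj v (b k)" by blast
      have nb: "\<not> adj v (b i)" if "i \<in> I" "i \<noteq> k" for i using p1 k va that by blast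
      show ?thesis
      proof (cases "\<exists>j\<in>I. j \<noteq> k \<and> adj v (c j)")
        case False
        then show ?thesis using va v k nb unfolding tD_def by blast
      next
        case True
        then obtain j where j: "j \<in> I" "j \<noteq> k" "adj v (c j)" by blast
        have "adj v (c i)" if i: "i \<in> I" "i \<noteq> k" for i
        proof (rule ccontr)
          assume n: "\<not> adj v (c i)"
          then have "i \<noteq> j" using j by auto
          then show False
            using C6[of a "b i" "c i" "c j" v "b k"] i j k n nb va adj_commute[of v a]
              adj_commute[of v "c j"] adj_commute[of v "b i"] adj_commute[of v "c i"]
            by auto
        qed
        then show ?thesis using va v k nb unfolding tC_def by blast
      qed
    qed
  next
    case va: True
    show ?thesis
    proof (cases "\<exists>j\<in>I. adj v (c j)")
      case True
      then obtain j where j: "j \<in> I" "adj v (c j)" by blast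
      have bc: "adj v (b i) \<longleftrightarrow> adj v (c i)" if "i \<in> I" for i
        using p2[of i j] p3[of i] that j va by blast
      show ?thesis
      proof (cases "\<forall>i\<in>I. i \<noteq> j \<longrightarrow> \<not> adj v (c i)")
        case True
        then show ?thesis using v va j bc unfolding tB_def by blast
      next
        case False
        then obtain i where i: "i \<in> I" "i \<noteq> j" "adj v (c i)" by blast
        show ?thesis
        proof (cases "\<forall>i\<in>I. adj v (c i)")
          case True
          then show ?thesis using v bc unfolding tU_def by blast
        next
          case False
          then obtain k where k: "k \<in> I" "\<not> adj v (c k)" by blast
          have "adj v (c l)" if "l \<in> I" "l \<noteq> k" for l
            using p5[of i j k l] i j k bc that by blast
          then have "v \<in> tF k" using v bc k unfolding tF_def by blast
          then show ?thesis using k by blast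
        qed
      qed
    next
      case nc: False
      show ?thesis
      proof (cases "\<exists>i\<in>I. \<exists>j\<in>I. i \<noteq> j \<and> adj v (b i) \<and> adj v (b j)")
        case True
        then obtain i j where ij: "i \<in> I" "j \<in> I" "i \<noteq> j" "adj v (b i)" "adj v (b j)" by blast
        show ?thesis
        proof (cases "\<forall>i\<in>I. adj v (b i)")
          case True
          then show ?thesis using v nc unfolding tA_def by blast
        next
          case False
          then obtain k where k: "k \<in> I" "\<not> adj v (b k)" by blast
          have "adj v (b l)" if "l \<in> I" "l \<noteq> k" for l
            using p5[of i j k l] ij k nc that by blast
          then have "v \<in> tAm k" using v nc k unfolding tAm_def by blast
          then show ?thesis using k by blast
        qed
      next
        case False
        then show ?thesis using v va nc unfolding tX_def tL_def by blast
      qed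
    qed
  qed
qed

section \<open>Adjacencies between the types\<close>

lemma two_b:
  assumes "i \<in> I" "j \<in> I" "i \<noteq> j" "adj v (b i)" "adj v (b j)" "adj w (b i)" "adj w (b j)" "v \<noteq> w"
  shows "adj v w"
  using C4[of v "b i" w "b j"] assms adj_commute[of "b i" w] adj_commute[of "b j" v] by auto

lemma b_c:
  assumes "i \<in> I" "j \<in> I" "i \<noteq> j" "adj v (b i)" "adj v (c j)" "adj w (b i)" "adj w (c j)" "v \<noteq> w"
  shows "adj v w"
  using C4[of v "b i" w "c j"] assms adj_commute[of "b i" w] adj_commute[of "c j" v] by auto

lemma a_c:
  assumes "i \<in> I" "adj v a" "adj v (c i)" "adj w a" "adj w (c i)" "v \<noteq> w"
  shows "adj v w"
  using C4[of v a w "c i"] assms adj_commute[of a w] adj_commute[of "c i" v] by auto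

text \<open>\<open>tK k\<close> and the following \<open>tM k\<close> are made to be components:
  vertices that avoid the other paths are anticomplete to a P3 \<open>b i\<close>,
  \<open>c i\<close>, \<open>c j\<close>, and vertices that avoid \<open>a\<close> and the other
  \<open>b i\<close> are anticomplete to a P3 \<open>b i\<close>, \<open>a\<close>,
  \<open>b j\<close>. Hence 2P3-freeness turns the closed neighbourhoods of \<open>b k\<close> and
  \<open>c k\<close> among them into cliques without further neighbours there.\<close>

definition tK where "tK k = {v. cadj v (b k) \<and> (\<forall>i\<in>I. i \<noteq> k \<longrightarrow> \<not> adj v (b i) \<and> \<not> adj v (c i))}"
definition tM where "tM k = {v. cadj v (c k) \<and> \<not> adj v a \<and> (\<forall>i\<in>I. i \<noteq> k \<longrightarrow> \<not> adj v (b i))}"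

lemma tK_simps [simp]:
  "v \<in> tK k \<Longrightarrow> i \<in> I \<Longrightarrow> i \<noteq> k \<Longrightarrow> \<not> adj v (b i)" "v \<in> tK k \<Longrightarrow> i \<in> I \<Longrightarrow> i \<noteq> k \<Longrightarrow> \<not> adj (b i) v"
  "v \<in> tK k \<Longrightarrow> i \<in> I \<Longrightarrow> i \<noteq> k \<Longrightarrow> \<not> adj v (c i)" "v \<in> tK k \<Longrightarrow> i \<in> I \<Longrightarrow> i \<noteq> k \<Longrightarrow> \<not> adj (c i) v"
  by (auto simp: tK_def adj_commute)

lemma K_P3_free:
  assumes "k \<in> I" "adj x y" "adj y z" "x \<noteq> z"
    and "\<And>v i. v \<in> {x, y, z} \<Longrightarrow> i \<in> I \<Longrightarrow> i \<noteq> k \<Longrightarrow> \<not> adj v (b i) \<and> \<not> adj v (c i)"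
  shows "adj x z"
proof -
  obtain i j where ij: "i \<in> I" "j \<in> I" "i \<noteq> k" "j \<noteq> k" "i \<noteq> j" by (rule pick2)
  then show ?thesis
    using twoP3[of x y z "b i" "c i" "c j"] assms(2-4) assms(5)[of x i] assms(5)[of y i]
      assms(5)[of z i] assms(5)[of x j] assms(5)[of y j] assms(5)[of z j] by auto
qed

lemma M_P3_free:
  assumes "k \<in> I" "adj x y" "adj y z" "x \<noteq> z"
    and "\<And>v. v \<in> {x, y, z} \<Longrightarrow> \<not> adj v a"
    and "\<And>v i. v \<in> {x, y, z} \<Longrightarrow> i \<in> I \<Longrightarrow> i \<noteq> k \<Longrightarrow> \<not> adj v (b i)"
  shows "adj x z"
proof -
  obtain i j where ij: "i \<in> I" "j \<in> I" "i \<noteq> k" "j \<noteq> k" "i \<noteq> j" by (rule pick2)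
  then show ?thesis
    using twoP3[of x y z "b i" a "b j"] assms(2-4) assms(5)[of x] assms(5)[of y] assms(5)[of z]
      assms(6)[of x i] assms(6)[of y i] assms(6)[of z i] assms(6)[of x j] assms(6)[of y j]
      assms(6)[of z j] by auto
qed

lemma K_clique:
  assumes k: "k \<in> I" and v: "v \<in> tK k" and w: "w \<in> tK k" and ne: "v \<noteq> w"
  shows "adj v w"
proof -
  have b: "cadj v (b k)" "cadj w (b k)" using v w unfolding tK_def by blast+
  show ?thesis
  proof (cases "v = b k \<or> w = b k")
    case True
    then show ?thesis using b ne adj_sym by (auto simp: cadj_def)
  next
    case False
    then have "adj v (b k)" "adj (b k) w" using b adj_commute by (auto simp: cadj_def)
    then show ?thesis by (rule K_P3_free[OF k _ _ ne]) (use v w k in auto)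
  qed
qed

text \<open>An edge from \<open>z\<close> to a member of \<open>tK k\<close> would give a P3 with
  ends \<open>z\<close> and \<open>b k\<close> among vertices that avoid the other paths, against
  \<open>K_P3_free\<close>.\<close>

lemma K_anti:
  assumes k: "k \<in> I" and v: "v \<in> tK k" and z: "\<And>i. i \<in> I \<Longrightarrow> i \<noteq> k \<Longrightarrow> \<not> adj z (b i) \<and> \<not> adj z (c i)"
    "\<not> cadj z (b k)"
  shows "\<not> adj z v" "\<not> adj v z"
proof -
  have "\<not> adj z v"
  proof
    assume zv: "adj z v"
    have b: "cadj v (b k)" using v unfolding tK_def by blast
    show False
    proof (cases "v = b k")
      case True
      then show False using zv z(2) by (simp add: cadj_def)
    next
      case False
      then have "adj v (b k)" "z \<noteq> b k" using b z(2) by (auto simp: cadj_def)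
      then have "adj z (b k)" by (intro K_P3_free[OF k zv]) (use v z k in auto)
      then show False using z(2) by (simp add: cadj_def)
    qed
  qed
  then show "\<not> adj z v" "\<not> adj v z" using adj_sym by blast+
qed

lemma M_clique:
  assumes k: "k \<in> I" and v: "v \<in> tM k" and w: "w \<in> tM k" and ne: "v \<noteq> w"
  shows "adj v w"
proof -
  have b: "cadj v (c k)" "cadj w (c k)" using v w unfolding tM_def by blast+
  show ?thesis
  proof (cases "v = c k \<or> w = c k")
    case True
    then show ?thesis using b ne adj_sym by (auto simp: cadj_def)
  next
    case False
    then have "adj v (c k)" "adj (c k) w" using b adj_commute by (auto simp: cadj_def)
    then show ?thesis by (rule M_P3_free[OF k _ _ ne]) (use v w k in \<open>unfold tM_def, auto\<close>)
  qed
qed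

lemma M_anti:
  assumes k: "k \<in> I" and v: "v \<in> tM k" and z: "\<not> adj z a" "\<And>i. i \<in> I \<Longrightarrow> i \<noteq> k \<Longrightarrow> \<not> adj z (b i)"
    "\<not> cadj z (c k)"
  shows "\<not> adj z v" "\<not> adj v z"
proof -
  have "\<not> adj z v"
  proof
    assume zv: "adj z v"
    have b: "cadj v (c k)" using v unfolding tM_def by blast
    show False
    proof (cases "v = c k")
      case True
      then show False using zv z(3) by (simp add: cadj_def)
    next
      case False
      then have "adj v (c k)" "z \<noteq> c k" using b z(3) by (auto simp: cadj_def)
      then have "adj z (c k)" by (intro M_P3_free[OF k zv]) (use v z k in \<open>unfold tM_def, auto\<close>)
      then show False using z(3) by (simp add: cadj_def)
    qed
  qed
  then show "\<not> adj z v" "\<not> adj v z" using adj_sym by blast+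
qed

text \<open>The definition of \<open>tB k\<close> leaves the adjacency to \<open>b k\<close> open so
  that \<open>b k\<close> itself is a member; for all other members it is forced by the 4-cycle
  through \<open>a\<close> and \<open>c k\<close>. \<open>tC k\<close> and \<open>c k\<close> are
  treated likewise.\<close>

lemma B_b: "k \<in> I \<Longrightarrow> v \<in> tB k \<Longrightarrow> cadj v (b k)"
  using a_c[of k v "b k"] by (auto simp: cadj_def)

lemma C_c: "k \<in> I \<Longrightarrow> v \<in> tC k \<Longrightarrow> cadj v (c k)"
proof -
  assume k: "k \<in> I" and v: "v \<in> tC k"
  obtain i where "i \<in> I" "i \<noteq> k" by (rule pick3[of k k])
  then show ?thesis using b_c[of k i v "c k"] k v by (auto simp: cadj_def)
qed

lemma in_K: "k \<in> I \<Longrightarrow> v \<in> tB k \<Longrightarrow> v \<in> tK k" "k \<in> I \<Longrightarrow> v \<in> tX k \<Longrightarrow> v \<in> tK k"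
  "k \<in> I \<Longrightarrow> v \<in> tD k \<Longrightarrow> v \<in> tK k"
  unfolding tK_def using B_b by (auto simp: cadj_def)

lemma in_M: "k \<in> I \<Longrightarrow> v \<in> tC k \<Longrightarrow> v \<in> tM k" "k \<in> I \<Longrightarrow> v \<in> tY \<Longrightarrow> v \<in> tM k"
  "k \<in> I \<Longrightarrow> v \<in> tG \<Longrightarrow> adj v (c k) \<Longrightarrow> v \<in> tM k" "k \<in> I \<Longrightarrow> v \<in> tD k \<Longrightarrow> adj v (c k) \<Longrightarrow> v \<in> tM k"
  unfolding tM_def using C_c by (auto simp: cadj_def)

lemma a_notin [simp]: "a \<notin> tD k" "a \<notin> tC k" "a \<notin> tZ" "a \<notin> tL" "a \<notin> tG" "a \<notin> tY"
  "a \<notin> tX k" "a \<notin> tB k" "k \<in> I \<Longrightarrow> a \<notin> tF k" "a \<notin> tU"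
proof -
  obtain i where i: "i \<in> I" "i \<noteq> k" by (rule pick3[of k k])
  show "a \<notin> tD k" using tD_simps(5)[of a k i] i by auto
  show "a \<notin> tC k" using tC_simps(5)[of a k i] i by auto
  show "a \<notin> tZ" using tZ_simps(3)[of a i] i by auto
  show "a \<notin> tL" using tL_simps(1)[of a] by auto
  show "a \<notin> tG" using tG_simps(3)[of a i] i by auto
  show "a \<notin> tY" using tY_simps(3)[of a i] i by auto
  show "a \<notin> tX k" using tX_simps(1)[of a k] by auto
  show "a \<notin> tB k" using tB_simps(1)[of a k] by auto
  show "a \<notin> tF k" if "k \<in> I" using tF_simps(1)[of a k k] that by auto
  show "a \<notin> tU" using tU_simps(3)[of a i] i by auto
qed

lemma b_notin [simp]:
  assumes "i \<in> I"
  shows "b i \<notin> tD k" "b i \<notin> tC k" "b i \<notin> tZ" "b i \<notin> tL" "b i \<notin> tG" "b i \<notin> tY"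
    "k \<in> I \<Longrightarrow> b i \<notin> tX k" "k \<in> I \<Longrightarrow> b i \<notin> tF k" "b i \<notin> tU" "b i \<notin> tA" "b i \<notin> tAm k"
    "i \<noteq> k \<Longrightarrow> b i \<notin> tK k"
proof -
  obtain j where j: "j \<in> I" "j \<noteq> k" "j \<noteq> i" by (rule pick3)
  show "b i \<notin> tD k" using tD_simps(1) pyr_adj(2) assms by metis
  show "b i \<notin> tC k" using tC_simps(1) pyr_adj(2) assms by metis
  show "b i \<notin> tZ" using tZ_simps(1) pyr_adj(2) assms by metis
  show "b i \<notin> tL" using tL_simps(5) pyr_adj(7) assms by metis
  show "b i \<notin> tG" using tG_simps(1) pyr_adj(2) assms by metis
  show "b i \<notin> tY" using tY_simps(1) pyr_adj(2) assms by metis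
  show "b i \<notin> tX k" if "k \<in> I" using tX_simps(3) pyr_adj(7) that assms by metis
  show "b i \<notin> tF k" if "k \<in> I" using tF_simps(1) pyr_adj(5) j that assms by metis
  show "b i \<notin> tU" using tU_simps(1) pyr_adj(5) assms by metis
  show "b i \<notin> tA" using tA_simps(1) pyr_adj(5) assms by metis
  show "b i \<notin> tAm k" using tAm_simps(1) pyr_adj(5) assms j by metis
  show "b i \<notin> tK k" if "i \<noteq> k" using tK_simps(3) pyr_adj(7) that assms by metis
qed

lemma c_notin [simp]:
  assumes "i \<in> I"
  shows "c i \<notin> tD k" "c i \<notin> tB k" "c i \<notin> tZ" "c i \<notin> tL" "c i \<notin> tG" "c i \<notin> tY" "c i \<notin> tX k"
    "k \<in> I \<Longrightarrow> c i \<notin> tF k" "c i \<notin> tU" "c i \<notin> tA" "c i \<notin> tAm k" "c i \<notin> tK k"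
proof -
  obtain j where j: "j \<in> I" "j \<noteq> k" "j \<noteq> i" by (rule pick3)
  show "c i \<notin> tD k" using tD_simps(3) pyr_adj(6) assms j by metis
  show "c i \<notin> tB k" using tB_simps(1) pyr_adj(4) assms by metis
  show "c i \<notin> tZ" using tZ_simps(3) pyr_adj(8) assms by metis
  show "c i \<notin> tL" using tL_simps(1) pyr_adj(4) assms by metis
  show "c i \<notin> tG" using tG_simps(3) pyr_adj(8) assms by metis
  show "c i \<notin> tY" using tY_simps(3) pyr_adj(8) assms by metis
  show "c i \<notin> tX k" using tX_simps(1) pyr_adj(4) assms by metis
  show "c i \<notin> tF k" if "k \<in> I" using tF_simps(1) pyr_adj(8) j that assms by metis
  show "c i \<notin> tU" using tU_simps(1) pyr_adj(8) j assms by metis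
  show "c i \<notin> tA" using tA_simps(1) pyr_adj(8) j assms by metis
  show "c i \<notin> tAm k" using tAm_simps(1) pyr_adj(8) assms j by metis
  show "c i \<notin> tK k" using tK_simps(3) pyr_adj(6) assms j by metis
qed

text \<open>Any two of these vertices share two neighbours among the \<open>b i\<close>, so
  C4-freeness makes their union a clique. It is one of the standard classes in which the outside
  neighbours of a component are located.\<close>

definition tR where "tR = tA \<union> tU \<union> (\<Union>j\<in>I. tF j)"

lemma F_a: "j \<in> I \<Longrightarrow> f \<in> tF j \<Longrightarrow> adj f a \<and> adj a f"
proof -
  assume jf: "j \<in> I" "f \<in> tF j"
  obtain i k where ik: "i \<in> I" "k \<in> I" "i \<noteq> j" "k \<noteq> j" "i \<noteq> k" by (rule pick2)
  have "\<not> adj a (c i)" "adj f (c i)" using jf ik by simp_all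
  then have "f \<noteq> a" by blast
  then have "adj f a" using two_b[of i k f a] jf ik by simp
  then show ?thesis using adj_sym by blast
qed

lemma U_a: "u \<in> tU \<Longrightarrow> adj u a \<and> adj a u"
proof -
  assume u: "u \<in> tU"
  obtain i k where ik: "i \<in> I" "k \<in> I" "i \<noteq> k" by (rule pick2)
  have "\<not> adj a (c i)" "adj u (c i)" using u ik by simp_all
  then have "u \<noteq> a" by blast
  then have "adj u a" using two_b[of i k u a] u ik by simp
  then show ?thesis using adj_sym by blast
qed

text \<open>Vertices \<open>f\<close> and \<open>g\<close> that miss different paths would lie on
  the 4-cycle \<open>f g (c i) (c j)\<close>. The common index becomes the index of the path missed
  by \<open>F\<close> in a mansion or 5-basket.\<close>

lemma F_unique:
  assumes "i \<in> I" "j \<in> I" "f \<in> tF i" "g \<in> tF j"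
  shows "i = j"
proof (rule ccontr)
  assume ij: "i \<noteq> j"
  obtain k where k: "k \<in> I" "k \<noteq> i" "k \<noteq> j" by (rule pick3)
  have "\<not> adj f (c i)" "adj g (c i)" using assms ij by simp_all
  then have "f \<noteq> g" by blast
  then have "adj f g" using a_c[of k f g] assms k F_a by simp
  moreover have "f \<noteq> c i" "g \<noteq> c j" using assms by auto
  ultimately show False using C4[of f g "c i" "c j"] assms ij by simp
qed

lemma R_two_b:
  assumes "v \<in> tR" "w \<in> tR"
  obtains i j where "i \<in> I" "j \<in> I" "i \<noteq> j" "adj v (b i)" "adj v (b j)" "adj w (b i)" "adj w (b j)"
proof -
  have "\<exists>k. \<forall>i\<in>I. i \<noteq> k \<longrightarrow> adj v (b i) \<and> adj w (b i)"
  proof (cases "\<exists>j\<in>I. v \<in> tF j")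
    case True
    then obtain j where j: "j \<in> I" "v \<in> tF j" by blast
    then have "w \<in> tA \<or> w \<in> tU \<or> w \<in> tF j" using assms F_unique unfolding tR_def by blast
    then have "\<forall>i\<in>I. i \<noteq> j \<longrightarrow> adj v (b i) \<and> adj w (b i)" using j by auto
    then show ?thesis by blast
  next
    case False
    then have v: "v \<in> tA \<or> v \<in> tU" using assms unfolding tR_def by blast
    obtain k where "w \<in> tA \<or> w \<in> tU \<or> w \<in> tF k" using assms unfolding tR_def by blast
    then have "\<forall>i\<in>I. i \<noteq> k \<longrightarrow> adj v (b i) \<and> adj w (b i)" using v by auto
    then show ?thesis by blast
  qed
  then obtain k where k: "\<And>i. i \<in> I \<Longrightarrow> i \<noteq> k \<Longrightarrow> adj v (b i) \<and> adj w (b i)" by blast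
  obtain i j where "i \<in> I" "j \<in> I" "i \<noteq> k" "j \<noteq> k" "i \<noteq> j" by (rule pick2)
  then show thesis using that k by blast
qed

lemma R_clique: "v \<in> tR \<Longrightarrow> w \<in> tR \<Longrightarrow> v \<noteq> w \<Longrightarrow> adj v w"
  using two_b R_two_b by metis

lemma a_in_R: "a \<in> tR" by (simp add: tR_def)

lemma in_R: "v \<in> tA \<Longrightarrow> v \<in> tR" "v \<in> tU \<Longrightarrow> v \<in> tR" "j \<in> I \<Longrightarrow> v \<in> tF j \<Longrightarrow> v \<in> tR"
  by (auto simp: tR_def)

lemma Am_clique: "v \<in> tAm j \<Longrightarrow> w \<in> tAm j \<Longrightarrow> v \<noteq> w \<Longrightarrow> adj v w"
  by (rule pick2[of j]) (use two_b in \<open>metis tAm_simps(1)\<close>)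

lemma A_Am: "v \<in> tA \<Longrightarrow> w \<in> tAm j \<Longrightarrow> j \<in> I \<Longrightarrow> adj v w \<and> adj w v"
proof -
  assume vw: "v \<in> tA" "w \<in> tAm j" "j \<in> I"
  obtain i k where ik: "i \<in> I" "k \<in> I" "i \<noteq> j" "k \<noteq> j" "i \<noteq> k" by (rule pick2)
  have "adj v (b j)" "\<not> adj w (b j)" using vw by simp_all
  then have "v \<noteq> w" by blast
  then have "adj v w" using two_b[of i k v w] vw ik by simp
  then show ?thesis using adj_sym by blast
qed

lemma Am_a: "w \<in> tAm j \<Longrightarrow> j \<in> I \<Longrightarrow> adj w a \<and> adj a w"
  using A_Am[of a w j] by simp

lemma Am_U: "v \<in> tU \<Longrightarrow> w \<in> tAm j \<Longrightarrow> j \<in> I \<Longrightarrow> adj v w \<and> adj w v"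
proof -
  assume vw: "v \<in> tU" "w \<in> tAm j" "j \<in> I"
  obtain i k where ik: "i \<in> I" "k \<in> I" "i \<noteq> j" "k \<noteq> j" "i \<noteq> k" by (rule pick2)
  have "adj v (b j)" "\<not> adj w (b j)" using vw by simp_all
  then have "v \<noteq> w" by blast
  then have "adj v w" using two_b[of i k v w] vw ik by simp
  then show ?thesis using adj_sym by blast
qed

lemma Am_F:
  assumes "i \<in> I" "j \<in> I" "w \<in> tAm i" "f \<in> tF j"
  shows "adj w f"
proof -
  obtain k where k: "k \<in> I" "k \<noteq> i" "k \<noteq> j" by (rule pick3)
  have "\<not> adj w (c k)" "adj f (c k)" using assms k by simp_all
  then have ne: "w \<noteq> f" by blast
  show ?thesis
  proof (cases "i = j")
    case True
    obtain l where "l \<in> I" "l \<noteq> i" "l \<noteq> k" by (rule pick3)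
    then show ?thesis using two_b[of k l w f] assms k ne True by simp
  next
    case False
    show ?thesis
    proof (rule ccontr)
      assume "\<not> adj w f"
      then show False
        by (intro C6[of w "b j" "c j" "c i" f "b k"]) (use assms k False in simp_all)
    qed
  qed
qed

text \<open>Vertices missing different \<open>b i\<close> and \<open>b j\<close> close, through
  these and \<open>c i\<close>, \<open>c j\<close>, to a 6-cycle if they are adjacent and otherwise,
  with the help of \<open>b k\<close>, to a 7-cycle.\<close>

lemma Am_unique:
  assumes "i \<in> I" "j \<in> I" "v \<in> tAm i" "w \<in> tAm j"
  shows "i = j"
proof (rule ccontr)
  assume ij: "i \<noteq> j"
  obtain k where k: "k \<in> I" "k \<noteq> i" "k \<noteq> j" by (rule pick3)
  show False
  proof (cases "adj v w")
    case True
    then show False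
      using C6[of v "b j" "c j" "c i" "b i" w] assms ij k adj_commute[of w v] by simp
  next
    case False
    then show False
      using C7[of v "b j" "c j" "c i" "b i" w "b k"] assms ij k by simp
  qed
qed

text \<open>Otherwise \<open>w\<close>, \<open>b k\<close>, \<open>v\<close> form a P3 that is
  anticomplete to the P3 \<open>b i\<close>, \<open>c i\<close>, \<open>c j\<close>, since
  \<open>w\<close> misses \<open>b i\<close>.\<close>

lemma Am_K:
  assumes "i \<in> I" "k \<in> I" "i \<noteq> k" "w \<in> tAm i" "v \<in> tK k"
  shows "adj w v"
proof (cases "v = b k")
  case True
  then show ?thesis using assms by simp
next
  case False
  then have bv: "adj (b k) v" using assms adj_sym unfolding tK_def cadj_def by blast
  obtain j where j: "j \<in> I" "j \<noteq> i" "j \<noteq> k" by (rule pick3)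
  have "adj w (b j)" "\<not> adj v (b j)" using assms j by simp_all
  then have ne: "w \<noteq> v" by blast
  show ?thesis
  proof (rule ccontr)
    assume "\<not> adj w v"
    then show False
      using twoP3[of w "b k" v "b i" "c i" "c j"] assms bv ne j by simp
  qed
qed

lemma Am_anti:
  assumes "i \<in> I" "w \<in> tAm i" and z: "\<And>j. j \<in> I \<Longrightarrow> \<not> adj z (b j) \<and> \<not> adj z (c j)"
  shows "\<not> adj z w"
proof
  assume zw: "adj z w"
  obtain j k where j: "j \<in> I" "k \<in> I" "j \<noteq> i" "k \<noteq> i" "j \<noteq> k" by (rule pick2)
  have "z \<noteq> b k" using z[of k] pyr_adj(7)[of k k] j by auto
  then show False
    using twoP3[of z w "b k" "b i" "c i" "c j"] assms j z[of i] z[of j] z[of k] zw by simp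
qed

text \<open>If both ends of an edge see their own \<open>c\<close>, there is a 4-cycle through
  \<open>c j\<close> and \<open>c k\<close>. If \<open>v\<close> misses \<open>c k\<close>, the path
  \<open>v\<close>, \<open>w\<close>, \<open>b j\<close> and the path \<open>b i\<close>,
  \<open>c i\<close>, \<open>c k\<close> form 2P3.\<close>

lemma KK_anti:
  assumes k: "k \<in> I" and j: "j \<in> I" and kj: "k \<noteq> j" and v: "v \<in> tK k" and w: "w \<in> tK j"
  shows "\<not> adj v w"
proof
  assume vw: "adj v w"
  have half: False if "k \<in> I" "j \<in> I" "k \<noteq> j" "v \<in> tK k" "w \<in> tK j" "adj v w" "\<not> adj v (c k)" for k j v w
  proof -
    obtain i where i: "i \<in> I" "i \<noteq> k" "i \<noteq> j" by (rule pick3)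
    have "cadj w (b j)" using that unfolding tK_def by blast
    then have wb: "adj w (b j)" using that by (auto simp: cadj_def)
    have "v \<noteq> b j" "\<not> adj v (b j)" using that by auto
    then show False
      using twoP3[of v w "b j" "b i" "c i" "c k"] that i wb by simp
  qed
  show False
  proof (cases "adj v (c k) \<and> adj w (c j)")
    case True
    have "v \<noteq> c j" "w \<noteq> c k" using v w k j by auto
    then show False using C4[of v w "c j" "c k"] True vw k j kj v w adj_commute[of "c k" v] by simp
  next
    case False
    then show False using half[of k j v w] half[of j k w v] assms vw adj_sym by blast
  qed
qed

lemma K_C_anti:
  assumes k: "k \<in> I" and j: "j \<in> I" and kj: "j \<noteq> k" and v: "v \<in> tK k" and w: "w \<in> tC j"
  shows "\<not> adj v w"
proof
  assume vw: "adj v w"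
  obtain i where i: "i \<in> I" "i \<noteq> j" "i \<noteq> k" by (rule pick3)
  have ne: "v \<noteq> b j" "w \<noteq> a" using v w j kj by auto
  show False
  proof (cases "adj v a")
    case True
    then show False using C4[of v w "b j" a] vw v w j kj ne adj_commute[of a v] by simp
  next
    case va: False
    then have "v \<noteq> b k" using k by auto
    then have vb: "adj v (b k)" using v unfolding tK_def cadj_def by blast
    show False
    proof (cases "adj v (c k)")
      case True
      show False
        using C6[of v w "c i" "b i" a "b k"] vw v w i j k kj va vb adj_commute[of "b k" v] by simp
    next
      case False
      have "w \<noteq> b k" "v \<noteq> c k" using v w k kj by auto
      then show False
        using C4[of v w "c k" "b k"] vw v w k j kj vb False adj_commute[of "b k" v] by auto
    qed
  qed
qed

lemma C_C:
  assumes k: "k \<in> I" and j: "j \<in> I" and v: "v \<in> tC k" and w: "w \<in> tC j" and ne: "v \<noteq> w"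
  shows "adj v w"
proof (cases "k = j")
  case True
  then show ?thesis using M_clique[OF k in_M(1)[OF k v]] in_M(1)[OF j w] ne by blast
next
  case False
  obtain i where i: "i \<in> I" "i \<noteq> j" "i \<noteq> k" by (rule pick3)
  show ?thesis
  proof (rule ccontr)
    assume "\<not> adj v w"
    then show False
      using C6[of v "b k" a "b j" w "c i"] v w i j k False by simp
  qed
qed

lemma C_F:
  assumes k: "k \<in> I" and j: "j \<in> I" and kj: "k \<noteq> j" and v: "v \<in> tC k" and f: "f \<in> tF j"
  shows "adj v f"
proof -
  obtain i where i: "i \<in> I" "i \<noteq> j" "i \<noteq> k" by (rule pick3)
  have "adj v (c j)" "\<not> adj f (c j)" using v f k j kj by simp_all
  then have "v \<noteq> f" by blast
  then show ?thesis using b_c[of k i v f] assms i by simp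
qed

lemma C_U:
  assumes k: "k \<in> I" and v: "v \<in> tC k" and u: "u \<in> tU"
  shows "adj v u"
proof -
  obtain i where i: "i \<in> I" "i \<noteq> k" "i \<noteq> k" by (rule pick3)
  have "\<not> adj v a" "adj u a" using v u U_a by simp_all
  then have "v \<noteq> u" by blast
  then show ?thesis using b_c[of k i v u] assms i by simp
qed

lemma A_C_anti: "w \<in> tA \<union> (\<Union>i\<in>I. tAm i) \<Longrightarrow> k \<in> I \<Longrightarrow> v \<in> tC k \<union> tY \<Longrightarrow> \<not> adj w v"
proof
  assume w: "w \<in> tA \<union> (\<Union>i\<in>I. tAm i)" and k: "k \<in> I" and v: "v \<in> tC k \<union> tY" and wv: "adj w v"
  obtain m where m: "m \<in> I" "\<And>i. i \<in> I \<Longrightarrow> i \<noteq> m \<Longrightarrow> adj w (b i)" "\<And>i. i \<in> I \<Longrightarrow> \<not> adj w (c i)"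
    using w k by auto
  obtain j where j: "j \<in> I" "j \<noteq> m" "j \<noteq> k" by (rule pick3)
  have "\<not> adj v (b j)" "adj v (c j)" "v \<noteq> b j" "w \<noteq> c j"
    using v j k m(2)[of j] w by auto
  then show False
    using C4[of w v "c j" "b j"] wv j m adj_commute[of "b j" w] by auto
qed

lemma D_Y_anti:
  assumes k: "k \<in> I" and v: "v \<in> tD k" and y: "y \<in> tY"
  shows "\<not> adj v y"
proof
  assume vy: "adj v y"
  obtain j where j: "j \<in> I" "j \<noteq> k" by (rule pick3[of k k])
  show False using C6[of v y "c j" "b j" a "b k"] vy v y j k by simp
qed

lemma X_Y_anti:
  assumes k: "k \<in> I" and v: "v \<in> tX k" and y: "y \<in> tY"
  shows "\<not> adj v y"
proof
  assume vy: "adj v y"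
  have "v \<noteq> c k" "y \<noteq> b k" using v y k by auto
  then show False using C4[of v y "c k" "b k"] vy v y k by auto
qed

lemma F_D_anti:
  assumes k: "k \<in> I" and v: "v \<in> tD k" and f: "f \<in> tF k"
  shows "\<not> adj f v"
proof
  assume fv: "adj f v"
  have "v \<noteq> a" "f \<noteq> b k" using v k F_a[OF k f] f by auto
  then show False using C4[of f v "b k" a] fv v f k F_a[OF k f] by auto
qed

text \<open>The component of \<open>z\<close> in a P3-free set is a clique, and an outside neighbour
  of the component does not even belong to the set. This packages the scheme by which classes of
  vertices are shown to be empty.\<close>

lemma clique_component:
  assumes "z \<in> S" "S \<subseteq> V"
    and P3: "\<And>x y z. x \<in> S \<Longrightarrow> y \<in> S \<Longrightarrow> z \<in> S \<Longrightarrow> adj x y \<Longrightarrow> adj y z \<Longrightarrow> x \<noteq> z \<Longrightarrow> adj x z"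
  obtains D x y d d' where "D \<subseteq> S" "z \<in> D" "\<And>x y. x \<in> D \<Longrightarrow> y \<in> D \<Longrightarrow> x \<noteq> y \<Longrightarrow> adj x y"
    "x \<notin> S" "y \<notin> S" "d \<in> D" "d' \<in> D" "adj d x" "adj d' y" "x \<noteq> y" "\<not> adj x y"
proof -
  define D where "D = {w \<in> S. cadj z w}"
  have cl: "adj x y" if "x \<in> D" "y \<in> D" "x \<noteq> y" for x y
    using that P3[of x z y] assms(1) adj_commute[of z x] unfolding D_def cadj_def by blast
  have D: "D \<subseteq> S" "z \<in> D" using assms(1) by (auto simp: D_def cadj_def)
  then have "D \<noteq> {}" "D \<subseteq> V" using assms(2) by blast+
  then obtain x y d d' where xy: "x \<notin> D" "y \<notin> D" "d \<in> D" "d' \<in> D" "adj d x" "adj d' y"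
      "x \<noteq> y" "\<not> adj x y"
    using clique_attachment[of D] cl by blast
  have "x \<notin> S" if "x \<notin> D" "d \<in> D" "adj d x" for x d
    using that P3[of z d x] assms(1) D(1) unfolding D_def cadj_def by blast
  then show thesis using that[OF D cl, of x y d d'] xy by blast
qed

section \<open>Vertices with too few neighbours on the pyramid\<close>

lemma Z_P3_free:
  assumes "x \<in> tZ \<union> tL" "y \<in> tZ \<union> tL" "z \<in> tZ \<union> tL" "adj x y" "adj y z" "x \<noteq> z"
  shows "adj x z"
proof -
  obtain k where k: "k \<in> I" using pick2 by blast
  show ?thesis by (rule K_P3_free[OF k assms(4-6)]) (use assms(1-3) in auto)
qed

lemma Z_nbr:
  assumes z: "z \<in> tZ" and zv: "adj z v"
  shows "v \<in> tZ \<union> tL \<union> tR"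
proof -
  have v: "v \<in> V" using zv adjD by blast
  have nb: "z \<noteq> b k" "z \<noteq> c k" if "k \<in> I" for k
    using z that by auto
  have "v \<notin> tK k" if "k \<in> I" for k
    using K_anti(1)[of k v z] z zv nb that by (auto simp: cadj_def)
  moreover have "v \<notin> tM k" if "k \<in> I" for k
    using M_anti(1)[of k v z] z zv nb that by (auto simp: cadj_def)
  moreover have "v \<notin> tAm k" if "k \<in> I" for k
    using Am_anti[of k v z] z zv that by auto
  moreover have "\<exists>k\<in>I. v \<in> tM k" if "v \<in> tG"
  proof -
    obtain k where "k \<in> I" "adj v (c k)" using \<open>v \<in> tG\<close> unfolding tG_def by blast
    then show ?thesis using in_M(3) \<open>v \<in> tG\<close> by blast
  qed
  moreover have "\<exists>k. k \<in> I" using pick2 by blast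
  ultimately show ?thesis using type_cases[OF v] in_K in_M(1,2) in_R by blast
qed

text \<open>The outside neighbours of a component of \<open>tZ\<close> lie in \<open>tL\<close> or
  \<open>tR\<close>. One in \<open>tL\<close> is adjacent to the whole component, as
  \<open>tZ \<union> tL\<close> is P3-free; next to one in \<open>tR\<close> the 4-cycle
  \<open>e v a w\<close> forces adjacency; and \<open>tR\<close> is a clique.\<close>

lemma Z_empty: "tZ = {}"
proof (rule ccontr)
  assume "tZ \<noteq> {}"
  then obtain z where z: "z \<in> tZ" by blast
  have "tZ \<subseteq> V" using in_type_V by blast
  then obtain D x y d d' where D: "D \<subseteq> tZ" "\<And>x y. x \<in> D \<Longrightarrow> y \<in> D \<Longrightarrow> x \<noteq> y \<Longrightarrow> adj x y"
    and xy: "x \<notin> tZ" "y \<notin> tZ" "d \<in> D" "d' \<in> D" "adj d x" "adj d' y" "x \<noteq> y" "\<not> adj x y"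
    by (rule clique_component[OF z]) (use Z_P3_free in blast)+
  have x: "x \<in> tL \<union> tR" and y: "y \<in> tL \<union> tR" using Z_nbr xy D(1) by blast+
  have spread: "adj e w" if "w \<in> tL" "d \<in> D" "adj d w" "e \<in> D" for e d w
    using Z_P3_free[of e d w] D that xy(1) unfolding cadj_def
    by (metis UnI1 UnI2 subsetD tL_simps(1) tZ_simps(1))
  have LR: "adj v w" if v: "v \<in> tL" "d \<in> D" "adj d v" and w: "w \<in> tR" "e \<in> D" "adj e w" for v d w e
  proof -
    have "e \<in> tZ" using w D(1) by blast
    then have "e \<noteq> a" "\<not> adj e a" "w \<noteq> a" using w(3) by auto
    moreover have "adj e v" using spread v w by blast
    moreover have "adj w a" using R_clique[OF w(1) a_in_R] \<open>w \<noteq> a\<close> by blast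
    moreover have "v \<noteq> w" using R_two_b[OF w(1) w(1)] v(1) tL_simps(3) by metis
    ultimately show ?thesis using C4[of e v a w] v(1) w(3) adj_commute[of w e] adj_commute[of w a] by auto
  qed
  show False
  proof (cases "x \<in> tL")
    case xL: True
    show False
    proof (cases "y \<in> tL")
      case True
      then show False using Z_P3_free[of x d' y] spread[of x d d'] xL xy D(1) adj_commute[of x d'] by blast
    next
      case False
      then show False using LR[of x d y d'] xL xy y by blast
    qed
  next
    case False
    then show False using LR[of y d' x d] R_clique[of x y] x y xy adj_commute[of x y] by blast
  qed
qed

text \<open>An edge \<open>e y\<close> would extend the pyramid by the path from \<open>a\<close>
  through \<open>e\<close> to \<open>y\<close>. This is the place where the maximality of
  \<open>t\<close> is used.\<close>

lemma L_Y_anti: "e \<in> tL \<Longrightarrow> y \<in> tY \<Longrightarrow> \<not> adj e y"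
proof
  assume e: "e \<in> tL" and y: "y \<in> tY" and ey: "adj e y"
  have "tpyramid (Suc t) a (b(Suc t := e)) (c(Suc t := y))"
    unfolding tpyramid_def
  proof (intro conjI ballI impI)
    show "3 \<le> Suc t" using t_ge by simp
    fix i assume "i \<in> {1..Suc t}"
    then have i: "i \<in> I \<and> i \<noteq> Suc t \<or> i = Suc t" by (auto simp: I_def)
    show "adj a ((b(Suc t := e)) i)" "adj ((b(Suc t := e)) i) ((c(Suc t := y)) i)"
      "\<not> adj a ((c(Suc t := y)) i)"
      using i e y ey by auto
    fix j assume "j \<in> {1..Suc t}" and ij: "i \<noteq> j"
    then have j: "j \<in> I \<and> j \<noteq> Suc t \<or> j = Suc t" by (auto simp: I_def)
    show "\<not> adj ((b(Suc t := e)) i) ((b(Suc t := e)) j)" "adj ((c(Suc t := y)) i) ((c(Suc t := y)) j)"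
      "\<not> adj ((b(Suc t := e)) i) ((c(Suc t := y)) j)"
      using i j ij e y by auto
  qed
  then show False using max_t by fastforce
qed

lemma L_nbr:
  assumes e: "e \<in> tL" and ev: "adj e v"
  shows "v \<in> tL \<union> tR"
proof -
  have v: "v \<in> V" using ev adjD by blast
  have nb: "e \<noteq> b k" if "k \<in> I" for k
    using e that by auto
  have "v \<notin> tK k" if "k \<in> I" for k
    using K_anti(1)[of k v e] e ev nb that by (auto simp: cadj_def)
  moreover have "v \<notin> tAm k" if "k \<in> I" for k
    using Am_anti[of k v e] e ev that by auto
  moreover have "v \<notin> tC k" if k: "k \<in> I" for k
  proof
    assume c: "v \<in> tC k"
    have "v \<noteq> a" using c by auto
    then show False using C4[of e v "b k" a] e ev c k nb[OF k] by auto
  qed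
  moreover have "v \<notin> tG"
  proof
    assume g: "v \<in> tG"
    then obtain i l where il: "i \<in> I" "l \<in> I" "adj v (c i)" "\<not> adj v (c l)" unfolding tG_def by blast
    then show False using C6[of a e v "c i" "c l" "b l"] e ev g by auto
  qed
  ultimately show ?thesis
    using type_cases[OF v] in_K in_R Z_empty L_Y_anti[OF e] ev by blast
qed

lemma L_empty: "tL = {}"
proof (rule ccontr)
  assume "tL \<noteq> {}"
  then obtain z where z: "z \<in> tL" by blast
  have "tL \<subseteq> V" using in_type_V by blast
  then obtain D x y d d' where "D \<subseteq> tL" "x \<notin> tL" "y \<notin> tL" "d \<in> D" "d' \<in> D" "adj d x" "adj d' y"
      "x \<noteq> y" "\<not> adj x y"
    by (rule clique_component[OF z]) (use Z_P3_free in blast)+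
  then show False using L_nbr R_clique by blast
qed

lemma G_same:
  assumes g: "g \<in> tG" and h: "h \<in> tG" and gh: "adj g h" and k: "k \<in> I"
  shows "adj g (c k) \<longleftrightarrow> adj h (c k)"
proof -
  have "adj q (c k)" if "p \<in> tG" "q \<in> tG" "adj p q" "adj p (c k)" for p q
  proof (rule ccontr)
    assume "\<not> adj q (c k)"
    then have "\<not> cadj q (c k)" using that k by (auto simp: cadj_def)
    then show False using M_anti(1)[OF k in_M(3)[OF k that(1,4)], of q] that adj_commute[of p q] by simp
  qed
  then show ?thesis using assms adj_sym by blast
qed

lemma G_P3_free:
  "x \<in> tG \<Longrightarrow> y \<in> tG \<Longrightarrow> z \<in> tG \<Longrightarrow> adj x y \<Longrightarrow> adj y z \<Longrightarrow> x \<noteq> z \<Longrightarrow> adj x z"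
proof -
  assume *: "x \<in> tG" "y \<in> tG" "z \<in> tG" "adj x y" "adj y z" "x \<noteq> z"
  obtain k where k: "k \<in> I" using pick2 by blast
  show ?thesis by (rule M_P3_free[OF k *(4-6)]) (use *(1-3) in auto)
qed

lemma G_c:
  assumes "g \<in> tG"
  obtains k l where "k \<in> I" "l \<in> I" "adj g (c k)" "\<not> adj g (c l)"
  using assms unfolding tG_def by blast

lemma G_A_anti: "g \<in> tG \<Longrightarrow> w \<in> tA \<Longrightarrow> \<not> adj g w"
proof
  assume g: "g \<in> tG" and w: "w \<in> tA" and gw: "adj g w"
  obtain k l where k: "k \<in> I" "adj g (c k)" using G_c[OF g] by blast
  have "g \<noteq> b k" "w \<noteq> c k" using g w k by auto
  then show False using C4[of g w "b k" "c k"] gw g w k adj_commute[of "c k" g] by simp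
qed

text \<open>If \<open>g\<close> sees some \<open>c k\<close> with \<open>k \<noteq> i\<close>, there
  is a 4-cycle \<open>g w (b k) (c k)\<close>. The remaining case, in which \<open>g\<close> sees
  only \<open>c i\<close>, is T0: the arguments are instantiated in the order
  \<open>p q u0 u2 u3 u1 w1 w2 w3\<close>, so \<open>a\<close> and \<open>w\<close> are its vertices
  \<open>p\<close> and \<open>q\<close>, and \<open>g\<close> is \<open>u1\<close>.\<close>

lemma G_Am_anti:
  assumes g: "g \<in> tG" and w: "w \<in> tAm i" and i: "i \<in> I"
  shows "\<not> adj g w"
proof
  assume gw: "adj g w"
  show False
  proof (cases "\<exists>k\<in>I. k \<noteq> i \<and> adj g (c k)")
    case True
    then obtain k where k: "k \<in> I" "k \<noteq> i" "adj g (c k)" by blast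
    have "g \<noteq> b k" "w \<noteq> c k" using g w k by auto
    then show False using C4[of g w "b k" "c k"] gw g w k i adj_commute[of "c k" g] by simp
  next
    case False
    obtain m where "m \<in> I" "adj g (c m)" using G_c[OF g] by blast
    then have gi: "adj g (c i)" using False by auto
    obtain j k where jk: "j \<in> I" "k \<in> I" "j \<noteq> i" "k \<noteq> i" "j \<noteq> k" by (rule pick2)
    have "\<not> adj g (c j)" "\<not> adj g (c k)" using False jk by blast+
    then show False
      using T0[of a w "b i" "b j" "b k" g "c i" "c j" "c k"] g w gw gi i jk Am_a[OF w i]
        adj_commute[of w g] adj_commute[of "b i" g] adj_commute[of a g] by simp
  qed
qed

text \<open>Only the case of \<open>g\<close> missing \<open>c j\<close> and seeing two other
  \<open>c i\<close>, \<open>c k\<close> survives C4 and C6. There T0 appears upside down: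
  \<open>c i\<close> and \<open>c k\<close> are its vertices \<open>p\<close> and \<open>q\<close>,
  while \<open>a\<close> takes the place of \<open>w1\<close>.\<close>

lemma G_X_anti:
  assumes g: "g \<in> tG" and x: "x \<in> tX j" and j: "j \<in> I"
  shows "\<not> adj g x"
proof
  assume gx: "adj g x"
  show False
  proof (cases "adj g (c j)")
    case True
    have "g \<noteq> b j" "x \<noteq> c j" using g x j by auto
    then show False using C4[of g x "b j" "c j"] gx g x j True adj_commute[of "c j" g] by simp
  next
    case False
    obtain k where k: "k \<in> I" "adj g (c k)" using G_c[OF g] by blast
    then have kj: "k \<noteq> j" using False by auto
    obtain i where i: "i \<in> I" "i \<noteq> j" "i \<noteq> k" by (rule pick3)
    show False
    proof (cases "adj g (c i)")
      case False
      then show False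
        using C6[of g x a "b i" "c i" "c k"] gx g x i j k kj adj_commute[of "c k" g] by simp
    next
      case True
      show False
        using T0[of "c i" "c k" "b i" "c j" g "b k" a "b j" x] g x gx i j k kj True False
          adj_commute[of x g] adj_commute[of "c i" g] adj_commute[of "c k" g] adj_commute[of "c j" g]
          adj_commute[of "b i" x] by simp
    qed
  qed
qed

lemma G_Y_anti: "g \<in> tG \<Longrightarrow> y \<in> tY \<Longrightarrow> \<not> adj g y"
proof -
  assume g: "g \<in> tG" and y: "y \<in> tY"
  obtain l where l: "l \<in> I" "\<not> adj g (c l)" using G_c[OF g] by blast
  then have "\<not> cadj g (c l)" using g by (auto simp: cadj_def)
  then show ?thesis using M_anti(1)[OF l(1) in_M(2)[OF l(1) y], of g] g by simp
qed

lemma G_C: "g \<in> tG \<Longrightarrow> v \<in> tC k \<Longrightarrow> k \<in> I \<Longrightarrow> adj g v \<longleftrightarrow> adj g (c k)"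
proof -
  assume g: "g \<in> tG" and v: "v \<in> tC k" and k: "k \<in> I"
  have "g \<noteq> v" using tC_simps(5)[OF v k] tG_simps(3)[OF g k] by blast
  show ?thesis
  proof (cases "adj g (c k)")
    case True
    then show ?thesis using M_clique[OF k in_M(3)[OF k g True] in_M(1)[OF k v] \<open>g \<noteq> v\<close>] by simp
  next
    case False
    then have "\<not> cadj g (c k)" using g k by (auto simp: cadj_def)
    then show ?thesis using M_anti(1)[OF k in_M(1)[OF k v], of g] g False by simp
  qed
qed

lemma G_D:
  assumes g: "g \<in> tG" and v: "v \<in> tD k" and k: "k \<in> I" and gv: "adj g v"
  shows "adj v (c k)" "i \<in> I \<Longrightarrow> adj g (c i) \<longleftrightarrow> i = k"
proof -
  have only: "j = k" if j: "j \<in> I" "adj g (c j)" for j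
  proof (rule ccontr)
    assume "j \<noteq> k"
    then show False
      using C6[of v g "c j" "b j" a "b k"] g v k j gv adj_commute[of v g] by simp
  qed
  obtain j where "j \<in> I" "adj g (c j)" using G_c[OF g] by blast
  then have gk: "adj g (c k)" using only by blast
  then show "i \<in> I \<Longrightarrow> adj g (c i) \<longleftrightarrow> i = k" using only by blast
  have "v \<noteq> c k" "g \<noteq> b k" using g v k by auto
  then show "adj v (c k)"
    using C4[of v g "c k" "b k"] g v k gv gk adj_commute[of v g] by simp
qed

lemma G_B:
  assumes g: "g \<in> tG" and v: "v \<in> tB k" and k: "k \<in> I" and gv: "adj g v" and i: "i \<in> I"
  shows "adj g (c i) \<longleftrightarrow> i = k"
proof -
  have gk: "adj g (c k)"
  proof (rule ccontr)
    assume n: "\<not> adj g (c k)"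
    obtain j where j: "j \<in> I" "adj g (c j)" using G_c[OF g] by blast
    then have "j \<noteq> k" using n by auto
    moreover have "g \<noteq> c k" "v \<noteq> c j" using g v k j by auto
    ultimately show False using C4[of g v "c k" "c j"] g v k gv j n adj_commute[of "c j" g] by simp
  qed
  have "j = k" if j: "j \<in> I" "adj g (c j)" for j
  proof (rule ccontr)
    assume jk: "j \<noteq> k"
    obtain l where l: "l \<in> I" "\<not> adj g (c l)" using G_c[OF g] by blast
    then have "l \<noteq> k" "l \<noteq> j" using gk j by auto
    then show False
      using C6[of a "b l" "c l" "c j" g v] g v k gv j jk l adj_commute[of "c l" g] adj_commute[of "c j" g]
      by simp
  qed
  then show ?thesis using gk i by blast
qed

lemma G_F:
  assumes g: "g \<in> tG" and f: "f \<in> tF i" and i: "i \<in> I" and gf: "adj g f"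
  shows "\<not> adj g (c i)"
proof
  assume gi: "adj g (c i)"
  obtain l where l: "l \<in> I" "\<not> adj g (c l)" using G_c[OF g] by blast
  then have "l \<noteq> i" using gi by auto
  moreover have "g \<noteq> c l" "f \<noteq> c i" using g f l i by auto
  ultimately show False using C4[of f g "c i" "c l"] g f i l gi gf adj_commute[of f g] by simp
qed

lemma G_nbr:
  assumes g: "g \<in> tG" and gv: "adj g v" and nv: "v \<notin> tG"
  obtains k where "k \<in> I" "adj g (c k)" "v \<in> tC k"
  | "v \<in> tR" "\<And>k. k \<in> I \<Longrightarrow> adj g (c k) \<Longrightarrow> v \<in> tU \<or> (\<exists>i\<in>I. i \<noteq> k \<and> v \<in> tF i)"
  | k where "k \<in> I" "\<And>i. i \<in> I \<Longrightarrow> adj g (c i) \<longleftrightarrow> i = k" "v \<in> tB k \<or> v \<in> tD k \<and> adj v (c k)"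
proof -
  have v: "v \<in> V" using gv adjD by blast
  consider "v \<in> tU" | i where "i \<in> I" "v \<in> tF i" | k where "k \<in> I" "v \<in> tC k"
    | k where "k \<in> I" "v \<in> tB k" | k where "k \<in> I" "v \<in> tD k"
    using type_cases[OF v] Z_empty L_empty G_A_anti[OF g] G_Am_anti[OF g] G_X_anti[OF g]
      G_Y_anti[OF g] gv nv by blast
  then show thesis
  proof cases
    case 1 then show thesis using that(2) in_R by blast
  next
    case (2 i)
    then have "\<not> adj g (c i)" using G_F[OF g _ _ gv] by blast
    then show thesis using 2 in_R(3) by (intro that(2)) (blast, metis)
  next
    case 3 then show thesis using that(1) G_C[OF g] gv by blast
  next
    case 4 then show thesis using that(3) G_B[OF g _ _ gv] by blast
  next
    case 5 then show thesis using that(3) G_D[OF g _ _ gv] by blast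
  qed
qed

lemma G_nbr_R:
  assumes R: "\<And>k. k \<in> I \<Longrightarrow> adj g (c k) \<Longrightarrow> v \<in> tU \<or> (\<exists>i\<in>I. i \<noteq> k \<and> v \<in> tF i)"
    and k: "k \<in> I" "adj g (c k)"
  shows "adj v a" "adj v (b k)" "adj v (c k)"
    and "x \<in> tC k \<Longrightarrow> adj x v"
  using R[OF k] k F_a U_a C_U C_F by auto

text \<open>By \<open>G_same\<close> all vertices of a component see the same \<open>c k\<close>,
  which ties the types of its outside neighbours together. The delicate case, treated by
  \<open>half\<close>, is an outside neighbour in \<open>tB k\<close> or \<open>tD k\<close>: then
  the component sees no \<open>c i\<close> except \<open>c k\<close>.\<close>

lemma G_empty: "tG = {}"
proof (rule ccontr)
  assume "tG \<noteq> {}"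
  then obtain g where g: "g \<in> tG" by blast
  have "tG \<subseteq> V" using in_type_V by blast
  then obtain D x y d d' where D: "D \<subseteq> tG" "g \<in> D" "\<And>x y. x \<in> D \<Longrightarrow> y \<in> D \<Longrightarrow> x \<noteq> y \<Longrightarrow> adj x y"
    and xy: "x \<notin> tG" "y \<notin> tG" "d \<in> D" "d' \<in> D" "adj d x" "adj d' y" "x \<noteq> y" "\<not> adj x y"
    by (rule clique_component[OF g]) (use G_P3_free in blast)+
  have same: "adj d (c k) \<longleftrightarrow> adj g (c k)" if "d \<in> D" "k \<in> I" for d k
    using G_same[of d g k] D that by (cases "d = g") blast+
  have half: "adj x y" if x: "adj d x" "x \<notin> tG" "d \<in> D" and y: "adj e y" "y \<notin> tG" "e \<in> D" "x \<noteq> y"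
    and k: "k \<in> I" "\<And>i. i \<in> I \<Longrightarrow> adj d (c i) \<longleftrightarrow> i = k"
    and xk: "x \<in> tB k \<or> x \<in> tD k \<and> adj x (c k)" for x y d e k
  proof -
    have dG: "d \<in> tG" and eG: "e \<in> tG" using x y D by blast+
    have ek: "adj e (c i) \<longleftrightarrow> i = k" if "i \<in> I" for i
      using same[OF y(3) that] same[OF x(3) that] k(2)[OF that] by simp
    have xK: "x \<in> tK k" using xk in_K k(1) by blast
    have x_e: "adj x h" if "h \<in> D" "x \<in> tD k" for h
    proof -
      have h: "h \<in> tG" using that D by blast
      have "adj h (c k)" using same[OF that(1) k(1)] same[OF x(3) k(1)] k by simp
      moreover have "x \<noteq> h" using x(2) h by blast
      ultimately show ?thesis
        using M_clique[OF k(1) in_M(4) in_M(3)] h that(2) xk k(1) by (metis tB_simps(1) tD_simps(1))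
    qed
    show ?thesis
      using G_nbr[OF eG y(1,2)]
    proof cases
      case (1 j)
      then have j: "j = k" using ek by blast
      have yM: "y \<in> tM k" using in_M(1) 1 j by blast
      show ?thesis
      proof (cases "x \<in> tB k")
        case True
        have "adj d (c k)" using k by blast
        then have dy: "adj d y" using G_C[OF dG _ k(1)] 1 j by blast
        show ?thesis
        proof (cases "x = b k")
          case True
          then show ?thesis using 1 j k by simp
        next
          case False
          then have "adj x (b k)" using B_b[OF k(1) True] by (simp add: cadj_def)
          moreover have "d \<noteq> b k" using dG k by auto
          ultimately show ?thesis
            using C4[of d x "b k" y] x(1) dy 1 j k dG y(4) adj_commute[of d y] by simp
        qed
      next
        case False
        then show ?thesis using M_clique[OF k(1) in_M(4) yM y(4)] xk k(1) by blast
      qed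
    next
      case 2
      have "adj e (c k)" using ek k(1) by simp
      note R = G_nbr_R[OF 2(2) k(1) this]
      show ?thesis
      proof (cases "x \<in> tB k")
        case True
        then show ?thesis using a_c[OF k(1), of x y] R(1,3) k(1) y(4) by simp
      next
        case False
        then have xD: "x \<in> tD k" using xk by blast
        have "e \<noteq> b k" using eG k by auto
        then show ?thesis
          using C4[of y "b k" x e] R x_e[OF y(3) xD] xD eG y k(1) adj_commute[of x y] by simp
      qed
    next
      case (3 j)
      then have "j = k" using ek by blast
      then have "y \<in> tK k" using 3 in_K by blast
      then show ?thesis using K_clique[OF k(1) xK _ y(4)] by blast
    qed
  qed
  have dG: "d \<in> tG" "d' \<in> tG" using xy D by blast+
  show False
    using G_nbr[OF dG(1) xy(5,1)]
  proof cases
    case x: (1 k)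
    show False
      using G_nbr[OF dG(2) xy(6,2)]
    proof cases
      case (1 j)
      then show False using C_C x xy by blast
    next
      case 2
      have "adj d' (c k)" using same x xy(3,4) by blast
      then show False using G_nbr_R(4)[OF 2(2) x(1)] x xy by blast
    next
      case (3 j)
      then show False using half[of d' y d x j] xy adj_sym by blast
    qed
  next
    case x: 2
    show False
      using G_nbr[OF dG(2) xy(6,2)]
    proof cases
      case (1 j)
      have "adj d (c j)" using same 1 xy(3,4) by blast
      then show False using G_nbr_R(4)[OF x(2) 1(1)] 1 xy adj_sym by blast
    next
      case 2
      then show False using R_clique x xy by blast
    next
      case (3 j)
      then show False using half[of d' y d x j] xy adj_sym by blast
    qed
  next
    case (3 k)
    then show False using half[of d x d' y k] xy by blast
  qed
qed

lemma types:
  assumes "v \<in> V"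
  shows "v \<in> tA \<or> v \<in> tY \<or> v \<in> tU \<or> (\<exists>j\<in>I. v \<in> tAm j) \<or> (\<exists>j\<in>I. v \<in> tB j) \<or> (\<exists>j\<in>I. v \<in> tX j) \<or>
    (\<exists>j\<in>I. v \<in> tD j) \<or> (\<exists>j\<in>I. v \<in> tC j) \<or> (\<exists>j\<in>I. v \<in> tF j)"
  using type_cases[OF assms] Z_empty L_empty G_empty by blast

end

section \<open>Consequences of a maximal degree sum\<close>

context simple_graph
begin

definition deg :: "'a \<Rightarrow> nat" where
  "deg v = card {u. adj v u}"

definition deg_sum :: "nat \<Rightarrow> 'a \<Rightarrow> (nat \<Rightarrow> 'a) \<Rightarrow> (nat \<Rightarrow> 'a) \<Rightarrow> nat" where
  "deg_sum t a b c = deg a + (\<Sum>i\<in>{1..t}. deg (b i)) + (\<Sum>i\<in>{1..t}. deg (c i))"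

lemma finite_adj: "finite {u. adj v u}"
  using finite_V by (rule finite_subset[rotated]) (auto dest: adjD)

text \<open>Open neighbourhoods of adjacent vertices are never comparable by inclusion, so the
  exchange arguments compare closed ones; passing to these raises each degree by one and preserves
  the order.\<close>

lemma deg_less:
  assumes sub: "\<And>u. cadj p u \<Longrightarrow> cadj q u" and z: "cadj q z" "\<not> cadj p z"
  shows "deg p < deg q"
proof -
  have c: "card {u. cadj v u} = Suc (deg v)" "finite {u. cadj v u}" for v
  proof -
    have "{u. cadj v u} = insert v {u. adj v u}" by (auto simp: cadj_def)
    then show "card {u. cadj v u} = Suc (deg v)" "finite {u. cadj v u}"
      using finite_adj by (simp_all add: deg_def)
  qed
  have "{u. cadj p u} \<subset> {u. cadj q u}" using assms by blast
  then have "card {u. cadj p u} < card {u. cadj q u}" by (rule psubset_card_mono[OF c(2)])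
  then show ?thesis by (simp add: c(1))
qed

end

text \<open>
  The maximal degree sum makes \<open>a\<close>, \<open>b i\<close> and \<open>c i\<close> the top elements of the chains that the
  neighbourhoods inside the parts form.
\<close>

locale best_pyramid = max_pyramid +
  assumes max_deg: "\<And>a' b' c'. tpyramid t a' b' c' \<Longrightarrow> deg_sum t a' b' c' \<le> deg_sum t a b c"
begin

lemma swap_sum:
  assumes "k \<in> I"
  shows "(\<Sum>i\<in>{1..t}. deg ((g(k := x)) i)) + deg (g k) = (\<Sum>i\<in>{1..t}. deg (g i)) + deg x"
proof -
  have k: "k \<in> {1..t}" using assms by (simp add: I_def)
  have "(\<Sum>i\<in>{1..t} - {k}. deg ((g(k := x)) i)) = (\<Sum>i\<in>{1..t} - {k}. deg (g i))"
    by (intro sum.cong) auto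
  then show ?thesis
    using sum.remove[of "{1..t}" k "\<lambda>i. deg ((g(k := x)) i)"] sum.remove[of "{1..t}" k "\<lambda>i. deg (g i)"] k
    by simp
qed

lemma swap_a: "tpyramid t w b c \<Longrightarrow> \<not> deg a < deg w"
  using max_deg[of w b c] by (simp add: deg_sum_def)

lemma swap_b: "k \<in> I \<Longrightarrow> tpyramid t a (b(k := x)) c \<Longrightarrow> \<not> deg (b k) < deg x"
  using max_deg[of a "b(k := x)" c] swap_sum[of k b x] by (simp add: deg_sum_def)

lemma swap_c: "k \<in> I \<Longrightarrow> tpyramid t a b (c(k := x)) \<Longrightarrow> \<not> deg (c k) < deg x"
  using max_deg[of a b "c(k := x)"] swap_sum[of k c x] by (simp add: deg_sum_def)

text \<open>Otherwise \<open>c k\<close> could be exchanged for \<open>x\<close>: every neighbour of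
  \<open>c k\<close> is also one of \<open>x\<close>, by a 4-cycle through \<open>v\<close> for
  those in \<open>tB k\<close> and by the cliques found above for the other types, while
  \<open>v\<close> is a neighbour of \<open>x\<close> only. The degree sum would grow.\<close>

lemma K_C_top:
  assumes k: "k \<in> I" and v: "v \<in> tK k" and nv: "\<not> adj v (c k)" and x: "x \<in> tC k"
  shows "\<not> adj v x"
proof
  assume vx: "adj v x"
  have "tpyramid t a b (c(k := x))"
    unfolding tpyramid_def I_def[symmetric]
    using t_ge x k by auto
  moreover have "deg (c k) < deg x"
  proof (rule deg_less)
    show "cadj x v" "\<not> cadj (c k) v" using vx nv v k adj_commute by (auto simp: cadj_def)
    fix u assume u: "cadj (c k) u"
    show "cadj x u"
    proof (cases "u = c k \<or> u = x")
      case True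
      then show ?thesis using C_c[OF k x] by (auto simp: cadj_def)
    next
      case False
      then have cu: "adj (c k) u" and ux: "u \<noteq> x" using u by (auto simp: cadj_def)
      then have "adj u (c k)" using adj_sym by blast
      have uV: "u \<in> V" using cu adjD by blast
      have ck: "adj x (c k)" using C_c[OF k x] vx nv by (auto simp: cadj_def)
      have B: "adj x u" if "u \<in> tB k"
      proof -
        have "u \<noteq> v" using \<open>adj u (c k)\<close> nv by auto
        then have "adj u v" using K_clique[OF k in_K(1)[OF k that] v] by blast
        moreover have "v \<noteq> c k" using v k by auto
        ultimately show ?thesis
          using C4[of v x "c k" u] vx ck cu ux nv by blast
      qed
      have Y: "adj x u" if "u \<in> tY"
        using M_clique[OF k in_M(1)[OF k x] in_M(2)[OF k that]] ux by blast
      have D: "adj x u" if "u \<in> tD k"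
        using M_clique[OF k in_M(1)[OF k x] in_M(4)[OF k that \<open>adj u (c k)\<close>]] ux by blast
      have ex: "u \<notin> tA" "u \<notin> tAm j" "j \<in> I \<Longrightarrow> u \<notin> tX j" "j \<in> I \<Longrightarrow> u \<in> tB j \<Longrightarrow> j = k"
        "u \<in> tD j \<Longrightarrow> j = k" "u \<in> tF j \<Longrightarrow> j \<noteq> k" for j
        using cu k tA_simps(4)[of u k] tAm_simps(4)[of u j k] tX_simps(4)[of u j k]
          tB_simps(4)[of u j k] tD_simps(4)[of u j k] tF_simps(4)[of u j k] by blast+
      consider "u \<in> tY" | "u \<in> tU" | "u \<in> tB k" | "u \<in> tD k" | j where "j \<in> I" "u \<in> tC j"
        | j where "j \<in> I" "j \<noteq> k" "u \<in> tF j"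
        using types[OF uV] ex by blast
      then have "adj x u"
        by cases (use B Y D C_U[OF k x] C_C[OF k _ x] C_F[OF k _ _ x] ux in blast)+
      then show ?thesis by (simp add: cadj_def)
    qed
  qed
  ultimately show False using swap_c[OF k] by blast
qed

lemma K_a: "k \<in> I \<Longrightarrow> x \<in> tK k \<Longrightarrow> x \<notin> tD k \<Longrightarrow> adj x a"
  unfolding tK_def tD_def cadj_def using adjD[of x "b k"] by auto

text \<open>A neighbour \<open>w\<close> of \<open>d\<close> that misses \<open>v\<close> lies on
  the 6-cycle \<open>w d v (c k) (c j) (b j)\<close> if it belongs to \<open>tA\<close>; otherwise
  it sees \<open>c k\<close>, and \<open>w (c k) v d\<close> is a 4-cycle.\<close>

lemma K_R:
  assumes k: "k \<in> I" and d: "d \<in> tK k" "\<not> adj d (c k)" and v: "v \<in> tK k" "adj v (c k)"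
    and w: "w \<in> tA \<or> w \<in> tU \<or> (\<exists>i\<in>I. i \<noteq> k \<and> w \<in> tF i)" and wd: "adj w d"
  shows "adj w v"
proof (rule ccontr)
  assume n: "\<not> adj w v"
  have dv: "adj d v" using K_clique[OF k d(1) v(1)] d v by blast
  obtain j where j: "j \<in> I" "j \<noteq> k" by (rule pick3[of k k])
  show False
  proof (cases "w \<in> tA")
    case True
    then show False using C6[of w d v "c k" "c j" "b j"] wd dv d v n k j by simp
  next
    case False
    then have wc: "adj w (c k)" using w k by auto
    have "\<exists>j\<in>I. j \<noteq> k \<and> adj w (b j)"
    proof (cases "w \<in> tU")
      case True
      then show ?thesis using j by auto
    next
      case nU: False
      then obtain i where i: "i \<in> I" "w \<in> tF i" using w False by blast
      obtain l where "l \<in> I" "l \<noteq> k" "l \<noteq> i" by (rule pick3)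
      then show ?thesis using i by auto
    qed
    then have "w \<noteq> v" "c k \<noteq> d" using v(1) d(1) k by auto
    then show False
      using C4[of w "c k" v d] wc v d wd dv n adj_commute[of d w] adj_commute[of v d] adj_commute[of "c k" d]
        adj_commute[of "c k" v] by auto
  qed
qed

lemma D_R:
  assumes k: "k \<in> I" and d: "d \<in> tD k" and x: "x \<in> tK k" "adj x a"
    and w: "w \<in> tR" and wd: "adj w d" and wx: "w \<noteq> x"
  shows "adj w x"
proof -
  have "d \<noteq> x" using d x(2) tD_simps(1) by metis
  have "w \<noteq> a" using d wd tD_simps(2) by metis
  have "a \<noteq> d" using d a_notin(1) by metis
  have "adj d x" "adj w a"
    using \<open>d \<noteq> x\<close> \<open>w \<noteq> a\<close> K_clique[OF k in_K(3)[OF k d] x(1)] R_clique[OF w a_in_R] by blast+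
  then show ?thesis
    using C4[of w a x d] x d wd wx \<open>a \<noteq> d\<close> adj_commute[of d w] adj_commute[of a x] adj_commute[of x d]
    by auto
qed

lemma D_nbr:
  assumes k: "k \<in> I" and v: "v \<in> tD k" and vx: "adj v x"
  shows "x \<in> tK k \<or> x \<in> tA \<or> (\<exists>i\<in>I. i \<noteq> k \<and> x \<in> tAm i) \<or> x \<in> tC k \<or>
    (\<exists>i\<in>I. i \<noteq> k \<and> x \<in> tF i) \<or> x \<in> tU"
proof -
  have x: "x \<in> V" using vx adjD by blast
  note vK = in_K(3)[OF k v]
  have "x \<notin> tAm k"
  proof
    assume w: "x \<in> tAm k"
    have "v \<noteq> a" "x \<noteq> b k" using v w k by auto
    then show False using C4[of v x a "b k"] vx v w k Am_a[OF w k] by simp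
  qed
  then have "j \<noteq> k" if "x \<in> tAm j" for j using that by blast
  moreover have "j = k" if "j \<in> I" "x \<in> tB j \<or> x \<in> tX j \<or> x \<in> tD j" for j
    using KK_anti[OF k that(1) _ vK] in_K[OF that(1)] that(2) vx by blast
  moreover have "x \<in> tK k" if "j \<in> I" "x \<in> tB j \<or> x \<in> tX j \<or> x \<in> tD j" for j
    using calculation(2)[OF that] in_K[OF k] that(2) by blast
  moreover have "x \<in> tC k" if "j \<in> I" "x \<in> tC j" for j
    using K_C_anti[OF k that(1) _ vK that(2)] that vx by blast
  moreover have "j \<noteq> k" if "x \<in> tF j" for j using F_D_anti[OF k v] that vx adj_sym by blast
  moreover have "x \<notin> tY" using D_Y_anti[OF k v] vx by blast
  ultimately show ?thesis using types[OF x] by blast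
qed

lemma R_cases: "w \<in> tA \<or> w \<in> tU \<or> (\<exists>i\<in>I. i \<noteq> k \<and> w \<in> tF i) \<Longrightarrow> w \<in> tR"
  using in_R by blast

text \<open>The exceptions form a clique inside \<open>tK k\<close> and have no neighbours in
  \<open>tC k\<close> by \<open>K_C_top\<close>. The outside neighbours that remain, in
  \<open>tK k\<close>, in \<open>tR\<close> and among the \<open>tAm i\<close>, are pairwise
  adjacent, so \<open>clique_attachment\<close> rules the exceptions out.\<close>

lemma D_c:
  assumes k: "k \<in> I" and v: "v \<in> tD k"
  shows "adj v (c k)"
proof (rule ccontr)
  assume nv: "\<not> adj v (c k)"
  define S where "S = {v \<in> tD k. \<not> adj v (c k)}"
  have SK: "s \<in> tD k" "s \<in> tK k" "\<not> adj s (c k)" if "s \<in> S" for s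
    using that in_K(3)[OF k] by (auto simp: S_def)
  have cl: "adj x y" if "x \<in> S" "y \<in> S" "x \<noteq> y" for x y using K_clique[OF k] SK that by blast
  have "S \<noteq> {}" "S \<subseteq> V" using v nv in_type_V by (auto simp: S_def)
  then obtain x y d d' where xy: "x \<notin> S" "y \<notin> S" "d \<in> S" "d' \<in> S" "adj d x" "adj d' y"
      "x \<noteq> y" "\<not> adj x y"
    using clique_attachment[of S] cl by blast
  let ?R = "\<lambda>w. w \<in> tA \<or> w \<in> tU \<or> (\<exists>i\<in>I. i \<noteq> k \<and> w \<in> tF i)"
  let ?M = "\<lambda>w. \<exists>i\<in>I. i \<noteq> k \<and> w \<in> tAm i"
  have n: "x \<in> tK k \<or> ?R x \<or> ?M x" if "x \<notin> S" "d \<in> S" "adj d x" for x d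
    using D_nbr[OF k SK(1)[OF that(2)] that(3)] K_C_top[OF k SK(2,3)[OF that(2)]] that by blast
  have KR: "adj x y" if "x \<in> tK k" "x \<notin> S" "?R y" "d \<in> S" "adj d y" "x \<noteq> y" for x y d
  proof -
    have yd: "adj y d" using that adj_sym by blast
    show ?thesis
    proof (cases "adj x (c k)")
      case True
      then show ?thesis using K_R[OF k SK(2,3)[OF that(4)] that(1) True that(3) yd] adj_sym by blast
    next
      case False
      then have "adj x a" using K_a[OF k that(1)] that(2) by (auto simp: S_def)
      then show ?thesis
        using D_R[OF k SK(1)[OF that(4)] that(1) _ R_cases[OF that(3)] yd] that(6) adj_sym by blast
    qed
  qed
  have M: "adj x y" if M: "?M x" "y \<in> tK k \<or> ?R y \<or> ?M y" "x \<noteq> y" for x y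
  proof -
    obtain i where i: "i \<in> I" "i \<noteq> k" "x \<in> tAm i" using M(1) by blast
    have "adj x y" if My: "?M y"
    proof -
      obtain j where j: "j \<in> I" "y \<in> tAm j" using My by blast
      then show ?thesis using Am_unique[OF i(1) j(1) i(3) j(2)] Am_clique i(3) \<open>x \<noteq> y\<close> by blast
    qed
    then show ?thesis using M(2) Am_K[OF i(1) k i(2,3)] A_Am[OF _ i(3,1)] Am_U[OF _ i(3,1)] Am_F[OF i(1) _ i(3)]
      by blast
  qed
  have K: "adj x y" if "x \<in> tK k" "y \<in> tK k" "x \<noteq> y" for x y using K_clique[OF k that] .
  have R: "adj x y" if "?R x" "?R y" "x \<noteq> y" for x y using R_clique R_cases that by blast
  have "x \<in> tK k \<or> ?R x \<or> ?M x" "y \<in> tK k \<or> ?R y \<or> ?M y" using n xy by blast+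
  then show False
    using K[of x y] R[of x y] KR[of x y d'] KR[of y x d] M[of x y] M[of y x] xy adj_commute[of x y] by metis
qed

text \<open>A missing edge would leave the path \<open>x\<close>, \<open>b k\<close>,
  \<open>c k\<close> anticomplete to the path \<open>b i\<close>, \<open>f\<close>,
  \<open>b j\<close>.\<close>

lemma X_F_adj:
  assumes k: "k \<in> I" and x: "x \<in> tX k" and f: "f \<in> tF k"
  shows "adj x f"
proof (rule ccontr)
  assume n: "\<not> adj x f"
  obtain i j where ij: "i \<in> I" "j \<in> I" "i \<noteq> k" "j \<noteq> k" "i \<noteq> j" by (rule pick2)
  have "x \<noteq> c k" using x k by auto
  then show False using twoP3[of x "b k" "c k" "b i" f "b j"] x f k n ij by simp
qed

lemma Y_F_adj:
  assumes k: "k \<in> I" and y: "y \<in> tY" and f: "f \<in> tF k"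
  shows "adj y f"
proof (rule ccontr)
  assume n: "\<not> adj y f"
  obtain i j where ij: "i \<in> I" "j \<in> I" "i \<noteq> k" "j \<noteq> k" "i \<noteq> j" by (rule pick2)
  have "y \<noteq> b k" using y k by auto
  then show False using twoP3[of y "c k" "b k" "b i" f "b j"] y f k n ij by simp
qed

text \<open>Without \<open>tF k\<close>, every outside neighbour of the clique \<open>tX k\<close>
  either belongs to \<open>tK k\<close> and sees \<open>c k\<close>, or lies in some
  \<open>tAm i\<close>, or lies in \<open>tR\<close> and falls under \<open>K_R\<close>. These are
  pairwise adjacent, against \<open>clique_attachment\<close>. This is why \<open>X\<close> cannot
  occur without \<open>F\<close>.\<close>

lemma X_F:
  assumes k: "k \<in> I" and v: "v \<in> tX k"
  shows "tF k \<noteq> {}"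
proof
  assume F: "tF k = {}"
  let ?S = "tX k"
  have cl: "adj x y" if "x \<in> ?S" "y \<in> ?S" "x \<noteq> y" for x y using K_clique[OF k] in_K(2)[OF k] that by blast
  have "?S \<noteq> {}" "?S \<subseteq> V" using v in_type_V by blast+
  then obtain x y d d' where xy: "x \<notin> ?S" "y \<notin> ?S" "d \<in> ?S" "d' \<in> ?S" "adj d x" "adj d' y"
      "x \<noteq> y" "\<not> adj x y"
    using clique_attachment[of ?S] cl by blast
  let ?R = "\<lambda>w. w \<in> tA \<or> w \<in> tU \<or> (\<exists>i\<in>I. i \<noteq> k \<and> w \<in> tF i)"
  let ?M = "\<lambda>w. \<exists>i\<in>I. i \<noteq> k \<and> w \<in> tAm i"
  let ?K = "\<lambda>w. w \<in> tK k \<and> adj w (c k)"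
  have n: "?K x \<or> ?R x \<or> ?M x" if x: "x \<notin> ?S" and d: "d \<in> ?S" and dx: "adj d x" for x d
  proof -
    have xV: "x \<in> V" using dx adjD by blast
    note dK = in_K(2)[OF k d]
    have ndc: "\<not> adj d (c k)" using d k by simp
    have "x \<notin> tAm k"
    proof
      assume w: "x \<in> tAm k"
      obtain j where j: "j \<in> I" "j \<noteq> k" by (rule pick3[of k k])
      show False using C6[of x d "b k" "c k" "c j" "b j"] w d k j dx adj_commute[of x d] by simp
    qed
    then have "j \<noteq> k" if "x \<in> tAm j" for j using that by blast
    moreover have "j = k" if "j \<in> I" "x \<in> tB j \<or> x \<in> tX j \<or> x \<in> tD j" for j
      using KK_anti[OF k that(1) _ dK] in_K[OF that(1)] that(2) dx by blast
    moreover have "?K x" if "x \<in> tB k \<or> x \<in> tD k" using that in_K D_c k by auto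
    moreover have "x \<notin> tC j" if "j \<in> I" for j
      using K_C_anti[OF k that _ dK] K_C_top[OF k dK ndc] dx by blast
    moreover have "?K x" if "j \<in> I" "x \<in> tB j \<or> x \<in> tX j \<or> x \<in> tD j" for j
      using calculation(2,3) that x by blast
    moreover have "x \<notin> tY" using X_Y_anti[OF k d] dx by blast
    moreover have "j \<noteq> k" if "x \<in> tF j" for j using F that by blast
    ultimately show ?thesis using types[OF xV] by blast
  qed
  have adjKR: "adj x y" if "?K x" "?R y" "d \<in> ?S" "adj d y" for x y d
    using K_R[OF k in_K(2)[OF k that(3)] _ _ _ that(2)] that k adj_sym by (metis tX_simps(3))
  have adjM: "adj x y" if M: "?M x" "?K y \<or> ?R y \<or> ?M y" "x \<noteq> y" for x y
  proof -
    obtain i where i: "i \<in> I" "i \<noteq> k" "x \<in> tAm i" using M(1) by blast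
    have "adj x y" if My: "?M y"
    proof -
      obtain j where j: "j \<in> I" "y \<in> tAm j" using My by blast
      then show ?thesis using Am_unique[OF i(1) j(1) i(3) j(2)] Am_clique i(3) \<open>x \<noteq> y\<close> by blast
    qed
    then show ?thesis using M(2) Am_K[OF i(1) k i(2,3)] A_Am[OF _ i(3,1)] Am_U[OF _ i(3,1)] Am_F[OF i(1) _ i(3)]
      by blast
  qed
  have adjK: "adj x y" if "?K x" "?K y" "x \<noteq> y" for x y using K_clique[OF k] that by blast
  have adjR: "adj x y" if "?R x" "?R y" "x \<noteq> y" for x y using R_clique R_cases that by blast
  have nx: "?K x \<or> ?R x \<or> ?M x" and ny: "?K y \<or> ?R y \<or> ?M y" using n xy by blast+
  have yx: "\<not> adj y x" "y \<noteq> x" using xy adj_sym by blast+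
  consider (M) "?M x" | (M') "?M y" | (K) "?K x" "?K y" | (R) "?R x" "?R y" | (KR) "?K x" "?R y"
    | (RK) "?R x" "?K y"
    using nx ny by sat
  then show False
  proof cases
    case M then show False using adjM[OF M ny] xy by blast
  next
    case M' then show False using adjM[OF M' nx] yx by blast
  next
    case K then show False using adjK[OF K] xy by blast
  next
    case R then show False using adjR[OF R] xy by blast
  next
    case KR then show False using adjKR[OF KR xy(4,6)] xy by blast
  next
    case RK then show False using adjKR[OF RK(2,1) xy(3,5)] yx by blast
  qed
qed

text \<open>A vertex \<open>f\<close> of \<open>tF k\<close>, which exists by \<open>X_F\<close>, is
  adjacent to both \<open>x\<close> and \<open>w\<close>; as it misses \<open>b k\<close>, the
  4-cycle \<open>x f w (b k)\<close> needs the chord \<open>x w\<close>.\<close>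

lemma X_A:
  assumes k: "k \<in> I" and x: "x \<in> tX k" and w: "w \<in> tA"
  shows "adj x w" "adj w x"
proof -
  obtain f where f: "f \<in> tF k" using X_F[OF k x] by blast
  have "\<not> adj f (b k)" "adj w (b k)" using f w k by simp_all
  then have "f \<noteq> w" by blast
  then have "adj f w" using R_clique in_R f w k by blast
  moreover have "x \<noteq> w"
  proof -
    obtain j where "j \<in> I" "j \<noteq> k" by (rule pick3[of k k])
    then show ?thesis using tX_simps(5)[OF x] tA_simps(1)[OF w] by blast
  qed
  moreover have "f \<noteq> b k" using f k by auto
  ultimately show "adj x w"
    using C4[of x f w "b k"] X_F_adj[OF k x f] x w k f by simp
  then show "adj w x" using adj_sym by blast
qed

text \<open>If no vertex of \<open>tD k\<close> had a neighbour in \<open>tA\<close> or in some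
  \<open>tAm i\<close>, its outside neighbours would lie in \<open>tK k\<close>,
  \<open>tC k\<close>, \<open>tU\<close> and the other \<open>tF i\<close>, and these are pairwise
  adjacent.\<close>

lemma D_roof:
  assumes k: "k \<in> I" and v: "v \<in> tD k"
  obtains d w where "d \<in> tD k" "adj d w" "w \<in> tA \<or> (\<exists>i\<in>I. i \<noteq> k \<and> w \<in> tAm i)"
proof (rule ccontr)
  note ob = that
  assume no: "\<not> thesis"
  let ?S = "tD k"
  have cl: "adj x y" if "x \<in> ?S" "y \<in> ?S" "x \<noteq> y" for x y using K_clique[OF k] in_K(3)[OF k] that by blast
  have "?S \<noteq> {}" "?S \<subseteq> V" using v in_type_V by blast+
  then obtain x y d d' where xy: "x \<notin> ?S" "y \<notin> ?S" "d \<in> ?S" "d' \<in> ?S" "adj d x" "adj d' y"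
      "x \<noteq> y" "\<not> adj x y"
    using clique_attachment[of ?S] cl by blast
  let ?R = "\<lambda>w. w \<in> tU \<or> (\<exists>i\<in>I. i \<noteq> k \<and> w \<in> tF i)"
  let ?K = "\<lambda>w. w \<in> tK k \<and> adj w a"
  have n: "?K x \<or> ?R x \<or> x \<in> tC k" if "x \<notin> ?S" "d \<in> ?S" "adj d x" for x d
    using D_nbr[OF k that(2,3)] ob[OF that(2,3)] no K_a[OF k _ that(1)] by blast
  have KC: "adj x y" if x: "?K x" "x \<notin> ?S" and y: "y \<in> tC k" and d: "d \<in> ?S" "adj d y" for x y d
  proof (rule ccontr)
    assume nxy: "\<not> adj x y"
    obtain j where j: "j \<in> I" "j \<noteq> k" by (rule pick3[of k k])
    have "adj x d" using K_clique[OF k _ in_K(3)[OF k d(1)]] x d(1) by blast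
    moreover have "x \<in> tK k" "adj a x" using x adj_sym by blast+
    ultimately show False using C6[of x d y "c j" "b j" a] y d nxy k j by simp
  qed
  have KR: "adj x y" if "?K x" "?R y" "d \<in> ?S" "adj d y" "x \<noteq> y" for x y d
    using D_R[OF k that(3)] that R_cases adj_sym by blast
  have CR: "adj x y" if "x \<in> tC k" "?R y" for x y
    using C_U[OF k that(1)] C_F[OF k _ _ that(1)] that(2) by blast
  have K: "adj x y" if "?K x" "?K y" "x \<noteq> y" for x y using K_clique[OF k] that by blast
  have R: "adj x y" if "?R x" "?R y" "x \<noteq> y" for x y using R_clique R_cases that by blast
  have "?K x \<or> ?R x \<or> x \<in> tC k" "?K y \<or> ?R y \<or> y \<in> tC k" using n xy by blast+
  then show False
    using K[of x y] R[of x y] KR[of x y d'] KR[of y x d] KC[of x y d'] KC[of y x d] CR[of x y] CR[of y x]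
      C_C[OF k k, of x y] xy adj_commute[of x y] by metis
qed

text \<open>The neighbour \<open>w\<close> from \<open>D_roof\<close> lies in \<open>tA\<close>,
  since a member of some \<open>tAm i\<close> would give a 6-cycle through \<open>c i\<close> and
  \<open>c k\<close>. It can replace \<open>a\<close>: every neighbour of \<open>a\<close> is also
  one of \<open>w\<close>, and \<open>v\<close> is a neighbour of \<open>w\<close> only, so the
  degree sum would grow.\<close>

lemma D_empty:
  assumes k: "k \<in> I"
  shows "tD k = {}"
proof (rule ccontr)
  assume "tD k \<noteq> {}"
  then obtain v w where v: "v \<in> tD k" and vw: "adj v w" and w: "w \<in> tA \<or> (\<exists>i\<in>I. i \<noteq> k \<and> w \<in> tAm i)"
    using D_roof[OF k] by blast
  note vc = D_c[OF k v]
  have va: "v \<noteq> a" using v a_notin(1) by blast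
  note vK = in_K(3)[OF k v]
  have wA: "w \<in> tA"
  proof (rule ccontr)
    assume "w \<notin> tA"
    then obtain i where i: "i \<in> I" "i \<noteq> k" "w \<in> tAm i" using w by blast
    then show False
      using C6[of v w a "b i" "c i" "c k"] v vw vc k Am_a[OF i(3,1)] adj_commute[of v "c k"] by simp
  qed
  have "tpyramid t w b c"
    unfolding tpyramid_def I_def[symmetric] using t_ge wA by auto
  moreover have "deg a < deg w"
  proof (rule deg_less)
    show "cadj w v" "\<not> cadj a v" using va vw v adj_sym by (auto simp: cadj_def)
    fix u assume u: "cadj a u"
    show "cadj w u"
    proof (cases "u = w \<or> u = a")
      case True
      then show ?thesis using R_clique[OF in_R(1)[OF wA] a_in_R] by (auto simp: cadj_def)
    next
      case False
      then have au: "adj a u" and ne: "u \<noteq> w" using u by (auto simp: cadj_def)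
      then have uV: "u \<in> V" using adjD by blast
      have B: "adj w u" if j: "j \<in> I" "u \<in> tB j" for j
      proof (rule ccontr)
        assume n: "\<not> adj w u"
        show False
        proof (cases "j = k")
          case True
          have "u \<noteq> v" using au v by auto
          then have "adj v u" using K_clique[OF k vK in_K(1)[OF k]] j True by blast
          moreover have "adj w a" using R_clique[OF in_R(1)[OF wA] a_in_R] vw v by (metis tD_simps(1))
          ultimately show False
            using C4[of w v u a] vw v va ne n au \<open>u \<noteq> v\<close> adj_commute[of a u] adj_commute[of a w] adj_commute[of v w]
            by auto
        next
          case False
          have "\<not> adj v u" using KK_anti[OF k j(1) _ vK in_K(1)[OF j]] False by blast
          moreover have "adj w a" using R_clique[OF in_R(1)[OF wA] a_in_R] vw v by (metis tD_simps(1))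
          ultimately show False
            using C6[of u a w v "c k" "c j"] vw v vc n au j k wA False adj_commute[of u v]
              adj_commute[of u w] adj_commute[of a u] adj_commute[of a w] adj_commute[of v w]
            by simp
        qed
      qed
      have "u \<notin> tY" "u \<notin> tC j" "u \<notin> tD j" for j
        using au tC_simps(2) tD_simps(2) tY_simps(2) by blast+
      then consider "u \<in> tR" | j where "j \<in> I" "u \<in> tAm j" | j where "j \<in> I" "u \<in> tB j"
        | j where "j \<in> I" "u \<in> tX j"
        using types[OF uV] in_R by blast
      then have "adj w u"
        by cases (use R_clique[OF in_R(1)[OF wA]] A_Am[OF wA] B X_A wA ne in blast)+
      then show ?thesis by (simp add: cadj_def)
    qed
  qed
  ultimately show False using swap_a by blast
qed

text \<open>Otherwise \<open>v\<close> could replace \<open>b k\<close>: by 4- and 6-cycles through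
  \<open>v\<close> and \<open>y\<close>, every neighbour of \<open>b k\<close> is also one of
  \<open>v\<close>, while \<open>y\<close> is a neighbour of \<open>v\<close> only.\<close>

lemma Y_B_anti:
  assumes k: "k \<in> I" and v: "v \<in> tB k" and y: "y \<in> tY"
  shows "\<not> adj y v"
proof
  assume yv: "adj y v"
  have vb: "v \<noteq> b k" using yv y k by auto
  note vK = in_K(1)[OF k v]
  have "adj v (b k)" using B_b[OF k v] vb by (simp add: cadj_def)
  have "tpyramid t a (b(k := v)) c"
    unfolding tpyramid_def I_def[symmetric] using t_ge v k by auto
  moreover have "deg (b k) < deg v"
  proof (rule deg_less)
    have "y \<noteq> b k" using y k by auto
    then show "cadj v y" "\<not> cadj (b k) y" using yv y k adj_sym by (auto simp: cadj_def)
    fix u assume u: "cadj (b k) u"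
    show "cadj v u"
    proof (cases "u = b k \<or> u = v")
      case True
      then show ?thesis using \<open>adj v (b k)\<close> by (auto simp: cadj_def)
    next
      case False
      then have bu: "adj (b k) u" and ne: "u \<noteq> v" using u by (auto simp: cadj_def)
      then have uV: "u \<in> V" using adjD by blast
      obtain j where j: "j \<in> I" "j \<noteq> k" by (rule pick3[of k k])
      have A: "adj v u" if "u \<in> tA"
      proof (rule ccontr)
        assume "\<not> adj v u"
        then show False
          using C6[of u "b k" v y "c j" "b j"] that yv v y k j \<open>adj v (b k)\<close> A_C_anti[of u k y]
            adj_commute[of v u] adj_commute[of y v] adj_commute[of "b k" v] by simp
      qed
      have C: "adj v u" if "u \<in> tC k"
      proof -
        have "u \<noteq> y" using that y k tC_simps(5) tY_simps(3) by metis
        then have "adj y u" using M_clique[OF k in_M(2)[OF k y] in_M(1)[OF k that]] by blast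
        moreover have "y \<noteq> b k" using y k by auto
        ultimately show ?thesis
          using C4[of y v "b k" u] yv bu \<open>adj v (b k)\<close> y k ne adj_commute[of u y] by auto
      qed
      have K: "adj v u" if "u \<in> tK k" using K_clique[OF k vK that] ne by blast
      have F: "adj v u" if "i \<in> I" "i \<noteq> k" "u \<in> tF i" for i
        using a_c[OF k, of v u] that v k F_a[of i u] ne by simp
      have U: "adj v u" if "u \<in> tU" using a_c[OF k, of v u] that v k U_a[of u] ne by simp
      have ex: "u \<notin> tY" "u \<in> tAm j \<Longrightarrow> j \<noteq> k" "u \<in> tX j \<Longrightarrow> j = k" "u \<in> tB j \<Longrightarrow> j = k"
        "u \<in> tC j \<Longrightarrow> j = k" "u \<in> tF j \<Longrightarrow> j \<noteq> k" for j
        using bu k tY_simps(4)[of u k] tAm_simps(2)[of u j k] tX_simps(6)[of u j k]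
          tB_simps(6)[of u j k] tC_simps(6)[of u j k] tF_simps(2)[of u j k] by metis+
      consider "u \<in> tA" | "u \<in> tU" | i where "i \<in> I" "i \<noteq> k" "u \<in> tAm i" | "u \<in> tK k"
        | "u \<in> tC k" | i where "i \<in> I" "i \<noteq> k" "u \<in> tF i"
        using types[OF uV] ex in_K[OF k] D_empty by blast
      then have "adj v u"
        by cases (use A C K F U Am_K[OF _ k _ _ vK] adj_sym in blast)+
      then show ?thesis by (simp add: cadj_def)
    qed
  qed
  ultimately show False using swap_b[OF k] by blast
qed

text \<open>If all \<open>tF j\<close> were empty, the outside neighbours of the clique
  \<open>tY\<close> would lie in \<open>tU\<close> and the \<open>tC k\<close>, which are pairwise
  adjacent.\<close>

lemma Y_F:
  assumes "y \<in> tY"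
  obtains j f where "j \<in> I" "f \<in> tF j"
proof (rule ccontr)
  note ob = that
  assume no: "\<not> thesis"
  obtain k where k: "k \<in> I" using pick2 by blast
  have cl: "adj x y" if "x \<in> tY" "y \<in> tY" "x \<noteq> y" for x y
    using M_clique[OF k in_M(2)[OF k] in_M(2)[OF k]] that by blast
  have "tY \<noteq> {}" "tY \<subseteq> V" using assms in_type_V by blast+
  then obtain x y d d' where xy: "x \<notin> tY" "y \<notin> tY" "d \<in> tY" "d' \<in> tY" "adj d x" "adj d' y"
      "x \<noteq> y" "\<not> adj x y"
    using clique_attachment[of tY] cl by blast
  have n: "x \<in> tU \<or> (\<exists>k\<in>I. x \<in> tC k)" if "x \<notin> tY" "d \<in> tY" "adj d x" for x d
  proof -
    have x: "x \<in> V" using that adjD by blast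
    have xd: "adj x d" using that(3) adj_sym by blast
    have Am: "x \<notin> tA \<union> (\<Union>i\<in>I. tAm i)" using A_C_anti[of x k d] k xd that(2) by blast
    have "x \<notin> tA" "x \<notin> tY" using Am that(1) by blast+
    moreover have "x \<notin> tAm j" if "j \<in> I" for j using Am that by blast
    moreover have "x \<notin> tB j" "x \<notin> tX j" "x \<notin> tD j" "x \<notin> tF j" if "j \<in> I" for j
      using Y_B_anti[OF that _ \<open>d \<in> tY\<close>] X_Y_anti[OF that _ \<open>d \<in> tY\<close>] D_empty[OF that]
        \<open>adj d x\<close> xd no ob[OF that] by blast+
    ultimately show ?thesis using types[OF x] by auto
  qed
  then have "x \<in> tU \<or> (\<exists>k\<in>I. x \<in> tC k)" "y \<in> tU \<or> (\<exists>k\<in>I. y \<in> tC k)" using xy by blast+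
  then show False using C_C C_U R_clique in_R(2) xy adj_sym by metis
qed

text \<open>A vertex of \<open>tU\<close> would be universal. Only its adjacency to
  \<open>tX k\<close> and \<open>tY\<close> needs an intermediary, a vertex of \<open>F\<close>
  supplied by \<open>X_F\<close> or \<open>Y_F\<close>, which is complete to these types by the path
  arguments above.\<close>

lemma U_empty: "tU = {}"
proof (rule ccontr)
  assume "tU \<noteq> {}"
  then obtain u where u: "u \<in> tU" by blast
  then have "u \<in> V" using in_type_V by blast
  then obtain v where v: "v \<in> V" "v \<noteq> u" "\<not> adj v u" using nonadj_exists by blast
  note uR = in_R(2)[OF u]
  have X: False if k: "k \<in> I" and x: "v \<in> tX k" for k
  proof -
    obtain f where f: "f \<in> tF k" using X_F[OF k x] by blast
    have "\<not> adj f (b k)" "adj u (b k)" using f u k by simp_all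
    then have "f \<noteq> u" by blast
    then have "adj f u" using R_clique[OF in_R(3)[OF k f] uR] by blast
    moreover have "f \<noteq> b k" using f k by auto
    ultimately show False using C4[of v f u "b k"] X_F_adj[OF k x f] v x k f u by simp
  qed
  have Y: False if y: "v \<in> tY"
  proof -
    obtain j f where f: "j \<in> I" "f \<in> tF j" by (rule Y_F[OF y])
    have "\<not> adj f (b j)" "adj u (b j)" using f u by simp_all
    then have "f \<noteq> u" by blast
    then have "adj f u" using R_clique[OF in_R(3)[OF f] uR] by blast
    moreover have "f \<noteq> c j" using f by auto
    ultimately show False using C4[of v f u "c j"] Y_F_adj[OF f(1) y f(2)] v y f u by simp
  qed
  have B: "adj v u" if "k \<in> I" "v \<in> tB k" for k
    using a_c[OF that(1), of v u] that u U_a[OF u] v by simp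
  have "v \<notin> tR" using R_clique[OF _ uR, of v] v by blast
  then have "v \<notin> tA" "v \<notin> tU" "j \<in> I \<Longrightarrow> v \<notin> tF j" for j using in_R by blast+
  moreover have "v \<notin> tAm j" "v \<notin> tC j" "v \<notin> tB j" "v \<notin> tD j" "v \<notin> tX j" if "j \<in> I" for j
    using Am_U[OF u _ that] C_U[OF that _ u] B[OF that] D_empty[OF that] X[OF that] v by blast+
  ultimately show False using types[OF v(1)] Y by auto
qed

end

section \<open>Nested orders and partitions\<close>

lemma nested_orderI:
  assumes "finite X" "finite Y" and top: "x0 \<in> X" "\<And>y. y \<in> Y \<Longrightarrow> E x0 y"
    and chain: "\<And>x x'. x \<in> X \<Longrightarrow> x' \<in> X \<Longrightarrow>
      {y \<in> Y. E x y} \<subseteq> {y \<in> Y. E x' y} \<or> {y \<in> Y. E x' y} \<subseteq> {y \<in> Y. E x y}"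
  obtains xs where "nested_order E X Y xs"
proof -
  obtain xs where xs: "distinct xs" "set xs = X"
    "\<And>i j. i \<le> j \<Longrightarrow> j < length xs \<Longrightarrow> {y \<in> Y. E (xs ! j) y} \<subseteq> {y \<in> Y. E (xs ! i) y}"
    by (rule chain_list[of X "\<lambda>x. {y \<in> Y. E x y}"]) (use assms in auto)
  obtain i where "i < length xs" "xs ! i = x0" using top(1) xs(2) by (metis in_set_conv_nth)
  then have "Y \<subseteq> {y \<in> Y. E (xs ! 0) y}" using xs(3)[of 0 i] top(2) by blast
  moreover have "xs \<noteq> []" using xs(2) top(1) by auto
  ultimately have "nested_order E X Y xs" using xs unfolding nested_order_def by auto
  then show thesis by (rule that)
qed

lemma partition_listI:
  assumes "\<Union> (set Ps) = Q" and disj: "sorted_wrt (\<lambda>S T. S \<inter> T = {}) Ps"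
  shows "partition_list Q Ps"
  unfolding partition_list_def
proof (intro conjI allI impI)
  show "\<Union> (set Ps) = Q" by fact
  fix i j assume "i < length Ps" "j < length Ps" "i \<noteq> j"
  then show "Ps ! i \<inter> Ps ! j = {}"
    using sorted_wrt_nth_less[OF disj, of i j] sorted_wrt_nth_less[OF disj, of j i]
    by (cases i j rule: linorder_cases) auto
qed

lemma villa_parts_disjoint:
  assumes "\<And>i. i \<in> {1..t} \<Longrightarrow> A \<inter> B i = {} \<and> A \<inter> C i = {}"
    and "\<And>i j. i \<in> {1..t} \<Longrightarrow> j \<in> {1..t} \<Longrightarrow> B i \<inter> C j = {}"
    and "\<And>i j. i \<in> {1..t} \<Longrightarrow> j \<in> {1..t} \<Longrightarrow> i \<noteq> j \<Longrightarrow> B i \<inter> B j = {} \<and> C i \<inter> C j = {}"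
  shows "sorted_wrt (\<lambda>S T. S \<inter> T = {}) (villa_parts t A B C)"
proof -
  have s: "sorted_wrt (\<lambda>i j. i \<noteq> j \<and> i \<in> {1..t} \<and> j \<in> {1..t}) [1..<t + 1]"
    by (rule sorted_wrt_mono_rel[OF _ sorted_wrt_upt]) auto
  have "sorted_wrt (\<lambda>i j. B i \<inter> B j = {}) [1..<t + 1]" "sorted_wrt (\<lambda>i j. C i \<inter> C j = {}) [1..<t + 1]"
    by (rule sorted_wrt_mono_rel[OF _ s]; use assms(3) in blast)+
  moreover have "set [1..<t + 1] = {1..t}" by auto
  ultimately show ?thesis
    using assms(1,2)
    unfolding villa_parts_def sorted_wrt.simps sorted_wrt_append sorted_wrt_map set_append set_map
    by blast
qed

lemma Union_villa_parts: "\<Union> (set (villa_parts t A B C)) = A \<union> (\<Union>i\<in>{1..t}. B i) \<union> (\<Union>i\<in>{1..t}. C i)"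
proof -
  have "{1..<Suc t} = {1..t}" by auto
  then show ?thesis unfolding villa_parts_def by auto
qed

context simple_graph
begin

lemma clique_adjI: "(\<And>x y. x \<in> S \<Longrightarrow> y \<in> S \<Longrightarrow> x \<noteq> y \<Longrightarrow> adj x y) \<Longrightarrow> clique E S"
  by (auto simp: clique_def adj_def)

lemma complete_adjI: "(\<And>x y. x \<in> S \<Longrightarrow> y \<in> T \<Longrightarrow> adj x y) \<Longrightarrow> complete E S T"
  by (auto simp: complete_def adj_def)

lemma anticomplete_adjI:
  "S \<subseteq> V \<Longrightarrow> T \<subseteq> V \<Longrightarrow> (\<And>x y. x \<in> S \<Longrightarrow> y \<in> T \<Longrightarrow> \<not> adj x y) \<Longrightarrow> anticomplete E S T"
  by (auto simp: anticomplete_def adj_def)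

end

context free_graph
begin

text \<open>Two members of one clique with incomparable neighbourhoods in another clique form an
  induced 4-cycle with their private neighbours. The vertex \<open>x0\<close> only has to be a
  largest element of the chain; it need not be first in the resulting list.\<close>

lemma nested_order_cliques:
  assumes V: "X \<subseteq> V" "Y \<subseteq> V" and disj: "X \<inter> Y = {}"
    and X: "\<And>x y. x \<in> X \<Longrightarrow> y \<in> X \<Longrightarrow> x \<noteq> y \<Longrightarrow> adj x y"
    and Y: "\<And>x y. x \<in> Y \<Longrightarrow> y \<in> Y \<Longrightarrow> x \<noteq> y \<Longrightarrow> adj x y"
    and top: "x0 \<in> X" "\<And>y. y \<in> Y \<Longrightarrow> adj x0 y"
  obtains xs where "nested_order E X Y xs"
proof -
  have chain: "{y \<in> Y. E x y} \<subseteq> {y \<in> Y. E x' y} \<or> {y \<in> Y. E x' y} \<subseteq> {y \<in> Y. E x y}"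
    if x: "x \<in> X" "x' \<in> X" for x x'
  proof (rule ccontr)
    assume "\<not> ?thesis"
    then obtain y y' where "y \<in> Y" "E x y" "\<not> E x' y" "y' \<in> Y" "E x' y'" "\<not> E x y'" by blast
    then have y: "y \<in> Y" "adj x y" "\<not> adj x' y" "y' \<in> Y" "adj x' y'" "\<not> adj x y'"
      using x V by (auto simp: adj_def)
    then have ne: "x \<noteq> x'" "y \<noteq> y'" "x \<noteq> y'" "y \<noteq> x'" using disj x by auto
    then have "adj y y'" "adj x' x" using X Y x y by blast+
    then show False using C4[of x y y' x'] y ne adj_sym by blast
  qed
  have "finite X" "finite Y" using V finite_V finite_subset by blast+
  moreover have "E x0 y" if "y \<in> Y" for y using top(2)[OF that] by (simp add: adj_def)
  ultimately show thesis using nested_orderI[of X Y x0 E] top(1) chain that by blast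
qed

end

section \<open>Assembling villas, mansions and 5-baskets\<close>

context best_pyramid
begin

definition tAA where "tAA = tA \<union> (\<Union>i\<in>I. tAm i)"

lemma tAA_simps:
  assumes w: "w \<in> tAA"
  shows "i \<in> I \<Longrightarrow> \<not> adj w (c i)" "\<exists>k. \<forall>i\<in>I. i \<noteq> k \<longrightarrow> adj w (b i)"
  using w unfolding tAA_def by auto

lemma AA_clique: "v \<in> tAA \<Longrightarrow> w \<in> tAA \<Longrightarrow> v \<noteq> w \<Longrightarrow> adj v w"
proof -
  assume vw: "v \<in> tAA" "w \<in> tAA" and ne: "v \<noteq> w"
  then consider "v \<in> tA" "w \<in> tA" | j where "v \<in> tA" "j \<in> I" "w \<in> tAm j"
    | j where "w \<in> tA" "j \<in> I" "v \<in> tAm j" | i j where "i \<in> I" "v \<in> tAm i" "j \<in> I" "w \<in> tAm j"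
    unfolding tAA_def by blast
  then show ?thesis
  proof cases
    case 1 then show ?thesis using R_clique[OF in_R(1) in_R(1) ne] by blast
  next
    case 2 then show ?thesis using A_Am by blast
  next
    case 3 then show ?thesis using A_Am by blast
  next
    case (4 i j)
    then have "i = j" using Am_unique by blast
    then show ?thesis using Am_clique 4 ne by blast
  qed
qed

lemma AA_R: "w \<in> tAA \<Longrightarrow> j \<in> I \<Longrightarrow> f \<in> tF j \<Longrightarrow> adj w f"
proof -
  assume w: "w \<in> tAA" and j: "j \<in> I" and f: "f \<in> tF j"
  obtain i where i: "i \<in> I" "i \<noteq> j" by (rule pick3[of j j])
  have "\<not> adj w (c i)" "adj f (c i)" using tAA_simps(1)[OF w] f i j by simp_all
  then have "w \<noteq> f" by blast
  then show ?thesis using w R_clique[OF in_R(1) in_R(3)[OF j f]] Am_F[OF _ j _ f] unfolding tAA_def by blast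
qed

lemma AA_C_anti: "w \<in> tAA \<Longrightarrow> k \<in> I \<Longrightarrow> v \<in> tC k \<Longrightarrow> \<not> adj w v"
  and AA_Y_anti: "w \<in> tAA \<Longrightarrow> v \<in> tY \<Longrightarrow> \<not> adj w v"
proof -
  show "w \<in> tAA \<Longrightarrow> k \<in> I \<Longrightarrow> v \<in> tC k \<Longrightarrow> \<not> adj w v" unfolding tAA_def using A_C_anti by blast
  obtain k where "k \<in> I" using pick2 by blast
  then show "w \<in> tAA \<Longrightarrow> v \<in> tY \<Longrightarrow> \<not> adj w v" unfolding tAA_def using A_C_anti by blast
qed

lemma V_types: "V = tAA \<union> (\<Union>k\<in>I. tB k) \<union> (\<Union>k\<in>I. tC k) \<union> (\<Union>k\<in>I. tF k) \<union> (\<Union>k\<in>I. tX k) \<union> tY"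
proof
  show "V \<subseteq> tAA \<union> (\<Union>k\<in>I. tB k) \<union> (\<Union>k\<in>I. tC k) \<union> (\<Union>k\<in>I. tF k) \<union> (\<Union>k\<in>I. tX k) \<union> tY"
    using types D_empty U_empty unfolding tAA_def by fast
  show "tAA \<union> (\<Union>k\<in>I. tB k) \<union> (\<Union>k\<in>I. tC k) \<union> (\<Union>k\<in>I. tF k) \<union> (\<Union>k\<in>I. tX k) \<union> tY \<subseteq> V"
    using in_type_V unfolding tAA_def by blast
qed

lemma types_disjoint:
  assumes k: "k \<in> I" and j: "j \<in> I"
  shows "tAA \<inter> tB k = {}" "tAA \<inter> tC k = {}" "tAA \<inter> tF k = {}" "tAA \<inter> tX k = {}" "tAA \<inter> tY = {}"
    "k \<noteq> j \<Longrightarrow> tB k \<inter> tB j = {}" "tB k \<inter> tC j = {}" "tB k \<inter> tF j = {}" "tB k \<inter> tX j = {}"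
    "tB k \<inter> tY = {}" "k \<noteq> j \<Longrightarrow> tC k \<inter> tC j = {}" "tC k \<inter> tF j = {}" "tC k \<inter> tX j = {}"
    "tC k \<inter> tY = {}" "tF k \<inter> tX j = {}" "tF k \<inter> tY = {}" "tX k \<inter> tY = {}"
proof -
  obtain i where i: "i \<in> I" "i \<noteq> k" "i \<noteq> j" by (rule pick3)
  obtain l where l: "l \<in> I" "l \<noteq> j" "l \<noteq> i" by (rule pick3)
  show "tAA \<inter> tB k = {}" using tAA_simps(1) tB_simps(3) k by blast
  show "tAA \<inter> tC k = {}" using tAA_simps(1) tC_simps(3) i by blast
  show "tAA \<inter> tF k = {}" using tAA_simps(1) tF_simps(3) i by blast
  show "tAA \<inter> tX k = {}"
  proof (rule ccontr)
    assume "tAA \<inter> tX k \<noteq> {}"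
    then obtain v where v: "v \<in> tAA" "v \<in> tX k" by blast
    obtain m where m: "\<And>i. i \<in> I \<Longrightarrow> i \<noteq> m \<Longrightarrow> adj v (b i)" using tAA_simps(2)[OF v(1)] by blast
    obtain n where "n \<in> I" "n \<noteq> k" "n \<noteq> m" by (rule pick3)
    then show False using m v(2) tX_simps(5) by blast
  qed
  show "tAA \<inter> tY = {}" using tAA_simps(1) tY_simps(5) k by blast
  show "tB k \<inter> tB j = {}" if "k \<noteq> j" using tB_simps(3) k j that by blast
  show "tB k \<inter> tC j = {}" using tB_simps(1) tC_simps(1) by blast
  show "tB k \<inter> tF j = {}" using tB_simps(3)[OF _ k i(1)] tF_simps(3)[OF _ i(1)] i by blast
  show "tB k \<inter> tX j = {}" using tB_simps(3)[OF _ k k] tX_simps(3)[OF _ j k] by blast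
  show "tB k \<inter> tY = {}" using tB_simps(1) tY_simps(1) by blast
  show "tC k \<inter> tC j = {}" if "k \<noteq> j" using tC_simps(5)[OF _ k] that by blast
  show "tC k \<inter> tF j = {}" using tC_simps(1) F_a j by blast
  show "tC k \<inter> tX j = {}" using tC_simps(1) tX_simps(1) by blast
  show "tC k \<inter> tY = {}" using tC_simps(5)[OF _ k] tY_simps(3)[OF _ k] by blast
  show "tF k \<inter> tX j = {}" using tF_simps(3)[OF _ i(1)] tX_simps(3)[OF _ j i(1)] i by blast
  show "tF k \<inter> tY = {}" using F_a k tY_simps(1) by blast
  show "tX k \<inter> tY = {}" using tX_simps(1) tY_simps(1) by blast
qed

lemma AA_pre:
  assumes w: "w \<in> tAA" and k: "k \<in> I" and u: "u \<in> tB k" and n: "\<not> adj w u" and i: "i \<in> I" "i \<noteq> k"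
  shows "adj w (b i)" "adj (b i) w"
proof -
  have "m = k" if "m \<in> I" "w \<in> tAm m" for m
    using Am_K[OF that(1) k _ that(2) in_K(1)[OF k u]] n by blast
  then show "adj w (b i)" using w i unfolding tAA_def by auto
  then show "adj (b i) w" by (rule adj_sym)
qed

text \<open>A fourth path would supply \<open>c l\<close> so that \<open>u\<close>,
  \<open>c k\<close>, \<open>c l\<close> and \<open>b i\<close>, \<open>w\<close>,
  \<open>b j\<close> form 2P3. This is the reason for the number three in 5-baskets.\<close>

lemma AA_B_small:
  assumes w: "w \<in> tAA" and k: "k \<in> I" and u: "u \<in> tB k" and n: "\<not> adj w u"
  shows "t = 3"
proof (rule ccontr)
  assume "t \<noteq> 3"
  then have t: "4 \<le> t" using t_ge by simp
  obtain i j where ij: "i \<in> I" "j \<in> I" "i \<noteq> k" "j \<noteq> k" "i \<noteq> j" by (rule pick2)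
  obtain l where l: "l \<in> I" "l \<noteq> i" "l \<noteq> k" "l \<noteq> j" by (rule pick4[OF t])
  have "u \<noteq> c l" using u l by auto
  then show False
    using twoP3[of "b i" w "b j" u "c k" "c l"] tAA_simps(1)[OF w] u k n ij l AA_pre[OF w k u n] by simp
qed

text \<open>Suppose that nonadjacencies occurred at two indices. If one vertex \<open>w\<close>
  misses members of both parts, 2P3 arises (\<open>both\<close>). Otherwise \<open>w\<close> and
  \<open>w'\<close> each see the vertex missed by the other, which gives the 6-cycle
  \<open>w w' u (c k) (c k') u'\<close>. The common index is the distinguished \<open>i0\<close> of
  the 5-basket.\<close>

lemma AA_B_unique:
  assumes w: "w \<in> tAA" and k: "k \<in> I" and u: "u \<in> tB k" and n: "\<not> adj w u"
    and w': "w' \<in> tAA" and k': "k' \<in> I" and u': "u' \<in> tB k'" and n': "\<not> adj w' u'"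
  shows "k = k'"
proof (rule ccontr)
  assume kk: "k \<noteq> k'"
  have uu: "\<not> adj u u'" using KK_anti[OF k k' kk in_K(1)[OF k u] in_K(1)[OF k' u']] .
  have both: False if w: "w \<in> tAA" and k: "k \<in> I" and u: "u \<in> tB k" and n: "\<not> adj w u"
    and k': "k' \<in> I" and u': "u' \<in> tB k'" and n': "\<not> adj w u'" and kk: "k \<noteq> k'" for w k u k' u'
  proof -
    have uu: "\<not> adj u u'" using KK_anti[OF k k' kk in_K(1)[OF k u] in_K(1)[OF k' u']] .
    obtain l where l: "l \<in> I" "l \<noteq> k" "l \<noteq> k'" by (rule pick3)
    have wk: "adj w (b k)" using AA_pre[OF w k' u' n' k kk] by blast
    then have "u \<noteq> b k" using n by auto
    then have bu: "adj (b k) u" using B_b[OF k u] adj_sym by (auto simp: cadj_def)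
    have bu': "\<not> adj (b k) u'" using u' kk k by simp
    have "w \<noteq> u" using tAA_simps(1)[OF w k] u k by auto
    moreover have "u' \<noteq> c l" using u' l by auto
    ultimately show False
      using twoP3[of w "b k" u u' "c k'" "c l"] wk bu bu' uu n n' tAA_simps(1)[OF w] u u' k k' l kk by simp
  qed
  show False
  proof (cases "adj w u' \<and> adj w' u")
    case False
    then show False using both[OF w k u n k' u' _ kk] both[OF w' k' u' n' k u] kk by blast
  next
    case True
    then have "w \<noteq> w'" using n by blast
    then have "adj w w'" using AA_clique w w' by blast
    then show False
      using C6[of w w' u "c k" "c k'" u'] True uu n n' tAA_simps(1)[OF w] tAA_simps(1)[OF w'] u u' k k' kk
        adj_commute[of u' w] adj_commute[of w' u'] by simp
  qed
qed

text \<open>A missing edge \<open>v x\<close> leaves a P3 through some \<open>c\<close> anticomplete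
  to a P3 centred at \<open>w\<close>. The exception, with \<open>i = k\<close> and \<open>w\<close>
  seeing \<open>v\<close>, is the 6-cycle \<open>w v u x (c j) (b j)\<close>.\<close>

lemma AA_B_C:
  assumes w: "w \<in> tAA" and k: "k \<in> I" and u: "u \<in> tB k" and n: "\<not> adj w u"
    and i: "i \<in> I" and v: "v \<in> tB i" and x: "x \<in> tC i"
  shows "adj v x"
proof (rule ccontr)
  assume vx: "\<not> adj v x"
  have "x \<noteq> c i" using vx v i by auto
  then have cx: "adj (c i) x" using C_c[OF i x] adj_sym by (auto simp: cadj_def)
  have nw: "\<not> adj w x" using AA_C_anti[OF w i x] .
  have vx': "v \<noteq> x" using v x tB_simps(1) tC_simps(1) by blast
  show False
  proof (cases "i = k")
    case True
    obtain j l where jl: "j \<in> I" "l \<in> I" "j \<noteq> k" "l \<noteq> k" "j \<noteq> l" by (rule pick2)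
    have *: False if v: "v \<in> tB k" and vx: "\<not> adj v x" and wv: "\<not> adj w v" for v
    proof -
      have "v \<noteq> x" using v x tB_simps(1) tC_simps(1) by blast
      then show False
        using twoP3[of v "c k" x "b j" w "b l"] cx vx wv nw tAA_simps(1)[OF w] AA_pre[OF w k u n] jl v x k True
          adj_commute[of v w] adj_commute[of x w] adj_commute[of "c k" w] by simp
    qed
    have wv: "adj w v" using *[of v] v vx True by blast
    have ux: "adj u x" using *[of u] u n by blast
    have "v \<noteq> u" using wv n by blast
    then have "adj v u" using K_clique[OF k in_K(1)[OF k] in_K(1)[OF k u]] v True by blast
    then show False
      using C6[of w v u x "c j" "b j"] wv ux vx n nw tAA_simps(1)[OF w] AA_pre[OF w k u n] jl u v x k True
      by simp
  next
    case False
    obtain l where l: "l \<in> I" "l \<noteq> k" "l \<noteq> i" by (rule pick3)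
    have wv: "adj w v" using AA_B_unique[OF w k u n w i v] False by blast
    have "\<not> adj u v" using KK_anti[OF k i _ in_K(1)[OF k u] in_K(1)[OF i v]] False by blast
    moreover have "\<not> adj u x" using K_C_anti[OF k i _ in_K(1)[OF k u] x] False by blast
    moreover have "u \<noteq> x" using u x tB_simps(1) tC_simps(1) by blast
    moreover have "v \<noteq> b l" using v l i tB_simps(3) pyr_adj(7) by metis
    ultimately show False
      using twoP3[of u "c k" x v w "b l"] wv vx n nw tAA_simps(1)[OF w] AA_pre[OF w k u n] l u v x k i False
        adj_commute[of v w] adj_commute[of u w] adj_commute[of x w] adj_commute[of x v] adj_commute[of "c k" w] by simp
  qed
qed

lemma AA_B_X:
  assumes w: "w \<in> tAA" and k: "k \<in> I" and u: "u \<in> tB k" and n: "\<not> adj w u"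
    and j: "j \<in> I" and x: "x \<in> tX j"
  shows False
proof -
  have xK: "x \<in> tK j" using in_K(2)[OF j x] .
  have nwc: "\<not> adj w (c i)" "\<not> adj (c i) w" if "i \<in> I" for i using tAA_simps(1)[OF w that] adj_sym by blast+
  have wx: "adj w x" if "j \<noteq> k \<or> w \<in> tA"
  proof (cases "w \<in> tA")
    case True
    then show ?thesis using X_A[OF j x] by blast
  next
    case False
    then obtain m where m: "m \<in> I" "w \<in> tAm m" using w unfolding tAA_def by blast
    have "m = k" using Am_K[OF m(1) k _ m(2) in_K(1)[OF k u]] n by blast
    then show ?thesis using Am_K[OF m(1) j _ m(2) xK] that False by blast
  qed
  show False
  proof (cases "j = k")
    case True
    obtain i l where il: "i \<in> I" "l \<in> I" "i \<noteq> k" "l \<noteq> k" "i \<noteq> l" by (rule pick2)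
    show False
    proof (cases "adj w x")
      case wx: True
      have "x \<noteq> u" using wx n by blast
      then have "adj x u" using K_clique[OF j xK] in_K(1)[OF k u] True by blast
      then show False
        using C6[of w x u "c k" "c i" "b i"] wx n nwc AA_pre[OF w k u n] il x u k True by simp
    next
      case False
      then have "w \<notin> tA" using wx by blast
      then obtain m where m: "m \<in> I" "w \<in> tAm m" using w unfolding tAA_def by blast
      have mk: "m = k" using Am_K[OF m(1) k _ m(2) in_K(1)[OF k u]] n by blast
      have "x \<noteq> c k" using x k by auto
      then show False
        using twoP3[of x "b k" "c k" "b i" w "b l"] False m mk il x k True adj_commute[of x w] by simp
    qed
  next
    case False
    obtain l where l: "l \<in> I" "l \<noteq> k" "l \<noteq> j" by (rule pick3)
    have "\<not> adj x u" using KK_anti[OF j k False xK in_K(1)[OF k u]] .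
    moreover have "adj w x" using wx False by blast
    moreover have "x \<noteq> b l" "u \<noteq> c j" using x u l j by auto
    ultimately show False
      using twoP3[of x w "b l" u "c k" "c j"] n nwc AA_pre[OF w k u n] l u x j k False
        adj_commute[of x w] by simp
  qed
qed

lemma AA_B_Y:
  assumes w: "w \<in> tAA" and k: "k \<in> I" and u: "u \<in> tB k" and n: "\<not> adj w u" and y: "y \<in> tY"
  shows False
proof -
  obtain i l where il: "i \<in> I" "l \<in> I" "i \<noteq> k" "l \<noteq> k" "i \<noteq> l" by (rule pick2)
  have "\<not> adj y u" "\<not> adj w y" using Y_B_anti[OF k u y] AA_Y_anti[OF w y] by blast+
  moreover have "u \<noteq> y" using u y tB_simps(1) tY_simps(1) by blast
  ultimately show False
    using twoP3[of u "c k" y "b i" w "b l"] n tAA_simps(1)[OF w] AA_pre[OF w k u n] il u y k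
      adj_commute[of u y] adj_commute[of u w] adj_commute[of y w] adj_commute[of "c k" w] by simp
qed

lemma F_B_anti: "j \<in> I \<Longrightarrow> f \<in> tF j \<Longrightarrow> v \<in> tB j \<Longrightarrow> \<not> adj f v"
proof
  assume j: "j \<in> I" and f: "f \<in> tF j" and v: "v \<in> tB j" and fv: "adj f v"
  obtain k where k: "k \<in> I" "k \<noteq> j" by (rule pick3[of j j])
  have "f \<noteq> c j" "v \<noteq> c k" using f v j k by auto
  then show False using C4[of f v "c j" "c k"] fv f v j k by simp
qed

lemma F_C_anti: "j \<in> I \<Longrightarrow> f \<in> tF j \<Longrightarrow> v \<in> tC j \<Longrightarrow> \<not> adj f v"
proof
  assume j: "j \<in> I" and f: "f \<in> tF j" and v: "v \<in> tC j" and fv: "adj f v"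
  have "f \<noteq> b j" using f j by auto
  moreover have "v \<noteq> a" using v a_notin(2) by metis
  ultimately show False using C4[of f v "b j" a] fv f v j F_a[OF j f] by simp
qed

text \<open>Since \<open>f\<close> misses both \<open>v\<close> and \<open>x\<close>, a missing edge
  \<open>v x\<close> would leave the path \<open>v\<close>, \<open>c j\<close>, \<open>x\<close>
  anticomplete to the path \<open>b i\<close>, \<open>f\<close>, \<open>b k\<close>.\<close>

lemma F_B_C:
  assumes j: "j \<in> I" and f: "f \<in> tF j" and v: "v \<in> tB j" and x: "x \<in> tC j"
  shows "adj v x"
proof (rule ccontr)
  assume vx: "\<not> adj v x"
  have "x \<noteq> c j" using vx v j by auto
  then have "adj (c j) x" using C_c[OF j x] adj_sym by (auto simp: cadj_def)
  moreover have "v \<noteq> x" using v x tB_simps(1) tC_simps(1) by blast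
  moreover obtain i k where "i \<in> I" "k \<in> I" "i \<noteq> j" "k \<noteq> j" "i \<noteq> k" by (rule pick2)
  ultimately show False
    using twoP3[of v "c j" x "b i" f "b k"] vx F_B_anti[OF j f v] F_C_anti[OF j f x] f v x j
      adj_commute[of v f] adj_commute[of x f] by simp
qed

lemma F_B: "j \<in> I \<Longrightarrow> f \<in> tF j \<Longrightarrow> k \<in> I \<Longrightarrow> k \<noteq> j \<Longrightarrow> v \<in> tB k \<Longrightarrow> adj f v"
proof -
  assume j: "j \<in> I" and f: "f \<in> tF j" and k: "k \<in> I" "k \<noteq> j" and v: "v \<in> tB k"
  have "f \<noteq> v" using types_disjoint(8)[OF k(1) j] f v by blast
  then show ?thesis using a_c[OF k(1), of f v] f v k F_a[OF j f] by simp
qed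

end

lemma sorted_wrt_villa_append:
  assumes "sorted_wrt (\<lambda>S T. S \<inter> T = {}) (villa_parts t A B C)" "sorted_wrt (\<lambda>S T. S \<inter> T = {}) Ps"
    and "\<And>S. S \<in> set Ps \<Longrightarrow> A \<inter> S = {}"
    and "\<And>i S. i \<in> {1..t} \<Longrightarrow> S \<in> set Ps \<Longrightarrow> B i \<inter> S = {} \<and> C i \<inter> S = {}"
  shows "sorted_wrt (\<lambda>S T. S \<inter> T = {}) (villa_parts t A B C @ Ps)"
proof -
  have "S \<inter> T = {}" if S: "S \<in> set (villa_parts t A B C)" and T: "T \<in> set Ps" for S T
  proof -
    have "set (villa_parts t A B C) = {A} \<union> B ` {1..t} \<union> C ` {1..t}"
      unfolding villa_parts_def by auto
    then consider "S = A" | i where "i \<in> {1..t}" "S = B i" | i where "i \<in> {1..t}" "S = C i"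
      using S by blast
    then show ?thesis using assms(3,4) T by cases blast+
  qed
  then show ?thesis using assms(1,2) unfolding sorted_wrt_append by simp
qed

context best_pyramid
begin

text \<open>This condition separates the outcomes: where it holds, the graph is a villa or a mansion
  according to whether all \<open>tF j\<close> are empty; where it fails, the graph is a
  5-basket.\<close>

definition roofed :: bool where
  "roofed \<longleftrightarrow> (\<forall>w\<in>tAA. \<forall>k\<in>I. \<forall>u\<in>tB k. adj w u)"

lemma types_subset [simp]:
  "tAA \<subseteq> V" "k \<in> I \<Longrightarrow> tB k \<subseteq> V" "k \<in> I \<Longrightarrow> tC k \<subseteq> V" "k \<in> I \<Longrightarrow> tF k \<subseteq> V" "k \<in> I \<Longrightarrow> tX k \<subseteq> V" "tY \<subseteq> V"
  using V_types by blast+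

lemma B_clique: "k \<in> I \<Longrightarrow> x \<in> tB k \<Longrightarrow> y \<in> tB k \<Longrightarrow> x \<noteq> y \<Longrightarrow> adj x y"
  using K_clique in_K(1) by blast

lemma B_B_anti: "i \<in> I \<Longrightarrow> j \<in> I \<Longrightarrow> i \<noteq> j \<Longrightarrow> x \<in> tB i \<Longrightarrow> y \<in> tB j \<Longrightarrow> \<not> adj x y"
  using KK_anti in_K(1) by blast

lemma B_C_anti: "i \<in> I \<Longrightarrow> j \<in> I \<Longrightarrow> i \<noteq> j \<Longrightarrow> x \<in> tB i \<Longrightarrow> y \<in> tC j \<Longrightarrow> \<not> adj x y"
  using K_C_anti in_K(1) by blast

lemma C_C_adj: "i \<in> I \<Longrightarrow> j \<in> I \<Longrightarrow> i \<noteq> j \<Longrightarrow> x \<in> tC i \<Longrightarrow> y \<in> tC j \<Longrightarrow> adj x y"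
  using C_C types_disjoint(11) by blast

lemma types_clique:
  "clique E tAA" "k \<in> I \<Longrightarrow> clique E (tB k)" "k \<in> I \<Longrightarrow> clique E (tC k)" "k \<in> I \<Longrightarrow> clique E (tF k)"
  "k \<in> I \<Longrightarrow> clique E (tX k)" "clique E tY"
proof -
  show "clique E tAA" by (intro clique_adjI AA_clique)
  show "k \<in> I \<Longrightarrow> clique E (tB k)" by (intro clique_adjI B_clique)
  show "k \<in> I \<Longrightarrow> clique E (tC k)" by (intro clique_adjI C_C)
  show "k \<in> I \<Longrightarrow> clique E (tF k)" by (intro clique_adjI R_clique in_R(3))
  show "k \<in> I \<Longrightarrow> clique E (tX k)" by (intro clique_adjI K_clique in_K(2))
  obtain i where "i \<in> I" using pick2 by blast
  then show "clique E tY" by (intro clique_adjI M_clique in_M(2))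
qed

lemma villa_disjoint: "sorted_wrt (\<lambda>S T. S \<inter> T = {}) (villa_parts t tAA tB tC)"
  by (rule villa_parts_disjoint; unfold I_def[symmetric]) (use types_disjoint in simp_all)

lemma Union_villa: "\<Union> (set (villa_parts t tAA tB tC)) = tAA \<union> (\<Union>k\<in>I. tB k) \<union> (\<Union>k\<in>I. tC k)"
  unfolding Union_villa_parts I_def ..

lemma villa_part:
  assumes "roofed"
  shows "villa_partition E t tAA tB tC"
proof -
  have B: "b i \<in> tB i" and C: "c i \<in> tC i" if "i \<in> I" for i using that by simp_all
  have "\<exists>bs. nested_order E (tB i) (tC i) bs \<and> {x \<in> tC i. E (last bs) x} \<noteq> {}" if i: "i \<in> I" for i
  proof -
    have "adj (b i) x" if "x \<in> tC i" for x using that i by simp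
    then obtain bs where bs: "nested_order E (tB i) (tC i) bs"
      using nested_order_cliques[of "tB i" "tC i" "b i"] types_subset(2,3)[OF i] types_disjoint(7)[OF i i]
        B_clique[OF i] C_C[OF i i] B[OF i] by blast
    then have "last bs \<in> tB i" by (metis last_in_set nested_order_def)
    then have "adj (last bs) (c i)" using i by simp
    then show ?thesis using bs C[OF i] by (auto simp: adj_def)
  qed
  moreover have "tAA \<noteq> {}" using pyr_types(1) unfolding tAA_def by blast
  moreover have "complete E tAA (\<Union>i\<in>I. tB i)" using assms unfolding roofed_def by (intro complete_adjI) blast
  moreover have "anticomplete E tAA (\<Union>i\<in>I. tC i)"
    by (intro anticomplete_adjI) (use types_subset AA_C_anti in blast)+
  moreover have "anticomplete E (tB i) (tB j) \<and> complete E (tC i) (tC j) \<and> anticomplete E (tB i) (tC j)"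
    if "i \<in> I" "j \<in> I" "i \<noteq> j" for i j
    using anticomplete_adjI[OF types_subset(2)[OF that(1)] types_subset(2)[OF that(2)]]
      anticomplete_adjI[OF types_subset(2)[OF that(1)] types_subset(3)[OF that(2)]]
      complete_adjI[of "tC i" "tC j"] B_B_anti[OF that] B_C_anti[OF that] C_C_adj[OF that] by blast
  ultimately show ?thesis
    using t_ge types_clique(1-3) B C unfolding villa_partition_def I_def[symmetric] by blast
qed

lemma no_F:
  assumes "\<And>j. j \<in> I \<Longrightarrow> tF j = {}"
  shows "k \<in> I \<Longrightarrow> tX k = {}" "tY = {}"
  using X_F Y_F assms by blast+

lemma is_villa:
  assumes "roofed" and F: "\<And>j. j \<in> I \<Longrightarrow> tF j = {}"
  shows "villa V E"
proof -
  have "V = tAA \<union> (\<Union>k\<in>I. tB k) \<union> (\<Union>k\<in>I. tC k)"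
    using V_types F no_F[OF F] by auto
  then have "partition_list V (villa_parts t tAA tB tC)"
    by (intro partition_listI villa_disjoint) (simp add: Union_villa)
  then show ?thesis
    using villa_part[OF assms(1)] t_ge unfolding villa_def t_villa_def by blast
qed

lemma one_F:
  assumes j: "j \<in> I" "tF j \<noteq> {}" and k: "k \<in> I" "k \<noteq> j"
  shows "tF k = {}" "tX k = {}"
  using F_unique X_F assms by blast+

lemma is_mansion:
  assumes roof: "roofed" and j: "j \<in> I" and F: "tF j \<noteq> {}"
  shows "mansion V E"
proof -
  obtain f where f: "f \<in> tF j" using F by blast
  have "(\<Union>k\<in>I. tF k) = tF j" "(\<Union>k\<in>I. tX k) = tX j" using one_F[OF j F] j by blast+
  then have V: "V = tAA \<union> (\<Union>k\<in>I. tB k) \<union> (\<Union>k\<in>I. tC k) \<union> tF j \<union> tX j \<union> tY" using V_types by simp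
  have "partition_list V (villa_parts t tAA tB tC @ [tF j, tX j, tY])"
  proof (rule partition_listI)
    show "\<Union> (set (villa_parts t tAA tB tC @ [tF j, tX j, tY])) = V"
      using V Union_villa by auto
    show "sorted_wrt (\<lambda>S T. S \<inter> T = {}) (villa_parts t tAA tB tC @ [tF j, tX j, tY])"
    proof (rule sorted_wrt_villa_append[OF villa_disjoint])
      show "sorted_wrt (\<lambda>S T. S \<inter> T = {}) [tF j, tX j, tY]"
        using types_disjoint(15-17)[OF j j] by simp
      show "tAA \<inter> S = {}" if "S \<in> set [tF j, tX j, tY]" for S
        using that types_disjoint(3-5)[OF j j] by auto
      show "tB i \<inter> S = {} \<and> tC i \<inter> S = {}" if "i \<in> {1..t}" and S: "S \<in> set [tF j, tX j, tY]" for i S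
      proof -
        have i: "i \<in> I" using \<open>i \<in> {1..t}\<close> unfolding I_def .
        show ?thesis using S types_disjoint(8-10,12-14)[OF i j] by auto
      qed
    qed
  qed
  moreover have "complete E (tF j) tAA" by (intro complete_adjI) (use AA_R j adj_sym in blast)
  moreover have "complete E (tF j) (\<Union>i\<in>I - {j}. tB i)"
    by (intro complete_adjI) (use F_B[OF j] in blast)
  moreover have "complete E (tF j) (\<Union>i\<in>I - {j}. tC i)"
    by (intro complete_adjI) (use C_F[OF _ j] adj_sym in blast)
  moreover have "anticomplete E (tF j) (tB j \<union> tC j)"
    by (intro anticomplete_adjI) (use types_subset j F_B_anti F_C_anti in blast)+
  moreover have "complete E (tB j) (tC j)" by (intro complete_adjI) (use F_B_C[OF j f] in blast)
  moreover have "complete E (tX j) (tAA \<union> tB j)"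
  proof (intro complete_adjI)
    fix x y assume x: "x \<in> tX j" and y: "y \<in> tAA \<union> tB j"
    show "adj x y"
    proof (cases "y \<in> tB j")
      case True
      then have "x \<noteq> y" using types_disjoint(9)[OF j j] x by blast
      then show ?thesis using K_clique[OF j in_K(2)[OF j x] in_K(1)[OF j True]] by blast
    next
      case False
      \<comment> \<open>Under \<open>roofed\<close> all \<open>tAm i\<close> are empty, because a
        member would miss \<open>b i\<close>. So \<open>tAA\<close> is just \<open>tA\<close>, where
        \<open>X_A\<close> applies.\<close>
      have "y \<notin> tAm i" if i: "i \<in> I" for i
      proof
        assume m: "y \<in> tAm i"
        then have "y \<in> tAA" using i unfolding tAA_def by blast
        moreover have "\<not> adj y (b i)" using m i by simp
        ultimately show False using roof i pyr_types(2)[OF i] unfolding roofed_def by blast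
      qed
      then show ?thesis using y False X_A[OF j x] unfolding tAA_def by blast
    qed
  qed
  moreover have "anticomplete E (tX j) (\<Union>i\<in>I - {j}. tB i)"
    by (intro anticomplete_adjI) (use types_subset j KK_anti[OF j] in_K in blast)+
  moreover have "anticomplete E (tX j) (\<Union>i\<in>I. tC i)"
  proof (intro anticomplete_adjI)
    fix x y assume x: "x \<in> tX j" and "y \<in> (\<Union>i\<in>I. tC i)"
    then obtain i where i: "i \<in> I" "y \<in> tC i" by blast
    have xc: "\<not> adj x (c j)" using x j by simp
    show "\<not> adj x y"
      using K_C_top[OF j in_K(2)[OF j x] xc] K_C_anti[OF j i(1) _ in_K(2)[OF j x] i(2)] i by blast
  qed (use types_subset j in blast)+
  moreover have "complete E (tF j) (tX j \<union> tY)"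
    by (intro complete_adjI) (use X_F_adj[OF j] Y_F_adj[OF j] adj_sym in blast)
  moreover have "anticomplete E (tX j) tY"
    by (intro anticomplete_adjI) (use types_subset j X_Y_anti in blast)+
  moreover have "complete E tY (\<Union>i\<in>I. tC i)"
  proof (intro complete_adjI)
    fix x y assume x: "x \<in> tY" and "y \<in> (\<Union>i\<in>I. tC i)"
    then obtain i where i: "i \<in> I" "y \<in> tC i" by blast
    then have "x \<noteq> y" using types_disjoint(14)[OF i(1) i(1)] x by blast
    then show "adj x y" using M_clique[OF i(1) in_M(2)[OF i(1) x] in_M(1)[OF i]] by blast
  qed
  moreover have "anticomplete E tY (tAA \<union> (\<Union>i\<in>I. tB i))"
    by (intro anticomplete_adjI) (use types_subset AA_Y_anti Y_B_anti adj_sym in blast)+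
  ultimately have "t_mansion t V E"
    using villa_part[OF roof] F t_ge types_clique(4,5)[OF j] types_clique(6) j
    unfolding t_mansion_def I_def[symmetric] by blast
  then show ?thesis using t_ge unfolding mansion_def by blast
qed

lemma is_five_basket:
  assumes "\<not> roofed"
  shows "five_basket V E"
proof -
  obtain w k u where w: "w \<in> tAA" and k: "k \<in> I" and u: "u \<in> tB k" and n: "\<not> adj w u"
    using assms unfolding roofed_def by blast
  have t: "t = 3" using AA_B_small[OF w k u n] .
  then have I: "I = {1, 2, 3}" unfolding I_def by auto
  define F where "F = (\<Union>j\<in>I. tF j)"
  have X: "tX j = {}" if "j \<in> I" for j using AA_B_X[OF w k u n that] by blast
  have Y: "tY = {}" using AA_B_Y[OF w k u n] by blast
  have V: "V = tAA \<union> (\<Union>k\<in>I. tB k) \<union> (\<Union>k\<in>I. tC k) \<union> F" using V_types X Y unfolding F_def by simp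
  have Fcl: "clique E F"
    unfolding F_def by (intro clique_adjI) (use R_clique in_R(3) in blast)
  have parts: "partition_list V (villa_parts t tAA tB tC @ [F])"
  proof (rule partition_listI)
    show "\<Union> (set (villa_parts t tAA tB tC @ [F])) = V" using V Union_villa by auto
    show "sorted_wrt (\<lambda>S T. S \<inter> T = {}) (villa_parts t tAA tB tC @ [F])"
    proof (rule sorted_wrt_villa_append[OF villa_disjoint])
      show "sorted_wrt (\<lambda>S T. S \<inter> T = {}) [F]" by simp
      show "tAA \<inter> S = {}" if "S \<in> set [F]" for S
        using that types_disjoint(3) unfolding F_def by (simp add: Int_UN_distrib)
      show "tB i \<inter> S = {} \<and> tC i \<inter> S = {}" if "i \<in> {1..t}" and S: "S \<in> set [F]" for i S
      proof -
        have i: "i \<in> I" using \<open>i \<in> {1..t}\<close> unfolding I_def .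
        show ?thesis using S types_disjoint(8,12)[OF i] unfolding F_def by (simp add: Int_UN_distrib)
      qed
    qed
  qed
  have "[1..<3 + 1] = [1, 2, 3::nat]" by (simp add: upt_rec)
  then have list: "villa_parts t tAA tB tC @ [F] = [tAA, tB 1, tB 2, tB 3, tC 1, tC 2, tC 3, F]"
    unfolding villa_parts_def t by simp
  have "complete E tAA (\<Union>i\<in>I - {k}. tB i)"
    by (intro complete_adjI) (use AA_B_unique[OF w k u n] in blast)
  moreover have "\<exists>as. nested_order E tAA (tB k) as"
  proof -
    have "adj a y" if "y \<in> tB k" for y using that by simp
    moreover have "a \<in> tAA" unfolding tAA_def by simp
    ultimately obtain as where "nested_order E tAA (tB k) as"
      using nested_order_cliques[OF types_subset(1) types_subset(2)[OF k] types_disjoint(1)[OF k k]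
        AA_clique B_clique[OF k]] by blast
    then show ?thesis ..
  qed
  ultimately have 1: "\<exists>i0\<in>I. complete E tAA (\<Union>i\<in>I - {i0}. tB i) \<and> (\<exists>as. nested_order E tAA (tB i0) as)"
    using k by blast
  have "anticomplete E tAA (\<Union>i\<in>I. tC i)"
    by (intro anticomplete_adjI) (use types_subset AA_C_anti in blast)+
  then have 2: "anticomplete E tAA (tC 1 \<union> tC 2 \<union> tC 3)" unfolding I by (simp add: Un_assoc)
  have 3: "anticomplete E (tB i) (tB j) \<and> complete E (tC i) (tC j)" "anticomplete E (tB i) (tC j)"
    if "i \<in> I" "j \<in> I" "i \<noteq> j" for i j
    using anticomplete_adjI[OF types_subset(2)[OF that(1)] types_subset(2)[OF that(2)]]
      anticomplete_adjI[OF types_subset(2)[OF that(1)] types_subset(3)[OF that(2)]]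
      complete_adjI[of "tC i" "tC j"] B_B_anti[OF that] B_C_anti[OF that] C_C_adj[OF that] by blast+
  have 4: "complete E (tB i) (tC i)" if "i \<in> I" for i
    by (intro complete_adjI) (use AA_B_C[OF w k u n that] in blast)
  have 5: "tB i \<noteq> {} \<and> tC i \<noteq> {} \<and> clique E (tB i) \<and> clique E (tC i)" if "i \<in> I" for i
    using that types_clique(2,3)[OF that] pyr_types(2,3)[OF that] by blast
  have 6: "\<exists>j\<in>I. complete E F (V - (tB j \<union> tC j \<union> F)) \<and> anticomplete E F (tB j \<union> tC j)"
  proof (cases "\<exists>j\<in>I. tF j \<noteq> {}")
    case True
    then obtain j where j: "j \<in> I" "tF j \<noteq> {}" by blast
    then have F: "F = tF j" using one_F(1)[OF j] unfolding F_def by blast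
    have "complete E F (V - (tB j \<union> tC j \<union> F))"
    proof (intro complete_adjI)
      fix x y assume x: "x \<in> F" and y: "y \<in> V - (tB j \<union> tC j \<union> F)"
      have x: "x \<in> tF j" using x F by simp
      consider "y \<in> tAA" | i where "i \<in> I" "i \<noteq> j" "y \<in> tB i" | i where "i \<in> I" "i \<noteq> j" "y \<in> tC i"
        using y V by blast
      then show "adj x y"
      proof cases
        case 1 then show ?thesis using AA_R[OF _ j(1) x] adj_sym by blast
      next
        case 2 then show ?thesis using F_B[OF j(1) x] by blast
      next
        case 3 then show ?thesis using C_F[OF _ j(1) _ _ x] adj_sym by blast
      qed
    qed
    moreover have "anticomplete E F (tB j \<union> tC j)" unfolding F
      by (intro anticomplete_adjI) (use types_subset j F_B_anti F_C_anti in blast)+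
    ultimately show ?thesis using j by blast
  next
    case False
    \<comment> \<open>Without \<open>F\<close> any index satisfies the last clause of the
      definition; \<open>k\<close> is at hand.\<close>
    then have "F = {}" unfolding F_def by blast
    then show ?thesis using k by (auto simp: complete_def anticomplete_def)
  qed
  have "tAA \<noteq> {}" using w by blast
  moreover have "\<forall>i\<in>I. tB i \<noteq> {} \<and> tC i \<noteq> {} \<and> clique E (tB i) \<and> clique E (tC i)" using 5 by blast
  moreover have "\<forall>i\<in>I. \<forall>j\<in>I. i \<noteq> j \<longrightarrow> anticomplete E (tB i) (tB j) \<and> complete E (tC i) (tC j)"
    using 3(1) by blast
  moreover have "\<forall>i\<in>I. complete E (tB i) (tC i) \<and> (\<forall>j\<in>I. j \<noteq> i \<longrightarrow> anticomplete E (tB i) (tC j))"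
    using 3(2) 4 by blast
  ultimately show ?thesis
    unfolding five_basket_def I[symmetric]
    using parts[unfolded list] types_clique(1) Fcl 1 2 6
    by (intro exI[of _ tAA] exI[of _ tB] exI[of _ tC] exI[of _ F] conjI)
qed

lemma is_special: "special V E"
  using is_villa is_mansion is_five_basket unfolding special_def by blast

end

section \<open>Choice of an optimal pyramid\<close>

context nonsimplicial_graph
begin

lemma tpyramid_bound:
  assumes "tpyramid t a b c"
  shows "t \<le> card V"
proof -
  have "inj_on b {1..t}"
  proof (rule inj_onI, rule ccontr)
    fix i j assume i: "i \<in> {1..t}" and j: "j \<in> {1..t}" and eq: "b i = b j" and "i \<noteq> j"
    have "adj (b i) (c i)" using assms i unfolding tpyramid_def by blast
    moreover have "\<not> adj (b j) (c i)"
      using assms i j \<open>i \<noteq> j\<close> unfolding tpyramid_def by (metis (no_types))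
    ultimately show False using eq by simp
  qed
  moreover have "b i \<in> V" if "i \<in> {1..t}" for i
  proof -
    have "adj a (b i)" using assms that unfolding tpyramid_def by blast
    then show ?thesis using adjD by blast
  qed
  ultimately show ?thesis using card_inj_on_le[of b "{1..t}" V] finite_V by (simp add: image_subset_iff)
qed

text \<open>The paths are numbered from 1, so position 0 of the two lists is a filler, for which
  \<open>a\<close> is used.\<close>

lemma pyramid_tpyramid:
  assumes "pyramid a b0 b1 b2 c0 c1 c2"
  shows "tpyramid 3 a (nth [a, b0, b1, b2]) (nth [a, c0, c1, c2])"
proof -
  have s: "{1..3} = {1, 2, 3::nat}" by auto
  show ?thesis unfolding tpyramid_def s using assms adj_commute[of b1 b0] adj_commute[of b2 b0] adj_commute[of b2 b1]
      adj_commute[of c1 c0] adj_commute[of c2 c0] adj_commute[of c2 c1] unfolding pyramid_def by simp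
qed

lemma nonsimplicial_special: "special V E"
proof (cases "\<exists>a b0 b1 b2 c0 c1 c2. pyramid a b0 b1 b2 c0 c1 c2")
  case False
  interpret pyramid_free_graph V E by unfold_locales (use False in blast)
  show ?thesis using is_five_crown by (simp add: special_def)
next
  case True
  then obtain a0 b0 c0 where p: "tpyramid 3 a0 b0 c0" using pyramid_tpyramid by blast
  have "\<exists>t. (\<exists>a b c. tpyramid t a b c) \<and> (\<forall>s. (\<exists>a b c. tpyramid s a b c) \<longrightarrow> s \<le> t)"
    using ex_has_greatest_nat[of "\<lambda>t. \<exists>a b c. tpyramid t a b c" 3 "\<lambda>t. t" "Suc (card V)"]
      p tpyramid_bound le_imp_less_Suc by blast
  then obtain t where t: "\<exists>a b c. tpyramid t a b c" and max: "\<And>s a b c. tpyramid s a b c \<Longrightarrow> s \<le> t"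
    by blast
  let ?P = "\<lambda>(a, b, c). tpyramid t a b c" and ?f = "\<lambda>(a, b, c). deg_sum t a b c"
  have deg: "deg v \<le> card V" for v
    unfolding deg_def using finite_V by (intro card_mono) (auto dest: adjD)
  have bound: "deg_sum t a b c \<le> card V + t * card V + t * card V" for a b c
    unfolding deg_sum_def using deg sum_bounded_above[of "{1..t}" "\<lambda>i. deg (b i)" "card V"]
      sum_bounded_above[of "{1..t}" "\<lambda>i. deg (c i)" "card V"] by (auto intro!: add_mono)
  obtain x where "?P x" using t by auto
  then have "\<exists>x. ?P x \<and> (\<forall>y. ?P y \<longrightarrow> ?f y \<le> ?f x)"
    by (rule ex_has_greatest_nat[where b = "Suc (card V + t * card V + t * card V)"])
      (use bound in \<open>auto simp: less_Suc_eq_le\<close>)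
  then obtain a b c where "tpyramid t a b c"
    "\<And>a' b' c'. tpyramid t a' b' c' \<Longrightarrow> deg_sum t a' b' c' \<le> deg_sum t a b c" by auto
  then interpret best_pyramid V E t a b c by unfold_locales (use max in blast)+
  show ?thesis by (rule is_special)
qed

end

section \<open>Villas, mansions, 5-baskets and 5-crowns are free\<close>

text \<open>
  Inside a part of the decomposition closed neighbourhoods are nested, so that an induced copy of a graph
  without dominated vertices meets each part at most once.
\<close>

definition nondominated :: "nat \<Rightarrow> (nat \<Rightarrow> nat \<Rightarrow> bool) \<Rightarrow> bool" where
  "nondominated n H \<longleftrightarrow> (\<forall>x\<in>{0..<n}. \<forall>y\<in>{0..<n}. H x y \<longrightarrow> (\<exists>z\<in>{0..<n}. z \<noteq> y \<and> H x z \<and> \<not> H y z))"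

text \<open>
  \<open>K\<close> and \<open>M\<close> stand for the vertices of an induced copy that lie in \<open>\<Union>i. C i \<union> Y\<close> and in \<open>A\<close>;
  the remaining vertices then lie in the \<open>B i\<close>.
\<close>

definition villaless :: "nat \<Rightarrow> (nat \<Rightarrow> nat \<Rightarrow> bool) \<Rightarrow> bool" where
  "villaless n H \<longleftrightarrow> (\<forall>K M. \<not> (\<forall>x\<in>{0..<n}. \<forall>y\<in>{0..<n}.
     (K x \<and> K y \<longrightarrow> x = y \<or> H x y) \<and> (M x \<and> M y \<longrightarrow> x = y) \<and> (K x \<and> M y \<longrightarrow> \<not> H x y) \<and>
     (H x y \<longrightarrow> K x \<or> M x \<or> K y \<or> M y) \<and>
     (K x \<and> H x y \<longrightarrow> K y \<or> M y \<or> (\<forall>z\<in>{0..<n}. H x z \<longrightarrow> K z \<or> M z \<or> y = z \<or> H y z))))"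

lemma atLeastLessThan_numerals:
  "{0..<4} = {0, 1, 2, 3::nat}" "{0..<6} = {0, 1, 2, 3, 4, 5::nat}" "{0..<7} = {0, 1, 2, 3, 4, 5, 6::nat}"
  "{0..<9} = {0, 1, 2, 3, 4, 5, 6, 7, 8::nat}"
  by auto

lemma nondominated:
  "nondominated 4 (cycle_rel 4)" "nondominated 6 (cycle_rel 6)" "nondominated 7 (cycle_rel 7)"
  "nondominated 9 T0_rel"
  unfolding nondominated_def atLeastLessThan_numerals
  by (simp_all add: cycle_rel_def T0_rel_def edges_rel_def)

lemma villaless:
  "villaless 4 (cycle_rel 4)" "villaless 6 (cycle_rel 6)" "villaless 7 (cycle_rel 7)" "villaless 9 T0_rel"
  unfolding villaless_def atLeastLessThan_numerals
  by (simp_all only: cycle_rel_def T0_rel_def edges_rel_def; intro allI; simp; sat)+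

text \<open>A vertex of \<open>F\<close> in a house has a clique of nonneighbours, so a pattern with
  this property avoids \<open>F\<close>. C4 is not among the patterns, as its vertices have one
  nonneighbour each; \<open>F_square\<close> takes over there.\<close>

lemma nonneighbours:
  assumes "n = 6 \<and> H = cycle_rel 6 \<or> n = 7 \<and> H = cycle_rel 7 \<or> n = 9 \<and> H = T0_rel \<or> n = 6 \<and> H = twoP3_rel"
  shows "\<forall>x\<in>{0..<n}. \<exists>y\<in>{0..<n}. \<exists>z\<in>{0..<n}. x \<noteq> y \<and> x \<noteq> z \<and> y \<noteq> z \<and> \<not> H x y \<and> \<not> H x z \<and> \<not> H y z"
  using assms by (elim disjE conjE; simp only: atLeastLessThan_numerals;
    simp add: cycle_rel_def T0_rel_def twoP3_rel_def edges_rel_def)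

text \<open>This keeps the patterns out of \<open>X\<close>, whose vertices become simplicial once
  \<open>F\<close> is removed.\<close>

lemma nonsimplicial_pattern:
  assumes "n = 4 \<and> H = cycle_rel 4 \<or> n = 6 \<and> H = cycle_rel 6 \<or> n = 7 \<and> H = cycle_rel 7 \<or> n = 9 \<and> H = T0_rel"
  shows "\<forall>x\<in>{0..<n}. \<exists>y\<in>{0..<n}. \<exists>z\<in>{0..<n}. y \<noteq> z \<and> H x y \<and> H x z \<and> \<not> H y z"
  using assms by (elim disjE conjE; simp only: atLeastLessThan_numerals;
    simp add: cycle_rel_def T0_rel_def twoP3_rel_def edges_rel_def)

text \<open>All five obstructions have this property, so none of them can use a universal vertex of
  the surrounding graph.\<close>

lemma pattern_nonuniversal:
  assumes "n = 4 \<and> H = cycle_rel 4 \<or> n = 6 \<and> H = cycle_rel 6 \<or> n = 7 \<and> H = cycle_rel 7 \<or> n = 9 \<and> H = T0_rel \<or>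
    n = 6 \<and> H = twoP3_rel"
  shows "\<forall>x\<in>{0..<n}. \<exists>y\<in>{0..<n}. x \<noteq> y \<and> \<not> H x y"
  using assms by (elim disjE conjE; simp only: atLeastLessThan_numerals;
    simp add: cycle_rel_def T0_rel_def twoP3_rel_def edges_rel_def)

text \<open>
  A villa is a house with \<open>F = X = Y = {}\<close>, a mansion one with \<open>A\<close> complete to every \<open>B i\<close>, and a 5-basket
  one with \<open>X = Y = {}\<close>, where \<open>i0\<close> and \<open>j\<close> are its two distinguished indices.
\<close>

locale house = simple_graph Q E for Q :: "'a set" and E +
  fixes I :: "nat set" and A F X Y :: "'a set" and B C :: "nat \<Rightarrow> 'a set" and i0 j :: nat
  assumes Q: "Q = A \<union> (\<Union>i\<in>I. B i) \<union> (\<Union>i\<in>I. C i) \<union> F \<union> X \<union> Y"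
    and third: "\<exists>i\<in>I. i \<noteq> k \<and> i \<noteq> l"
    and i0: "i0 \<in> I" and j: "j \<in> I"
    and A_A: "x \<in> A \<Longrightarrow> y \<in> A \<Longrightarrow> x \<noteq> y \<Longrightarrow> adj x y"
    and F_F: "x \<in> F \<Longrightarrow> y \<in> F \<Longrightarrow> x \<noteq> y \<Longrightarrow> adj x y"
    and X_X: "x \<in> X \<Longrightarrow> y \<in> X \<Longrightarrow> x \<noteq> y \<Longrightarrow> adj x y"
    and Y_Y: "x \<in> Y \<Longrightarrow> y \<in> Y \<Longrightarrow> x \<noteq> y \<Longrightarrow> adj x y"
    and B_B: "i \<in> I \<Longrightarrow> k \<in> I \<Longrightarrow> x \<in> B i \<Longrightarrow> y \<in> B k \<Longrightarrow> x \<noteq> y \<Longrightarrow> adj x y \<longleftrightarrow> i = k"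
    and C_C: "i \<in> I \<Longrightarrow> k \<in> I \<Longrightarrow> x \<in> C i \<Longrightarrow> y \<in> C k \<Longrightarrow> x \<noteq> y \<Longrightarrow> adj x y"
    and B_C: "i \<in> I \<Longrightarrow> k \<in> I \<Longrightarrow> i \<noteq> k \<Longrightarrow> x \<in> B i \<Longrightarrow> y \<in> C k \<Longrightarrow> \<not> adj x y"
    and A_C: "i \<in> I \<Longrightarrow> x \<in> A \<Longrightarrow> y \<in> C i \<Longrightarrow> \<not> adj x y"
    and A_Y: "x \<in> A \<Longrightarrow> y \<in> Y \<Longrightarrow> \<not> adj x y"
    and A_B: "i \<in> I \<Longrightarrow> i \<noteq> i0 \<Longrightarrow> x \<in> A \<Longrightarrow> y \<in> B i \<Longrightarrow> adj x y"
    and Y_C: "i \<in> I \<Longrightarrow> x \<in> Y \<Longrightarrow> y \<in> C i \<Longrightarrow> adj x y"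
    and Y_B: "i \<in> I \<Longrightarrow> x \<in> Y \<Longrightarrow> y \<in> B i \<Longrightarrow> \<not> adj x y"
    and X_Y: "x \<in> X \<Longrightarrow> y \<in> Y \<Longrightarrow> \<not> adj x y"
    and X_C: "i \<in> I \<Longrightarrow> x \<in> X \<Longrightarrow> y \<in> C i \<Longrightarrow> \<not> adj x y"
    and X_B: "i \<in> I \<Longrightarrow> x \<in> X \<Longrightarrow> y \<in> B i \<Longrightarrow> adj x y \<longleftrightarrow> i = j"
    and X_A: "x \<in> X \<Longrightarrow> y \<in> A \<Longrightarrow> adj x y"
    and F_A: "x \<in> F \<Longrightarrow> y \<in> A \<Longrightarrow> adj x y"
    and F_X: "x \<in> F \<Longrightarrow> y \<in> X \<Longrightarrow> adj x y"
    and F_Y: "x \<in> F \<Longrightarrow> y \<in> Y \<Longrightarrow> adj x y"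
    and F_B: "i \<in> I \<Longrightarrow> x \<in> F \<Longrightarrow> y \<in> B i \<Longrightarrow> adj x y \<longleftrightarrow> i \<noteq> j"
    and F_C: "i \<in> I \<Longrightarrow> x \<in> F \<Longrightarrow> y \<in> C i \<Longrightarrow> adj x y \<longleftrightarrow> i \<noteq> j"
    and F_B_C: "f \<in> F \<Longrightarrow> x \<in> B j \<Longrightarrow> y \<in> C j \<Longrightarrow> adj x y"
    and X_nonempty: "X \<noteq> {} \<Longrightarrow> F \<noteq> {}"
    and A_chain: "x \<in> A \<Longrightarrow> y \<in> A \<Longrightarrow>
      (\<forall>z\<in>B i0. adj x z \<longrightarrow> adj y z) \<or> (\<forall>z\<in>B i0. adj y z \<longrightarrow> adj x z)"
    and B_chain: "i \<in> I \<Longrightarrow> x \<in> B i \<Longrightarrow> y \<in> B i \<Longrightarrow>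
      (\<forall>z\<in>C i. adj x z \<longrightarrow> adj y z) \<or> (\<forall>z\<in>C i. adj y z \<longrightarrow> adj x z)"
    and kinds: "(\<forall>x\<in>A. \<forall>y\<in>B i0. adj x y) \<or>
      X = {} \<and> Y = {} \<and> card I = 3 \<and> (\<forall>i\<in>I. \<forall>x\<in>B i. \<forall>y\<in>C i. adj x y)"
    and A_top: "\<exists>x\<in>A. \<forall>y\<in>B i0. adj x y"
    and B_top: "i \<in> I \<Longrightarrow> \<exists>x\<in>B i. \<forall>y\<in>C i. adj x y"
    and B_nbr: "i \<in> I \<Longrightarrow> x \<in> B i \<Longrightarrow> \<exists>y\<in>C i. adj x y"
begin

lemma Q_cases:
  assumes "z \<in> Q"
  obtains "z \<in> A" | i where "i \<in> I" "z \<in> B i" | i where "i \<in> I" "z \<in> C i" | "z \<in> F" | "z \<in> X" | "z \<in> Y"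
  using assms Q by blast

lemma nbr_A:
  assumes x: "x \<in> A" and xz: "adj x z"
  shows "z \<in> A \<or> (\<exists>i\<in>I. z \<in> B i) \<or> z \<in> F \<or> z \<in> X"
proof -
  have "z \<in> Q" using xz adjD by blast
  then show ?thesis
  proof (cases rule: Q_cases)
    case 1 then show ?thesis by blast
  next
    case (2 i) then show ?thesis by blast
  next
    case (3 i) then show ?thesis using A_C x xz by blast
  next
    case 4 then show ?thesis by blast
  next
    case 5 then show ?thesis by blast
  next
    case 6 then show ?thesis using A_Y x xz by blast
  qed
qed

lemma nbr_B:
  assumes i: "i \<in> I" and x: "x \<in> B i" and xz: "adj x z"
  shows "z \<in> A \<or> z \<in> B i \<or> z \<in> C i \<or> (z \<in> F \<and> i \<noteq> j) \<or> (z \<in> X \<and> i = j)"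
proof -
  have "z \<in> Q" using xz adjD by blast
  then show ?thesis
  proof (cases rule: Q_cases)
    case 1 then show ?thesis by blast
  next
    case (2 k) then show ?thesis using B_B[OF i 2(1) x 2(2)] xz adjD[OF xz] by blast
  next
    case (3 k) then show ?thesis using B_C[OF i 3(1) _ x 3(2)] xz by blast
  next
    case 4 then show ?thesis using F_B[OF i 4 x] xz adj_commute[of x z] by blast
  next
    case 5 then show ?thesis using X_B[OF i 5 x] xz adj_commute[of x z] by blast
  next
    case 6 then show ?thesis using Y_B[OF i 6 x] xz adj_commute[of x z] by blast
  qed
qed

lemma nbr_C:
  assumes i: "i \<in> I" and x: "x \<in> C i" and xz: "adj x z"
  shows "z \<in> B i \<or> (\<exists>k\<in>I. z \<in> C k) \<or> (z \<in> F \<and> i \<noteq> j) \<or> z \<in> Y"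
proof -
  have "z \<in> Q" using xz adjD by blast
  then show ?thesis
  proof (cases rule: Q_cases)
    case 1 then show ?thesis using A_C[OF i 1 x] xz adj_commute[of x z] by blast
  next
    case (2 k) then show ?thesis using B_C[OF 2(1) i _ 2(2) x] xz adj_commute[of x z] by blast
  next
    case (3 k) then show ?thesis by blast
  next
    case 4 then show ?thesis using F_C[OF i 4 x] xz adj_commute[of x z] by blast
  next
    case 5 then show ?thesis using X_C[OF i 5 x] xz adj_commute[of x z] by blast
  next
    case 6 then show ?thesis by blast
  qed
qed

definition dom :: "'a \<Rightarrow> 'a \<Rightarrow> bool" where
  "dom x y \<longleftrightarrow> (\<forall>z. adj x z \<longrightarrow> z = y \<or> adj y z)"

lemma A_dom:
  assumes x: "x \<in> A" and y: "y \<in> A"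
  shows "dom x y \<or> dom y x"
proof -
  have "dom x y" if x: "x \<in> A" and y: "y \<in> A" and c: "\<forall>z\<in>B i0. adj x z \<longrightarrow> adj y z" for x y
    unfolding dom_def
  proof (intro allI impI)
    fix z assume z: "adj x z"
    from nbr_A[OF x z] consider "z \<in> A" | i where "i \<in> I" "z \<in> B i" | "z \<in> F" | "z \<in> X" by blast
    then show "z = y \<or> adj y z"
    proof cases
      case 1 then show ?thesis using A_A[OF y, of z] by blast
    next
      case (2 i) then show ?thesis using A_B[OF _ _ y, of i z] c z by blast
    next
      case 3 then show ?thesis using F_A[OF _ y, of z] adj_commute[of z y] by blast
    next
      case 4 then show ?thesis using X_A[OF _ y, of z] adj_commute[of z y] by blast
    qed
  qed
  then show ?thesis using A_chain[OF x y] x y by blast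
qed

text \<open>Members of \<open>B i\<close> can differ in \<open>A\<close> and in \<open>C i\<close>,
  and two chains need not agree; but never do both sides vary. If \<open>A\<close> is not complete
  to \<open>B i\<close>, then \<open>i = i0\<close> and \<open>kinds\<close> makes
  \<open>B i\<close> complete to \<open>C i\<close>. The chain condition on \<open>A\<close> also
  nests the neighbourhoods of \<open>B i0\<close> in \<open>A\<close>.\<close>

lemma B_dom:
  assumes i: "i \<in> I" and x: "x \<in> B i" and y: "y \<in> B i"
  shows "dom x y \<or> dom y x"
proof -
  have *: "dom x y" if x: "x \<in> B i" and y: "y \<in> B i" and a: "\<forall>z\<in>A. adj x z \<longrightarrow> adj y z"
    and c: "\<forall>z\<in>C i. adj x z \<longrightarrow> adj y z" for x y
    unfolding dom_def
  proof (intro allI impI)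
    fix z assume z: "adj x z"
    from nbr_B[OF i x z]
    consider "z \<in> A" | "z \<in> B i" | "z \<in> C i" | "z \<in> F" "i \<noteq> j" | "z \<in> X" "i = j" by blast
    then show "z = y \<or> adj y z"
    proof cases
      case 1 then show ?thesis using a z by blast
    next
      case 2 then show ?thesis using B_B[OF i i y, of z] by blast
    next
      case 3 then show ?thesis using c z by blast
    next
      case 4 then show ?thesis using F_B[OF i _ y, of z] adj_commute[of z y] by blast
    next
      case 5 then show ?thesis using X_B[OF i _ y, of z] adj_commute[of z y] by blast
    qed
  qed
  show ?thesis
  proof (cases "\<forall>u\<in>A. \<forall>v\<in>B i. adj u v")
    case True
    then have "\<forall>z\<in>A. adj v z" if "v \<in> B i" for v using that adj_commute[of v] by blast
    then show ?thesis using *[OF x y] *[OF y x] B_chain[OF i x y] x y by blast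
  next
    case False
    then have i: "i = i0" using A_B[OF i] by blast
    then have c: "adj u z" if "u \<in> B i" "z \<in> C i" for u z using kinds False i0 that by blast
    have "(\<forall>z\<in>A. adj x z \<longrightarrow> adj y z) \<or> (\<forall>z\<in>A. adj y z \<longrightarrow> adj x z)"
    proof (rule ccontr)
      assume "\<not> ?thesis"
      then obtain z w where "z \<in> A" "w \<in> A" "adj z x" "\<not> adj z y" "adj w y" "\<not> adj w x"
        using adj_commute[of x] adj_commute[of y] by blast
      then show False using A_chain[of z w] x y unfolding i by blast
    qed
    then show ?thesis using *[OF x y] *[OF y x] c x y by blast
  qed
qed

definition K :: "'a set" where
  "K = (\<Union>i\<in>I. C i) \<union> Y"

lemma K_clique: "x \<in> K \<Longrightarrow> y \<in> K \<Longrightarrow> x \<noteq> y \<Longrightarrow> adj x y"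
  unfolding K_def using C_C Y_C Y_Y adj_commute[of x y] by blast

lemma K_A: "x \<in> K \<Longrightarrow> y \<in> A \<Longrightarrow> \<not> adj x y"
  unfolding K_def using A_C A_Y adj_commute[of x y] by blast

text \<open>When \<open>X\<close> is nonempty, \<open>kinds\<close> makes \<open>A\<close> complete
  to \<open>B i0\<close>, hence also to \<open>B j\<close>. So \<open>A\<close>, \<open>B j\<close>
  and \<open>X\<close>, which contain all neighbours of \<open>x\<close> outside \<open>F\<close>,
  form one clique.\<close>

lemma X_nbrs_clique:
  assumes x: "x \<in> X" and "adj x y" "adj x z" "y \<noteq> z" "y \<notin> F" "z \<notin> F"
  shows "adj y z"
proof -
  have *: "u \<in> A \<or> u \<in> B j \<or> u \<in> X" if u: "adj x u" "u \<notin> F" for u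
  proof -
    have "u \<in> Q" using u adjD by blast
    then show ?thesis
    proof (cases rule: Q_cases)
      case (2 i) then show ?thesis using X_B[OF _ x] u by blast
    next
      case (3 i) then show ?thesis using X_C[OF _ x] u by blast
    next
      case 6 then show ?thesis using X_Y[OF x] u by blast
    qed (use u in blast)+
  qed
  have jA: "adj u v" if "u \<in> A" "v \<in> B j" for u v
    using kinds A_B[OF j _ that] that x by blast
  show ?thesis
    using *[OF assms(2,5)] *[OF assms(3,6)] \<open>y \<noteq> z\<close> A_A[of y z] X_X[of y z] B_B[OF j j, of y z] jA[of y z] jA[of z y]
      X_A[of y z] X_A[of z y] X_B[OF j, of y z] X_B[OF j, of z y] adj_commute[of y z] by blast
qed

lemma F_nonnbr:
  assumes f: "f \<in> F" and "y \<in> Q" "f \<noteq> y" "\<not> adj f y"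
  shows "y \<in> B j \<or> y \<in> C j"
  using \<open>y \<in> Q\<close>
proof (cases rule: Q_cases)
  case 1 then show ?thesis using assms F_A by blast
next
  case 2 then show ?thesis using assms F_B by blast
next
  case 3 then show ?thesis using assms F_C by blast
next
  case 4 then show ?thesis using assms F_F by blast
next
  case 5 then show ?thesis using assms F_X by blast
next
  case 6 then show ?thesis using assms F_Y by blast
qed

text \<open>All nonneighbours of \<open>f\<close> lie in \<open>B j\<close> and \<open>C j\<close>,
  and the presence of \<open>f\<close> makes these two cliques complete to each other.\<close>

lemma F_nonnbrs_clique:
  assumes f: "f \<in> F" and y: "y \<in> Q" "f \<noteq> y" "\<not> adj f y" and z: "z \<in> Q" "f \<noteq> z" "\<not> adj f z" and "y \<noteq> z"
  shows "adj y z"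
  using F_nonnbr[OF f y] F_nonnbr[OF f z] \<open>y \<noteq> z\<close> B_B[OF j j, of y z] C_C[OF j j, of y z]
    F_B_C[OF f, of y z] F_B_C[OF f, of z y] adj_commute[of y z] by blast

text \<open>The common neighbours of \<open>f\<close> and its nonneighbour \<open>r\<close> lie in
  \<open>A\<close> and \<open>X\<close> if \<open>r\<close> belongs to \<open>B j\<close>, and in
  the \<open>C i\<close> and \<open>Y\<close> if it belongs to \<open>C j\<close>. In both cases
  they form a clique.\<close>

lemma F_square:
  assumes f: "f \<in> F" and r: "r \<in> Q" "f \<noteq> r" "\<not> adj f r"
    and y: "adj f y" "adj r y" and z: "adj f z" "adj r z" and "y \<noteq> z"
  shows "adj y z"
proof (cases "r \<in> B j")
  case True
  have *: "u \<in> A \<or> u \<in> X" if "adj f u" "adj r u" for u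
    using nbr_B[OF j True that(2)] that F_B[OF j f] F_C[OF j f] by blast
  show ?thesis using *[OF y] *[OF z] \<open>y \<noteq> z\<close> A_A[of y z] X_X[of y z] X_A[of y z] X_A[of z y] adj_commute[of y z] by blast
next
  case False
  then have r: "r \<in> C j" using F_nonnbr[OF f r] by blast
  have *: "u \<in> K" if "adj f u" "adj r u" for u
    using nbr_C[OF j r that(2)] that F_B[OF j f] unfolding K_def by blast
  show ?thesis using K_clique[OF *[OF y] *[OF z] \<open>y \<noteq> z\<close>] .
qed

lemma P3_clique: "adj p0 p1 \<Longrightarrow> adj p1 p2 \<Longrightarrow> \<not> adj p0 p2 \<Longrightarrow> p0 \<noteq> p2 \<Longrightarrow>
    (\<And>x y. x \<in> S \<Longrightarrow> y \<in> S \<Longrightarrow> x \<noteq> y \<Longrightarrow> adj x y) \<Longrightarrow> \<exists>p\<in>{p0, p1, p2}. p \<notin> S"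
  by blast

text \<open>What remains after the removal of \<open>F\<close>, \<open>K\<close> and
  \<open>A\<close> is a disjoint union of cliques, namely \<open>B j \<union> X\<close> and the
  other \<open>B i\<close>.\<close>

lemma P3_meets_A:
  assumes p: "adj p0 p1" "adj p1 p2" "\<not> adj p0 p2" "p0 \<noteq> p2"
    and F: "\<forall>p\<in>{p0, p1, p2}. p \<in> Q \<and> p \<notin> F \<and> p \<notin> K"
  shows "\<exists>p\<in>{p0, p1, p2}. p \<in> A"
proof (rule ccontr)
  assume A: "\<not> ?thesis"
  have part: "(\<exists>i\<in>I. p \<in> B i) \<or> p \<in> X" if "p \<in> {p0, p1, p2}" for p
  proof -
    have "p \<in> Q" "p \<notin> F" "p \<notin> K" "p \<notin> A" using that A F by blast+
    then show ?thesis using Q_cases[of p] unfolding K_def by blast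
  qed
  consider i where "i \<in> I" "p1 \<in> B i" | "p1 \<in> X" using part by blast
  then show False
  proof cases
    case 1
    have *: "p \<in> B i \<or> p \<in> X \<and> i = j" if "p \<in> {p0, p2}" for p
    proof -
      have "adj p1 p" using that p adj_commute[of p0 p1] by blast
      then show ?thesis using nbr_B[OF 1, of p] that A F 1(1) unfolding K_def by blast
    qed
    then have "adj p0 p2"
      using *[of p0] *[of p2] p(4) B_B[OF 1(1) 1(1), of p0 p2] X_X[of p0 p2] X_B[OF j, of p0 p2] X_B[OF j, of p2 p0]
        adj_commute[of p0 p2] by blast
    then show False using p(3) by blast
  next
    case 2
    have "adj p1 p0" using p(1) adj_commute[of p0 p1] by blast
    then show False using X_nbrs_clique[OF 2, of p0 p2] p F by blast
  qed
qed

text \<open>The first path contains a vertex \<open>a\<close> of \<open>A\<close>, so the second one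
  lies in \<open>K\<close> and \<open>B i0\<close>. As \<open>K\<close> is a clique, the second path
  has a vertex \<open>v\<close> in \<open>B i0\<close>, missed by \<open>a\<close>, and the house
  must be a 5-basket. A further vertex \<open>w\<close> of the second path lies in some
  \<open>C m\<close> with \<open>m \<noteq> i0\<close>. Avoiding \<open>v\<close> and
  \<open>w\<close>, the first path is confined to the clique \<open>A \<union> B l\<close> for the
  third index \<open>l\<close>.\<close>

lemma twoP3_avoid:
  assumes p: "adj p0 p1" "adj p1 p2" "\<not> adj p0 p2" "p0 \<noteq> p2"
    and q: "adj q0 q1" "adj q1 q2" "\<not> adj q0 q2" "q0 \<noteq> q2"
    and pF: "\<forall>p\<in>{p0, p1, p2}. p \<in> Q \<and> p \<notin> F" and qF: "\<forall>q\<in>{q0, q1, q2}. q \<in> Q \<and> q \<notin> F"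
    and pq: "\<forall>p\<in>{p0, p1, p2}. \<forall>q\<in>{q0, q1, q2}. p \<noteq> q \<and> \<not> adj p q"
    and K: "\<forall>p\<in>{p0, p1, p2}. p \<notin> K"
  shows False
proof -
  obtain a where a: "a \<in> {p0, p1, p2}" "a \<in> A" using P3_meets_A[OF p] pF K by blast
  have q_part: "q' \<in> K \<or> q' \<in> B i0" if q': "q' \<in> {q0, q1, q2}" for q'
  proof -
    have n: "a \<noteq> q'" "\<not> adj a q'" using pq a(1) q' by blast+
    have "q' \<in> Q" using qF q' by blast
    then show ?thesis
    proof (cases rule: Q_cases)
      case 1 then show ?thesis using A_A[OF a(2)] n by blast
    next
      case (2 i) then show ?thesis using A_B[OF _ _ a(2)] n by blast
    next
      case 3 then show ?thesis unfolding K_def by blast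
    next
      case 4 then show ?thesis using qF q' by blast
    next
      case 5 then show ?thesis using X_A[OF _ a(2)] n adj_commute[of a q'] by blast
    next
      case 6 then show ?thesis unfolding K_def by blast
    qed
  qed
  obtain v where v: "v \<in> {q0, q1, q2}" "v \<notin> K" using P3_clique[OF q K_clique] by blast
  have vB: "v \<in> B i0" and av: "\<not> adj a v" using v q_part a pq by blast+
  then have kind: "X = {}" "Y = {}" "card I = 3" and BC: "\<And>i x y. i \<in> I \<Longrightarrow> x \<in> B i \<Longrightarrow> y \<in> C i \<Longrightarrow> adj x y"
    using kinds a(2) by blast+
  have cl: "adj x y" if "x \<in> B i0 \<union> C i0" "y \<in> B i0 \<union> C i0" "x \<noteq> y" for x y
    using that B_B[OF i0 i0, of x y] C_C[OF i0 i0, of x y] BC[OF i0, of x y] BC[OF i0, of y x]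
      adj_commute[of x y] by blast
  obtain w where w: "w \<in> {q0, q1, q2}" "w \<notin> B i0 \<union> C i0" using P3_clique[OF q cl] by blast
  then obtain m where m: "m \<in> I" "w \<in> C m" "m \<noteq> i0" using q_part[OF w(1)] kind unfolding K_def by blast
  obtain l where l: "l \<in> I" "l \<noteq> i0" "l \<noteq> m" using third by blast
  have "finite I" using \<open>card I = 3\<close> by (simp add: card_ge_0_finite)
  then have I: "I = {i0, m, l}" using card_seteq[of I "{i0, m, l}"] kind(3) i0 m l by simp
  have p_part: "p' \<in> A \<union> B l" if p': "p' \<in> {p0, p1, p2}" for p'
  proof -
    have n: "p' \<noteq> v" "\<not> adj p' v" "\<not> adj p' w" using pq p' v(1) w(1) by blast+
    have "p' \<in> Q" using pF p' by blast
    then show ?thesis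
    proof (cases rule: Q_cases)
      case (2 i)
      have "i \<noteq> i0" using B_B[OF i0 i0 _ vB, of p'] n(1,2) 2 by blast
      moreover have "i \<noteq> m" using BC[OF m(1) _ m(2), of p'] n(3) 2 by blast
      ultimately show ?thesis using I 2 by blast
    next
      case (3 i) then show ?thesis using K p' unfolding K_def by blast
    next
      case 4 then show ?thesis using pF p' by blast
    qed (use kind in blast)+
  qed
  have "adj x y" if "x \<in> A \<union> B l" "y \<in> A \<union> B l" "x \<noteq> y" for x y
    using that A_A[of x y] B_B[OF l(1) l(1), of x y] A_B[OF l(1,2), of x y] A_B[OF l(1,2), of y x]
      adj_commute[of x y] by blast
  then show False using P3_clique[OF p, of "A \<union> B l"] p_part by blast
qed

text \<open>Two anticomplete paths cannot both meet the clique \<open>K\<close>, so one of them may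
  be taken as the path avoiding it.\<close>

lemma no_twoP3_avoiding_F:
  assumes p: "adj p0 p1" "adj p1 p2" "\<not> adj p0 p2" "p0 \<noteq> p2"
    and q: "adj q0 q1" "adj q1 q2" "\<not> adj q0 q2" "q0 \<noteq> q2"
    and pF: "\<forall>p\<in>{p0, p1, p2}. p \<in> Q \<and> p \<notin> F" and qF: "\<forall>q\<in>{q0, q1, q2}. q \<in> Q \<and> q \<notin> F"
    and pq: "\<forall>p\<in>{p0, p1, p2}. \<forall>q\<in>{q0, q1, q2}. p \<noteq> q \<and> \<not> adj p q"
  shows False
proof (cases "\<forall>p\<in>{p0, p1, p2}. p \<notin> K")
  case True then show False using twoP3_avoid[OF assms] by blast
next
  case False
  then obtain p' where p': "p' \<in> {p0, p1, p2}" "p' \<in> K" by blast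
  have "q' \<notin> K" if "q' \<in> {q0, q1, q2}" for q' using K_clique[OF p'(2), of q'] pq p'(1) that by blast
  moreover have "q' \<noteq> p' \<and> \<not> adj q' p'" if "q' \<in> {q0, q1, q2}" "p' \<in> {p0, p1, p2}" for p' q'
    using pq that adj_commute[of q' p'] by blast
  ultimately show False using twoP3_avoid[OF q p qF pF] by blast
qed

lemma pattern_avoids_F:
  assumes f: "inj_on f {0..<n}" "f ` {0..<n} \<subseteq> Q" "\<forall>x\<in>{0..<n}. \<forall>y\<in>{0..<n}. adj (f x) (f y) \<longleftrightarrow> H x y"
    and H: "\<forall>x\<in>{0..<n}. \<exists>y\<in>{0..<n}. \<exists>z\<in>{0..<n}. x \<noteq> y \<and> x \<noteq> z \<and> y \<noteq> z \<and> \<not> H x y \<and> \<not> H x z \<and> \<not> H y z"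
    and x: "x \<in> {0..<n}"
  shows "f x \<notin> F"
proof
  assume F: "f x \<in> F"
  obtain y z where y: "y \<in> {0..<n}" and z: "z \<in> {0..<n}" and ne: "x \<noteq> y" "x \<noteq> z" "y \<noteq> z"
    and "\<not> H x y" "\<not> H x z" "\<not> H y z" using H x by blast
  then have "\<not> adj (f x) (f y)" "\<not> adj (f x) (f z)" "\<not> adj (f y) (f z)" using f(3) x by blast+
  moreover have "f x \<noteq> f y" "f x \<noteq> f z" "f y \<noteq> f z" using inj_on_eq_iff[OF f(1)] x y z ne by blast+
  moreover have "f y \<in> Q" "f z \<in> Q" using f(2) y z by blast+
  ultimately show False using F_nonnbrs_clique[OF F] by blast
qed

text \<open>Closed neighbourhoods of two vertices of \<open>A\<close>, or of two of the same
  \<open>B i\<close>, are comparable, which nondomination forbids. The copy thus has at most one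
  vertex in \<open>A\<close> and no edge inside the \<open>B i\<close>. A vertex of \<open>K\<close>
  has all its neighbours among the \<open>B i\<close> in a single clique. These facts are the
  conditions that \<open>villaless\<close> refutes.\<close>

lemma no_pattern_avoiding_F:
  assumes f: "inj_on f {0..<n}" "f ` {0..<n} \<subseteq> Q" "\<forall>x\<in>{0..<n}. \<forall>y\<in>{0..<n}. adj (f x) (f y) \<longleftrightarrow> H x y"
    and nd: "nondominated n H" and vl: "villaless n H"
    and ns: "\<forall>x\<in>{0..<n}. \<exists>y\<in>{0..<n}. \<exists>z\<in>{0..<n}. y \<noteq> z \<and> H x y \<and> H x z \<and> \<not> H y z"
    and F: "\<And>x. x \<in> {0..<n} \<Longrightarrow> f x \<notin> F"
  shows False
proof -
  have inj: "x \<noteq> y \<Longrightarrow> f x \<noteq> f y" if "x \<in> {0..<n}" "y \<in> {0..<n}" for x y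
    using inj_on_eq_iff[OF f(1)] that by blast
  have X: "f x \<notin> X" if x: "x \<in> {0..<n}" for x
  proof
    assume X: "f x \<in> X"
    obtain y z where y: "y \<in> {0..<n}" and z: "z \<in> {0..<n}" and "y \<noteq> z" "H x y" "H x z" "\<not> H y z"
      using ns x by blast
    then have "adj (f x) (f y)" "adj (f x) (f z)" "\<not> adj (f y) (f z)" "f y \<noteq> f z" using f(3) x inj by blast+
    then show False using X_nbrs_clique[OF X] F y z by blast
  qed
  have dom: "\<not> (dom (f x) (f y) \<or> dom (f y) (f x))" if x: "x \<in> {0..<n}" and y: "y \<in> {0..<n}" and h: "adj (f x) (f y)" for x y
  proof -
    have *: "\<not> dom (f x) (f y)" if x: "x \<in> {0..<n}" and y: "y \<in> {0..<n}" and h: "adj (f x) (f y)" for x y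
    proof -
      obtain z where z: "z \<in> {0..<n}" "z \<noteq> y" "H x z" "\<not> H y z"
        using nd x y h f(3) unfolding nondominated_def by blast
      then have "adj (f x) (f z)" "\<not> adj (f y) (f z)" "f z \<noteq> f y" using f(3) x y inj by blast+
      then show ?thesis unfolding dom_def by blast
    qed
    show ?thesis using *[OF x y h] *[OF y x] h adj_commute[of "f x" "f y"] by blast
  qed
  define KK where "KK x \<longleftrightarrow> f x \<in> K" for x
  define M where "M x \<longleftrightarrow> f x \<in> A" for x
  have B: "\<exists>i\<in>I. f x \<in> B i" if "x \<in> {0..<n}" "\<not> KK x" "\<not> M x" for x
  proof -
    have "f x \<in> Q" using f(2) that(1) by blast
    then show ?thesis using that F[OF that(1)] X[OF that(1)] unfolding KK_def M_def K_def by (cases rule: Q_cases) blast+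
  qed
  have "(KK x \<and> KK y \<longrightarrow> x = y \<or> H x y) \<and> (M x \<and> M y \<longrightarrow> x = y) \<and> (KK x \<and> M y \<longrightarrow> \<not> H x y) \<and>
     (H x y \<longrightarrow> KK x \<or> M x \<or> KK y \<or> M y) \<and>
     (KK x \<and> H x y \<longrightarrow> KK y \<or> M y \<or> (\<forall>z\<in>{0..<n}. H x z \<longrightarrow> KK z \<or> M z \<or> y = z \<or> H y z))"
    if x: "x \<in> {0..<n}" and y: "y \<in> {0..<n}" for x y
  proof (intro conjI impI)
    have H: "H x y \<longleftrightarrow> adj (f x) (f y)" using f(3) x y by blast
    show "x = y \<or> H x y" if "KK x \<and> KK y" using that K_clique inj[OF x y] H unfolding KK_def by blast
    show "x = y" if "M x \<and> M y" using that A_A A_dom dom[OF x y] inj[OF x y] unfolding M_def by blast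
    show "\<not> H x y" if "KK x \<and> M y" using that K_A H unfolding KK_def M_def by blast
    show "KK x \<or> M x \<or> KK y \<or> M y" if h: "H x y"
    proof (rule ccontr)
      assume "\<not> ?thesis"
      then obtain i k where i: "i \<in> I" "f x \<in> B i" and k: "k \<in> I" "f y \<in> B k" using B x y by blast
      have a: "adj (f x) (f y)" using h H by blast
      then have "i = k" using B_B[OF i(1) k(1) i(2) k(2)] adjD by blast
      then show False using B_dom[OF i] k dom[OF x y a] by blast
    qed
    show "KK y \<or> M y \<or> (\<forall>z\<in>{0..<n}. H x z \<longrightarrow> KK z \<or> M z \<or> y = z \<or> H y z)" if h: "KK x \<and> H x y"
    proof (rule ccontr)
      assume "\<not> ?thesis"
      then obtain z where z: "z \<in> {0..<n}" "H x z" "\<not> KK z" "\<not> M z" "y \<noteq> z" "\<not> H y z" and yn: "\<not> KK y" "\<not> M y" by blast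
      obtain i k where i: "i \<in> I" "f y \<in> B i" and k: "k \<in> I" "f z \<in> B k" using B yn z y by blast
      have a: "adj (f x) (f y)" "adj (f x) (f z)" "\<not> adj (f y) (f z)" "f y \<noteq> f z"
        using h z f(3) x y inj by blast+
      have "f x \<notin> Y" using Y_B i a(1) by blast
      then obtain l where l: "l \<in> I" "f x \<in> C l" using h unfolding KK_def K_def by blast
      have "l = i" using B_C[OF i(1) l(1) _ i(2) l(2)] a(1) adj_commute[of "f x" "f y"] by blast
      moreover have "l = k" using B_C[OF k(1) l(1) _ k(2) l(2)] a(2) adj_commute[of "f x" "f z"] by blast
      ultimately show False using B_B[OF i(1) k(1) i(2) k(2)] a(3,4) by blast
    qed
  qed
  then show False using vl[unfolded villaless_def, rule_format, of KK M] by blast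
qed

end

context simple_graph
begin

lemma has_induced_adj:
  assumes "has_induced V E {0..<n} H"
  obtains f where "inj_on f {0..<n}" "f ` {0..<n} \<subseteq> V"
    "\<forall>x\<in>{0..<n}. \<forall>y\<in>{0..<n}. adj (f x) (f y) \<longleftrightarrow> H x y"
proof -
  obtain f where f: "inj_on f {0..<n}" "f ` {0..<n} \<subseteq> V" "\<forall>x\<in>{0..<n}. \<forall>y\<in>{0..<n}. E (f x) (f y) \<longleftrightarrow> H x y"
    using assms unfolding has_induced_def by blast
  have "adj (f x) (f y) \<longleftrightarrow> H x y" if "x \<in> {0..<n}" "y \<in> {0..<n}" for x y
  proof -
    have "f x \<in> V" "f y \<in> V" using f(2) that by blast+
    then show ?thesis using adj_iff f(3) that by simp
  qed
  then show thesis using that[of f] f by blast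
qed

end

context house
begin

lemma B_nonempty: "i \<in> I \<Longrightarrow> \<exists>x. x \<in> B i" and A_nonempty: "\<exists>x. x \<in> A"
  using B_top A_top by blast+

lemma C_nonempty: "i \<in> I \<Longrightarrow> \<exists>x. x \<in> C i"
  using B_nonempty B_nbr by blast

lemma nonuniversal:
  assumes v: "v \<in> Q"
  shows "\<exists>u\<in>Q. u \<noteq> v \<and> \<not> E v u"
proof -
  \<comment> \<open>The vertex \<open>w\<close> distinguishes \<open>u\<close> from
    \<open>v\<close>, so that inequality never has to be read off from the disjointness of
    parts.\<close>
  have *: ?thesis if "adj v w" "\<not> adj u w" "\<not> adj u v" "u \<in> Q" for u w
    using that v by (metis adj_iff adj_commute)
  show ?thesis using v
  proof (cases rule: Q_cases)
    case 1
    obtain k where k: "k \<in> I" "k \<noteq> i0" using third by blast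
    obtain w where w: "w \<in> B k" using B_nonempty[OF k(1)] by blast
    obtain u where u: "u \<in> C i0" using C_nonempty[OF i0] by blast
    show ?thesis
      using *[of w u] A_B[OF k 1 w] B_C[OF k(1) i0 k(2) w u] A_C[OF i0 1 u] adj_commute[of u] Q u i0 by blast
  next
    case (2 i)
    obtain k where k: "k \<in> I" "k \<noteq> i" using third by blast
    obtain w where w: "w \<in> C i" "adj v w" using B_nbr[OF 2] by blast
    obtain u where u: "u \<in> B k" using B_nonempty[OF k(1)] by blast
    have n: "\<not> adj u w" using B_C[OF k(1) 2(1) k(2) u w(1)] .
    then have "u \<noteq> v" using w(2) by blast
    then show ?thesis using *[OF w(2) n] B_B[OF k(1) 2(1) u 2(2)] k u Q by blast
  next
    case (3 i)
    obtain k where k: "k \<in> I" "k \<noteq> i0" "k \<noteq> i" using third by blast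
    obtain w where w: "w \<in> B k" using B_nonempty[OF k(1)] by blast
    obtain u where u: "u \<in> A" using A_nonempty by blast
    have "adj u w" "\<not> adj v w" "\<not> adj u v"
      using A_B[OF k(1,2) u w] B_C[OF k(1) 3(1) k(3) w 3(2)] adj_commute[of v w] A_C[OF 3(1) u 3(2)] by blast+
    moreover have "u \<in> Q" using u Q by blast
    ultimately show ?thesis using v by (metis adj_iff adj_commute)
  next
    case 4
    obtain k where k: "k \<in> I" "k \<noteq> j" using third by blast
    obtain w where w: "w \<in> C k" using C_nonempty[OF k(1)] by blast
    obtain u where u: "u \<in> B j" using B_nonempty[OF j] by blast
    have "j \<noteq> k" using k(2) by blast
    then show ?thesis
      using *[of w u] F_C[OF k(1) 4 w] k(2) B_C[OF j k(1) _ u w] F_B[OF j 4 u] adj_commute[of u v] Q u j by blast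
  next
    case 5
    obtain k where k: "k \<in> I" "k \<noteq> j" using third by blast
    obtain u where u: "u \<in> C k" using C_nonempty[OF k(1)] by blast
    obtain w where w: "w \<in> B j" using B_nonempty[OF j] by blast
    have "j \<noteq> k" using k(2) by blast
    then show ?thesis
      using *[of w u] X_B[OF j 5 w] B_C[OF j k(1) _ w u] adj_commute[of u] X_C[OF k(1) 5 u] Q u k(1) by blast
  next
    case 6
    obtain w where w: "w \<in> C j" using C_nonempty[OF j] by blast
    obtain u where u: "u \<in> A" using A_nonempty by blast
    show ?thesis using *[of w u] Y_C[OF j 6 w] A_C[OF j u w] A_Y[OF u 6] Q u by blast
  qed
qed

lemma nonsimplicial:
  assumes Y: "Y \<noteq> {} \<Longrightarrow> F \<noteq> {}" and v: "v \<in> Q"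
  shows "\<not> simplicial Q E v"
proof -
  \<comment> \<open>Here too, \<open>w\<close> serves only to show that the nonadjacent neighbours
    \<open>y\<close> and \<open>z\<close> are different vertices.\<close>
  have *: ?thesis if "adj v y" "adj v z" "\<not> adj y z" "adj y w" "\<not> adj z w" for y z w
  proof -
    have "y \<noteq> z" using that by blast
    then show ?thesis using that unfolding simplicial_def clique_def nbhd_def adj_def by blast
  qed
  have two: ?thesis if i: "i \<in> I" and k: "k \<in> I" and "i \<noteq> k" and "\<And>y. y \<in> B i \<union> B k \<Longrightarrow> adj v y" for i k
  proof -
    obtain y z where y: "y \<in> B i" and z: "z \<in> B k" using B_nonempty i k by blast
    obtain w where w: "w \<in> C i" "adj y w" using B_nbr[OF i y] by blast
    have n: "\<not> adj z w" using B_C[OF k i _ z w(1)] \<open>i \<noteq> k\<close> by blast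
    then have "y \<noteq> z" using w(2) by blast
    then have "\<not> adj y z" using B_B[OF i k y z] \<open>i \<noteq> k\<close> by simp
    moreover have "adj v y" "adj v z" using that(4) y z by blast+
    ultimately show ?thesis using *[OF _ _ _ w(2) n] by blast
  qed
  obtain a where a: "a \<in> A" "\<forall>y\<in>B i0. adj a y" using A_top by blast
  have aB: "adj a y" if "i \<in> I" "y \<in> B i" for i y using a A_B[OF that(1) _ a(1) that(2)] that(2) by blast
  show ?thesis using v
  proof (cases rule: Q_cases)
    case 1
    obtain i where i: "i \<in> I" "i \<noteq> i0" using third by blast
    obtain k where k: "k \<in> I" "k \<noteq> i0" "k \<noteq> i" using third by blast
    show ?thesis using two[OF i(1) k(1)] k(3) A_B[OF i 1] A_B[OF k(1,2) 1] by blast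
  next
    case (2 i)
    obtain c where c: "c \<in> C i" "adj v c" using B_nbr[OF 2] by blast
    obtain k where k: "k \<in> I" "k \<noteq> i" using third by blast
    obtain w where w: "w \<in> B k" using B_nonempty[OF k(1)] by blast
    show ?thesis
      using *[of a c w] aB[OF 2] adj_commute[of a v] c A_C[OF 2(1) a(1) c(1)] aB[OF k(1) w]
        B_C[OF k(1) 2(1) k(2) w c(1)] adj_commute[of c w] by blast
  next
    case (3 i)
    obtain b where b: "b \<in> B i" "\<forall>y\<in>C i. adj b y" using B_top[OF 3(1)] by blast
    obtain k where k: "k \<in> I" "k \<noteq> i" using third by blast
    then have "i \<noteq> k" by blast
    obtain c where c: "c \<in> C k" using C_nonempty[OF k(1)] by blast
    have bc: "\<not> adj b c" using B_C[OF 3(1) k(1) \<open>i \<noteq> k\<close> b(1) c] .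
    have bv: "adj b v" using b 3 by blast
    then have "v \<noteq> c" using bc by blast
    then have "adj v c" using C_C[OF 3(1) k(1) 3(2) c] by blast
    then show ?thesis
      using *[of b c a] bv adj_commute[of v b] bc aB[OF 3(1) b(1)] adj_commute[of a b] A_C[OF k(1) a(1) c]
        adj_commute[of a c] by blast
  next
    case 4
    obtain i where i: "i \<in> I" "i \<noteq> j" using third by blast
    obtain k where k: "k \<in> I" "k \<noteq> j" "k \<noteq> i" using third by blast
    show ?thesis using two[OF i(1) k(1)] i k F_B[OF i(1) 4] F_B[OF k(1) 4] by blast
  next
    case 5
    obtain f where f: "f \<in> F" using X_nonempty 5 by blast
    obtain b where b: "b \<in> B j" using B_nonempty[OF j] by blast
    obtain c where c: "c \<in> C j" "adj b c" using B_nbr[OF j b] by blast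
    show ?thesis
      using *[of b f c] X_B[OF j 5 b] F_X[OF f 5] adj_commute[of f v] F_B[OF j f b] adj_commute[of f b] c
        F_C[OF j f c(1)] by blast
  next
    case 6
    obtain f where f: "f \<in> F" using Y 6 by blast
    obtain c where c: "c \<in> C j" using C_nonempty[OF j] by blast
    show ?thesis
      using *[of f c a] F_Y[OF f 6] adj_commute[of f v] Y_C[OF j 6 c] F_C[OF j f c] F_A[OF f a(1)]
        A_C[OF j a(1) c] adj_commute[of a c] by blast
  qed
qed

lemma house_free: "is_free Q E"
proof -
  have 1: "\<not> has_induced Q E {0..<n} H"
    if H: "n = 6 \<and> H = cycle_rel 6 \<or> n = 7 \<and> H = cycle_rel 7 \<or> n = 9 \<and> H = T0_rel" for n H
  proof
    assume "has_induced Q E {0..<n} H"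
    then obtain f where f: "inj_on f {0..<n}" "f ` {0..<n} \<subseteq> Q"
      "\<forall>x\<in>{0..<n}. \<forall>y\<in>{0..<n}. adj (f x) (f y) \<longleftrightarrow> H x y" using has_induced_adj by blast
    have nn: "\<forall>x\<in>{0..<n}. \<exists>y\<in>{0..<n}. \<exists>z\<in>{0..<n}. x \<noteq> y \<and> x \<noteq> z \<and> y \<noteq> z \<and> \<not> H x y \<and> \<not> H x z \<and> \<not> H y z"
      by (rule nonneighbours) (use H in blast)
    have ns: "\<forall>x\<in>{0..<n}. \<exists>y\<in>{0..<n}. \<exists>z\<in>{0..<n}. y \<noteq> z \<and> H x y \<and> H x z \<and> \<not> H y z"
      by (rule nonsimplicial_pattern) (use H in blast)
    have "nondominated n H" "villaless n H" using H nondominated villaless by blast+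
    then show False using no_pattern_avoiding_F[OF f _ _ ns pattern_avoids_F[OF f nn]] by blast
  qed
  have 2: "\<not> has_induced Q E {0..<4} (cycle_rel 4)"
  proof
    assume "has_induced Q E {0..<4} (cycle_rel 4)"
    then obtain f where f: "inj_on f {0..<4}" "f ` {0..<4} \<subseteq> Q"
      "\<forall>x\<in>{0..<4}. \<forall>y\<in>{0..<4}. adj (f x) (f y) \<longleftrightarrow> cycle_rel 4 x y" using has_induced_adj by blast
    have ns: "\<forall>x\<in>{0..<4}. \<exists>y\<in>{0..<4}. \<exists>z\<in>{0..<4}. y \<noteq> z \<and> cycle_rel 4 x y \<and> cycle_rel 4 x z \<and> \<not> cycle_rel 4 y z"
      by (rule nonsimplicial_pattern) blast
    have sq: "\<forall>x\<in>{0..<4}. \<exists>r\<in>{0..<4}. \<exists>y\<in>{0..<4}. \<exists>z\<in>{0..<4}. x \<noteq> r \<and> \<not> cycle_rel 4 x r \<and>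
      cycle_rel 4 x y \<and> cycle_rel 4 r y \<and> cycle_rel 4 x z \<and> cycle_rel 4 r z \<and> y \<noteq> z \<and> \<not> cycle_rel 4 y z"
      unfolding atLeastLessThan_numerals by (simp add: cycle_rel_def)
    have "f x \<notin> F" if x: "x \<in> {0..<4}" for x
    proof
      assume F: "f x \<in> F"
      obtain r y z where m: "r \<in> {0..<4}" "y \<in> {0..<4}" "z \<in> {0..<4}" and
        h: "x \<noteq> r" "\<not> cycle_rel 4 x r" "cycle_rel 4 x y" "cycle_rel 4 r y" "cycle_rel 4 x z" "cycle_rel 4 r z"
        "y \<noteq> z" "\<not> cycle_rel 4 y z" using sq x by blast
      have "f r \<in> Q" "f x \<noteq> f r" "f y \<noteq> f z" using f(2) inj_on_eq_iff[OF f(1)] x m h by blast+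
      moreover have "\<not> adj (f x) (f r)" "adj (f x) (f y)" "adj (f r) (f y)" "adj (f x) (f z)" "adj (f r) (f z)"
        "\<not> adj (f y) (f z)" using f(3) x m h by blast+
      ultimately show False using F_square[OF F] by blast
    qed
    then show False using no_pattern_avoiding_F[OF f nondominated(1) villaless(1) ns] by blast
  qed
  have 3: "\<not> has_induced Q E {0..<6} twoP3_rel"
  proof
    assume "has_induced Q E {0..<6} twoP3_rel"
    then obtain f where f: "inj_on f {0..<6}" "f ` {0..<6} \<subseteq> Q"
      "\<forall>x\<in>{0..<6}. \<forall>y\<in>{0..<6}. adj (f x) (f y) \<longleftrightarrow> twoP3_rel x y" using has_induced_adj by blast
    have nn: "\<forall>x\<in>{0..<6}. \<exists>y\<in>{0..<6}. \<exists>z\<in>{0..<6}. x \<noteq> y \<and> x \<noteq> z \<and> y \<noteq> z \<and>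
        \<not> twoP3_rel x y \<and> \<not> twoP3_rel x z \<and> \<not> twoP3_rel y z"
      by (rule nonneighbours) blast
    have av: "f x \<in> Q \<and> f x \<notin> F" if "x \<in> {0..<6}" for x
      using pattern_avoids_F[OF f nn that] f(2) that by blast
    have adj: "adj (f x) (f y) \<longleftrightarrow> twoP3_rel x y" and ne: "f x = f y \<longleftrightarrow> x = y" if "x \<in> {0..<6}" "y \<in> {0..<6}" for x y
      using f(3) inj_on_eq_iff[OF f(1)] that by blast+
    show False
      by (rule no_twoP3_avoiding_F[of "f 0" "f 1" "f 2" "f 3" "f 4" "f 5"])
        (use av in \<open>simp_all add: adj ne twoP3_rel_def edges_rel_def\<close>)
  qed
  show ?thesis unfolding is_free_def using 1 2 3 by blast
qed

end

section \<open>Freeness of 5-crowns\<close>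

lemma crown_pattern_4:
  assumes "\<And>x. x \<in> {0..<4} \<Longrightarrow> P0 x \<or> P1 x \<or> P2 x \<or> P3 x \<or> P4 x"
    and "\<And>x y. x \<in> {0..<4} \<Longrightarrow> y \<in> {0..<4} \<Longrightarrow> x \<noteq> y \<Longrightarrow>
      \<not> (P0 x \<and> P0 y) \<and> \<not> (P1 x \<and> P1 y) \<and> \<not> (P2 x \<and> P2 y) \<and> \<not> (P3 x \<and> P3 y) \<and> \<not> (P4 x \<and> P4 y)"
    and "\<And>x y. x \<in> {0..<4} \<Longrightarrow> y \<in> {0..<4} \<Longrightarrow> cycle_rel 4 x y \<Longrightarrow>
      \<not> (P0 x \<and> P2 y) \<and> \<not> (P1 x \<and> P3 y) \<and> \<not> (P2 x \<and> P4 y) \<and> \<not> (P3 x \<and> P0 y) \<and> \<not> (P4 x \<and> P1 y)"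
  shows False
proof -
  \<comment> \<open>A 4-cycle would occupy four different parts. Four of five cyclically arranged
    parts form a path, along which adjacent vertices must be in consecutive parts, so the cycle
    cannot close.\<close>
  have "\<not> (\<forall>x\<in>{0..<4}. (P0 x \<or> P1 x \<or> P2 x \<or> P3 x \<or> P4 x) \<and> (\<forall>y\<in>{0..<4}.
      (x \<noteq> y \<longrightarrow> \<not> (P0 x \<and> P0 y) \<and> \<not> (P1 x \<and> P1 y) \<and> \<not> (P2 x \<and> P2 y) \<and> \<not> (P3 x \<and> P3 y) \<and> \<not> (P4 x \<and> P4 y)) \<and>
      (cycle_rel 4 x y \<longrightarrow> \<not> (P0 x \<and> P2 y) \<and> \<not> (P1 x \<and> P3 y) \<and> \<not> (P2 x \<and> P4 y) \<and> \<not> (P3 x \<and> P0 y) \<and> \<not> (P4 x \<and> P1 y))))"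
    unfolding atLeastLessThan_numerals by (simp add: cycle_rel_def del: One_nat_def; sat)
  moreover have "\<forall>x\<in>{0..<4}. (P0 x \<or> P1 x \<or> P2 x \<or> P3 x \<or> P4 x) \<and> (\<forall>y\<in>{0..<4}.
      (x \<noteq> y \<longrightarrow> \<not> (P0 x \<and> P0 y) \<and> \<not> (P1 x \<and> P1 y) \<and> \<not> (P2 x \<and> P2 y) \<and> \<not> (P3 x \<and> P3 y) \<and> \<not> (P4 x \<and> P4 y)) \<and>
      (cycle_rel 4 x y \<longrightarrow> \<not> (P0 x \<and> P2 y) \<and> \<not> (P1 x \<and> P3 y) \<and> \<not> (P2 x \<and> P4 y) \<and> \<not> (P3 x \<and> P0 y) \<and> \<not> (P4 x \<and> P1 y)))"
    by (rule ballI, rule conjI[OF assms(1)], assumption, rule ballI, rule conjI; rule impI)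
      (rule assms(2,3); assumption)+
  ultimately show False by (rule notE)
qed

text \<open>The classes 1 and 2 together, 3 and 4 together, and class 0 are three cliques covering
  everything, whereas the four ends of 2P3 are pairwise nonadjacent.\<close>

lemma crown_pattern_6:
  assumes "\<And>x. x \<in> {0..<6} \<Longrightarrow> P0 x \<or> P1 x \<or> P2 x \<or> P3 x \<or> P4 x"
    and "\<And>x y. x \<in> {0..<6} \<Longrightarrow> y \<in> {0..<6} \<Longrightarrow> x \<noteq> y \<Longrightarrow> \<not> twoP3_rel x y \<Longrightarrow>
      (\<not> (P0 x \<and> P0 y) \<and> \<not> (P1 x \<and> P1 y) \<and> \<not> (P2 x \<and> P2 y) \<and> \<not> (P3 x \<and> P3 y) \<and> \<not> (P4 x \<and> P4 y)) \<and> \<not> (P4 x \<and> P3 y) \<and> \<not> (P1 x \<and> P2 y)"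
    and "\<And>x y. x \<in> {0..<6} \<Longrightarrow> y \<in> {0..<6} \<Longrightarrow> twoP3_rel x y \<Longrightarrow>
      \<not> (P0 x \<and> P2 y) \<and> \<not> (P1 x \<and> P3 y) \<and> \<not> (P2 x \<and> P4 y) \<and> \<not> (P3 x \<and> P0 y) \<and> \<not> (P4 x \<and> P1 y)"
  shows False
proof -
  have "\<not> (\<forall>x\<in>{0..<6}. (P0 x \<or> P1 x \<or> P2 x \<or> P3 x \<or> P4 x) \<and> (\<forall>y\<in>{0..<6}.
      (x \<noteq> y \<longrightarrow> \<not> twoP3_rel x y \<longrightarrow> (\<not> (P0 x \<and> P0 y) \<and> \<not> (P1 x \<and> P1 y) \<and> \<not> (P2 x \<and> P2 y) \<and> \<not> (P3 x \<and> P3 y) \<and> \<not> (P4 x \<and> P4 y)) \<and> \<not> (P4 x \<and> P3 y) \<and> \<not> (P1 x \<and> P2 y)) \<and>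
      (twoP3_rel x y \<longrightarrow> \<not> (P0 x \<and> P2 y) \<and> \<not> (P1 x \<and> P3 y) \<and> \<not> (P2 x \<and> P4 y) \<and> \<not> (P3 x \<and> P0 y) \<and> \<not> (P4 x \<and> P1 y))))"
    unfolding atLeastLessThan_numerals by (simp add: twoP3_rel_def edges_rel_def; sat)
  moreover have "\<forall>x\<in>{0..<6}. (P0 x \<or> P1 x \<or> P2 x \<or> P3 x \<or> P4 x) \<and> (\<forall>y\<in>{0..<6}.
      (x \<noteq> y \<longrightarrow> \<not> twoP3_rel x y \<longrightarrow> (\<not> (P0 x \<and> P0 y) \<and> \<not> (P1 x \<and> P1 y) \<and> \<not> (P2 x \<and> P2 y) \<and> \<not> (P3 x \<and> P3 y) \<and> \<not> (P4 x \<and> P4 y)) \<and> \<not> (P4 x \<and> P3 y) \<and> \<not> (P1 x \<and> P2 y)) \<and>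
      (twoP3_rel x y \<longrightarrow> \<not> (P0 x \<and> P2 y) \<and> \<not> (P1 x \<and> P3 y) \<and> \<not> (P2 x \<and> P4 y) \<and> \<not> (P3 x \<and> P0 y) \<and> \<not> (P4 x \<and> P1 y)))"
    by (rule ballI, rule conjI[OF assms(1)], assumption, rule ballI, rule conjI; (rule impI)+)
      (rule assms(2,3); assumption)+
  ultimately show False by (rule notE)
qed

text \<open>The parts are shifted so that the distinguished index of the 5-crown is 0.\<close>

locale crown = simple_graph Q E for Q :: "'a set" and E +
  fixes Z :: "nat \<Rightarrow> 'a set"
  assumes Q: "Q = (\<Union>i<5. Z i)"
    and same: "i < 5 \<Longrightarrow> x \<in> Z i \<Longrightarrow> y \<in> Z i \<Longrightarrow> x \<noteq> y \<Longrightarrow> adj x y"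
    and far: "i < 5 \<Longrightarrow> x \<in> Z i \<Longrightarrow> y \<in> Z ((i + 2) mod 5) \<Longrightarrow> \<not> adj x y \<and> x \<noteq> y"
    and dom: "i < 5 \<Longrightarrow> x \<in> Z i \<Longrightarrow> y \<in> Z i \<Longrightarrow>
      (\<forall>z. adj x z \<longrightarrow> z = y \<or> adj y z) \<or> (\<forall>z. adj y z \<longrightarrow> z = x \<or> adj x z)"
    and top: "i < 5 \<Longrightarrow> \<exists>x\<in>Z i. \<forall>y\<in>Z ((i + 1) mod 5) \<union> Z ((i + 4) mod 5). adj x y"
    and Z1_Z2: "x \<in> Z 1 \<Longrightarrow> y \<in> Z 2 \<Longrightarrow> adj x y"
    and Z4_Z3: "x \<in> Z 4 \<Longrightarrow> y \<in> Z 3 \<Longrightarrow> adj x y"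
begin

lemma fars: "x \<in> Z 0 \<Longrightarrow> y \<in> Z 2 \<Longrightarrow> \<not> adj x y" "x \<in> Z 1 \<Longrightarrow> y \<in> Z 3 \<Longrightarrow> \<not> adj x y"
  "x \<in> Z 2 \<Longrightarrow> y \<in> Z 4 \<Longrightarrow> \<not> adj x y" "x \<in> Z 3 \<Longrightarrow> y \<in> Z 0 \<Longrightarrow> \<not> adj x y" "x \<in> Z 4 \<Longrightarrow> y \<in> Z 1 \<Longrightarrow> \<not> adj x y"
  using far[of 0 x y] far[of 1 x y] far[of 2 x y] far[of 3 x y] far[of 4 x y] by (simp_all add: numeral_2_eq_2)

lemma Z_cases: "x \<in> Q \<Longrightarrow> x \<in> Z 0 \<or> x \<in> Z 1 \<or> x \<in> Z 2 \<or> x \<in> Z 3 \<or> x \<in> Z 4"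
proof -
  have "{..<5} = {0, 1, 2, 3, 4::nat}" by auto
  then show "x \<in> Q \<Longrightarrow> ?thesis" unfolding Q by simp
qed

text \<open>Two vertices of the copy in the same part are adjacent and one dominates the other,
  contrary to nondomination.\<close>

lemma transversal:
  assumes f: "inj_on f {0..<n}" "\<forall>x\<in>{0..<n}. \<forall>y\<in>{0..<n}. adj (f x) (f y) \<longleftrightarrow> H x y"
    and nd: "nondominated n H"
    and x: "x \<in> {0..<n}" and y: "y \<in> {0..<n}" and "x \<noteq> y" and i: "i < 5" and Z: "f x \<in> Z i" "f y \<in> Z i"
  shows False
proof -
  have inj: "u \<noteq> v \<Longrightarrow> f u \<noteq> f v" if "u \<in> {0..<n}" "v \<in> {0..<n}" for u v
    using inj_on_eq_iff[OF f(1)] that by blast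
  have *: "\<exists>z. adj (f x) z \<and> z \<noteq> f y \<and> \<not> adj (f y) z" if x: "x \<in> {0..<n}" and y: "y \<in> {0..<n}" and h: "adj (f x) (f y)" for x y
  proof -
    obtain z where z: "z \<in> {0..<n}" "z \<noteq> y" "H x z" "\<not> H y z"
      using nd x y h f(2) unfolding nondominated_def by blast
    then have "adj (f x) (f z)" "\<not> adj (f y) (f z)" "f z \<noteq> f y" using f(2) x y inj by blast+
    then show ?thesis by blast
  qed
  have a: "adj (f x) (f y)" using same[OF i Z] inj[OF x y \<open>x \<noteq> y\<close>] by blast
  show False using *[OF x y a] *[OF y x] a adj_commute[of "f x" "f y"] dom[OF i Z] by blast
qed

lemma crown_free: "is_free Q E"
proof -
  \<comment> \<open>C6, C7 and T0 have more vertices than there are parts, so the pigeonhole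
    principle suffices.\<close>
  have 1: "\<not> has_induced Q E {0..<n} H" if nd: "nondominated n H" and n: "n > 5" for n H
  proof
    assume "has_induced Q E {0..<n} H"
    then obtain f where f: "inj_on f {0..<n}" "f ` {0..<n} \<subseteq> Q"
      "\<forall>x\<in>{0..<n}. \<forall>y\<in>{0..<n}. adj (f x) (f y) \<longleftrightarrow> H x y" using has_induced_adj by blast
    have "\<forall>x\<in>{0..<n}. \<exists>i<5. f x \<in> Z i" using f(2) unfolding Q by blast
    then obtain l where l: "\<forall>x\<in>{0..<n}. l x < 5 \<and> f x \<in> Z (l x)" by metis
    have "inj_on l {0..<n}"
    proof (rule inj_onI, rule ccontr)
      fix x y assume x: "x \<in> {0..<n}" and y: "y \<in> {0..<n}" and eq: "l x = l y" and "x \<noteq> y"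
      have "l x < 5" "f x \<in> Z (l x)" "f y \<in> Z (l x)" using l x y eq by (blast, blast, metis)
      then show False using transversal[OF f(1,3) nd x y \<open>x \<noteq> y\<close>] by blast
    qed
    moreover have "l ` {0..<n} \<subseteq> {..<5}" using l by blast
    ultimately have "card {0..<n} \<le> card {..<5::nat}" using card_inj_on_le by blast
    then show False using n by simp
  qed
  have 2: "\<not> has_induced Q E {0..<4} (cycle_rel 4)"
  proof
    assume "has_induced Q E {0..<4} (cycle_rel 4)"
    then obtain f where f: "inj_on f {0..<4}" "f ` {0..<4} \<subseteq> Q"
      "\<forall>x\<in>{0..<4}. \<forall>y\<in>{0..<4}. adj (f x) (f y) \<longleftrightarrow> cycle_rel 4 x y" using has_induced_adj by blast
    have c: "f x \<in> Z 0 \<or> f x \<in> Z 1 \<or> f x \<in> Z 2 \<or> f x \<in> Z 3 \<or> f x \<in> Z 4" if "x \<in> {0..<4}" for x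
      using Z_cases f(2) that by blast
    have t: "\<not> (f x \<in> Z 0 \<and> f y \<in> Z 0) \<and> \<not> (f x \<in> Z 1 \<and> f y \<in> Z 1) \<and> \<not> (f x \<in> Z 2 \<and> f y \<in> Z 2) \<and> \<not> (f x \<in> Z 3 \<and> f y \<in> Z 3) \<and> \<not> (f x \<in> Z 4 \<and> f y \<in> Z 4)"
      if "x \<in> {0..<4}" "y \<in> {0..<4}" "x \<noteq> y" for x y
      using transversal[OF f(1,3) nondominated(1) that, of 0] transversal[OF f(1,3) nondominated(1) that, of 1]
        transversal[OF f(1,3) nondominated(1) that, of 2] transversal[OF f(1,3) nondominated(1) that, of 3]
        transversal[OF f(1,3) nondominated(1) that, of 4] by auto
    have e: "\<not> (f x \<in> Z 0 \<and> f y \<in> Z 2) \<and> \<not> (f x \<in> Z 1 \<and> f y \<in> Z 3) \<and> \<not> (f x \<in> Z 2 \<and> f y \<in> Z 4) \<and>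
        \<not> (f x \<in> Z 3 \<and> f y \<in> Z 0) \<and> \<not> (f x \<in> Z 4 \<and> f y \<in> Z 1)"
      if "x \<in> {0..<4}" "y \<in> {0..<4}" "cycle_rel 4 x y" for x y
      using f(3) that fars[of "f x" "f y"] by blast
    show False
      by (rule crown_pattern_4[of "\<lambda>x. f x \<in> Z 0" "\<lambda>x. f x \<in> Z 1" "\<lambda>x. f x \<in> Z 2" "\<lambda>x. f x \<in> Z 3" "\<lambda>x. f x \<in> Z 4"]) (fact c t e)+
  qed
  have 3: "\<not> has_induced Q E {0..<6} twoP3_rel"
  proof
    assume "has_induced Q E {0..<6} twoP3_rel"
    then obtain f where f: "inj_on f {0..<6}" "f ` {0..<6} \<subseteq> Q"
      "\<forall>x\<in>{0..<6}. \<forall>y\<in>{0..<6}. adj (f x) (f y) \<longleftrightarrow> twoP3_rel x y" using has_induced_adj by blast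
    have c: "f x \<in> Z 0 \<or> f x \<in> Z 1 \<or> f x \<in> Z 2 \<or> f x \<in> Z 3 \<or> f x \<in> Z 4" if "x \<in> {0..<6}" for x
      using Z_cases f(2) that by blast
    have ne: "f x \<noteq> f y" if "x \<in> {0..<6}" "y \<in> {0..<6}" "x \<noteq> y" for x y
      using inj_on_eq_iff[OF f(1)] that by blast
    have t: "(\<not> (f x \<in> Z 0 \<and> f y \<in> Z 0) \<and> \<not> (f x \<in> Z 1 \<and> f y \<in> Z 1) \<and> \<not> (f x \<in> Z 2 \<and> f y \<in> Z 2) \<and> \<not> (f x \<in> Z 3 \<and> f y \<in> Z 3) \<and> \<not> (f x \<in> Z 4 \<and> f y \<in> Z 4)) \<and>
        \<not> (f x \<in> Z 4 \<and> f y \<in> Z 3) \<and> \<not> (f x \<in> Z 1 \<and> f y \<in> Z 2)"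
      if "x \<in> {0..<6}" "y \<in> {0..<6}" "x \<noteq> y" "\<not> twoP3_rel x y" for x y
    proof -
      have n: "\<not> adj (f x) (f y)" "f x \<noteq> f y" using f(3) inj_on_eq_iff[OF f(1)] that by blast+
      then have "\<not> (f x \<in> Z i \<and> f y \<in> Z i)" if "i < 5" for i using same that by blast
      from this[of 0] this[of 1] this[of 2] this[of 3] this[of 4] n(1) Z4_Z3 Z1_Z2 show ?thesis by auto
    qed
    have e: "\<not> (f x \<in> Z 0 \<and> f y \<in> Z 2) \<and> \<not> (f x \<in> Z 1 \<and> f y \<in> Z 3) \<and> \<not> (f x \<in> Z 2 \<and> f y \<in> Z 4) \<and>
        \<not> (f x \<in> Z 3 \<and> f y \<in> Z 0) \<and> \<not> (f x \<in> Z 4 \<and> f y \<in> Z 1)"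
      if "x \<in> {0..<6}" "y \<in> {0..<6}" "twoP3_rel x y" for x y
      using f(3) that fars[of "f x" "f y"] by blast
    show False
      by (rule crown_pattern_6[of "\<lambda>x. f x \<in> Z 0" "\<lambda>x. f x \<in> Z 1" "\<lambda>x. f x \<in> Z 2" "\<lambda>x. f x \<in> Z 3" "\<lambda>x. f x \<in> Z 4"]) (fact c t e)+
  qed
  show ?thesis unfolding is_free_def using 1 2 3 nondominated by simp
qed

lemma nonuniversal:
  assumes v: "v \<in> Q"
  shows "\<exists>u\<in>Q. u \<noteq> v \<and> \<not> E v u"
proof -
  obtain i where i: "i < 5" "v \<in> Z i" using v unfolding Q by blast
  have k: "(i + 2) mod 5 < 5" by simp
  obtain u where u: "u \<in> Z ((i + 2) mod 5)" using top[OF k] by blast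
  have "u \<in> Q" using u k unfolding Q by blast
  moreover have "\<not> adj v u \<and> v \<noteq> u" using far[OF i u] .
  ultimately show ?thesis using v by (metis adj_iff)
qed

lemma nonsimplicial:
  assumes v: "v \<in> Q"
  shows "\<not> simplicial Q E v"
proof -
  obtain i where i: "i < 5" "v \<in> Z i" using v unfolding Q by blast
  have 1: "((i + 1) mod 5 + 4) mod 5 = i" "((i + 4) mod 5 + 1) mod 5 = i" "((i + 4) mod 5 + 2) mod 5 = (i + 1) mod 5"
    using i(1) by presburger+
  have 2: "(i + 1) mod 5 < 5" "(i + 4) mod 5 < 5" by simp_all
  obtain y where y: "y \<in> Z ((i + 1) mod 5)" "adj y v" using top[OF 2(1)] i(2) 1(1) by auto
  obtain z where z: "z \<in> Z ((i + 4) mod 5)" "adj z v" using top[OF 2(2)] i(2) 1(2) by auto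
  have "\<not> adj z y \<and> z \<noteq> y" using far[OF 2(2) z(1), of y] y(1) 1(3) by simp
  moreover have "adj v z" "adj v y" using y z adj_sym by blast+
  ultimately show ?thesis unfolding simplicial_def clique_def nbhd_def adj_def by blast
qed

end

section \<open>From the definitions to houses and crowns\<close>

lemma descending_nth:
  assumes "\<And>i. Suc i < length xs \<Longrightarrow> g (xs ! Suc i) \<subseteq> g (xs ! i)"
  shows "m \<le> n \<Longrightarrow> n < length xs \<Longrightarrow> g (xs ! n) \<subseteq> g (xs ! m)"
proof (induction n)
  case 0 then show ?case by simp
next
  case (Suc n)
  show ?case
  proof (cases "m = Suc n")
    case False
    then have "g (xs ! n) \<subseteq> g (xs ! m)" using Suc by simp
    then show ?thesis using assms[OF Suc.prems(2)] by blast
  qed simp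
qed

lemma nested_order_facts:
  assumes xs: "nested_order E X Y xs"
  shows nested_order_chain: "x \<in> X \<Longrightarrow> y \<in> X \<Longrightarrow> (\<forall>z\<in>Y. E x z \<longrightarrow> E y z) \<or> (\<forall>z\<in>Y. E y z \<longrightarrow> E x z)"
    and nested_order_top: "\<exists>x\<in>X. \<forall>y\<in>Y. E x y"
    and nested_order_last: "x \<in> X \<Longrightarrow> {z \<in> Y. E (last xs) z} \<subseteq> {z \<in> Y. E x z}"
proof -
  have len: "length xs > 0" and set: "set xs = X" and top: "{y \<in> Y. E (xs ! 0) y} = Y"
    and desc: "\<And>i. Suc i < length xs \<Longrightarrow> {y \<in> Y. E (xs ! Suc i) y} \<subseteq> {y \<in> Y. E (xs ! i) y}"
    using xs unfolding nested_order_def by auto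
  have mono: "{y \<in> Y. E (xs ! n) y} \<subseteq> {y \<in> Y. E (xs ! m) y}" if "m \<le> n" "n < length xs" for m n
    by (rule descending_nth[of xs "\<lambda>x. {y \<in> Y. E x y}", OF desc that])
  show "(\<forall>z\<in>Y. E x z \<longrightarrow> E y z) \<or> (\<forall>z\<in>Y. E y z \<longrightarrow> E x z)" if x: "x \<in> X" and y: "y \<in> X"
  proof -
    obtain m n where m: "m < length xs" "x = xs ! m" and n: "n < length xs" "y = xs ! n"
      using x y unfolding set[symmetric] in_set_conv_nth by blast
    show ?thesis
    proof (cases "m \<le> n")
      case True then show ?thesis using mono[OF True n(1)] m n by blast
    next
      case False
      then have "n \<le> m" by simp
      then show ?thesis using mono[OF _ m(1)] m n by blast
    qed
  qed
  have "xs ! 0 \<in> X" using len set nth_mem by blast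
  then show "\<exists>x\<in>X. \<forall>y\<in>Y. E x y" using top by blast
  show "{z \<in> Y. E (last xs) z} \<subseteq> {z \<in> Y. E x z}" if x: "x \<in> X"
  proof -
    obtain m where m: "m < length xs" "x = xs ! m" using x unfolding set[symmetric] in_set_conv_nth by blast
    have "last xs = xs ! (length xs - 1)" using len by (simp add: last_conv_nth)
    then show ?thesis using mono[of m "length xs - 1"] m by simp
  qed
qed

text \<open>When all neighbourhoods are equal, every listing is nested. This furnishes the chain
  conditions of a house on the side where the two cliques are complete to each other.\<close>

lemma complete_nested_order:
  assumes "finite X" "X \<noteq> {}" "complete E X Y"
  obtains xs where "nested_order E X Y xs" "set xs = X" "xs \<noteq> []"
proof -
  obtain xs where xs: "set xs = X" "distinct xs" using finite_distinct_list assms(1) by blast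
  then have ne: "xs \<noteq> []" using assms(2) by auto
  have E: "E (xs ! i) y" if "i < length xs" "y \<in> Y" for i y
    using assms(3) xs(1) that nth_mem unfolding complete_def by blast
  have "nested_order E X Y xs"
    unfolding nested_order_def using xs ne E by auto
  then show thesis using that xs(1) ne by blast
qed

lemma houseI:
  assumes g: "is_graph Q E"
    and Q: "Q = A \<union> (\<Union>i\<in>I. B i) \<union> (\<Union>i\<in>I. C i) \<union> F \<union> X \<union> Y"
    and third: "\<And>k l. \<exists>i\<in>I. i \<noteq> k \<and> i \<noteq> l" and i0: "i0 \<in> I" and j: "j \<in> I"
    and cl: "clique E A" "clique E F" "clique E X" "clique E Y" "\<And>i. i \<in> I \<Longrightarrow> clique E (B i) \<and> clique E (C i)"
    and pair: "\<And>i k. i \<in> I \<Longrightarrow> k \<in> I \<Longrightarrow> i \<noteq> k \<Longrightarrow>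
      anticomplete E (B i) (B k) \<and> complete E (C i) (C k) \<and> anticomplete E (B i) (C k)"
    and AB: "\<And>i. i \<in> I \<Longrightarrow> i \<noteq> i0 \<Longrightarrow> complete E A (B i)"
    and AC: "\<And>i. i \<in> I \<Longrightarrow> anticomplete E A (C i)"
    and FA: "complete E F A"
    and FB: "\<And>i. i \<in> I \<Longrightarrow> i \<noteq> j \<Longrightarrow> complete E F (B i) \<and> complete E F (C i)"
    and Fj: "anticomplete E F (B j \<union> C j)"
    and FBC: "F \<noteq> {} \<Longrightarrow> complete E (B j) (C j)"
    and XA: "complete E X (A \<union> B j)"
    and XB: "\<And>i. i \<in> I \<Longrightarrow> i \<noteq> j \<Longrightarrow> anticomplete E X (B i)"
    and XC: "\<And>i. i \<in> I \<Longrightarrow> anticomplete E X (C i)"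
    and FXY: "complete E F (X \<union> Y)" and XY: "anticomplete E X Y"
    and YC: "\<And>i. i \<in> I \<Longrightarrow> complete E Y (C i)" and YA: "anticomplete E Y A"
    and YB: "\<And>i. i \<in> I \<Longrightarrow> anticomplete E Y (B i)"
    and XF: "X \<noteq> {} \<Longrightarrow> F \<noteq> {}"
    and nA: "nested_order E A (B i0) as"
    and nB: "\<And>i. i \<in> I \<Longrightarrow> \<exists>bs. nested_order E (B i) (C i) bs \<and> {c \<in> C i. E (last bs) c} \<noteq> {}"
    and kinds: "complete E A (B i0) \<or> X = {} \<and> Y = {} \<and> card I = 3 \<and> (\<forall>i\<in>I. complete E (B i) (C i))"
  shows "house Q E I A F X Y B C i0 j"
proof -
  interpret simple_graph Q E by unfold_locales (rule g)
  have sA: "A \<subseteq> Q" and sF: "F \<subseteq> Q" and sX: "X \<subseteq> Q" and sY: "Y \<subseteq> Q" unfolding Q by blast+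
  have sB: "B i \<subseteq> Q" and sC: "C i \<subseteq> Q" if "i \<in> I" for i using that unfolding Q by blast+
  have c: "adj x y" if "complete E S T" "S \<subseteq> Q" "T \<subseteq> Q" "x \<in> S" "y \<in> T" for S T x y
    using that unfolding complete_def adj_def by blast
  have n: "\<not> adj x y" if "anticomplete E S T" "x \<in> S" "y \<in> T" for S T x y
    using that unfolding anticomplete_def adj_def by blast
  have q: "adj x y" if "clique E S" "S \<subseteq> Q" "x \<in> S" "y \<in> S" "x \<noteq> y" for S x y
    using that unfolding clique_def adj_def by blast
  have n': "\<not> adj x y" if "anticomplete E T S" "x \<in> S" "y \<in> T" for S T x y
    using n[OF that(1,3,2)] adj_commute by blast
  show ?thesis
  proof unfold_locales
    show "\<exists>i\<in>I. i \<noteq> k \<and> i \<noteq> l" for k l by (rule third)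
    show "adj x y \<longleftrightarrow> i = k" if "i \<in> I" "k \<in> I" "x \<in> B i" "y \<in> B k" "x \<noteq> y" for i k x y
      using that q[of "B i" x y] cl(5) sB n[of "B i" "B k" x y] pair by blast
    show "adj x y" if "i \<in> I" "k \<in> I" "x \<in> C i" "y \<in> C k" "x \<noteq> y" for i k x y
      using that q[of "C i" x y] cl(5) sC c[of "C i" "C k" x y] pair by blast
    show "\<not> adj x y" if "i \<in> I" "k \<in> I" "i \<noteq> k" "x \<in> B i" "y \<in> C k" for i k x y
      using that n[of "B i" "C k" x y] pair by blast
    show "adj x y \<longleftrightarrow> i = j" if "i \<in> I" "x \<in> X" "y \<in> B i" for i x y
    proof (cases "i = j")
      case True then show ?thesis using c[OF XA sX, of x y] sA sB that by blast
    next
      case False then show ?thesis using n[OF XB] that by blast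
    qed
    show "adj x y \<longleftrightarrow> i \<noteq> j" if "i \<in> I" "x \<in> F" "y \<in> B i" for i x y
    proof (cases "i = j")
      case True then show ?thesis using n[OF Fj, of x y] that by blast
    next
      case False then show ?thesis using c[of F "B i" x y] FB sF sB that by blast
    qed
    show "adj x y \<longleftrightarrow> i \<noteq> j" if "i \<in> I" "x \<in> F" "y \<in> C i" for i x y
    proof (cases "i = j")
      case True then show ?thesis using n[OF Fj, of x y] that by blast
    next
      case False then show ?thesis using c[of F "C i" x y] FB sF sC that by blast
    qed
    show "(\<forall>z\<in>B i0. adj x z \<longrightarrow> adj y z) \<or> (\<forall>z\<in>B i0. adj y z \<longrightarrow> adj x z)" if "x \<in> A" "y \<in> A" for x y
      using nested_order_chain[OF nA that] that sA unfolding adj_def by blast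
    show "(\<forall>z\<in>C i. adj x z \<longrightarrow> adj y z) \<or> (\<forall>z\<in>C i. adj y z \<longrightarrow> adj x z)" if i: "i \<in> I" and xy: "x \<in> B i" "y \<in> B i" for i x y
    proof -
      obtain bs where "nested_order E (B i) (C i) bs" using nB[OF i] by blast
      from nested_order_chain[OF this xy] show ?thesis using xy sB[OF i] unfolding adj_def by blast
    qed
    show "\<exists>x\<in>A. \<forall>y\<in>B i0. adj x y" using nested_order_top[OF nA] sA sB[OF i0] unfolding adj_def by blast
    show "\<exists>x\<in>B i. \<forall>y\<in>C i. adj x y" if i: "i \<in> I" for i
    proof -
      obtain bs where "nested_order E (B i) (C i) bs" using nB[OF i] by blast
      from nested_order_top[OF this] show ?thesis using sB[OF i] sC[OF i] unfolding adj_def by blast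
    qed
    show "\<exists>y\<in>C i. adj x y" if i: "i \<in> I" and x: "x \<in> B i" for i x
    proof -
      obtain bs where bs: "nested_order E (B i) (C i) bs" "{c \<in> C i. E (last bs) c} \<noteq> {}" using nB[OF i] by blast
      then have "{c \<in> C i. E x c} \<noteq> {}" using nested_order_last[OF bs(1) x] by blast
      then show ?thesis using x sB[OF i] sC[OF i] unfolding adj_def by blast
    qed
    show "(\<forall>x\<in>A. \<forall>y\<in>B i0. adj x y) \<or>
      X = {} \<and> Y = {} \<and> card I = 3 \<and> (\<forall>i\<in>I. \<forall>x\<in>B i. \<forall>y\<in>C i. adj x y)"
    proof -
      have "\<forall>x\<in>A. \<forall>y\<in>B i0. adj x y" if "complete E A (B i0)" using c[OF that sA sB[OF i0]] by blast
      moreover have "\<forall>i\<in>I. \<forall>x\<in>B i. \<forall>y\<in>C i. adj x y" if "\<forall>i\<in>I. complete E (B i) (C i)" using c sB sC that by blast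
      ultimately show ?thesis using kinds by blast
    qed
    show "adj x y" if "f \<in> F" "x \<in> B j" "y \<in> C j" for f x y using c[OF FBC sB[OF j] sC[OF j]] that by blast
    show "adj x y" if "i \<in> I" "i \<noteq> i0" "x \<in> A" "y \<in> B i" for i x y using c[OF AB sA sB] that by blast
    show "adj x y" if "i \<in> I" "x \<in> Y" "y \<in> C i" for i x y using c[OF YC sY sC] that by blast
    show "\<not> adj x y" if "i \<in> I" "x \<in> Y" "y \<in> B i" for i x y using n[OF YB] that by blast
    show "\<not> adj x y" if "i \<in> I" "x \<in> A" "y \<in> C i" for i x y using n[OF AC] that by blast
    show "\<not> adj x y" if "x \<in> A" "y \<in> Y" for x y using n'[OF YA] that by blast
    show "\<not> adj x y" if "i \<in> I" "x \<in> X" "y \<in> C i" for i x y using n[OF XC] that by blast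
    show "\<not> adj x y" if "x \<in> X" "y \<in> Y" for x y using n[OF XY] that by blast
    show "adj x y" if "x \<in> X" "y \<in> A" for x y using c[OF XA sX, of x y] sA sB[OF j] that by blast
    show "adj x y" if "x \<in> F" "y \<in> A" for x y using c[OF FA sF sA] that by blast
    show "adj x y" if "x \<in> F" "y \<in> X" for x y using c[OF FXY sF, of x y] sX sY that by blast
    show "adj x y" if "x \<in> F" "y \<in> Y" for x y using c[OF FXY sF, of x y] sX sY that by blast
    show "adj x y" if "x \<in> A" "y \<in> A" "x \<noteq> y" for x y using q[OF cl(1) sA that] .
    show "adj x y" if "x \<in> F" "y \<in> F" "x \<noteq> y" for x y using q[OF cl(2) sF that] .
    show "adj x y" if "x \<in> X" "y \<in> X" "x \<noteq> y" for x y using q[OF cl(3) sX that] .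
    show "adj x y" if "x \<in> Y" "y \<in> Y" "x \<noteq> y" for x y using q[OF cl(4) sY that] .
  qed (use Q i0 j XF in auto)
qed

text \<open>As \<open>A\<close> is complete to every \<open>B i\<close>, any index may serve as
  \<open>i0\<close>; the index \<open>j\<close> of the path missed by \<open>F\<close> is
  taken.\<close>

lemma villa_partition_house:
  assumes g: "is_graph Q E" and v: "villa_partition E t A B C" and j: "j \<in> {1..t}"
    and Q: "Q = A \<union> (\<Union>i\<in>{1..t}. B i) \<union> (\<Union>i\<in>{1..t}. C i) \<union> F \<union> X \<union> Y"
    and cl: "clique E F" "clique E X" "clique E Y"
    and F: "complete E F A" "complete E F (\<Union>i\<in>{1..t} - {j}. B i)" "complete E F (\<Union>i\<in>{1..t} - {j}. C i)"
      "anticomplete E F (B j \<union> C j)" "F \<noteq> {} \<Longrightarrow> complete E (B j) (C j)" "complete E F (X \<union> Y)"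
    and X: "complete E X (A \<union> B j)" "anticomplete E X (\<Union>i\<in>{1..t} - {j}. B i)"
      "anticomplete E X (\<Union>i\<in>{1..t}. C i)" "anticomplete E X Y" "X \<noteq> {} \<Longrightarrow> F \<noteq> {}"
    and Y: "complete E Y (\<Union>i\<in>{1..t}. C i)" "anticomplete E Y (A \<union> (\<Union>i\<in>{1..t}. B i))"
  shows "house Q E {1..t} A F X Y B C j j"
proof -
  have t: "3 \<le> t" and A: "A \<noteq> {}" "clique E A"
    and BC: "\<And>i. i \<in> {1..t} \<Longrightarrow> clique E (B i) \<and> clique E (C i)"
    and AB: "complete E A (\<Union>i\<in>{1..t}. B i)" and AC: "anticomplete E A (\<Union>i\<in>{1..t}. C i)"
    and pair: "\<And>i k. i \<in> {1..t} \<Longrightarrow> k \<in> {1..t} \<Longrightarrow> i \<noteq> k \<Longrightarrow>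
      anticomplete E (B i) (B k) \<and> complete E (C i) (C k) \<and> anticomplete E (B i) (C k)"
    and nB: "\<And>i. i \<in> {1..t} \<Longrightarrow> \<exists>bs. nested_order E (B i) (C i) bs \<and> {c \<in> C i. E (last bs) c} \<noteq> {}"
    using v unfolding villa_partition_def by blast+
  have "finite A" using g Q unfolding is_graph_def by simp
  have ABi: "complete E A (B i)" if "i \<in> {1..t}" for i using AB that unfolding complete_def by blast
  obtain as where nA: "nested_order E A (B j) as" using complete_nested_order[OF \<open>finite A\<close> A(1) ABi[OF j]] by blast
  have third: "\<exists>i\<in>{1..t}. i \<noteq> k \<and> i \<noteq> l" for k l
  proof -
    have "{1, 2, 3} \<subseteq> {1..t}" using t by auto
    moreover have "\<exists>i\<in>{1, 2, 3}. i \<noteq> k \<and> i \<noteq> l" by (cases "k = 1"; cases "l = 1"; cases "k = 2"; cases "l = 2") auto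
    ultimately show ?thesis by blast
  qed
  have s: "complete E S T'" if "complete E S T" "T' \<subseteq> T" for S T T' using that unfolding complete_def by blast
  have s': "anticomplete E S T'" if "anticomplete E S T" "T' \<subseteq> T" for S T T' using that unfolding anticomplete_def by blast
  have FBi: "complete E F (B i) \<and> complete E F (C i)" if "i \<in> {1..t}" "i \<noteq> j" for i
    using s[OF F(2), of "B i"] s[OF F(3), of "C i"] that by blast
  have ACi: "anticomplete E A (C i)" and XCi: "anticomplete E X (C i)" and YCi: "complete E Y (C i)"
    and YBi: "anticomplete E Y (B i)" if "i \<in> {1..t}" for i
    using s'[OF AC, of "C i"] s'[OF X(3), of "C i"] s[OF Y(1), of "C i"] s'[OF Y(2), of "B i"] that by blast+
  have XBi: "anticomplete E X (B i)" if "i \<in> {1..t}" "i \<noteq> j" for i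
    using s'[OF X(2), of "B i"] that by blast
  have YA: "anticomplete E Y A" using s'[OF Y(2), of A] by blast
  show ?thesis
    by (rule houseI[OF g Q third j j A(2) cl BC pair ABi ACi F(1) FBi F(4,5) X(1) XBi XCi F(6) X(4) YCi YA YBi
      X(5) nA nB disjI1[OF ABi[OF j]]])
qed

definition obstruction_free :: "'a set \<Rightarrow> ('a \<Rightarrow> 'a \<Rightarrow> bool) \<Rightarrow> bool" where
  "obstruction_free Q E \<longleftrightarrow> is_free Q E \<and> (\<forall>v\<in>Q. \<not> simplicial Q E v) \<and> (\<forall>v\<in>Q. \<exists>u\<in>Q. u \<noteq> v \<and> \<not> E v u)"

lemma house_obstruction_free:
  assumes "house Q E I A F X Y B C i0 j" "Y \<noteq> {} \<Longrightarrow> F \<noteq> {}"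
  shows "obstruction_free Q E"
proof -
  interpret house Q E I A F X Y B C i0 j by (rule assms(1))
  show ?thesis unfolding obstruction_free_def using house_free nonsimplicial[OF assms(2)] nonuniversal by blast
qed

lemma villa_obstruction_free:
  assumes g: "is_graph Q E" and v: "villa Q E"
  shows "obstruction_free Q E"
proof -
  obtain t A B C where t: "3 \<le> t" and p: "partition_list Q (villa_parts t A B C)" and v: "villa_partition E t A B C"
    using v unfolding villa_def t_villa_def by blast
  have Q: "Q = A \<union> (\<Union>i\<in>{1..t}. B i) \<union> (\<Union>i\<in>{1..t}. C i) \<union> {} \<union> {} \<union> {}"
    using p unfolding partition_list_def Union_villa_parts by blast
  \<comment> \<open>With \<open>F\<close>, \<open>X\<close> and \<open>Y\<close> empty, any index
    may serve as \<open>j\<close>.\<close>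
  have "1 \<in> {1..t}" using t by simp
  from villa_partition_house[OF g v this Q] have "house Q E {1..t} A {} {} {} B C 1 1"
    by (simp add: clique_def complete_def anticomplete_def)
  then show ?thesis by (rule house_obstruction_free) simp
qed

lemma mansion_obstruction_free:
  assumes g: "is_graph Q E" and v: "mansion Q E"
  shows "obstruction_free Q E"
proof -
  obtain t A B C F X Y j where p: "partition_list Q (villa_parts t A B C @ [F, X, Y])" and F: "F \<noteq> {}"
    and cl: "clique E F" "clique E X" "clique E Y" and v: "villa_partition E t A B C" and j: "j \<in> {1..t}"
    and 1: "complete E F A" "complete E F (\<Union>i\<in>{1..t} - {j}. B i)" "complete E F (\<Union>i\<in>{1..t} - {j}. C i)"
      "anticomplete E F (B j \<union> C j)" "complete E (B j) (C j)"
    and 2: "complete E X (A \<union> B j)" "anticomplete E X (\<Union>i\<in>{1..t} - {j}. B i)" "anticomplete E X (\<Union>i\<in>{1..t}. C i)"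
    and 3: "complete E F (X \<union> Y)" "anticomplete E X Y" "complete E Y (\<Union>i\<in>{1..t}. C i)"
      "anticomplete E Y (A \<union> (\<Union>i\<in>{1..t}. B i))"
    using v unfolding mansion_def t_mansion_def by (elim exE conjE bexE) (rule that)
  have "Q = \<Union> (set (villa_parts t A B C)) \<union> F \<union> X \<union> Y"
    using p unfolding partition_list_def by auto
  then have Q: "Q = A \<union> (\<Union>i\<in>{1..t}. B i) \<union> (\<Union>i\<in>{1..t}. C i) \<union> F \<union> X \<union> Y" unfolding Union_villa_parts .
  show ?thesis
    by (rule house_obstruction_free[OF villa_partition_house[OF g v j Q cl 1 3(1) 2 3(2) F 3(3,4)]]) (rule F)
qed

lemma five_basket_obstruction_free:
  assumes g: "is_graph Q E" and v: "five_basket Q E"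
  shows "obstruction_free Q E"
proof -
  let ?I = "{1, 2, 3::nat}"
  obtain A B C F where p: "partition_list Q [A, B 1, B 2, B 3, C 1, C 2, C 3, F]"
    and A: "A \<noteq> {}" "clique E A" and F: "clique E F"
    and 1: "\<forall>i\<in>?I. B i \<noteq> {} \<and> C i \<noteq> {} \<and> clique E (B i) \<and> clique E (C i)"
    and 2: "\<forall>i\<in>?I. \<forall>j\<in>?I. i \<noteq> j \<longrightarrow> anticomplete E (B i) (B j) \<and> complete E (C i) (C j)"
    and 3: "\<exists>i0\<in>?I. complete E A (\<Union>i\<in>?I - {i0}. B i) \<and> (\<exists>as. nested_order E A (B i0) as)"
    and 4: "anticomplete E A (C 1 \<union> C 2 \<union> C 3)"
    and 5: "\<forall>i\<in>?I. complete E (B i) (C i) \<and> (\<forall>j\<in>?I. j \<noteq> i \<longrightarrow> anticomplete E (B i) (C j))"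
    and 6: "\<exists>j0\<in>?I. complete E F (Q - (B j0 \<union> C j0 \<union> F)) \<and> anticomplete E F (B j0 \<union> C j0)"
    using v unfolding five_basket_def by (elim exE conjE) (rule that)
  obtain i0 as where i0: "i0 \<in> ?I" and AB: "complete E A (\<Union>i\<in>?I - {i0}. B i)" and nA: "nested_order E A (B i0) as"
    using 3 by blast
  obtain j where j: "j \<in> ?I" and FQ: "complete E F (Q - (B j \<union> C j \<union> F))" and Fj: "anticomplete E F (B j \<union> C j)"
    using 6 by blast
  have Q: "Q = A \<union> (\<Union>i\<in>?I. B i) \<union> (\<Union>i\<in>?I. C i) \<union> F \<union> {} \<union> {}"
    using p unfolding partition_list_def by auto
  let ?P = "[A, B 1, B 2, B 3, C 1, C 2, C 3, F]"
  have disj: "?P ! m \<inter> ?P ! n = {}" if "m < 8" "n < 8" "m \<noteq> n" for m n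
    using p that unfolding partition_list_def by simp
  have dA: "A \<inter> (B i \<union> C i \<union> F) = {}" if "i \<in> ?I" for i
    using that disj[of 0 1] disj[of 0 2] disj[of 0 3] disj[of 0 4] disj[of 0 5] disj[of 0 6] disj[of 0 7] by auto
  have dB: "B i \<inter> (B k \<union> C k \<union> F) = {}" if "i \<in> ?I" "k \<in> ?I" "i \<noteq> k" for i k
    using that disj[of 1 2] disj[of 1 3] disj[of 1 5] disj[of 1 6] disj[of 1 7]
      disj[of 2 1] disj[of 2 3] disj[of 2 4] disj[of 2 6] disj[of 2 7]
      disj[of 3 1] disj[of 3 2] disj[of 3 4] disj[of 3 5] disj[of 3 7] by auto
  have dC: "C i \<inter> (B k \<union> C k \<union> F) = {}" if "i \<in> ?I" "k \<in> ?I" "i \<noteq> k" for i k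
    using that disj[of 4 2] disj[of 4 3] disj[of 4 5] disj[of 4 6] disj[of 4 7]
      disj[of 5 1] disj[of 5 3] disj[of 5 4] disj[of 5 6] disj[of 5 7]
      disj[of 6 1] disj[of 6 2] disj[of 6 4] disj[of 6 5] disj[of 6 7] by auto
  have s: "complete E F S" if "S \<subseteq> Q" "S \<inter> (B j \<union> C j \<union> F) = {}" for S
    using FQ that unfolding complete_def by blast
  have FA: "complete E F A" using s[OF _ dA[OF j]] Q by blast
  have FB: "complete E F (B i) \<and> complete E F (C i)" if "i \<in> ?I" "i \<noteq> j" for i
  proof -
    have "B i \<subseteq> Q" "C i \<subseteq> Q" using that Q by blast+
    then show ?thesis using s dB[OF that(1) j that(2)] dC[OF that(1) j that(2)] by blast
  qed
  have fin: "finite (B i)" if "i \<in> ?I" for i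
  proof -
    have "B i \<subseteq> Q" using that Q by blast
    then show ?thesis using g finite_subset unfolding is_graph_def by blast
  qed
  have nB: "\<exists>bs. nested_order E (B i) (C i) bs \<and> {c \<in> C i. E (last bs) c} \<noteq> {}" if i: "i \<in> ?I" for i
  proof -
    have BC: "complete E (B i) (C i)" and "B i \<noteq> {}" and C: "C i \<noteq> {}" using 1 5 i by blast+
    then obtain bs where bs: "nested_order E (B i) (C i) bs" "set bs = B i" "bs \<noteq> []"
      using complete_nested_order[OF fin[OF i]] by blast
    have "last bs \<in> B i" using last_in_set[OF bs(3)] bs(2) by simp
    moreover obtain c where "c \<in> C i" using C by blast
    ultimately have "c \<in> {c \<in> C i. E (last bs) c}" using BC unfolding complete_def by blast
    then show ?thesis using bs(1) by blast
  qed
  have third: "\<exists>i\<in>?I. i \<noteq> k \<and> i \<noteq> l" for k l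
    by (cases "k = 1"; cases "l = 1"; cases "k = 2"; cases "l = 2") auto
  have "house Q E ?I A F {} {} B C i0 j"
  proof (rule houseI[OF g Q third i0 j A(2) F _ _ _ _ _ _ FA FB Fj _ _ _ _ _ _ _ _ _ _ nA nB])
    show "clique E (B i) \<and> clique E (C i)" if "i \<in> ?I" for i using bspec[OF 1 that] by simp
    show "anticomplete E (B i) (B k) \<and> complete E (C i) (C k) \<and> anticomplete E (B i) (C k)"
      if "i \<in> ?I" "k \<in> ?I" "i \<noteq> k" for i k
      using bspec[OF bspec[OF 2 that(1)] that(2)] bspec[OF conjunct2[OF bspec[OF 5 that(1)]] that(2)] that(3) by simp
    show "complete E A (B i)" if "i \<in> ?I" "i \<noteq> i0" for i using AB that unfolding complete_def by blast
    show "anticomplete E A (C i)" if "i \<in> ?I" for i using 4 that unfolding anticomplete_def by blast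
    show "complete E (B j) (C j)" using bspec[OF 5 j] by simp
    show "complete E A (B i0) \<or> {} = {} \<and> {} = {} \<and> card ?I = 3 \<and> (\<forall>i\<in>?I. complete E (B i) (C i))"
      using 5 by simp
  qed (simp_all add: clique_def complete_def anticomplete_def)
  then show ?thesis by (rule house_obstruction_free) simp
qed

lemma crown_obstruction_free:
  assumes g: "is_graph Q E" and v: "five_crown Q E"
  shows "obstruction_free Q E"
proof -
  interpret simple_graph Q E by unfold_locales (rule g)
  obtain X s where r: "ring_partition 5 Q E X" and "s < 5"
    and s: "complete E (X ((s + 4) mod 5)) (X ((s + 3) mod 5))" "complete E (X ((s + 1) mod 5)) (X ((s + 2) mod 5))"
    using v unfolding five_crown_def by blast
  have p: "partition_list Q (map X [0..<5])" and us: "\<And>i. i < 5 \<Longrightarrow> X i \<noteq> {} \<and>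
        (\<exists>us. distinct us \<and> set us = X i \<and> us \<noteq> [] \<and> X i \<subseteq> closed_nbhd Q E (last us) \<and>
           (\<forall>j. Suc j < length us \<longrightarrow> closed_nbhd Q E (us ! Suc j) \<subseteq> closed_nbhd Q E (us ! j)) \<and>
           closed_nbhd Q E (us ! 0) = X ((i + 5 - 1) mod 5) \<union> X i \<union> X ((i + 1) mod 5))"
    using r unfolding ring_partition_def by blast+
  have QX: "Q = (\<Union>i<5. X i)" using p unfolding partition_list_def by (auto simp: lessThan_atLeast0)
  have disj: "X i \<inter> X k = {}" if "i < 5" "k < 5" "i \<noteq> k" for i k
    using p that unfolding partition_list_def by auto
  have sub: "X i \<subseteq> Q" if "i < 5" for i using that QX by blast
  have cn: "y \<in> closed_nbhd Q E x \<longleftrightarrow> y = x \<or> adj x y" if "x \<in> Q" for x y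
    using that unfolding closed_nbhd_def nbhd_def adj_def by blast
  have ring: "X i \<subseteq> closed_nbhd Q E x"
      "closed_nbhd Q E x \<subseteq> X ((i + 4) mod 5) \<union> X i \<union> X ((i + 1) mod 5)"
      "closed_nbhd Q E x \<subseteq> closed_nbhd Q E y \<or> closed_nbhd Q E y \<subseteq> closed_nbhd Q E x"
      "\<exists>u\<in>X i. closed_nbhd Q E u = X ((i + 4) mod 5) \<union> X i \<union> X ((i + 1) mod 5)"
    if i: "i < 5" and x: "x \<in> X i" and y: "y \<in> X i" for i x y
  proof -
    have pred: "(i + 5 - 1) mod 5 = (i + 4) mod 5" by (simp add: add.commute)
    obtain us where u: "set us = X i" "us \<noteq> []" "X i \<subseteq> closed_nbhd Q E (last us)"
      "closed_nbhd Q E (us ! 0) = X ((i + 4) mod 5) \<union> X i \<union> X ((i + 1) mod 5)"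
      and desc: "\<forall>j. Suc j < length us \<longrightarrow> closed_nbhd Q E (us ! Suc j) \<subseteq> closed_nbhd Q E (us ! j)"
      using conjunct2[OF us[OF i]] unfolding pred by (elim exE conjE) (rule that)
    have mono: "closed_nbhd Q E (us ! n) \<subseteq> closed_nbhd Q E (us ! m)" if "m \<le> n" "n < length us" for m n
      by (rule descending_nth[OF _ that]) (rule desc[rule_format])
    obtain m n where m: "m < length us" "x = us ! m" and n: "n < length us" "y = us ! n"
      using x y unfolding u(1)[symmetric] in_set_conv_nth by blast
    have "last us = us ! (length us - 1)" using u(2) by (simp add: last_conv_nth)
    moreover have "m \<le> length us - 1" "length us - 1 < length us" using m(1) by linarith+
    ultimately show "X i \<subseteq> closed_nbhd Q E x" using mono[of m "length us - 1"] m(2) u(3) by (metis subset_trans)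
    show "closed_nbhd Q E x \<subseteq> X ((i + 4) mod 5) \<union> X i \<union> X ((i + 1) mod 5)" using mono[of 0 m] m u(4) by simp
    show "closed_nbhd Q E x \<subseteq> closed_nbhd Q E y \<or> closed_nbhd Q E y \<subseteq> closed_nbhd Q E x"
      using mono[OF _ m(1), of n] mono[OF _ n(1), of m] m n by (cases "m \<le> n") simp_all
    have "us ! 0 \<in> X i" using u(1,2) nth_mem by auto
    then show "\<exists>u\<in>X i. closed_nbhd Q E u = X ((i + 4) mod 5) \<union> X i \<union> X ((i + 1) mod 5)" using u(4) by blast
  qed
  define Z where "Z k = X ((k + s) mod 5)" for k
  have Z: "Z ((k + l) mod 5) = X (((k + s) mod 5 + l) mod 5)" for k l
    unfolding Z_def by (simp add: mod_simps ac_simps)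
  have lt: "i mod 5 < 5" for i :: nat by simp
  interpret crown Q E Z
  proof unfold_locales
    have "(\<Union>k<5. Z k) = (\<Union>k<5. X k)"
    proof (intro equalityI subsetI)
      fix x assume "x \<in> (\<Union>k<5. X k)"
      then obtain k where k: "k < 5" "x \<in> X k" by blast
      \<comment> \<open>The inverse of the shift by \<open>s\<close>; adding 5 first keeps the
        subtraction of natural numbers exact.\<close>
      have "((k + 5 - s) mod 5 + s) mod 5 = k" using k(1) \<open>s < 5\<close> by (simp add: mod_add_left_eq)
      then have "x \<in> Z ((k + 5 - s) mod 5)" unfolding Z_def using k(2) by simp
      then show "x \<in> (\<Union>k<5. Z k)" using lt by blast
    qed (use lt Z_def in blast)
    then show "Q = (\<Union>k<5. Z k)" using QX by simp
  next
    fix i x y assume "x \<in> Z i" "y \<in> Z i" "x \<noteq> y"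
    then have x: "x \<in> X ((i + s) mod 5)" "y \<in> X ((i + s) mod 5)" unfolding Z_def by blast+
    show "adj x y" using ring(1)[OF lt x] x sub[OF lt] cn[of x y] \<open>x \<noteq> y\<close> by blast
  next
    fix i x y assume "x \<in> Z i" and y: "y \<in> Z ((i + 2) mod 5)"
    define m where "m = (i + s) mod 5"
    have x: "x \<in> X m" and y: "y \<in> X ((m + 2) mod 5)" using \<open>x \<in> Z i\<close> y Z[of i 2] unfolding Z_def m_def by simp_all
    have m: "m < 5" unfolding m_def by simp
    have "(m + 2) mod 5 \<noteq> m" "(m + 2) mod 5 \<noteq> (m + 4) mod 5" "(m + 2) mod 5 \<noteq> (m + 1) mod 5" using m by presburger+
    then have "y \<notin> X m" "y \<notin> X ((m + 4) mod 5)" "y \<notin> X ((m + 1) mod 5)" using disj lt m y by blast+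
    then have "y \<notin> closed_nbhd Q E x" using ring(2)[OF m x x] by blast
    then show "\<not> adj x y \<and> x \<noteq> y" using cn sub[OF m] x by blast
  next
    fix i x y assume "x \<in> Z i" "y \<in> Z i"
    then have x: "x \<in> X ((i + s) mod 5)" "y \<in> X ((i + s) mod 5)" unfolding Z_def by blast+
    have V: "x \<in> Q" "y \<in> Q" using x sub[OF lt] by blast+
    show "(\<forall>z. adj x z \<longrightarrow> z = y \<or> adj y z) \<or> (\<forall>z. adj y z \<longrightarrow> z = x \<or> adj x z)"
      using ring(3)[OF lt x] cn[OF V(1)] cn[OF V(2)] by blast
  next
    fix i :: nat
    define m where "m = (i + s) mod 5"
    have m: "m < 5" unfolding m_def by simp
    have Zi: "Z i = X m" "Z ((i + 1) mod 5) = X ((m + 1) mod 5)" "Z ((i + 4) mod 5) = X ((m + 4) mod 5)"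
      using Z[of i 1] Z[of i 4] unfolding Z_def m_def by simp_all
    obtain v where v: "v \<in> X m" using us[OF m] by blast
    obtain u where u: "u \<in> X m" "closed_nbhd Q E u = X ((m + 4) mod 5) \<union> X m \<union> X ((m + 1) mod 5)"
      using ring(4)[OF m v v] by blast
    have "(m + 1) mod 5 \<noteq> m" "(m + 4) mod 5 \<noteq> m" using m by presburger+
    then have "u \<notin> X ((m + 1) mod 5)" "u \<notin> X ((m + 4) mod 5)" using disj lt m u(1) by blast+
    then have "adj u y" if "y \<in> X ((m + 1) mod 5) \<union> X ((m + 4) mod 5)" for y
      using that cn[of u y] u sub[OF m] by blast
    then show "\<exists>x\<in>Z i. \<forall>y\<in>Z ((i + 1) mod 5) \<union> Z ((i + 4) mod 5). adj x y" unfolding Zi using u(1) by blast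
  next
    fix x y assume "x \<in> Z 1" "y \<in> Z 2"
    then show "adj x y" using s(2) sub[OF lt] unfolding complete_def Z_def adj_def by (metis add.commute subsetD)
  next
    fix x y assume "x \<in> Z 4" "y \<in> Z 3"
    then show "adj x y" using s(1) sub[OF lt] unfolding complete_def Z_def adj_def by (metis add.commute subsetD)
  qed
  show ?thesis unfolding obstruction_free_def using crown_free nonsimplicial nonuniversal by blast
qed

lemma special_obstruction_free: "is_graph Q E \<Longrightarrow> special Q E \<Longrightarrow> obstruction_free Q E"
  using villa_obstruction_free mansion_obstruction_free five_basket_obstruction_free crown_obstruction_free
  unfolding special_def by blast

section \<open>Anticomponents and universal vertices\<close>

lemma special_nonempty:
  assumes "special Q E"
  shows "Q \<noteq> {}"
proof -
  have five: "Q \<noteq> {}" if "five_basket Q E"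
    using that unfolding five_basket_def partition_list_def by auto
  have villa: "Q \<noteq> {}" if h: "villa Q E"
  proof -
    obtain t A B C where "partition_list Q (villa_parts t A B C)" "villa_partition E t A B C"
      using h unfolding villa_def t_villa_def by blast
    then show ?thesis unfolding partition_list_def villa_parts_def villa_partition_def by auto
  qed
  have mansion: "Q \<noteq> {}" if h: "mansion Q E"
  proof -
    obtain t A B C F X Y where "partition_list Q (villa_parts t A B C @ [F, X, Y])" "F \<noteq> {}"
      using h unfolding mansion_def t_mansion_def by blast
    then show ?thesis unfolding partition_list_def by auto
  qed
  have crown: "Q \<noteq> {}" if h: "five_crown Q E"
  proof -
    obtain X where p: "partition_list Q (map X [0..<5])" and "X 0 \<noteq> {}"
      using h unfolding five_crown_def ring_partition_def by force
    have "X 0 \<in> set (map X [0..<5])" by (simp add: image_iff) (rule bexI[of _ 0]; simp)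
    then show ?thesis using p \<open>X 0 \<noteq> {}\<close> unfolding partition_list_def by blast
  qed
  show ?thesis using assms five villa mansion crown unfolding special_def by blast
qed

lemma is_graph_subset: "is_graph V E \<Longrightarrow> Q \<subseteq> V \<Longrightarrow> Q \<noteq> {} \<Longrightarrow> is_graph Q E"
  unfolding is_graph_def using finite_subset by blast

lemma is_free_subset:
  assumes "is_free V E" "Q \<subseteq> V"
  shows "is_free Q E"
proof -
  have "has_induced V E S H" if "has_induced Q E S H" for S H
    using that assms(2) unfolding has_induced_def by (meson subset_trans)
  then show ?thesis using assms(1) unfolding is_free_def by blast
qed

text \<open>The vertexwise form of \<open>G\<close> being obtained from \<open>Q\<close> by adding
  universal vertices, see \<open>universal_outside_iff\<close>. All three conditions of the theorem
  are compared through it.\<close>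

definition universal_outside :: "'a set \<Rightarrow> ('a \<Rightarrow> 'a \<Rightarrow> bool) \<Rightarrow> 'a set \<Rightarrow> bool" where
  "universal_outside V E Q \<longleftrightarrow> Q \<subseteq> V \<and> (\<forall>v\<in>V - Q. \<forall>u\<in>V. u \<noteq> v \<longrightarrow> E v u)"

lemma universal_outside_iff:
  "Q \<subseteq> V \<and> clique E (V - Q) \<and> complete E (V - Q) Q \<longleftrightarrow> universal_outside V E Q"
proof
  assume h: "Q \<subseteq> V \<and> clique E (V - Q) \<and> complete E (V - Q) Q"
  then have "E v u" if "v \<in> V - Q" "u \<in> V" "u \<noteq> v" for v u
    using that unfolding clique_def complete_def by (cases "u \<in> Q") auto
  then show "universal_outside V E Q" using h unfolding universal_outside_def by blast
next
  assume h: "universal_outside V E Q"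
  have "E v u" if "v \<in> V - Q" "u \<in> V" "u \<noteq> v" for v u
    using h that unfolding universal_outside_def by blast
  then show "Q \<subseteq> V \<and> clique E (V - Q) \<and> complete E (V - Q) Q"
    using h unfolding universal_outside_def clique_def complete_def by (metis DiffD1 DiffD2 subsetD)
qed

text \<open>Every vertex of an obstruction has a nonneighbour in it, so an induced copy contains no
  universal vertex and lies inside \<open>Q\<close>.\<close>

lemma universal_outside_free:
  assumes u: "universal_outside V E Q" and Q: "is_free Q E"
  shows "is_free V E"
proof -
  have *: "has_induced Q E {0..<n} H"
    if ind: "has_induced V E {0..<n} H" and H: "\<forall>x\<in>{0..<n}. \<exists>y\<in>{0..<n}. x \<noteq> y \<and> \<not> H x y" for n H
  proof -
    obtain f where f: "inj_on f {0..<n}" "f ` {0..<n} \<subseteq> V" "\<forall>x\<in>{0..<n}. \<forall>y\<in>{0..<n}. E (f x) (f y) \<longleftrightarrow> H x y"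
      using ind unfolding has_induced_def by blast
    have "f x \<in> Q" if x: "x \<in> {0..<n}" for x
    proof (rule ccontr)
      assume n: "f x \<notin> Q"
      obtain y where y: "y \<in> {0..<n}" "x \<noteq> y" "\<not> H x y" using H x by blast
      have "f y \<noteq> f x" using inj_on_eq_iff[OF f(1)] x y by blast
      then have "E (f x) (f y)" using u f(2) n x y(1) unfolding universal_outside_def by blast
      then show False using f(3) x y by blast
    qed
    then show ?thesis using f unfolding has_induced_def by blast
  qed
  have "\<not> has_induced V E {0..<n} H"
    if "\<not> has_induced Q E {0..<n} H" "n = 4 \<and> H = cycle_rel 4 \<or> n = 6 \<and> H = cycle_rel 6 \<or> n = 7 \<and> H = cycle_rel 7 \<or>
      n = 9 \<and> H = T0_rel \<or> n = 6 \<and> H = twoP3_rel" for n H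
    using *[OF _ pattern_nonuniversal[OF that(2)]] that(1) by blast
  then show ?thesis using Q unfolding is_free_def by simp
qed

lemma universal_outside_simplicial:
  assumes u: "universal_outside V E Q" and nu: "\<forall>v\<in>Q. \<exists>w\<in>Q. w \<noteq> v \<and> \<not> E v w" and "Q \<noteq> {}"
    and Q: "\<forall>v\<in>Q. \<not> simplicial Q E v"
  shows "\<forall>v\<in>V. \<not> simplicial V E v"
proof
  fix v assume v: "v \<in> V"
  show "\<not> simplicial V E v"
  proof (cases "v \<in> Q")
    case True
    have "nbhd Q E v \<subseteq> nbhd V E v" using u unfolding universal_outside_def nbhd_def by blast
    then show ?thesis using Q True unfolding simplicial_def clique_def by blast
  next
    case False
    obtain x where x: "x \<in> Q" using \<open>Q \<noteq> {}\<close> by blast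
    then obtain y where y: "y \<in> Q" "y \<noteq> x" "\<not> E x y" using nu by blast
    have "w \<in> nbhd V E v" if w: "w \<in> Q" for w
    proof -
      have "w \<noteq> v" "w \<in> V" "v \<in> V - Q" using w False v u unfolding universal_outside_def by blast+
      then show ?thesis using u unfolding universal_outside_def nbhd_def by blast
    qed
    then have "x \<in> nbhd V E v" "y \<in> nbhd V E v" using x y(1) by blast+
    moreover have "x \<noteq> y" using y(2) by simp
    ultimately show ?thesis using y(3) unfolding simplicial_def clique_def by metis
  qed
qed

lemma free_nonsimplicial_special:
  assumes g: "is_graph V E" and f: "is_free V E" and ns: "\<forall>v\<in>V. \<not> simplicial V E v"
  shows "\<exists>Q. universal_outside V E Q \<and> special Q E"
proof -
  have sym: "E x y \<longleftrightarrow> E y x" if "x \<in> V" "y \<in> V" for x y using g that unfolding is_graph_def by blast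
  \<comment> \<open>The nonuniversal vertices. A nonneighbour of such a vertex is again
    nonuniversal, so inside \<open>Q\<close> every vertex still has a nonneighbour and a single
    deletion suffices.\<close>
  define Q where "Q = {v \<in> V. \<exists>u\<in>V. u \<noteq> v \<and> \<not> E v u}"
  have QV: "Q \<subseteq> V" unfolding Q_def by blast
  have u: "universal_outside V E Q" unfolding universal_outside_def Q_def by blast
  have ne: "Q \<noteq> {}"
  proof
    assume "Q = {}"
    then have "clique E V" using u unfolding universal_outside_def clique_def by auto
    then have "simplicial V E v" if "v \<in> V" for v using that unfolding simplicial_def clique_def nbhd_def by blast
    then show False using g ns unfolding is_graph_def by blast
  qed
  have nu: "\<exists>w\<in>Q. w \<noteq> v \<and> \<not> E w v" if v: "v \<in> Q" for v
  proof -
    obtain w where w: "w \<in> V" "w \<noteq> v" "\<not> E v w" using v unfolding Q_def by blast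
    then have "\<not> E w v" using sym[of v w] v QV by blast
    moreover have "v \<in> V" "v \<noteq> w" using v QV w(2) by auto
    ultimately have "w \<in> Q" using w(1) unfolding Q_def by blast
    then show ?thesis using w(2) \<open>\<not> E w v\<close> by blast
  qed
  have nsQ: "\<not> simplicial Q E v" if v: "v \<in> Q" for v
  proof
    assume s: "simplicial Q E v"
    \<comment> \<open>Universal vertices never contribute a nonadjacent pair to a neighbourhood, so
      a vertex simplicial in \<open>Q\<close> is simplicial in \<open>V\<close>.\<close>
    have "E x y" if x: "x \<in> nbhd V E v" and y: "y \<in> nbhd V E v" and "x \<noteq> y" for x y
    proof (cases "x \<in> Q \<and> y \<in> Q")
      case True
      then have "x \<in> nbhd Q E v" "y \<in> nbhd Q E v" using x y unfolding nbhd_def by blast+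
      then show ?thesis using s \<open>x \<noteq> y\<close> unfolding simplicial_def clique_def by blast
    next
      case False
      have V: "x \<in> V" "y \<in> V" "y \<noteq> x" using x y \<open>x \<noteq> y\<close> unfolding nbhd_def by auto
      have *: "E p q" if "p \<in> V" "p \<notin> Q" "q \<in> V" "q \<noteq> p" for p q
        using u that unfolding universal_outside_def by blast
      show ?thesis using False *[of x y] *[of y x] V \<open>x \<noteq> y\<close> sym[of x y] by blast
    qed
    then have "simplicial V E v" using v QV unfolding simplicial_def clique_def by blast
    then show False using ns v QV by blast
  qed
  interpret nonsimplicial_graph Q E
    by unfold_locales (use is_graph_subset[OF g QV ne] is_free_subset[OF f QV] nsQ nu in blast)+
  show ?thesis using u nonsimplicial_special by blast
qed

text \<open>If the complement were disconnected, nonadjacent pairs \<open>x\<close>,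
  \<open>u\<close> and \<open>y\<close>, \<open>w\<close> from two of its components would be
  completely joined to each other and form an induced 4-cycle.\<close>

lemma C4_free_anticonnected:
  assumes g: "is_graph Q E" and C4: "\<not> has_induced Q E {0..<4} (cycle_rel 4)"
    and nu: "\<forall>v\<in>Q. \<exists>u\<in>Q. u \<noteq> v \<and> \<not> E v u"
  shows "anticonnected E Q"
proof (rule ccontr)
  assume n: "\<not> anticonnected E Q"
  interpret simple_graph Q E by unfold_locales (rule g)
  define R where "R = (\<lambda>a b. a \<in> Q \<and> b \<in> Q \<and> a \<noteq> b \<and> \<not> E a b)"
  obtain x y where x: "x \<in> Q" and y: "y \<in> Q" and xy: "\<not> R\<^sup>*\<^sup>* x y"
    using n V_nonempty unfolding anticonnected_def R_def by blast
  obtain u where u: "u \<in> Q" "u \<noteq> x" "\<not> E x u" using nu x by blast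
  obtain w where w: "w \<in> Q" "w \<noteq> y" "\<not> E y w" using nu y by blast
  have xu: "R\<^sup>*\<^sup>* x u" using x u unfolding R_def by blast
  have "\<not> E w y" using w y adj_commute[of w y] adj_iff by blast
  then have "R w y" using w y unfolding R_def by blast
  then have xw: "\<not> R\<^sup>*\<^sup>* x w" using xy by (meson rtranclp.rtrancl_into_rtrancl)
  have far: "adj p q" if "R\<^sup>*\<^sup>* x p" "\<not> R\<^sup>*\<^sup>* x q" "p \<in> Q" "q \<in> Q" for p q
  proof -
    have "p \<noteq> q" "\<not> R p q" using that by (auto intro: rtranclp.rtrancl_into_rtrancl)
    then show ?thesis using that unfolding R_def adj_def by blast
  qed
  have a: "adj x y" "adj u y" "adj u w" "adj x w"
    using far[OF _ xy x y] far[OF xu xy u(1) y] far[OF xu xw u(1) w(1)] far[OF _ xw x w(1)] by blast+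
  have na: "\<not> adj x u" "\<not> adj y w" using u w unfolding adj_def by blast+
  have "has_induced Q E {0..<4} (cycle_rel 4)"
  proof (rule has_inducedI[of "[x, y, u, w]"])
    show "distinct [x, y, u, w]" using a u w adjD by auto
    show "set [x, y, u, w] \<subseteq> Q" using x y u w by simp
    show "\<not> cycle_rel 4 i i" if "i < 4" for i
    proof -
      have "i \<in> {0..<4}" using that by simp
      then show ?thesis unfolding atLeastLessThan_numerals by (elim insertE emptyE; simp add: cycle_rel_def)
    qed
    show "adj ([x, y, u, w] ! i) ([x, y, u, w] ! j) \<longleftrightarrow> cycle_rel 4 i j" if "j < 4" "i < j" for i j
    proof -
    have "i \<in> {0..<4}" "j \<in> {0..<4}" using that by simp_all
    then show ?thesis
      using \<open>i < j\<close> unfolding atLeastLessThan_numerals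
      by (elim insertE emptyE; simp add: a na a(2)[THEN adj_sym] cycle_rel_def)
    qed
    show "length [x, y, u, w] = 4" by simp
  qed (rule cycle_rel_sym)
  then show False using C4 by blast
qed

lemma anticonnected_not_universal:
  assumes T: "anticonnected E T" and v: "v \<in> T" and w: "w \<in> T" "w \<noteq> v" and u: "\<forall>u\<in>T. u \<noteq> v \<longrightarrow> E v u"
  shows False
proof -
  have "(\<lambda>a b. a \<in> T \<and> b \<in> T \<and> a \<noteq> b \<and> \<not> E a b)\<^sup>*\<^sup>* v w" using T v w unfolding anticonnected_def by blast
  then obtain z where "z \<in> T" "z \<noteq> v" "\<not> E v z"
  proof (cases rule: converse_rtranclpE)
    case (step z)
    then have "z \<in> T" "v \<noteq> z" "\<not> E v z" by simp_all
    then show thesis using that[of z] by simp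
  qed (use w(2) in simp)
  then show False using u by blast
qed

lemma card_ge_2_other:
  assumes "2 \<le> card T"
  obtains w where "w \<in> T" "w \<noteq> v"
proof -
  have "\<not> T \<subseteq> {v}" using assms card_mono[of "{v}" T] by auto
  then show thesis using that by blast
qed

text \<open>A universal vertex is isolated in the complement, so an anticonnected set with two or
  more vertices lies inside \<open>Q\<close>. This gives both the maximality of \<open>Q\<close> and
  its uniqueness.\<close>

lemma universal_outside_anticomponent:
  assumes u: "universal_outside V E Q" and a: "anticonnected E Q" and Q: "2 \<le> card Q"
  shows "anticomponent V E Q" "anticomponent V E T \<Longrightarrow> 2 \<le> card T \<Longrightarrow> T = Q"
proof -
  have sub: "T \<subseteq> Q" if T: "anticonnected E T" "T \<subseteq> V" "2 \<le> card T" for T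
  proof
    fix v assume v: "v \<in> T"
    obtain w where w: "w \<in> T" "w \<noteq> v" using card_ge_2_other[OF T(3)] .
    show "v \<in> Q"
      using anticonnected_not_universal[OF T(1) v w] u T(2) v unfolding universal_outside_def by blast
  qed
  have QV: "Q \<subseteq> V" using u unfolding universal_outside_def by blast
  have "\<not> anticonnected E T" if QT: "Q \<subset> T" "T \<subseteq> V" for T
  proof
    assume T: "anticonnected E T"
    obtain v where v: "v \<in> T" "v \<notin> Q" using QT(1) by blast
    obtain w where "w \<in> Q" "w \<noteq> v" using card_ge_2_other[OF Q] .
    then show False
      using anticonnected_not_universal[OF T v(1), of w] u QT v unfolding universal_outside_def by blast
  qed
  then show "anticomponent V E Q" unfolding anticomponent_def using QV a by blast
  show "T = Q" if T: "anticomponent V E T" "2 \<le> card T"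
  proof (rule ccontr)
    assume "T \<noteq> Q"
    then have "T \<subset> Q" using sub T unfolding anticomponent_def by blast
    then show False using T(1) QV a unfolding anticomponent_def by blast
  qed
qed

lemma unique_anticomponent_universal_outside:
  assumes g: "is_graph V E" and S: "anticomponent V E S"
    and unique: "\<And>T. anticomponent V E T \<Longrightarrow> 2 \<le> card T \<Longrightarrow> T = S"
  shows "universal_outside V E S"
  unfolding universal_outside_def
proof (intro conjI ballI impI)
  show "S \<subseteq> V" using S unfolding anticomponent_def by blast
  fix v u assume v: "v \<in> V - S" and u: "u \<in> V" "u \<noteq> v"
  show "E v u"
  proof (rule ccontr)
    assume vu: "\<not> E v u"
    define R where "R U = (\<lambda>a b. a \<in> U \<and> b \<in> U \<and> a \<noteq> b \<and> \<not> E a b)" for U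
    have R_mono: "(R U)\<^sup>*\<^sup>* x y \<Longrightarrow> U \<subseteq> W \<Longrightarrow> (R W)\<^sup>*\<^sup>* x y" for U W x y
      by (rule rtranclp_mono[THEN predicate2D]) (auto simp: R_def)
    \<comment> \<open>\<open>T\<close> is the component of \<open>v\<close> in the complement. It
      contains the nonneighbour \<open>u\<close>, hence is nontrivial and must equal
      \<open>S\<close>, although \<open>v\<close> lies outside \<open>S\<close>.\<close>
    define T where "T = {z \<in> V. (R V)\<^sup>*\<^sup>* v z}"
    have vT: "v \<in> T" using v unfolding T_def by blast
    have "R V v u" using v u vu unfolding R_def by blast
    then have uT: "u \<in> T" using u unfolding T_def by blast
    \<comment> \<open>Anticonnectedness of \<open>T\<close> asks for walks inside \<open>T\<close>,
      whereas membership in \<open>T\<close> gives walks in \<open>V\<close>; every vertex along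
      such a walk belongs to \<open>T\<close> as well.\<close>
    have from_v: "(R T)\<^sup>*\<^sup>* v z" if "(R V)\<^sup>*\<^sup>* v z" for z
      using that
    proof (induction rule: rtranclp_induct)
      case (step y z)
      have "y \<in> V" "z \<in> V" using step.hyps(2) unfolding R_def by blast+
      moreover have "(R V)\<^sup>*\<^sup>* v z" using step.hyps by (rule rtranclp.rtrancl_into_rtrancl)
      ultimately have "y \<in> T" "z \<in> T" using step.hyps(1) unfolding T_def by blast+
      then have "R T y z" using step.hyps(2) unfolding R_def by blast
      with step.IH show ?case by (rule rtranclp.rtrancl_into_rtrancl)
    qed simp
    have "symp (R T)"
    proof (rule sympI)
      fix x y assume "R T x y"
      then show "R T y x" using g unfolding R_def T_def is_graph_def by blast
    qed
    then have "symp (R T)\<^sup>*\<^sup>*" by (rule symp_rtranclp)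
    then have "(R T)\<^sup>*\<^sup>* x y" if "x \<in> T" "y \<in> T" for x y
      using from_v that unfolding T_def by (metis (no_types, lifting) mem_Collect_eq rtranclp_trans sympD)
    then have "anticonnected E T" using vT unfolding anticonnected_def R_def by blast
    moreover have "\<not> anticonnected E W" if W: "T \<subset> W" "W \<subseteq> V" for W
    proof
      assume a: "anticonnected E W"
      obtain w where w: "w \<in> W" "w \<notin> T" using W by blast
      have "(R W)\<^sup>*\<^sup>* v w" using a w vT W unfolding anticonnected_def R_def by blast
      then have "(R V)\<^sup>*\<^sup>* v w" using R_mono W(2) by blast
      then show False using w W(2) unfolding T_def by blast
    qed
    ultimately have "anticomponent V E T" unfolding anticomponent_def T_def by blast
    moreover have "finite T" using g unfolding is_graph_def T_def by simp
    then have "card {u, v} \<le> card T" using uT vT by (intro card_mono) auto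
    then have "2 \<le> card T" using u(2) by simp
    ultimately have "T = S" by (rule unique)
    then show False using vT v by blast
  qed
qed

theorem theorem7p1:
  fixes V :: "'a set" and E :: "'a \<Rightarrow> 'a \<Rightarrow> bool"
  assumes "is_graph V E"
  shows "((is_free V E \<and> (\<forall>v\<in>V. \<not> simplicial V E v)) \<longleftrightarrow>
           (\<exists>S. anticomponent V E S \<and> 2 \<le> card S \<and>
                (\<forall>T. anticomponent V E T \<and> 2 \<le> card T \<longrightarrow> T = S) \<and>
                special S E)) \<and>
         ((\<exists>S. anticomponent V E S \<and> 2 \<le> card S \<and>
                (\<forall>T. anticomponent V E T \<and> 2 \<le> card T \<longrightarrow> T = S) \<and>
                special S E) \<longleftrightarrow>
           (\<exists>Q. Q \<subseteq> V \<and> special Q E \<and> clique E (V - Q) \<and> complete E (V - Q) Q))"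
    (is "(?a \<longleftrightarrow> ?b) \<and> (?b \<longleftrightarrow> ?c)")
proof -
  have c: "?c \<longleftrightarrow> (\<exists>Q. universal_outside V E Q \<and> special Q E)"
  proof (rule ex_cong1)
    show "Q \<subseteq> V \<and> special Q E \<and> clique E (V - Q) \<and> complete E (V - Q) Q \<longleftrightarrow>
        universal_outside V E Q \<and> special Q E" for Q
      using universal_outside_iff[of Q V E] by argo
  qed
  have Q: "is_graph Q E \<and> obstruction_free Q E \<and> Q \<noteq> {}" if "universal_outside V E Q" "special Q E" for Q
  proof -
    have "Q \<subseteq> V" "Q \<noteq> {}" using that special_nonempty unfolding universal_outside_def by blast+
    then show ?thesis using is_graph_subset[OF assms] special_obstruction_free that(2) by blast
  qed
  have ca: ?a if "universal_outside V E Q" "special Q E" for Q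
    using Q[OF that] universal_outside_free[OF that(1)] universal_outside_simplicial[OF that(1)]
    unfolding obstruction_free_def by blast
  have cb: ?b if universal: "universal_outside V E Q" and sp: "special Q E" for Q
  proof -
    have g: "is_graph Q E" and o: "obstruction_free Q E" and "Q \<noteq> {}" using Q[OF universal sp] by blast+
    then have a: "anticonnected E Q"
      using C4_free_anticonnected unfolding obstruction_free_def is_free_def by blast
    obtain v where v: "v \<in> Q" using \<open>Q \<noteq> {}\<close> by blast
    then obtain u where u: "u \<in> Q" "u \<noteq> v" using o unfolding obstruction_free_def by blast
    have "finite Q" using g unfolding is_graph_def by blast
    then have "card {u, v} \<le> card Q" using u v by (intro card_mono) auto
    then have 2: "2 \<le> card Q" using u(2) by simp
    have "T = Q" if T: "anticomponent V E T \<and> 2 \<le> card T" for T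
      using universal_outside_anticomponent(2)[OF universal a 2] T by blast
    then show ?thesis
      using universal_outside_anticomponent(1)[OF universal a 2] 2 sp by (intro exI[of _ Q] conjI allI impI)
  qed
  have bc: "\<exists>Q. universal_outside V E Q \<and> special Q E" if b: ?b
  proof -
    obtain S where S: "anticomponent V E S" "\<forall>T. anticomponent V E T \<and> 2 \<le> card T \<longrightarrow> T = S" "special S E"
      using b by (elim exE conjE) (rule that)
    have "universal_outside V E S"
      by (rule unique_anticomponent_universal_outside[OF assms S(1)]) (use S(2) in simp)
    then show ?thesis using S(3) by (intro exI[of _ S] conjI)
  qed
  have ac: "\<exists>Q. universal_outside V E Q \<and> special Q E" if a: ?a
    by (rule free_nonsimplicial_special[OF assms conjunct1[OF a] conjunct2[OF a]])
  show ?thesis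
  proof (intro conjI iffI)
    assume h: ?a
    obtain Q where "universal_outside V E Q" "special Q E" using ac[OF h] by (elim exE conjE)
    then show ?b by (rule cb)
  next
    assume h: ?b
    obtain Q where Q: "universal_outside V E Q" "special Q E" using bc[OF h] by (elim exE conjE)
    show "is_free V E" "\<forall>v\<in>V. \<not> simplicial V E v" using ca[OF Q] by (rule conjunct1, rule conjunct2)
  next
    assume ?b
    then show ?c unfolding c by (rule bc)
  next
    assume ?c
    then obtain Q where "universal_outside V E Q" "special Q E" unfolding c by (elim exE conjE)
    then show ?b by (rule cb)
  qed
qed

end
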